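(* For every real $\alpha\ge 0$, $$\lim_{n\to+\infty}\frac{1}{n}\log\kappa_n(\alpha)=\frac{\pi}{\sqrt{3}}.$$
   Context: For $\alpha\in\mathbb{R}$, $\mathcal{A}_\alpha$ denotes the complex cubic oscillator on $L^2(\mathbb{R})$: the closure of the operator $-\frac{d^2}{dx^2}+ix^3+i\alpha x$ with domain $\mathcal{C}_0^\infty(\mathbb{R})$. It is maximally accretive, with domain $H^2(\mathbb{R})\cap L^2(\mathbb{R};x^6\,dx)$, and has compact resolvent. For $\alpha\ge 0$ its spectrum is real (known fact); each eigenvalue has geometric multiplicity one, and the eigenvalues $(\lambda_n(\alpha))_{n\ge1}$ are labelled in increasing order. $\Pi_n(\alpha)$ denotes the spectral (Riesz) projection of $\mathcal{A}_\alpha$ associated with the eigenvalue $\lambda_n(\alpha)$, and $\kappa_n(\alpha)=\|\Pi_n(\alpha)\|$ (operator norm on $L^2(\mathbb{R})$) is the $n$-th instability index. *)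

theory Defs
  imports "HOL-Complex_Analysis.Contour_Integration"
begin

section \<open>The Hilbert space of square-integrable functions on the line\<close>

definition square_integrable :: "(real \<Rightarrow> complex) \<Rightarrow> bool" where
  "square_integrable f \<longleftrightarrow>
     f \<in> borel_measurable lborel \<and> integrable lborel (\<lambda>x. (cmod (f x))\<^sup>2)"

definition L2_eq :: "(real \<Rightarrow> complex) \<Rightarrow> (real \<Rightarrow> complex) \<Rightarrow> bool" where
  "L2_eq f g \<longleftrightarrow> square_integrable f \<and> square_integrable g \<and> (AE x in lborel. f x = g x)"

lemma square_integrable_0: "square_integrable (\<lambda>x. 0)"
  by (simp add: square_integrable_def)

lemma part_equivp_L2_eq: "part_equivp L2_eq"
proof (rule part_equivpI)
  show "\<exists>f. L2_eq f f"
    using square_integrable_0 by (auto simp: L2_eq_def)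
  show "symp L2_eq"
    by (auto simp: symp_def L2_eq_def elim: eventually_mono)
  show "transp L2_eq"
    by (auto simp: transp_def L2_eq_def elim: eventually_elim2)
qed

quotient_type L2R = "real \<Rightarrow> complex" / partial: L2_eq
  by (rule part_equivp_L2_eq)

lemma square_integrable_add:
  assumes "square_integrable f" "square_integrable g"
  shows "square_integrable (\<lambda>x. f x + g x)"
proof -
  have m [measurable]: "f \<in> borel_measurable lborel" "g \<in> borel_measurable lborel"
    and i: "integrable lborel (\<lambda>x. (cmod (f x))\<^sup>2)" "integrable lborel (\<lambda>x. (cmod (g x))\<^sup>2)"
    using assms by (auto simp: square_integrable_def)
  have b: "(cmod (f x + g x))\<^sup>2 \<le> 2 * (cmod (f x))\<^sup>2 + 2 * (cmod (g x))\<^sup>2" for x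
  proof -
    have "(cmod (f x + g x))\<^sup>2 \<le> (cmod (f x) + cmod (g x))\<^sup>2"
      by (intro power_mono norm_triangle_ineq) auto
    also have "\<dots> \<le> 2 * (cmod (f x))\<^sup>2 + 2 * (cmod (g x))\<^sup>2"
      using sum_squares_bound[of "cmod (f x)" "cmod (g x)"] by (simp add: power2_sum)
    finally show ?thesis .
  qed
  have "integrable lborel (\<lambda>x. (cmod (f x + g x))\<^sup>2)"
    by (rule Bochner_Integration.integrable_bound
          [of _ "\<lambda>x. 2 * (cmod (f x))\<^sup>2 + 2 * (cmod (g x))\<^sup>2"])
       (use i b in auto)
  then show ?thesis by (simp add: square_integrable_def)
qed

lemma square_integrable_cmult:
  assumes "square_integrable f"
  shows "square_integrable (\<lambda>x. c * f x)"
  using assms by (auto simp: square_integrable_def norm_mult power_mult_distrib)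

lemma square_integrable_uminus:
  assumes "square_integrable f"
  shows "square_integrable (\<lambda>x. - f x)"
  using square_integrable_cmult[OF assms, of "-1"] by simp

lemma square_integrable_diff:
  assumes "square_integrable f" "square_integrable g"
  shows "square_integrable (\<lambda>x. f x - g x)"
  using square_integrable_add[OF assms(1) square_integrable_uminus[OF assms(2)]] by simp

lemma integrable_inner_L2:
  assumes "square_integrable f" "square_integrable g"
  shows "integrable lborel (\<lambda>x. f x \<bullet> g x)"
proof -
  have m [measurable]: "f \<in> borel_measurable lborel" "g \<in> borel_measurable lborel"
    and i: "integrable lborel (\<lambda>x. (cmod (f x))\<^sup>2)" "integrable lborel (\<lambda>x. (cmod (g x))\<^sup>2)"
    using assms by (auto simp: square_integrable_def)
  have b: "\<bar>f x \<bullet> g x\<bar> \<le> (cmod (f x))\<^sup>2 + (cmod (g x))\<^sup>2" for x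
  proof -
    have "\<bar>f x \<bullet> g x\<bar> \<le> cmod (f x) * cmod (g x)" by (rule Cauchy_Schwarz_ineq2)
    also have "\<dots> \<le> (cmod (f x))\<^sup>2 + (cmod (g x))\<^sup>2"
      using sum_squares_bound[of "cmod (f x)" "cmod (g x)"]
        mult_nonneg_nonneg[OF norm_ge_zero[of "f x"] norm_ge_zero[of "g x"]] by linarith
    finally show ?thesis .
  qed
  show ?thesis
    by (rule Bochner_Integration.integrable_bound
          [of _ "\<lambda>x. (cmod (f x))\<^sup>2 + (cmod (g x))\<^sup>2"])
       (use i b in auto)
qed

text \<open>
  The library has no class of complex inner product spaces.  \<open>L2R\<close> is made a real inner product
  space with the inner product \<open>Re \<langle>u, v\<rangle>\<close>, which induces the usual norm of \<open>L\<^sup>2\<close>;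
  the complex structure is carried by \<open>scaleC\<close> below.
\<close>

instantiation L2R :: real_inner
begin

lift_definition zero_L2R :: L2R is "\<lambda>x. 0"
  by (simp add: L2_eq_def square_integrable_0)

lift_definition plus_L2R :: "L2R \<Rightarrow> L2R \<Rightarrow> L2R" is "\<lambda>f g x. f x + g x"
  by (auto simp: L2_eq_def square_integrable_add elim: eventually_elim2)

lift_definition uminus_L2R :: "L2R \<Rightarrow> L2R" is "\<lambda>f x. - f x"
  by (auto simp: L2_eq_def square_integrable_uminus elim: eventually_mono)

lift_definition minus_L2R :: "L2R \<Rightarrow> L2R \<Rightarrow> L2R" is "\<lambda>f g x. f x - g x"
  by (auto simp: L2_eq_def square_integrable_diff elim: eventually_elim2)

lift_definition scaleR_L2R :: "real \<Rightarrow> L2R \<Rightarrow> L2R" is "\<lambda>r f x. complex_of_real r * f x"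
  by (auto simp: L2_eq_def square_integrable_cmult elim: eventually_mono)

lift_definition inner_L2R :: "L2R \<Rightarrow> L2R \<Rightarrow> real" is "\<lambda>f g. LINT x|lborel. Re (f x * cnj (g x))"
proof -
  fix f f' g g' :: "real \<Rightarrow> complex"
  assume "L2_eq f f'" "L2_eq g g'"
  then show "(LINT x|lborel. Re (f x * cnj (g x))) = (LINT x|lborel. Re (f' x * cnj (g' x)))"
    by (intro integral_cong_AE) (auto simp: L2_eq_def square_integrable_def elim: eventually_elim2)
qed

definition norm_L2R :: "L2R \<Rightarrow> real" where
  "norm_L2R u = sqrt (u \<bullet> u)"

definition sgn_L2R :: "L2R \<Rightarrow> L2R" where
  "sgn_L2R u = scaleR (inverse (norm u)) u"

definition dist_L2R :: "L2R \<Rightarrow> L2R \<Rightarrow> real" where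
  "dist_L2R u v = norm (u - v)"

definition uniformity_L2R :: "(L2R \<times> L2R) filter" where
  "uniformity_L2R = (INF e\<in>{0<..}. principal {(u, v). dist u v < e})"

definition open_L2R :: "L2R set \<Rightarrow> bool" where
  "open_L2R U \<longleftrightarrow> (\<forall>u\<in>U. eventually (\<lambda>(u', v). u' = u \<longrightarrow> v \<in> U) uniformity)"

instance
proof
  fix u v w :: L2R and r s :: real
  have inner_alt: "Re (a * cnj b) = a \<bullet> b" for a b
    by (simp add: inner_complex_def)
  show "u + v + w = u + (v + w)"
    by transfer (auto simp: L2_eq_def add.assoc intro!: square_integrable_add)
  show "u + v = v + u"
    by transfer (auto simp: L2_eq_def add.commute intro!: square_integrable_add)
  show "0 + u = u"
    by transfer (auto simp: L2_eq_def)
  show "- u + u = 0"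
    by transfer (auto simp: L2_eq_def square_integrable_0)
  show "u - v = u + - v"
    by transfer (auto simp: L2_eq_def square_integrable_diff)
  show "r *\<^sub>R (u + v) = r *\<^sub>R u + r *\<^sub>R v"
    by transfer (auto simp: L2_eq_def distrib_left distrib_right
        intro!: square_integrable_add square_integrable_cmult)
  show "(r + s) *\<^sub>R u = r *\<^sub>R u + s *\<^sub>R u"
    by transfer (auto simp: L2_eq_def distrib_left distrib_right
        intro!: square_integrable_add square_integrable_cmult)
  show "r *\<^sub>R s *\<^sub>R u = (r * s) *\<^sub>R u"
    by transfer (auto simp: L2_eq_def mult.assoc intro!: square_integrable_cmult)
  show "1 *\<^sub>R u = u"
    by transfer (auto simp: L2_eq_def)
  show "dist u v = norm (u - v)" by (rule dist_L2R_def)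
  show "sgn u = scaleR (inverse (norm u)) u" by (rule sgn_L2R_def)
  show "uniformity = (INF e\<in>{0<..}. principal {(u::L2R, v). dist u v < e})"
    by (rule uniformity_L2R_def)
  show "open U \<longleftrightarrow> (\<forall>u\<in>U. \<forall>\<^sub>F (u', v) in uniformity. u' = u \<longrightarrow> v \<in> U)" for U :: "L2R set"
    by (rule open_L2R_def)
  show "u \<bullet> v = v \<bullet> u"
    by transfer (simp only: inner_alt inner_commute)
  show "(u + v) \<bullet> w = u \<bullet> w + v \<bullet> w"
    by transfer (simp only: inner_alt, simp add: inner_add_left integrable_inner_L2 L2_eq_def)
  show "r *\<^sub>R u \<bullet> v = r * (u \<bullet> v)"
    by transfer (simp add: mult.assoc flip: right_diff_distrib distrib_left)
  show "0 \<le> u \<bullet> u"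
    by transfer (simp only: inner_alt, simp)
  show "u \<bullet> u = 0 \<longleftrightarrow> u = 0"
  proof transfer
    fix f assume "L2_eq f f"
    then have f: "square_integrable f" by (simp add: L2_eq_def)
    have "(LINT x|lborel. f x \<bullet> f x) = 0 \<longleftrightarrow> (AE x in lborel. f x \<bullet> f x = 0)"
      by (rule integral_nonneg_eq_0_iff_AE) (auto intro: integrable_inner_L2 f)
    then show "(LINT x|lborel. Re (f x * cnj (f x))) = 0 \<longleftrightarrow> L2_eq f (\<lambda>x. 0)"
      unfolding inner_alt using f by (auto simp: L2_eq_def square_integrable_0)
  qed
  show "norm u = sqrt (u \<bullet> u)" by (rule norm_L2R_def)
qed

end

text \<open>
  The class of a function in \<open>L\<^sup>2\<close>.  This is meaningful only for square-integrable functions,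
  which covers its uses below (\<open>square_integrable_test_function\<close> and \<open>square_integrable_cubic_expr\<close>).
\<close>

definition to_L2 :: "(real \<Rightarrow> complex) \<Rightarrow> L2R" where
  "to_L2 = abs_L2R"

lemma Re_mult_cnj: "Re (z * cnj z) = (cmod z)\<^sup>2"
  by (simp add: complex_mult_cnj cmod_power2)

lemma norm_to_L2:
  assumes "square_integrable f"
  shows "norm (to_L2 f) = sqrt (LINT x|lborel. (cmod (f x))\<^sup>2)"
proof -
  have "L2_eq f f" using assms by (simp add: L2_eq_def)
  then show ?thesis
    unfolding norm_L2R_def to_L2_def
    by (simp only: inner_L2R.abs_eq Re_mult_cnj)
qed

lemma to_L2_diff:
  assumes "square_integrable f" "square_integrable g"
  shows "to_L2 (\<lambda>x. f x - g x) = to_L2 f - to_L2 g"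
  using assms by (simp add: to_L2_def minus_L2R.abs_eq L2_eq_def)

lemma to_L2_surj: "\<exists>f. square_integrable f \<and> to_L2 f = u"
proof -
  have "L2_eq (rep_L2R u) (rep_L2R u)"
    using Quotient3_L2R by (rule Quotient3_rep_reflp)
  then have "square_integrable (rep_L2R u)" by (simp add: L2_eq_def)
  moreover have "to_L2 (rep_L2R u) = u"
    unfolding to_L2_def using Quotient3_L2R by (rule Quotient3_abs_rep)
  ultimately show ?thesis by blast
qed

lemma nn_integral_to_L2:
  assumes "square_integrable f"
  shows "(\<integral>\<^sup>+x. ennreal ((cmod (f x))\<^sup>2) \<partial>lborel) = ennreal ((norm (to_L2 f))\<^sup>2)"
proof -
  have "0 \<le> (LINT x|lborel. (cmod (f x))\<^sup>2)" by simp
  then show ?thesis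
    using assms by (subst nn_integral_eq_integral) (auto simp: norm_to_L2 square_integrable_def)
qed

lemma L2_Cauchy_limit:
  assumes sq: "\<And>n. square_integrable (f n)"
    and le: "\<And>m n. n \<le> m \<Longrightarrow> norm (to_L2 (f m) - to_L2 (f n)) \<le> (1/2)^n"
  shows "\<exists>u. (\<lambda>n. to_L2 (f n)) \<longlonglongrightarrow> u"
proof -
  have meas [measurable]: "f n \<in> borel_measurable lborel" for n
    using sq by (simp add: square_integrable_def)
  have nn: "(\<integral>\<^sup>+x. ennreal ((cmod (f m x - f n x))\<^sup>2) \<partial>lborel) \<le> ennreal ((1/4)^n)"
    if "n \<le> m" for m n
  proof -
    have "(norm (to_L2 (f m) - to_L2 (f n)))\<^sup>2 \<le> ((1/2)^n)\<^sup>2"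
      using le[OF that] by (intro power_mono) auto
    also have "((1/2)^n)\<^sup>2 = (1/4 :: real)^n"
      by (simp add: power2_eq_square flip: power_mult_distrib)
    finally show ?thesis
      using nn_integral_to_L2[OF square_integrable_diff[OF sq sq], of m n]
      by (simp add: to_L2_diff sq ennreal_leI)
  qed

  define h where "h n x = 2 ^ n * (cmod (f (Suc n) x - f n x))\<^sup>2" for n x
  have [measurable]: "h n \<in> borel_measurable lborel" for n
    unfolding h_def by measurable
  have h_nonneg: "0 \<le> h n x" for n x by (simp add: h_def)
  have "(\<integral>\<^sup>+x. (\<Sum>n. ennreal (h n x)) \<partial>lborel) = (\<Sum>n. \<integral>\<^sup>+x. ennreal (h n x) \<partial>lborel)"
    by (rule nn_integral_suminf) measurable
  also have "\<dots> \<le> (\<Sum>n. ennreal ((1/2)^n))"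
  proof (rule suminf_le)
    fix n
    have "(\<integral>\<^sup>+x. ennreal (h n x) \<partial>lborel)
        = ennreal (2^n) * (\<integral>\<^sup>+x. ennreal ((cmod (f (Suc n) x - f n x))\<^sup>2) \<partial>lborel)"
      unfolding h_def by (subst ennreal_mult) (auto intro!: nn_integral_cmult)
    also have "\<dots> \<le> ennreal (2^n) * ennreal ((1/4)^n)"
      by (intro mult_left_mono nn) auto
    also have "\<dots> = ennreal ((1/2)^n)"
      by (simp flip: ennreal_mult power_mult_distrib)
    finally show "(\<integral>\<^sup>+x. ennreal (h n x) \<partial>lborel) \<le> ennreal ((1/2)^n)" .
  qed auto
  also have "\<dots> = ennreal (\<Sum>n. (1/2)^n)"
    by (rule suminf_ennreal2) (auto intro: summable_geometric)
  also have "\<dots> < \<infinity>" by simp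
  finally have "AE x in lborel. (\<Sum>n. ennreal (h n x)) \<noteq> \<infinity>"
    by (intro nn_integral_PInf_AE) auto
  then have conv: "AE x in lborel. convergent (\<lambda>n. f n x)"
  proof (rule AE_mp, intro AE_I2 impI)
    fix x assume "(\<Sum>n. ennreal (h n x)) \<noteq> \<infinity>"
    then have sh: "summable (\<lambda>n. h n x)"
      by (intro summable_suminf_not_top) (auto simp: h_nonneg)
    have "summable (\<lambda>n. f (Suc n) x - f n x)"
    proof (rule summable_comparison_test)
      show "summable (\<lambda>n. (1/2)^n + h n x)"
        by (intro summable_add sh summable_geometric) auto
      have "norm (f (Suc n) x - f n x) \<le> (1/2)^n + h n x" for n
      proof -
        define a where "a = norm (f (Suc n) x - f n x)"
        define t where "t = (2::real) ^ n"
        have t: "t > 0" by (simp add: t_def)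
        have "0 \<le> (t * a - 1)\<^sup>2 + t * a" using t by (simp add: a_def)
        then have "t * a \<le> 1 + t * (t * a\<^sup>2)"
          by (simp add: power2_eq_square algebra_simps)
        then have "a \<le> 1 / t + t * a\<^sup>2"
          using t by (simp add: field_simps)
        then show ?thesis
          by (simp add: a_def t_def h_def power_one_over)
      qed
      then show "\<exists>N. \<forall>n\<ge>N. norm (f (Suc n) x - f n x) \<le> (1/2)^n + h n x" by blast
    qed
    then have "convergent (\<lambda>n. \<Sum>k<n. f (Suc k) x - f k x)"
      by (simp add: summable_iff_convergent)
    then have "convergent (\<lambda>n. f n x - f 0 x)"
      by (simp only: sum_lessThan_telescope[of "\<lambda>n. f n x"])
    then have "convergent (\<lambda>n. (f n x - f 0 x) + f 0 x)"
      by (intro convergent_add convergent_const)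
    then show "convergent (\<lambda>n. f n x)" by simp
  qed

  define F where "F x = lim (\<lambda>n. f n x)" for x
  have [measurable]: "F \<in> borel_measurable lborel"
    unfolding F_def by (rule borel_measurable_lim_metric) measurable
  have FL: "(\<integral>\<^sup>+x. ennreal ((cmod (F x - f n x))\<^sup>2) \<partial>lborel) \<le> ennreal ((1/4)^n)" for n
  proof -
    have "(\<integral>\<^sup>+x. ennreal ((cmod (F x - f n x))\<^sup>2) \<partial>lborel)
        = (\<integral>\<^sup>+x. liminf (\<lambda>m. ennreal ((cmod (f m x - f n x))\<^sup>2)) \<partial>lborel)"
    proof (rule nn_integral_cong_AE, use conv in \<open>rule AE_mp\<close>, intro AE_I2 impI)
      fix x assume "convergent (\<lambda>n. f n x)"
      then have "(\<lambda>m. f m x) \<longlonglongrightarrow> F x" by (simp add: F_def convergent_LIMSEQ_iff)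
      then have "(\<lambda>m. ennreal ((cmod (f m x - f n x))\<^sup>2)) \<longlonglongrightarrow> ennreal ((cmod (F x - f n x))\<^sup>2)"
        by (intro tendsto_ennrealI tendsto_intros)
      then show "ennreal ((cmod (F x - f n x))\<^sup>2) = liminf (\<lambda>m. ennreal ((cmod (f m x - f n x))\<^sup>2))"
        by (rule lim_imp_Liminf[OF trivial_limit_sequentially, symmetric])
    qed
    also have "\<dots> \<le> liminf (\<lambda>m. \<integral>\<^sup>+x. ennreal ((cmod (f m x - f n x))\<^sup>2) \<partial>lborel)"
      by (rule nn_integral_liminf) measurable
    also have "\<dots> \<le> liminf (\<lambda>m. ennreal ((1/4)^n))"
      by (rule Liminf_mono) (use nn in \<open>auto intro: eventually_sequentiallyI\<close>)
    also have "\<dots> = ennreal ((1/4)^n)" by (simp add: Liminf_const)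
    finally show ?thesis .
  qed
  have sqF': "square_integrable (\<lambda>x. F x - f n x)" for n
    unfolding square_integrable_def
  proof
    show "integrable lborel (\<lambda>x. (cmod (F x - f n x))\<^sup>2)"
      by (rule integrableI_bounded)
         (use le_less_trans[OF FL[of n]] in \<open>auto simp: less_top\<close>)
  qed simp
  have sqF: "square_integrable F"
    using square_integrable_add[OF sqF' sq, of 0 0] by simp
  have b: "norm (to_L2 (f n) - to_L2 F) \<le> (1/2)^n" for n
  proof -
    have "ennreal ((norm (to_L2 F - to_L2 (f n)))\<^sup>2) \<le> ennreal ((1/4)^n)"
      using FL[of n] nn_integral_to_L2[OF sqF'[of n]] by (simp add: to_L2_diff sq sqF)
    then have "(norm (to_L2 F - to_L2 (f n)))\<^sup>2 \<le> (1/4)^n" by simp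
    also have "(1/4)^n = ((1/2 :: real)^n)\<^sup>2"
      by (simp add: power2_eq_square flip: power_mult_distrib)
    finally have "norm (to_L2 F - to_L2 (f n)) \<le> (1/2)^n"
      by (rule power2_le_imp_le) simp
    then show ?thesis by (simp add: norm_minus_commute)
  qed
  have "(\<lambda>n. to_L2 (f n) - to_L2 F) \<longlonglongrightarrow> 0"
  proof (rule Lim_null_comparison)
    show "\<forall>\<^sub>F n in sequentially. norm (to_L2 (f n) - to_L2 F) \<le> (1/2)^n"
      by (rule always_eventually) (intro allI b)
    show "(\<lambda>n. (1/2 :: real)^n) \<longlonglongrightarrow> 0"
      by (rule LIMSEQ_power_zero) simp
  qed
  then have "(\<lambda>n. to_L2 (f n)) \<longlonglongrightarrow> to_L2 F"
    by (rule LIM_zero_cancel)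
  then show ?thesis by blast
qed

instance L2R :: banach
proof
  fix X :: "nat \<Rightarrow> L2R"
  assume "Cauchy X"
  then have "\<forall>n. \<exists>N. \<forall>m\<ge>N. \<forall>k\<ge>N. norm (X m - X k) < (1/2)^n"
    by (simp add: Cauchy_iff)
  then obtain N where N: "\<And>n m k. N n \<le> m \<Longrightarrow> N n \<le> k \<Longrightarrow> norm (X m - X k) < (1/2)^n"
    by metis
  define r where "r n = n + (\<Sum>i\<le>n. N i)" for n
  have r: "strict_mono r" by (rule strict_monoI_Suc) (simp add: r_def)
  have rN: "N n \<le> r n" for n
    using member_le_sum[of n "{..n}" N] by (simp add: r_def)
  have "\<forall>n. \<exists>f. square_integrable f \<and> to_L2 f = X (r n)"
    using to_L2_surj by blast
  then obtain f where f: "\<And>n. square_integrable (f n)" "\<And>n. to_L2 (f n) = X (r n)"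
    by metis
  have "norm (to_L2 (f m) - to_L2 (f n)) \<le> (1/2)^n" if "n \<le> m" for m n
  proof -
    have "r n \<le> r m" using r that by (simp add: strict_mono_less_eq)
    then show ?thesis using N[of n "r m" "r n"] rN[of n] by (simp add: f(2))
  qed
  with f(1) obtain u where "(\<lambda>n. to_L2 (f n)) \<longlonglongrightarrow> u"
    using L2_Cauchy_limit by blast
  then have "(X \<circ> r) \<longlonglongrightarrow> u" by (simp add: f(2) comp_def)
  with \<open>Cauchy X\<close> r have "X \<longlonglongrightarrow> u" by (metis Cauchy_converges_subseq)
  then show "convergent X" by (rule convergentI)
qed

lift_definition scaleC :: "complex \<Rightarrow> L2R \<Rightarrow> L2R" is "\<lambda>c f x. c * f x"
  by (auto simp: L2_eq_def square_integrable_cmult elim: eventually_mono)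

lemma scaleC_add_right: "scaleC c (u + v) = scaleC c u + scaleC c v"
  by transfer (auto simp: L2_eq_def algebra_simps
      intro!: square_integrable_add square_integrable_cmult)

lemma scaleC_scaleR: "scaleC c (r *\<^sub>R u) = r *\<^sub>R scaleC c u"
  by transfer (auto simp: L2_eq_def mult.left_commute intro!: square_integrable_cmult)

lemma norm_scaleC: "norm (scaleC c u) = cmod c * norm u"
proof -
  have "scaleC c u \<bullet> scaleC c u = (cmod c)\<^sup>2 * (u \<bullet> u)"
  proof transfer
    fix c f assume "L2_eq f f"
    have "Re (c * f x * cnj (c * f x)) = (cmod c)\<^sup>2 * Re (f x * cnj (f x))" for x
      by (simp only: Re_mult_cnj norm_mult power_mult_distrib)
    then show "(LINT x|lborel. Re (c * f x * cnj (c * f x)))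
             = (cmod c)\<^sup>2 * (LINT x|lborel. Re (f x * cnj (f x)))"
      by simp
  qed
  then show ?thesis by (simp add: norm_L2R_def real_sqrt_mult)
qed

lift_definition scaleC_op :: "complex \<Rightarrow> L2R \<Rightarrow>\<^sub>L L2R" is scaleC
proof -
  fix c
  show "bounded_linear (scaleC c)"
    by (rule bounded_linear_intro[where K = "cmod c"])
       (simp_all add: scaleC_add_right scaleC_scaleR norm_scaleC mult.commute)
qed


section \<open>Unbounded operators, resolvents and Riesz projections\<close>

text \<open>
  An unbounded operator on \<open>L\<^sup>2\<close> is given by its graph.  \<open>resolvent_of A z R\<close> says that
  \<open>z - A\<close>, with the domain of \<open>A\<close>, is a bijection onto \<open>L\<^sup>2\<close> whose inverse is the bounded
  operator \<open>R\<close>: the graph of \<open>R\<close> is the converse of the graph of \<open>z - A\<close>.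
\<close>

definition resolvent_of :: "(L2R \<times> L2R) set \<Rightarrow> complex \<Rightarrow> (L2R \<Rightarrow>\<^sub>L L2R) \<Rightarrow> bool" where
  "resolvent_of A z R \<longleftrightarrow>
     {(f, blinfun_apply R f) | f. True} = {(scaleC z u - v, u) | u v. (u, v) \<in> A}"

lemma resolvent_of_unique:
  assumes "resolvent_of A z R" "resolvent_of A z S"
  shows "R = S"
proof (rule blinfun_eqI)
  fix f
  have "(f, blinfun_apply R f) \<in> {(f, blinfun_apply S f) | f. True}"
    using assms unfolding resolvent_of_def by blast
  then show "blinfun_apply R f = blinfun_apply S f" by simp
qed

definition resolvent :: "(L2R \<times> L2R) set \<Rightarrow> complex \<Rightarrow> L2R \<Rightarrow>\<^sub>L L2R" where
  "resolvent A z = (THE R. resolvent_of A z R)"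

definition spectrum :: "(L2R \<times> L2R) set \<Rightarrow> complex set" where
  "spectrum A = {z. \<nexists>R. resolvent_of A z R}"

definition eigenvalues :: "(L2R \<times> L2R) set \<Rightarrow> complex set" where
  "eigenvalues A = {z. \<exists>u. u \<noteq> 0 \<and> (u, scaleC z u) \<in> A}"

text \<open>
  The operator-valued counterpart of the library's \<open>contour_integral\<close>, which only treats
  complex-valued integrands.
\<close>

definition op_contour_integral ::
    "(real \<Rightarrow> complex) \<Rightarrow> (complex \<Rightarrow> L2R \<Rightarrow>\<^sub>L L2R) \<Rightarrow> L2R \<Rightarrow>\<^sub>L L2R" where
  "op_contour_integral g F =
     integral {0..1} (\<lambda>t. scaleC_op (vector_derivative g (at t within {0..1})) o\<^sub>L F (g t))"

text \<open>
  The Riesz projection at an isolated point \<open>\<mu>\<close> of the spectrum, over any circle that encloses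
  no other point of the spectrum; its value does not depend on the radius.
\<close>

definition riesz_projection :: "(L2R \<times> L2R) set \<Rightarrow> complex \<Rightarrow> L2R \<Rightarrow>\<^sub>L L2R" where
  "riesz_projection A \<mu> =
     (let r = SOME r. 0 < r \<and> cball \<mu> r \<inter> spectrum A \<subseteq> {\<mu>}
      in scaleC_op (1 / (2 * of_real pi * \<i>)) o\<^sub>L
           op_contour_integral (circlepath \<mu> r) (resolvent A))"


section \<open>The complex cubic oscillator\<close>

definition ddx :: "(real \<Rightarrow> complex) \<Rightarrow> real \<Rightarrow> complex" where
  "ddx f = (\<lambda>x. vector_derivative f (at x))"

definition test_function :: "(real \<Rightarrow> complex) \<Rightarrow> bool" where
  "test_function \<phi> \<longleftrightarrow>
     (\<forall>n x. (ddx ^^ n) \<phi> differentiable (at x)) \<and> compact (closure {x. \<phi> x \<noteq> 0})"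

definition cubic_expr :: "real \<Rightarrow> (real \<Rightarrow> complex) \<Rightarrow> real \<Rightarrow> complex" where
  "cubic_expr \<alpha> \<phi> = (\<lambda>x. - ddx (ddx \<phi>) x + \<i> * of_real (x ^ 3) * \<phi> x + \<i> * of_real \<alpha> * of_real x * \<phi> x)"

lemma ddx_eq_0:
  assumes "x \<notin> closure {x. f x \<noteq> 0}"
  shows "ddx f x = 0"
proof -
  have "\<forall>\<^sub>F y in nhds x. y \<in> - closure {x. f x \<noteq> 0}"
    using assms by (intro eventually_nhds_in_open) auto
  then have ev: "\<forall>\<^sub>F y in nhds x. f y = 0"
  proof (rule eventually_mono)
    show "f y = 0" if "y \<in> - closure {x. f x \<noteq> 0}" for y
      using that subsetD[OF closure_subset, of y "{x. f x \<noteq> 0}"] by auto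
  qed
  then have "(f has_vector_derivative 0) (at x)"
    by (subst has_vector_derivative_cong_ev[where g = "\<lambda>_. 0"])
       (auto dest: eventually_nhds_x_imp_x elim: eventually_mono)
  then show ?thesis by (simp add: ddx_def vector_derivative_at)
qed

lemma test_function_ddx:
  assumes "test_function \<phi>"
  shows "test_function (ddx \<phi>)"
proof -
  have "{x. ddx \<phi> x \<noteq> 0} \<subseteq> closure {x. \<phi> x \<noteq> 0}"
    using ddx_eq_0 by blast
  then have "closure {x. ddx \<phi> x \<noteq> 0} \<subseteq> closure {x. \<phi> x \<noteq> 0}"
    by (simp add: closure_minimal)
  moreover have "(ddx ^^ n) (ddx \<phi>) differentiable (at x)" for n x
    using assms unfolding test_function_def by (metis funpow_Suc_right comp_apply)
  ultimately show ?thesis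
    using assms unfolding test_function_def
    by (metis closed_closure compact_Int_closed inf.absorb_iff2)
qed

lemma test_function_continuous:
  assumes "test_function \<phi>"
  shows "continuous_on UNIV \<phi>"
proof -
  have "\<phi> differentiable (at x)" for x
    using assms unfolding test_function_def by (metis funpow_0)
  then show ?thesis
    by (simp add: continuous_at_imp_continuous_on differentiable_imp_continuous_within)
qed

lemma square_integrable_continuous_compact:
  assumes "continuous_on UNIV f" "compact K" "\<And>x. x \<notin> K \<Longrightarrow> f x = 0"
  shows "square_integrable f"
proof -
  have "continuous_on K (\<lambda>x. (cmod (f x))\<^sup>2)"
    using assms(1) by (intro continuous_intros) (auto intro: continuous_on_subset)
  then have "set_integrable lborel K (\<lambda>x. (cmod (f x))\<^sup>2)"
    using assms(2) by (intro borel_integrable_compact[unfolded set_integrable_def[symmetric]]) auto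
  moreover have "(\<lambda>x. indicator K x *\<^sub>R (cmod (f x))\<^sup>2) = (\<lambda>x. (cmod (f x))\<^sup>2)"
    using assms(3) by (fastforce simp: indicator_def)
  moreover have "f \<in> borel_measurable lborel"
    using assms(1) borel_measurable_continuous_onI by (simp add: borel_measurable_continuous_onI)
  ultimately show ?thesis
    by (simp add: square_integrable_def set_integrable_def)
qed

lemma square_integrable_test_function:
  assumes "test_function \<phi>"
  shows "square_integrable \<phi>"
proof (rule square_integrable_continuous_compact)
  show "compact (closure {x. \<phi> x \<noteq> 0})" using assms by (simp add: test_function_def)
  show "\<phi> x = 0" if "x \<notin> closure {x. \<phi> x \<noteq> 0}" for x
    using that subsetD[OF closure_subset, of x "{x. \<phi> x \<noteq> 0}"] by auto
qed (rule test_function_continuous[OF assms])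

lemma square_integrable_cubic_expr:
  assumes "test_function \<phi>"
  shows "square_integrable (cubic_expr \<alpha> \<phi>)"
proof (rule square_integrable_continuous_compact)
  let ?K = "closure {x. \<phi> x \<noteq> 0} \<union> closure {x. ddx \<phi> x \<noteq> 0}"
  note d1 = test_function_ddx[OF assms]
  show "compact ?K"
    using assms d1 by (intro compact_Un) (simp_all add: test_function_def)
  show "cubic_expr \<alpha> \<phi> x = 0" if "x \<notin> ?K" for x
  proof -
    have "\<phi> x = 0"
      using that subsetD[OF closure_subset, of x "{x. \<phi> x \<noteq> 0}"] by auto
    moreover have "ddx (ddx \<phi>) x = 0" using that by (intro ddx_eq_0) auto
    ultimately show ?thesis by (simp add: cubic_expr_def)
  qed
  show "continuous_on UNIV (cubic_expr \<alpha> \<phi>)"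
    unfolding cubic_expr_def
    by (intro continuous_intros test_function_continuous assms test_function_ddx)
qed

definition cubic_oscillator :: "real \<Rightarrow> (L2R \<times> L2R) set" where
  "cubic_oscillator \<alpha> =
     closure {(to_L2 \<phi>, to_L2 (cubic_expr \<alpha> \<phi>)) | \<phi>. test_function \<phi>}"

text \<open>
  The eigenvalues in increasing order, the \<open>k\<close>-th entry of the enumeration being
  \<open>\<lambda>\<^bsub>k+1\<^esub>(\<alpha>)\<close>.  All of them are required to be real by the condition on the range.
\<close>

definition eigenvalue_enum :: "real \<Rightarrow> nat \<Rightarrow> real" where
  "eigenvalue_enum \<alpha> =
     (THE l. strict_mono l \<and> range (\<lambda>k. complex_of_real (l k)) = eigenvalues (cubic_oscillator \<alpha>))"

definition eigenvalue :: "real \<Rightarrow> nat \<Rightarrow> real" where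
  "eigenvalue \<alpha> n = eigenvalue_enum \<alpha> (n - 1)"

definition spectral_projection :: "real \<Rightarrow> nat \<Rightarrow> L2R \<Rightarrow>\<^sub>L L2R" where
  "spectral_projection \<alpha> n =
     riesz_projection (cubic_oscillator \<alpha>) (complex_of_real (eigenvalue \<alpha> n))"

definition instability_index :: "real \<Rightarrow> nat \<Rightarrow> real" where
  "instability_index \<alpha> n = norm (spectral_projection \<alpha> n)"

end

theory Submission
 imports Defs "HOL-Complex_Analysis.Complex_Analysis" "HOL-Real_Asymp.Real_Asymp"
begin

text \<open>
  After rotating the line into the complex plane, the eigenvalue equation becomes y'' = (z^3 + a z + l) y,
  whose decaying solution Y (Sibuya's solution) is entire in l. On sectors around the positive axis
  ln |Y(0)| = K Re l^(5/6) + O(|l|^(2/3)), by a Riccati comparison with the Liouville-Green phase. The two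
  decaying Jost solutions of the oscillator are rotated copies of Y, and the eigenvalues are the zeros of
  their Wronskian D. By Phragmen-Lindelof the quotient of the two rotated copies has modulus different
  from 1 off the real axis, so D has only real zeros; on the real axis D vanishes when the phase of Y on
  the rotated ray, which is asymptotic to (sqrt 3/2) K l^(5/6), meets multiples of pi. The Riesz projection
  at a zero has rank one and norm (norm psi)^2/|D'|, psi being the eigenfunction, so that
  ln kappa_n ~ (K/2) l_n^(5/6) while n pi ~ (sqrt 3/2) K l_n^(5/6).
\<close>

text \<open>The reality of the spectrum must be proved here: \<open>eigenvalue_enum\<close> is a
  unique description, so an increasing enumeration of all eigenvalues has to be exhibited, and the
  radius in \<open>riesz_projection\<close> is an arbitrary choice, so the spectrum has to be
  identified as the zero set of D. Errors O(|l|^(2/3)) swamp every power of l, so constants and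
  polynomial factors are not tracked. Only D' needs more, since size estimates do not differentiate.
  On the positive axis D Y(0) = -4 i |f| sin Th, where f is the value at 0 of the rotated copy of Y
  and Th its shifted phase, and Th' is controlled by a Cauchy estimate on a sector. The numbers are
  those of l^(5/6) at the angle 4 pi/5: ln |f| ~ K cos(2 pi/3) l^(5/6) = -(K/2) l^(5/6), Th ~ K
  sin(2 pi/3) l^(5/6), hence ln |D'| ~ -(3K/2) l^(5/6). As psi has norm |f| up to powers of l, ln
  kappa has the rate -K + 3K/2. The asymptotics of Y fail near the negative axis; the growth there,
  which Phragmen-Lindelof presupposes, is a crude bound improved by that same principle in a
  sixth-root variable.\<close>

definition pot :: "complex => complex => complex => complex" where
 "pot a l z = z^3 + a*z + l"

section \<open>Entire solutions from their Taylor coefficients at 0\<close>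

fun ode_coeff :: "complex => complex => complex => complex => nat => complex" where
 "ode_coeff A B a l 0 = A"
| "ode_coeff A B a l (Suc 0) = B"
| "ode_coeff A B a l (Suc (Suc n)) =
  (l * ode_coeff A B a l n + (if n = 0 then 0 else a * ode_coeff A B a l (n - 1))
    + (if n < 3 then 0 else ode_coeff A B a l (n - 3)))/of_nat ((n + 2)*(n + 1))"

lemma norm_ode_coeff_step:
 "norm (ode_coeff A B a l (Suc (Suc n))) <=
  (norm l*norm (ode_coeff A B a l n) + (if n = 0 then 0 else norm a*norm (ode_coeff A B a l (n - 1)))
    + (if n < 3 then 0 else norm (ode_coeff A B a l (n - 3))))/real ((n + 2)*(n + 1))"
proof -
 have "norm (l * ode_coeff A B a l n + (if n = 0 then 0 else a * ode_coeff A B a l (n - 1))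
    + (if n < 3 then 0 else ode_coeff A B a l (n - 3))) <=
  norm l*norm (ode_coeff A B a l n) + (if n = 0 then 0 else norm a*norm (ode_coeff A B a l (n - 1)))
    + (if n < 3 then 0 else norm (ode_coeff A B a l (n - 3)))"
  by (intro order.trans[OF norm_triangle_ineq] add_mono) (auto simp: norm_mult)
 thus ?thesis by (simp only: ode_coeff.simps norm_divide norm_of_nat) (intro divide_right_mono, auto)
qed

lemma norm_ode_coeff_le_power:
 assumes "norm A <= 1" "norm B <= 1" "norm l <= L" shows "norm (ode_coeff A B a l n) <= (1 + L + norm a)^n"
 using assms
proof (induction A B a l n rule: ode_coeff.induct)
 case (1 A B a l) thus ?case by simp
next
 case (2 A B a l)
 moreover have "0 <= L" using 2 norm_ge_zero order_trans by blast
 ultimately have "norm B <= 1 + L + norm a" using norm_ge_zero[of a] by linarith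
 thus ?case by simp
next
 case (3 A B a l n)
 define T where "T = 1 + L + norm a"
 have L: "0 <= L" using 3 norm_ge_zero order_trans by blast
 hence T: "1 <= T" by (simp add: T_def)
 have pT: "T^(n-k) <= T^n" for k using T by (intro power_increasing) auto
 have T0: "0 <= T^n" using T by simp
 have 1: "norm l*norm (ode_coeff A B a l n) <= L*T^n" using 3 L by (intro mult_mono) (auto simp: T_def)
 have 2: "(if n = 0 then 0 else norm a*norm (ode_coeff A B a l (n-1))) <= norm a*T^n"
  using 3(2)[OF _ 3(4-6)] pT[of 1] T0 by (auto simp: T_def intro!: mult_left_mono)
 have h3: "(if n < 3 then 0 else norm (ode_coeff A B a l (n-3))) <= T^n"
  using 3(3)[OF _ 3(4-6)] pT[of 3] T0 by (auto simp: T_def)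
 have "norm (ode_coeff A B a l (Suc (Suc n))) <= (L*T^n + norm a*T^n + T^n)/real ((n+2)*(n+1))"
  by (rule order_trans[OF norm_ode_coeff_step]) (intro divide_right_mono add_mono 1 2 h3, simp)
 also have "... <= (L*T^n + norm a*T^n + T^n)/1"
  using T0 L by (intro divide_left_mono) (auto intro!: add_pos_nonneg)
 also have "... = T^Suc n" by (simp add: T_def algebra_simps)
 also have "... <= T^Suc (Suc n)" using T by (intro power_increasing) auto
 finally show ?case by (simp add: T_def)
qed

text \<open>The recursion divides by (n+2)(n+1), so past a threshold a bound M e^n reproduces itself
  for every ratio e; M only has to absorb the first coefficients. Uniformity in \<open>l\<close> is
  what later yields joint continuity and holomorphy in \<open>l\<close>.\<close>

lemma ode_coeff_decay:
 assumes "norm A <= 1" "norm B <= 1" "0 < e" "e <= 1" "0 <= L"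
 shows "EX M>=0. ALL l n. norm l <= L --> norm (ode_coeff A B a l n) <= M*e^n"
proof -
 define T where "T = 1 + L + norm a"
 have T: "1 <= T" using assms by (simp add: T_def)
 \<comment> \<open>With m = k+3 the indices m, m-1, m-3 on the right exceed k by 3, 2, 0, and the
   new index is k+5: the induction closes once S/((m+2)(m+1)) <= e^5.\<close>
 define S where "S = L*e^3 + norm a*e^2 + 1"
 obtain N :: nat where N: "S/e^5 < real N" using reals_Archimedean2 by blast
 define N' where "N' = N + 4"
 define M where "M = (T/e)^N'"
 have Te: "1 <= T/e" using T assms by (simp)
 have M: "0 <= M" using Te by (simp add: M_def)
 have "norm (ode_coeff A B a l n) <= M*e^n" if l: "norm l <= L" for l n
 proof (induction n rule: less_induct)
  case (less n)
  show ?case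
  proof (cases "n <= N'")
   case True
   have "norm (ode_coeff A B a l n) <= T^n" unfolding T_def using assms l by (intro norm_ode_coeff_le_power) auto
   also have "... = (T/e)^n*e^n" using assms by (simp add: power_divide)
   also have "... <= M*e^n" unfolding M_def using Te True assms by (intro mult_right_mono power_increasing) auto
   finally show ?thesis .
  next
   case False
   define m where "m = n - 2"
   have m: "n = Suc (Suc m)" "m >= N" "m >= 3" using False by (auto simp: N'_def m_def)
   obtain k where k: "m = k + 3" using m(3) by (metis le_add_diff_inverse2)
   have "norm (ode_coeff A B a l n) <= (norm l*norm (ode_coeff A B a l m) + norm a*norm (ode_coeff A B a l (m - 1))
    + norm (ode_coeff A B a l (m - 3)))/real ((m + 2)*(m + 1))" using norm_ode_coeff_step[of A B a l m] m by simp
   also have "... <= (L*(M*e^m) + norm a*(M*e^(m-1)) + M*e^(m-3))/real ((m+2)*(m+1))"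
    using less m l assms by (intro divide_right_mono add_mono mult_mono) auto
   also have "L*(M*e^m) + norm a*(M*e^(m-1)) + M*e^(m-3) = M*e^k*S"
    by (simp add: k S_def algebra_simps eval_nat_numeral)
   also have "M*e^k*S/real ((m+2)*(m+1)) <= M*e^k*e^5"
   proof -
    have "S <= e^5*real N" using N assms by (simp add: field_simps)
    also have "... <= e^5*real ((m+2)*(m+1))"
    proof (intro mult_left_mono)
     have "N <= (m+2)*(m+1)" using m(2) by (simp)
     thus "real N <= real ((m+2)*(m+1))" by (simp only: of_nat_le_iff)
    qed (use assms in auto)
    finally have "S/real ((m+2)*(m+1)) <= e^5" by (subst pos_divide_le_eq) (auto simp del: of_nat_mult)
    hence "M*e^k*(S/real ((m+2)*(m+1))) <= M*e^k*e^5" using M assms by (intro mult_left_mono) auto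
    thus ?thesis by simp
   qed
   also have "... = M*e^n" by (simp add: m k eval_nat_numeral)
   finally show ?thesis .
  qed
 qed
 with M show ?thesis by blast
qed

definition ode_sol :: "complex => complex => complex => complex => complex => complex" where
 "ode_sol A B a l z = (\<Sum>n. ode_coeff A B a l n*z^n)"

definition ode_dsol :: "complex => complex => complex => complex => complex => complex" where
 "ode_dsol A B a l z = (\<Sum>n. diffs (ode_coeff A B a l) n*z^n)"

text \<open>Decay with a ratio e such that e R <= 1/4 leaves terms of size (1/4)^n; the factor n+1
  from differentiation is at most 2^n and costs the step to (1/2)^n.\<close>

lemma ode_series_bound:
 assumes "norm A <= 1" "norm B <= 1" "0 <= L" "0 <= R" shows "EX M. ALL l z n. norm l <= L --> norm z <= R -->
  norm (ode_coeff A B a l n*z^n) <= M*(1/2)^n & norm (diffs (ode_coeff A B a l) n*z^n) <= M*(1/2)^n"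
proof -
 define e where "e = 1/(4*(R+1))"
 have e: "0 < e" "e <= 1" "e*R <= 1/4" using assms by (auto simp: e_def)
 obtain M where M: "M >= 0" "!!l n. norm l <= L ==> norm (ode_coeff A B a l n) <= M*e^n"
  using ode_coeff_decay[OF assms(1,2) e(1,2) assms(3)] by blast
 have "norm (ode_coeff A B a l n*z^n) <= M*(1/2)^n & norm (diffs (ode_coeff A B a l) n*z^n) <= M*(1/2)^n"
  if l: "norm l <= L" and z: "norm z <= R" for l z n
 proof
  have p0: "e*norm z <= 1/4" using order_trans[OF mult_left_mono[OF z] e(3)] e(1) by simp
  have p: "e^n*norm z^n <= (1/4)^n" unfolding power_mult_distrib[symmetric] using p0 e by (intro power_mono) auto
  have q: "(1/4 :: real)^n <= (1/2)^n" by (intro power_mono) auto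
  have "norm (ode_coeff A B a l n*z^n) <= M*e^n*norm z^n"
   unfolding norm_mult norm_power by (intro mult_right_mono M l) auto
  also have "... <= M*(1/2)^n" using M(1) p q by (simp add: mult.assoc mult_left_mono)
  finally show "norm (ode_coeff A B a l n*z^n) <= M*(1/2)^n" .
  have n2: "real (Suc n) <= 2^n" using less_exp[of n] by (metis Suc_leI of_nat_le_iff of_nat_numeral of_nat_power)
  have "norm (diffs (ode_coeff A B a l) n*z^n) = real (Suc n)*norm (ode_coeff A B a l (Suc n))*norm z^n"
   by (simp add: diffs_def norm_mult norm_power del: of_nat_Suc)
  also have "... <= 2^n*(M*e^Suc n)*norm z^n" using n2 by (intro mult_right_mono mult_mono M l) auto
  also have "... = 2^n*M*e*(e^n*norm z^n)" by simp
  also have "... <= 2^n*M*1*(1/4)^n" using e M p by (intro mult_mono) auto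
  also have "... = M*(2*(1/4))^n" by (simp only: power_mult_distrib) simp
  finally show "norm (diffs (ode_coeff A B a l) n*z^n) <= M*(1/2)^n" by simp
 qed
 thus ?thesis by blast
qed

context
 fixes A B a :: complex
 assumes AB: "norm A <= 1" "norm B <= 1"
begin

lemma ode_coeff_summable: "summable (%n. ode_coeff A B a l n*z^n)"
proof -
 obtain M where M: "!!n. norm (ode_coeff A B a l n*z^n) <= M*(1/2)^n"
  using ode_series_bound[OF AB, of "norm l" "norm z" a] by auto
 show ?thesis by (rule summable_comparison_test'[OF summable_mult[OF summable_geometric] M]) auto
qed

lemma ode_sol_deriv: "(ode_sol A B a l has_field_derivative ode_dsol A B a l z) (at z)"
 unfolding ode_sol_def[abs_def] ode_dsol_def
 by (rule termdiffs_strong_converges_everywhere) (rule ode_coeff_summable)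

text \<open>Multiplying a power series by z or z^3 shifts its coefficients; the case distinctions in
  \<open>ode_coeff\<close> are exactly these shifts.\<close>

lemma diffs2_sums: "(%n. diffs (diffs (ode_coeff A B a l)) n*z^n) sums (pot a l z * ode_sol A B a l z)"
proof -
 let ?c = "ode_coeff A B a l"
 have s: "(%n. ?c n*z^n) sums ode_sol A B a l z"
  unfolding ode_sol_def by (rule summable_sums[OF ode_coeff_summable])
 have 1: "(%n. (if n = 0 then 0 else ?c (n-1))*z^n) sums (z * ode_sol A B a l z)"
 proof -
  have "(%n. (%n. (if n = 0 then 0 else ?c (n-1))*z^n) (Suc n)) sums (z * ode_sol A B a l z)"
   using sums_mult[OF s, of z] by (simp add: mult_ac)
  thus ?thesis by (subst (asm) sums_Suc_iff) simp
 qed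
 have 3: "(%n. (if n < 3 then 0 else ?c (n-3))*z^n) sums (z^3 * ode_sol A B a l z)"
 proof -
  have "(%n. (%n. (if n < 3 then 0 else ?c (n-3))*z^n) (n+3)) sums (z^3 * ode_sol A B a l z)"
   using sums_mult[OF s, of "z^3"] by (simp add: mult_ac power_add)
  thus ?thesis by (subst (asm) sums_iff_shift) (simp)
 qed
 have "(%n. l*(?c n*z^n) + a*((if n = 0 then 0 else ?c (n - 1))*z^n)
   + (if n < 3 then 0 else ?c (n - 3))*z^n) sums (l * ode_sol A B a l z + a*(z * ode_sol A B a l z) + z^3 * ode_sol A B a l z)"
  by (intro sums_add sums_mult s 1 3)
 moreover have "diffs (diffs ?c) n*z^n = l*(?c n*z^n) + a*((if n = 0 then 0 else ?c (n - 1))*z^n)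
   + (if n < 3 then 0 else ?c (n - 3))*z^n" for n
 proof -
  have "(of_nat ((n+2)*(n+1)) :: complex) ~= 0" by (simp only: of_nat_eq_0_iff) simp
  moreover have "diffs (diffs ?c) n = of_nat ((n+2)*(n+1))*?c (Suc (Suc n))"
   unfolding diffs_def by (simp add: algebra_simps del: ode_coeff.simps)
  moreover have "N*(X/N) = X" if "N ~= 0" for N X :: complex using that by simp
  ultimately have "diffs (diffs ?c) n = l*?c n + (if n = 0 then 0 else a*?c (n-1)) + (if n < 3 then 0 else ?c (n-3))"
   by (simp only: ode_coeff.simps(3))
  thus ?thesis by (simp add: algebra_simps)
 qed
 ultimately show ?thesis by (simp add: pot_def algebra_simps)
qed

lemma ode_dsol_deriv: "(ode_dsol A B a l has_field_derivative pot a l z * ode_sol A B a l z) (at z)"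
proof -
 have "((%z. \<Sum>n. diffs (ode_coeff A B a l) n*z^n) has_field_derivative (\<Sum>n. diffs (diffs (ode_coeff A B a l)) n*z^n)) (at z)"
  by (rule termdiffs_strong_converges_everywhere) (rule termdiff_converges_all[OF ode_coeff_summable])
 thus ?thesis unfolding ode_dsol_def[abs_def] using sums_unique[OF diffs2_sums[of l z]] by simp
qed

lemma ode_sol_0: "ode_sol A B a l 0 = A" and ode_dsol_0: "ode_dsol A B a l 0 = B"
 by (simp_all add: ode_sol_def ode_dsol_def diffs_def)

lemma ode_coeff_holomorphic: "(%l. ode_coeff A B a l n) holomorphic_on S"
proof (induction n rule: less_induct)
 case (less n)
 show ?case
 proof (cases "n < 2")
  case True hence "n = 0 | n = 1" by auto
  thus ?thesis by auto
 next
  case False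
  define m where "m = n - 2"
  have m: "n = Suc (Suc m)" using False by (simp add: m_def)
  have "(%l. (if m = 0 then 0 else a * ode_coeff A B a l (m-1))) holomorphic_on S"
   using less m by (cases "m = 0") (auto intro!: holomorphic_intros)
  moreover have "(%l. (if m < 3 then 0 else ode_coeff A B a l (m-3))) holomorphic_on S"
   using less m by (cases "m < 3") (auto)
  ultimately show ?thesis unfolding m ode_coeff.simps
   using less m by (intro holomorphic_intros) (auto simp del: of_nat_mult of_nat_add)
 qed
qed

text \<open>The M-test on a product of discs serves twice: for joint continuity in (l, z) and, on
  slices, for holomorphy in l.\<close>

lemma ode_sol_uniform:
 assumes "0 <= L" "0 <= R"
 shows "uniform_limit (cball 0 L \<times> cball 0 R) (%n (l,z). \<Sum>i<n. ode_coeff A B a l i*z^i) (%(l,z). ode_sol A B a l z) sequentially"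
  "uniform_limit (cball 0 L \<times> cball 0 R) (%n (l,z). \<Sum>i<n. diffs (ode_coeff A B a l) i*z^i) (%(l,z). ode_dsol A B a l z) sequentially"
proof -
 obtain M where M: "!!l z n. norm l <= L ==> norm z <= R ==>
  norm (ode_coeff A B a l n*z^n) <= M*(1/2)^n & norm (diffs (ode_coeff A B a l) n*z^n) <= M*(1/2)^n"
  using ode_series_bound[OF AB assms] by blast
 have s: "summable (%n. M*(1/2)^n)" by (intro summable_mult) auto
 have "uniform_limit (cball 0 L \<times> cball 0 R) (%n p. \<Sum>i<n. ode_coeff A B a (fst p) i * snd p^i)
  (%p. \<Sum>i. ode_coeff A B a (fst p) i * snd p^i) sequentially"
  using M by (intro Weierstrass_m_test[OF _ s]) auto
 thus "uniform_limit (cball 0 L \<times> cball 0 R) (%n (l,z). \<Sum>i<n. ode_coeff A B a l i*z^i) (%(l,z). ode_sol A B a l z) sequentially"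
  by (simp add: case_prod_unfold ode_sol_def)
 have "uniform_limit (cball 0 L \<times> cball 0 R) (%n p. \<Sum>i<n. diffs (ode_coeff A B a (fst p)) i * snd p^i)
  (%p. \<Sum>i. diffs (ode_coeff A B a (fst p)) i * snd p^i) sequentially"
  using M by (intro Weierstrass_m_test[OF _ s]) auto
 thus "uniform_limit (cball 0 L \<times> cball 0 R) (%n (l,z). \<Sum>i<n. diffs (ode_coeff A B a l) i*z^i) (%(l,z). ode_dsol A B a l z) sequentially"
  by (simp add: case_prod_unfold ode_dsol_def)
qed

lemma continuous_on_ode_coeff: "continuous_on S (%l. ode_coeff A B a l n)"
 by (intro holomorphic_on_imp_continuous_on ode_coeff_holomorphic)

lemma continuous_on_ode:
 "continuous_on UNIV (%(l,z). ode_sol A B a l z)" "continuous_on UNIV (%(l,z). ode_dsol A B a l z)"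
proof -
 have cc: "continuous_on S (%p. ode_coeff A B a (fst p) n)" for S :: "(complex \<times> complex) set" and n
  by (rule continuous_on_compose2[OF continuous_on_ode_coeff[of UNIV]]) (auto intro: continuous_intros)
 have *: "continuous_on UNIV F" if u: "!!L R. 0 <= L ==> 0 <= R ==> uniform_limit (cball 0 L \<times> cball 0 R) G F sequentially"
  and G: "!!n S. continuous_on S (G n)" for F :: "complex \<times> complex => complex" and G :: "nat => _"
 proof (rule continuous_at_imp_continuous_on, safe)
  fix l z :: complex
  let ?S = "cball 0 (norm l + 1) \<times> cball 0 (norm z + 1) :: (complex \<times> complex) set"
  have "continuous_on ?S F" by (rule uniform_limit_theorem[OF _ u]) (use G in auto)
  moreover have "(l, z) : interior ?S" by (simp add: interior_Times)
  ultimately show "isCont F (l, z)" by (rule continuous_on_interior)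
 qed
 show "continuous_on UNIV (%(l,z). ode_sol A B a l z)"
  by (rule *[OF ode_sol_uniform(1)]) (auto simp: case_prod_unfold intro!: continuous_intros cc)
 show "continuous_on UNIV (%(l,z). ode_dsol A B a l z)"
  by (rule *[OF ode_sol_uniform(2)]) (auto simp: case_prod_unfold diffs_def intro!: continuous_intros cc)
qed

lemma holomorphic_on_ode:
 "(%l. ode_sol A B a l z) holomorphic_on S" "(%l. ode_dsol A B a l z) holomorphic_on S"
proof -
 have *: "F holomorphic_on S" if u: "!!L. 0 <= L ==> uniform_limit (cball 0 L) G F sequentially"
  and G: "!!n S. G n holomorphic_on S" for F :: "complex => complex" and G :: "nat => _"
 proof -
  have "F holomorphic_on UNIV"
  proof (rule holomorphic_uniform_sequence[OF open_UNIV])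
   show "G n holomorphic_on UNIV" for n by (rule G)
   show "EX d>0. cball x d <= UNIV & uniform_limit (cball x d) G F sequentially" for x
   proof (intro exI[of _ 1] conjI)
    have "cball x 1 <= cball 0 (norm x + 1)"
    proof
     fix y assume "y : cball x 1"
     thus "y : cball 0 (norm x + 1)" using norm_triangle_sub[of y x] by (simp add: dist_norm norm_minus_commute)
    qed
    thus "uniform_limit (cball x 1) G F sequentially" by (rule uniform_limit_on_subset[OF u, rotated]) auto
   qed auto
  qed
  thus ?thesis by (rule holomorphic_on_subset) auto
 qed
 have sub: "(%l. (l, z)) ` cball 0 L <= cball 0 L \<times> cball 0 (norm z)" for L :: real by auto
 have u: "uniform_limit (cball 0 L) (%n l. G n (l, z)) (%l. F (l, z)) sequentially"
  if "uniform_limit (cball 0 L \<times> cball 0 (norm z)) G F sequentially" for L and F :: "complex \<times> complex => complex" and G :: "nat => _"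
  using that unfolding uniform_limit_iff by (auto elim!: eventually_mono)
 show "(%l. ode_sol A B a l z) holomorphic_on S"
  using u[OF ode_sol_uniform(1)[of _ "norm z"]] by (intro *) (auto intro!: holomorphic_intros ode_coeff_holomorphic)
 show "(%l. ode_dsol A B a l z) holomorphic_on S"
  using u[OF ode_sol_uniform(2)[of _ "norm z"]] by (intro *) (auto simp: diffs_def intro!: holomorphic_intros ode_coeff_holomorphic)
qed
end

section \<open>Integration from infinity along horizontal lines\<close>

text \<open>Projecting on the direction of f b - f a reduces the claim to the monotonicity of a real
  function. Derivatives are asked for in the open interval only, so majorants built from
  \<open>sqrt\<close> can be used up to 0.\<close>

lemma norm_increment_le:
 fixes f :: "real => complex" and phi :: "real => real"
 assumes "a <= b" and "continuous_on {a..b} f" "continuous_on {a..b} phi"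
  and f: "!!t. a < t ==> t < b ==> (f has_vector_derivative f' t) (at t)"
  and phi: "!!t. a < t ==> t < b ==> (phi has_real_derivative phi' t) (at t)"
  and le: "!!t. a < t ==> t < b ==> norm (f' t) <= phi' t" shows "norm (f b - f a) <= phi b - phi a"
proof -
 define u where "u = sgn (f b - f a)"
 have u: "norm u <= 1" by (simp add: u_def norm_sgn)
 define g where "g t = phi t - u \<bullet> f t" for t
 have "g a <= g b"
 proof (rule DERIV_nonneg_imp_increasing_open[OF assms(1)])
  show "continuous_on {a..b} g" unfolding g_def by (intro continuous_intros assms)
  fix t assume t: "a < t" "t < b"
  have "((%t. u \<bullet> f t) has_vector_derivative u \<bullet> f' t) (at t)"
   using bounded_linear.has_vector_derivative[OF bounded_linear_inner_right f[OF t]] .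
  hence "(g has_real_derivative phi' t - u \<bullet> f' t) (at t)"
   unfolding g_def by (intro derivative_intros phi t) (simp add: has_real_derivative_iff_has_vector_derivative)
  moreover have "u \<bullet> f' t <= phi' t"
  proof -
   have "u \<bullet> f' t <= norm u*norm (f' t)" by (rule norm_cauchy_schwarz)
   also have "... <= 1*norm (f' t)" using u by (intro mult_right_mono) auto
   finally show ?thesis using le[OF t] by simp
  qed
  ultimately show "EX y. (g has_real_derivative y) (at t) & 0 <= y" by auto
 qed
 moreover have "u \<bullet> (f b - f a) = norm (f b - f a)"
  by (simp add: u_def sgn_div_norm dot_square_norm power2_eq_square divide_simps)
 ultimately show ?thesis by (simp add: g_def inner_diff_right)
qed

lemma has_vector_derivative_horizontal:
 assumes "(f has_field_derivative f') (at (z + of_real s))"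
 shows "((%s. f (z + of_real s)) has_vector_derivative f') (at s)"
proof -
 have "((%s. z + of_real s) has_vector_derivative 1) (at s)" by (auto intro!: derivative_eq_intros)
 from field_vector_diff_chain_at[OF this] assms show ?thesis by (simp add: o_def)
qed

lemma has_real_derivative_Re:
 assumes "(f has_vector_derivative f') (at s)" shows "((%s. Re (f s)) has_real_derivative Re f') (at s)"
 using bounded_linear.has_vector_derivative[OF bounded_linear_Re assms]
 by (simp add: has_real_derivative_iff_has_vector_derivative)

text \<open>A sector of half-opening pi/4 moved to the right by R. It is convex and stable under
  shifts to the right; for R >= 0 the real part of z^(3/2) is at least (Re z)^(3/2)/2 on it; and it
  still contains the far part of all rays of angle up to pi/5, which the rotated solutions
  require.\<close>

definition wedge :: "real => complex set" where
 "wedge R = {z. abs (Im z) < Re z - R}"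

lemma open_wedge: "open (wedge R)" unfolding wedge_def by (intro open_Collect_less continuous_intros)

lemma convex_wedge: "convex (wedge R)"
proof -
 have "wedge R = {z. inner (Complex (-1) 1) z < -R} \<inter> {z. inner (Complex (-1) (-1)) z < -R}"
  by (auto simp: wedge_def inner_complex_def)
 thus ?thesis by (simp add: convex_Int convex_halfspace_lt)
qed

lemma wedge_shift: "z : wedge R ==> 0 <= s ==> z + of_real s : wedge R" by (simp add: wedge_def)

lemma wedge_Re: "z : wedge R ==> R < Re z" by (auto simp: wedge_def)

lemma of_real_in_wedge: "of_real x : wedge R \<longleftrightarrow> R < x" by (simp add: wedge_def)

text \<open>Integrating from infinity along horizontal lines, without improper integrals: the primitive has
 a common limit along all of them.\<close>

lemma horizontal_limit:
 fixes H h :: "complex => complex" and b :: "complex => real"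
 assumes H: "!!z. z : wedge R ==> (H has_field_derivative h z) (at z)"
  and b: "!!z s. z : wedge R ==> 0 <= s ==> norm (H (z + of_real s) - H z) <= b z"
  and b0: "!!z. z : wedge R ==> tendsto (%s. b (z + of_real s)) 0 at_top"
  and seg: "!!z z'. z : wedge R ==> z' : wedge R ==> EX et. tendsto et 0 at_top &
   (ALL s>=0. ALL ze:closed_segment z z'. norm (h (ze + of_real s)) <= et s)"
 shows "EX L. ALL z:wedge R. norm (H z - L) <= b z"
proof -
 define z0 :: complex where "z0 = of_real (R+1)"
 have z0: "z0 : wedge R" unfolding z0_def of_real_in_wedge by simp
 define X where "X n = H (z0 + of_real (real n))" for n
 have bn: "LIMSEQ (%n. b (z0 + of_real (real n))) 0"
  by (rule filterlim_compose[OF b0[OF z0] filterlim_real_sequentially])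
 have "Cauchy X"
 proof (rule metric_CauchyI)
  fix e :: real assume e: "e > 0"
  hence "\<forall>\<^sub>F n in sequentially. b (z0 + of_real (real n)) < e/2"
   using order_tendstoD(2)[OF bn, of "e/2"] by simp
  then obtain N where N: "!!n. n >= N ==> b (z0 + of_real (real n)) < e/2" by (auto simp: eventually_sequentially)
  have d: "dist (X n) (X N) < e/2" if "n >= N" for n
  proof -
   have "norm (H ((z0 + of_real (real N)) + of_real (real (n-N))) - H (z0 + of_real (real N))) <= b (z0 + of_real (real N))"
    using wedge_shift[OF z0, of "real N"] by (intro b) auto
   thus ?thesis using N[of N] that by (simp add: X_def dist_norm)
  qed
  show "EX M. ALL m>=M. ALL n>=M. dist (X m) (X n) < e" using d by (meson dist_triangle_half_l)
 qed
 then obtain L where L: "LIMSEQ X L" using Cauchy_convergent convergent_def by blast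
 have "norm (H z - L) <= b z" if z: "z : wedge R" for z
 proof -
  obtain et where et: "tendsto et 0 at_top" "!!s ze. s >= 0 ==> ze : closed_segment z z0 ==> norm (h (ze + of_real s)) <= et s"
   using seg[OF z z0] by blast
  have sub: "closed_segment z z0 <= wedge R" by (rule closed_segment_subset[OF z z0 convex_wedge])
  \<comment> \<open>The two horizontal lines are compared through the translated segment between
    them, on which h tends to 0 uniformly.\<close>
  have "norm (H (z + of_real (real n)) - X n) <= et (real n)*norm (z-z0)" for n
  proof -
   have "norm ((%ze. H (ze + of_real (real n))) z - (%ze. H (ze + of_real (real n))) z0) <= et (real n)*norm (z-z0)"
   proof (rule field_differentiable_bound[where S = "closed_segment z z0" and f' = "%ze. h (ze + of_real (real n))"])
    show "((%ze. H (ze + of_real (real n))) has_field_derivative h (ze + of_real (real n))) (at ze within closed_segment z z0)"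
     if "ze : closed_segment z z0" for ze
    proof -
     have "(H has_field_derivative h (ze + of_real (real n))) (at (ze + of_real (real n)))"
      using that sub by (intro H wedge_shift) auto
     thus ?thesis by (simp only: DERIV_shift has_field_derivative_at_within)
    qed
    show "norm (h (ze + of_real (real n))) <= et (real n)" if "ze : closed_segment z z0" for ze
     using that by (intro et(2)) auto
   qed auto
   thus ?thesis by (simp add: X_def)
  qed
  moreover have "LIMSEQ (%n. et (real n)*norm (z-z0)) 0"
   using tendsto_mult_right[OF filterlim_compose[OF et(1) filterlim_real_sequentially], of "norm (z-z0)"] by simp
  ultimately have "LIMSEQ (%n. H (z + of_real (real n)) - X n) 0"
   by (rule Lim_null_comparison[OF always_eventually, OF allI])
  from tendsto_add[OF this L] have "LIMSEQ (%n. H (z + of_real (real n))) L" by simp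
  hence "LIMSEQ (%n. norm (H z - H (z + of_real (real n)))) (norm (H z - L))" by (intro tendsto_intros)
  thus ?thesis
  proof (rule tendsto_upperbound)
   show "\<forall>\<^sub>F n in sequentially. norm (H z - H (z + of_real (real n))) <= b z"
    by (intro always_eventually allI, subst norm_minus_commute) (rule b[OF z], simp)
  qed simp
 qed
 thus ?thesis by blast
qed

section \<open>The Liouville-Green phase\<close>

text \<open>The integral of sqrt(z^3 + a z), up to terms vanishing at infinity, plus the logarithm
  of the amplitude factor (z^3)^(1/4). The parameter \<open>l\<close> is absent: it contributes l/(2
  z^(3/2)), whose integral converges at infinity, so one normalisation serves all
  \<open>l\<close>.\<close>

definition phase :: "complex => complex => complex" where
 "phase a z = 2/5*csqrt z^5 + a*csqrt z + 3/4*Ln z"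

definition dphase :: "complex => complex => complex" where
 "dphase a z = csqrt z^3 + a/(2*csqrt z) + 3/(4*z)"

text \<open>The defect of exp(- phase): that function solves w'' = (z^3 + a z - remainder) w. What
  matters is that the defect is bounded on the wedge.\<close>

definition remainder :: "complex => complex => complex" where
 "remainder a z = - (a^2/(4*z) + a/csqrt z^3 + 21/(16*z^2))"

lemma phase_deriv:
 assumes "0 < Re z" shows "(phase a has_field_derivative dphase a z) (at z)"
proof -
 have z: "z ~: nonpos_Reals" "csqrt z ~= 0" "z ~= 0" using assms by (auto simp: complex_nonpos_Reals_iff)
 define w where "w = csqrt z"
 have w: "w ~= 0" using z by (simp add: w_def)
 have c: "(csqrt has_field_derivative 1/(2*w)) (at z)"
  using has_field_derivative_csqrt[OF z(1)] by (simp add: w_def inverse_eq_divide)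
 have 1: "((%z. 2/5*csqrt z^5) has_field_derivative w^3) (at z)"
  using DERIV_cmult[OF DERIV_power[OF c, of 5], of "2/5"] w by (simp add: w_def[symmetric] eval_nat_numeral)
 have 2: "((%z. a*csqrt z) has_field_derivative a/(2*w)) (at z)" using DERIV_cmult[OF c, of a] by simp
 have 3: "((%z. 3/4*Ln z) has_field_derivative 3/(4*z)) (at z)"
  using DERIV_cmult[OF has_field_derivative_Ln[OF z(1)], of "3/4"] by (simp add: inverse_eq_divide)
 show ?thesis unfolding phase_def[abs_def] dphase_def using DERIV_add[OF DERIV_add[OF 1 2] 3] by (simp add: w_def)
qed

lemma dphase_deriv:
 assumes "0 < Re z" shows "(dphase a has_field_derivative dphase a z^2 - z^3 - a*z + remainder a z) (at z)"
proof -
 have z: "z ~: nonpos_Reals" "csqrt z ~= 0" "z ~= 0" using assms by (auto simp: complex_nonpos_Reals_iff)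
 define w where "w = csqrt z"
 have w: "z = w^2" "w ~= 0" using z by (auto simp: w_def)
 have "(dphase a has_field_derivative 3/2*w-a/(4*w^3) - 3/(4*z^2)) (at z)"
 proof -
  have c: "(csqrt has_field_derivative 1/(2*w)) (at z)"
   using has_field_derivative_csqrt[OF z(1)] by (simp add: w_def inverse_eq_divide)
  have 1: "((%z. csqrt z^3) has_field_derivative 3/2*w) (at z)"
   using DERIV_power[OF c, of 3] w(2) by (simp add: w_def[symmetric] power2_eq_square)
  have 2: "((%z. a/(2*csqrt z)) has_field_derivative - (a/(4*w^3))) (at z)"
   using w(2) z(1) by (auto intro!: derivative_eq_intros simp: w_def[symmetric] power3_eq_cube)
  have 3: "((%z. 3/(4*z)) has_field_derivative - (3/(4*z^2))) (at z)"
   using z(3) by (auto intro!: derivative_eq_intros simp: power2_eq_square)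
  show ?thesis unfolding dphase_def[abs_def] using DERIV_add[OF DERIV_add[OF 1 2] 3] by simp
 qed
 moreover have "3/2*w-a/(4*w^3) - 3/(4*z^2) = dphase a z^2 - z^3 - a*z + remainder a z"
  unfolding dphase_def remainder_def w_def[symmetric] using w(2) unfolding w(1)
  by (simp add: field_simps power2_eq_square) (simp add: eval_nat_numeral)?
 ultimately show ?thesis by simp
qed

text \<open>For csqrt z = p + i q the hypothesis bounds q^2 by Re z/4, and the real part of the cube
  is p (p^2 - 3 q^2) = p (Re z - 2 q^2).\<close>

lemma csqrt_wedge:
 assumes "abs (Im z) < Re z" shows "Re (csqrt z^3) >= Re z * sqrt (Re z)/2" "norm (csqrt z) >= sqrt (Re z)"
proof -
 define p q x where "p = Re (csqrt z)" and "q = Im (csqrt z)" and "x = Re z"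
 have x: "x > 0" using assms by (simp add: x_def)
 have z: "z = csqrt z^2" by simp
 have 1: "x = p^2 - q^2" "Im z = 2*p*q" unfolding x_def p_def q_def by (subst (1) z, simp add: power2_eq_square)+
 have p: "p >= 0" using csqrt_principal[of z] by (auto simp: p_def)
 have "(Im z)^2 < x^2" using assms power_strict_mono[of "abs (Im z)" x 2] by (simp add: x_def)
 hence lt: "4*((x + q^2)*q^2) < x^2" unfolding 1(2) using 1(1) by (simp add: power_mult_distrib)
 have q: "q^2 < x/4"
 proof (rule ccontr)
  assume "~q^2 < x/4"
  hence "(5*x/4)*(x/4) <= (x + q^2)*q^2" using x by (intro mult_mono) auto
  hence "5*x^2/16 <= (x + q^2)*q^2" by (simp add: power2_eq_square)
  moreover have "0 < x^2" using x by simp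
  ultimately show False using lt by linarith
 qed
 have px: "sqrt x <= p" using p 1(1) by (intro real_le_lsqrt) auto
 have "Re (csqrt z^3) = p*(p^2 - 3*q^2)"
  by (simp add: p_def q_def power2_eq_square power3_eq_cube algebra_simps del: csqrt.sel)
 also have "... >= sqrt x*(x/2)" using 1(1) q px p x by (intro mult_mono) auto
 finally show "Re (csqrt z^3) >= Re z * sqrt (Re z)/2" by (simp add: x_def mult.commute)
 show "norm (csqrt z) >= sqrt (Re z)" by (simp add: complex_Re_le_cmod)
qed

lemma Re_dphase_ge:
 assumes "abs (Im z) < Re z" "1 <= Re z" "4*norm a <= Re z" shows "Re (dphase a z) >= Re z * sqrt (Re z)/4"
proof -
 define x where "x = Re z"
 have x: "1 <= x" "4*norm a <= x" using assms by (auto simp: x_def)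
 have "norm (a/(2*csqrt z)) <= (x/4)/(2 * sqrt x)"
  unfolding norm_divide norm_mult using csqrt_wedge(2)[OF assms(1)] x by (intro frac_le) (auto simp: x_def)
 also have "... <= x * sqrt x/8" using x by (simp add: field_simps)
 finally have 1: "Re (a/(2*csqrt z)) >= - (x * sqrt x/8)" using abs_Re_le_cmod[of "a/(2*csqrt z)"] by linarith
 have 2: "Re (3/(4*z)) >= 0" using x unfolding Re_divide by (simp add: x_def)
 have 3: "0 <= x * sqrt x" using x by simp
 show ?thesis using 1 2 3 csqrt_wedge(1)[OF assms(1)] by (simp add: dphase_def x_def)
qed

lemma norm_remainder_le:
 assumes "abs (Im z) < Re z" "1 <= Re z" shows "norm (remainder a z) <= norm a^2 + norm a + 2"
proof -
 have z: "1 <= norm z" using assms complex_Re_le_cmod[of z] by linarith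
 have "1 <= sqrt (Re z)" using assms by simp
 hence w: "1 <= norm (csqrt z)" using csqrt_wedge(2)[OF assms(1)] by linarith
 have "norm (a^2/(4*z)) <= norm a^2/1"
  unfolding norm_divide norm_power norm_mult using z by (intro divide_left_mono) auto
 moreover have "norm (a/csqrt z^3) <= norm a/1"
  unfolding norm_divide norm_power norm_mult using w by (intro divide_left_mono) (auto)
 moreover have "norm (21/(16*z^2)) <= 2"
 proof -
  have "norm (21/(16*z^2)) <= 21/16" unfolding norm_divide norm_power norm_mult
  proof -
   have q: "1 <= (norm z)^2" using one_le_power[OF z, of 2] .
   have "21/(norm z)^2 <= 21/1" by (rule divide_left_mono) (use q in auto)
   thus "norm (21 :: complex)/(norm (16 :: complex)*(norm z)^2) <= 21/16" by simp
  qed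
  thus ?thesis by simp
 qed
 ultimately show ?thesis unfolding remainder_def norm_minus_cancel
  by (intro order_trans[OF norm_triangle_ineq] order_trans[OF add_mono[OF norm_triangle_ineq order_refl]]) simp
qed

lemma remainder_holomorphic: "0 <= R ==> remainder a holomorphic_on wedge R"
proof -
 assume "0 <= R"
 hence z: "z ~: nonpos_Reals" "csqrt z ~= 0" "z ~= 0" if "z : wedge R" for z
  using wedge_Re[OF that] by (auto simp: complex_nonpos_Reals_iff)
 thus ?thesis unfolding remainder_def[abs_def] by (intro holomorphic_intros) auto
qed

context
 fixes a :: complex and R :: real
 assumes R: "1 <= R" "4*norm a <= R"
begin

lemma wedge_dphase: "z : wedge R ==> Re (dphase a z) >= Re z * sqrt (Re z)/4"
 using R by (intro Re_dphase_ge) (auto simp: wedge_def)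

lemma phase_increasing:
 assumes "z : wedge R" "0 <= s" shows "Re (phase a z) + s/4 <= Re (phase a (z + of_real s))"
proof -
 define g where "g s = Re (phase a (z + of_real s)) - s/4" for s
 have "g 0 <= g s"
 proof (rule DERIV_nonneg_imp_nondecreasing[OF assms(2)])
  fix t :: real assume t: "0 <= t" "t <= s"
  have zt: "z + of_real t : wedge R" using assms t by (intro wedge_shift)
  have x: "1 <= Re (z + of_real t)" using wedge_Re[OF zt] R by simp
  have "1*1 <= Re (z + of_real t) * sqrt (Re (z + of_real t))" using x by (intro mult_mono) auto
  hence "1/4 <= Re (dphase a (z + of_real t))" using wedge_dphase[OF zt] by linarith
  moreover have "(g has_real_derivative Re (dphase a (z + of_real t)) - 1/4) (at t)"
   unfolding g_def using x by (auto intro!: derivative_eq_intros has_vector_derivative_horizontal phase_deriv)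
  ultimately show "EX y. (g has_real_derivative y) (at t) & 0 <= y" by auto
 qed
 thus ?thesis by (simp add: g_def)
qed

text \<open>Variation of constants: u = exp(2 phase) times a primitive of exp(- 2 phase) k that
  vanishes at infinity. The damping rate 2 Re dphase is at least (Re z)^(3/2)/2, which yields the
  gain over B.\<close>

lemma damped_primitive:
 assumes k: "k holomorphic_on wedge R" "!!z. z : wedge R ==> norm (k z) <= B"
 shows "EX u. (ALL z:wedge R. (u has_field_derivative 2*dphase a z*u z + k z) (at z)) &
  (ALL z:wedge R. norm (u z) <= 2*B/(Re z * sqrt (Re z)))"
proof -
 have pd: "(phase a has_field_derivative dphase a z) (at z)" if "z : wedge R" for z
  using wedge_Re[OF that] R by (intro phase_deriv) auto
 define h where "h z = exp (- 2*phase a z)*k z" for z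
 have "phase a holomorphic_on wedge R" by (rule holomorphic_on_open[THEN iffD2, OF open_wedge]) (use pd in blast)
 hence hh: "h holomorphic_on wedge R" and pc: "continuous_on (wedge R) (phase a)"
  unfolding h_def[abs_def] by (auto intro!: holomorphic_intros k holomorphic_on_imp_continuous_on)
 obtain H where H: "!!z. z : wedge R ==> (H has_field_derivative h z) (at z)"
  using holomorphic_convex_primitive'[OF convex_wedge open_wedge hh] at_within_open[OF _ open_wedge] by metis
 define E where "E z = norm (exp (- 2*phase a z))" for z
 have E: "E z = exp (- 2*Re (phase a z))" for z by (simp add: E_def)
 have h: "norm (h z) <= B*E z" if "z : wedge R" for z
 proof -
  have "norm (h z) = norm (k z)*E z" by (simp add: h_def norm_mult E)
  also have "... <= B*E z" using k(2)[OF that] by (intro mult_right_mono) (auto simp: E)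
  finally show ?thesis .
 qed
 have "of_real (R+1) : wedge R" unfolding of_real_in_wedge by simp
 from k(2)[OF this] have B: "0 <= B" by (rule order_trans[OF norm_ge_zero])
 define b where "b z = 2*B/(Re z * sqrt (Re z))*E z" for z
 have x: "1 < Re z" if "z : wedge R" for z using wedge_Re[OF that] R by simp
 have xs: "1 <= Re z * sqrt (Re z)" if "z : wedge R" for z
  using mult_mono[of 1 "Re z" 1 "sqrt (Re z)"] x[OF that] by simp
 have bE: "b z <= 2*B*E z" if "z : wedge R" for z
 proof -
  have "2*B/(Re z * sqrt (Re z)) <= 2*B/1" using B xs[OF that] by (intro divide_left_mono) auto
  thus ?thesis unfolding b_def by (intro mult_right_mono) (auto simp: E)
 qed
 have bnn: "0 <= b z" if "z : wedge R" for z
  unfolding b_def using B x[OF that] by (intro mult_nonneg_nonneg) (auto simp: E)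
 have Es: "E (z + of_real s) <= E z*exp (- s/2)" if "z : wedge R" "0 <= s" for z s
  unfolding E exp_add[symmetric] using phase_increasing[OF that] by simp
 have e0: "tendsto (%s::real. C*exp (- s/2)) 0 at_top" for C by real_asymp
 have "EX L. ALL z:wedge R. norm (H z - L) <= b z"
 proof (rule horizontal_limit[where h = h])
  fix z s assume z: "z : wedge R" and s: "0 <= (s::real)"
  define c where "c = 2*B/(Re z * sqrt (Re z))"
  have c: "0 <= c" using B xs[OF z] by (simp add: c_def)
  \<comment> \<open>A majorant: its derivative 2 c Re dphase E is at least B E, by the choice of c
    and the lower bound for Re dphase.\<close>
  define phi where "phi t = - c*E (z + of_real t)" for t
  have "norm (H (z + of_real s) - H (z + of_real 0)) <= phi s - phi 0"
  proof (rule norm_increment_le[where f' = "%t. h (z + of_real t)" and phi' = "%t. c*(2*Re (dphase a (z + of_real t))*E (z + of_real t))"])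
   have H': "((%t. H (z + of_real t)) has_vector_derivative h (z + of_real t)) (at t)" if "0 <= t" for t
    using that z by (intro has_vector_derivative_horizontal H wedge_shift)
   thus "0 < t ==> ((%t. H (z + of_real t)) has_vector_derivative h (z + of_real t)) (at t)" for t by simp
   show "continuous_on {0..s} (%t. H (z + of_real t))"
    by (intro continuous_at_imp_continuous_on ballI has_vector_derivative_continuous[OF H']) auto
   have phi': "(phi has_real_derivative c*(2*Re (dphase a (z + of_real t))*E (z + of_real t))) (at t)" if "0 <= t" for t
    unfolding phi_def[abs_def] E
    using that z by (auto intro!: derivative_eq_intros has_vector_derivative_horizontal pd wedge_shift)
   thus "0 < t ==> (phi has_real_derivative c*(2*Re (dphase a (z + of_real t))*E (z + of_real t))) (at t)" for t by simp
   show "continuous_on {0..s} phi" by (intro continuous_at_imp_continuous_on ballI DERIV_isCont[OF phi']) auto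
   fix t :: real assume t: "0 < t"
   hence zt: "z + of_real t : wedge R" using z by (intro wedge_shift) auto
   have "Re z * sqrt (Re z) <= Re (z + of_real t) * sqrt (Re (z + of_real t))"
    using t x[OF z] by (intro mult_mono) auto
   hence "Re z * sqrt (Re z)/4 <= Re (dphase a (z + of_real t))" using wedge_dphase[OF zt] by linarith
   hence "c*(2*(Re z * sqrt (Re z)/4)) <= c*(2*Re (dphase a (z + of_real t)))"
    using c by (intro mult_left_mono) auto
   also have "c*(2*(Re z * sqrt (Re z)/4)) = B" using x[OF z] by (simp add: c_def)
   finally have "B*E (z + of_real t) <= c*(2*Re (dphase a (z + of_real t)))*E (z + of_real t)"
    by (intro mult_right_mono) (auto simp: E)
   thus "norm (h (z + of_real t)) <= c*(2*Re (dphase a (z + of_real t))*E (z + of_real t))"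
    using h[OF zt] by (simp)
  qed (use s in auto)
  also have "... <= b z" using mult_nonneg_nonneg[OF c, of "E (z + of_real s)"] by (simp add: phi_def b_def c_def E)
  finally show "norm (H (z + of_real s) - H z) <= b z" by simp
 next
  fix z assume z: "z : wedge R"
  show "tendsto (%s. b (z + of_real s)) 0 at_top"
  proof (rule real_tendsto_sandwich[OF _ _ tendsto_const e0])
   show "\<forall>\<^sub>F s in at_top. 0 <= b (z + of_real s)"
    using eventually_ge_at_top[of 0] by eventually_elim (intro bnn wedge_shift z)
   show "\<forall>\<^sub>F s in at_top. b (z + of_real s) <= (2*B*E z)*exp (- s/2)"
    using eventually_ge_at_top[of 0]
   proof eventually_elim
    case (elim s)
    have "b (z + of_real s) <= 2*B*E (z + of_real s)" by (intro bE wedge_shift z elim)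
    also have "... <= 2*B*(E z*exp (- s/2))" using B by (intro mult_left_mono Es z elim) auto
    finally show ?case by (simp)
   qed
  qed
 next
  fix z z' assume z: "z : wedge R" "z' : wedge R"
  have sub: "closed_segment z z' <= wedge R" by (rule closed_segment_subset[OF z convex_wedge])
  have "continuous_on (closed_segment z z') E"
   unfolding E_def by (intro continuous_intros continuous_on_subset[OF pc sub])
  then obtain M where M: "!!ze. ze : closed_segment z z' ==> E ze <= M"
   using continuous_attains_sup[of "closed_segment z z'" E] by fastforce
  show "EX et. tendsto et 0 at_top & (ALL s>=0. ALL ze:closed_segment z z'. norm (h (ze + of_real s)) <= et s)"
  proof (intro exI[of _ "%s. (B*M)*exp (- s/2)"] conjI e0 allI impI ballI)
   fix s ze assume s: "0 <= (s::real)" and ze: "ze : closed_segment z z'"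
   hence ze': "ze : wedge R" using sub by auto
   have "norm (h (ze + of_real s)) <= B*E (ze + of_real s)" by (intro h wedge_shift ze' s)
   also have "... <= B*(M*exp (- s/2))"
    by (intro mult_left_mono B order_trans[OF Es[OF ze' s]] mult_right_mono M ze) auto
   finally show "norm (h (ze + of_real s)) <= (B*M)*exp (- s/2)" by (simp)
  qed
 qed (use H in auto)
 then obtain L where L: "!!z. z : wedge R ==> norm (H z - L) <= b z" by blast
 define u where "u z = exp (2*phase a z)*(H z - L)" for z
 show ?thesis
 proof (intro exI[of _ u] conjI ballI)
  fix z assume z: "z : wedge R"
  have "h z*exp (2*phase a z) = k z" by (simp add: h_def exp_add[symmetric])
  thus "(u has_field_derivative 2*dphase a z*u z + k z) (at z)"
   unfolding u_def[abs_def] using H[OF z] pd[OF z] by (auto intro!: derivative_eq_intros)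
  have "norm (u z) <= norm (exp (2*phase a z))*b z" unfolding u_def norm_mult by (intro mult_left_mono L z) auto
  also have "... = 2*B/(Re z * sqrt (Re z))*(exp (2*Re (phase a z))*exp (- 2*Re (phase a z)))"
   by (simp add: b_def E)
  also have "exp (2*Re (phase a z))*exp (- 2*Re (phase a z)) = 1" by (simp add: exp_add[symmetric])
  finally show "norm (u z) <= 2*B/(Re z * sqrt (Re z))" by simp
 qed
qed

text \<open>Integrating M x^(-3/2) in from infinity costs one power of x and leaves 2 M x^(-1/2),
  which is still small far out.\<close>

lemma decaying_primitive:
 assumes u: "u holomorphic_on wedge R" "!!z. z : wedge R ==> norm (u z) <= M/(Re z * sqrt (Re z))"
 shows "EX d. (ALL z:wedge R. (d has_field_derivative u z) (at z)) & (ALL z:wedge R. norm (d z) <= 2*M/sqrt (Re z))"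
proof -
 obtain H where H: "!!z. z : wedge R ==> (H has_field_derivative u z) (at z)"
  using holomorphic_convex_primitive'[OF convex_wedge open_wedge u(1)] at_within_open[OF _ open_wedge] by metis
 have x: "1 < Re z" if "z : wedge R" for z using wedge_Re[OF that] R by simp
 have M: "0 <= M"
 proof -
  have z: "of_real (R+1) : wedge R" unfolding of_real_in_wedge by simp
  have "0 <= M/(Re (of_real (R+1)) * sqrt (Re (of_real (R+1))))" using u(2)[OF z] norm_ge_zero order_trans by blast
  thus ?thesis using R by (simp add: zero_le_divide_iff mult_le_0_iff)
 qed
 have "EX L. ALL z:wedge R. norm (H z - L) <= 2*M/sqrt (Re z)"
 proof (rule horizontal_limit[where h = u])
  fix z s assume z: "z : wedge R" and s: "0 <= (s::real)"
  define phi where "phi t = - 2*M/sqrt (Re z + t)" for t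
  have "norm (H (z + of_real s) - H (z + of_real 0)) <= phi s - phi 0"
  proof (rule norm_increment_le[where f' = "%t. u (z + of_real t)" and phi' = "%t. M/((Re z + t) * sqrt (Re z + t))"])
   have H': "((%t. H (z + of_real t)) has_vector_derivative u (z + of_real t)) (at t)" if "0 <= t" for t
    using that z by (intro has_vector_derivative_horizontal H wedge_shift)
   thus "0 < t ==> ((%t. H (z + of_real t)) has_vector_derivative u (z + of_real t)) (at t)" for t by simp
   show "continuous_on {0..s} (%t. H (z + of_real t))"
    by (intro continuous_at_imp_continuous_on ballI has_vector_derivative_continuous[OF H']) auto
   have phi': "(phi has_real_derivative M/((Re z + t) * sqrt (Re z + t))) (at t)" if "0 <= t" for t
    unfolding phi_def[abs_def] using that x[OF z] by (auto intro!: derivative_eq_intros simp: field_simps)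
   thus "0 < t ==> (phi has_real_derivative M/((Re z + t) * sqrt (Re z + t))) (at t)" for t by simp
   show "continuous_on {0..s} phi" by (intro continuous_at_imp_continuous_on ballI DERIV_isCont[OF phi']) auto
   fix t :: real assume t: "0 < t"
   hence zt: "z + of_real t : wedge R" using z by (intro wedge_shift) auto
   thus "norm (u (z + of_real t)) <= M/((Re z + t) * sqrt (Re z + t))" using u(2)[OF zt] by simp
  qed (use s in auto)
  also have "... <= 2*M/sqrt (Re z)" using M x[OF z] s by (simp add: phi_def)
  finally show "norm (H (z + of_real s) - H z) <= 2*M/sqrt (Re z)" by simp
 next
  fix z assume z: "z : wedge R"
  show "tendsto (%s. 2*M/sqrt (Re (z + of_real s))) 0 at_top" by simp real_asymp
 next
  fix z z' assume z: "z : wedge R" "z' : wedge R"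
  have sub: "closed_segment z z' <= wedge R" by (rule closed_segment_subset[OF z convex_wedge])
  show "EX et. tendsto et 0 at_top & (ALL s>=0. ALL ze:closed_segment z z'. norm (u (ze + of_real s)) <= et s)"
  proof (intro exI[of _ "%s. M/(1+s)"] conjI allI impI ballI)
   show "tendsto (%s. M/(1+s)) 0 at_top" by real_asymp
   fix s ze assume s: "0 <= (s::real)" and ze: "ze : closed_segment z z'"
   hence ze': "ze + of_real s : wedge R" and ze'': "ze : wedge R" using sub by (auto intro: wedge_shift)
   have "(1+s)*1 <= Re (ze + of_real s) * sqrt (Re (ze + of_real s))" using x[OF ze''] s by (intro mult_mono) auto
   hence "M/(Re (ze + of_real s) * sqrt (Re (ze + of_real s))) <= M/(1+s)"
    using M s by (intro divide_left_mono) auto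
   thus "norm (u (ze + of_real s)) <= M/(1+s)" using u(2)[OF ze'] by linarith
  qed
 qed (use H in auto)
 then obtain L where L: "!!z. z : wedge R ==> norm (H z - L) <= 2*M/sqrt (Re z)" by blast
 show ?thesis
 proof (intro exI[of _ "%z. H z - L"] conjI ballI L)
  show "((%z. H z - L) has_field_derivative u z) (at z)" if "z : wedge R" for z
   using DERIV_diff[OF H[OF that] DERIV_const[of L]] by simp
 qed
qed
end

text \<open>For holomorphic terms a summable bound on the functions themselves is enough; it
  controls the derivatives as well.\<close>

lemma series_has_field_derivative:
 fixes f f' :: "nat => complex => complex" and A :: "nat => real"
 assumes S: "open S" and f: "!!n z. z : S ==> (f n has_field_derivative f' n z) (at z)"
  and A: "!!n z. z : S ==> norm (f n z) <= A n" "summable A" and z: "z : S"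
 shows "((%z. \<Sum>n. f n z) has_field_derivative (\<Sum>n. f' n z)) (at z)" "summable (%n. f' n z)"
proof -
 have A0: "0 <= A n" for n using A(1)[OF z, of n] norm_ge_zero order_trans by blast
 have "EX g g'. ALL x : S. ((%n. f n x) sums g x) & ((%n. f' n x) sums g' x) & (g has_field_derivative g' x) (at x)"
 proof (rule series_and_derivative_comparison_complex[OF S f])
  fix x assume x: "x : S"
  show "EX d h. 0 < d & summable h & range h <= nonneg_Reals & (\<forall>\<^sub>F n in sequentially. ALL y:ball x d \<inter> S. cmod (f n y) <= cmod (h n))"
   using A A0 by (intro exI[of _ 1] exI[of _ "%n. of_real (A n)"]) (auto)
 qed
 then obtain g g' where g: "!!x. x : S ==> (%n. f n x) sums g x" "!!x. x : S ==> (%n. f' n x) sums g' x"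
   "!!x. x : S ==> (g has_field_derivative g' x) (at x)" by blast
 have "((%z. \<Sum>n. f n z) has_field_derivative g' z) (at z)"
  by (rule has_field_derivative_transform_within_open[OF g(3)[OF z] S z]) (use g(1) sums_unique in blast)
 thus "((%z. \<Sum>n. f n z) has_field_derivative (\<Sum>n. f' n z)) (at z)"
  using sums_unique[OF g(2)[OF z]] by simp
 show "summable (%n. f' n z)" using g(2)[OF z] sums_summable by blast
qed

section \<open>The amplitude equation and its solution as a power series in l\<close>

text \<open>With y = exp(- phase) v the equation for y turns into v'' = 2 dphase v' + (remainder +
  l) v. Here \<open>d\<close> stands for v, \<open>u\<close> for v' and \<open>k\<close> for the
  last term.\<close>

definition damped_sol :: "complex => real => (complex => complex) => (complex => complex) => (complex => complex) => bool" where
 "damped_sol a R k d u \<longleftrightarrow> (ALL z:wedge R. (d has_field_derivative u z) (at z) &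
  (u has_field_derivative 2*dphase a z*u z + k z) (at z))"

lemma damped_sol_holomorphic:
 "damped_sol a R k d u ==> d holomorphic_on wedge R" "damped_sol a R k d u ==> u holomorphic_on wedge R"
 by (auto simp: damped_sol_def holomorphic_on_open[OF open_wedge])

lemma damped_sol_series:
 fixes A :: "nat => real"
 assumes s: "!!n. damped_sol a R (k n) (d n) (u n)"
  and A: "!!n z. z : wedge R ==> norm (d n z) <= A n" "!!n z. z : wedge R ==> norm (u n z) <= A n"
   "!!n z. z : wedge R ==> norm (k n z) <= A n" "summable A"
 shows "damped_sol a R (%z. \<Sum>n. k n z) (%z. \<Sum>n. d n z) (%z. \<Sum>n. u n z)" unfolding damped_sol_def
proof (intro ballI conjI)
 fix z assume z: "z : wedge R"
 have d: "!!n z. z : wedge R ==> (d n has_field_derivative u n z) (at z)"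
  and u: "!!n z. z : wedge R ==> (u n has_field_derivative 2*dphase a z*u n z + k n z) (at z)"
  using s by (auto simp: damped_sol_def)
 show "((%z. \<Sum>n. d n z) has_field_derivative (\<Sum>n. u n z)) (at z)"
  by (rule series_has_field_derivative(1)[OF open_wedge d A(1,4) z])
 have su: "summable (%n. u n z)" and sk: "summable (%n. k n z)"
  by (rule summable_comparison_test'[OF A(4)], use A(2,3)[OF z] in simp)+
 have "(\<Sum>n. 2*dphase a z*u n z + k n z) = 2*dphase a z*(\<Sum>n. u n z) + (\<Sum>n. k n z)"
  by (simp add: suminf_add[symmetric] suminf_mult su sk)
 thus "((%z. \<Sum>n. u n z) has_field_derivative 2*dphase a z*(\<Sum>n. u n z) + (\<Sum>n. k n z)) (at z)"
  using series_has_field_derivative(1)[OF open_wedge u A(2,4) z] by simp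
qed

definition remainder_bound :: "complex => real" where
 "remainder_bound a = norm a^2 + norm a + 2"

lemma remainder_bound_ge: "2 <= remainder_bound a" by (simp add: remainder_bound_def)

context
 fixes a :: complex and R :: real
 assumes R: "1 <= R" "4*norm a <= R"
begin

lemma wedge_ge:
 assumes "z : wedge R" shows "1 < Re z" "sqrt R <= sqrt (Re z)" "1 <= sqrt (Re z)" "sqrt R <= Re z * sqrt (Re z)" "1 <= Re z * sqrt (Re z)"
proof -
 show 1: "1 < Re z" "sqrt R <= sqrt (Re z)" "1 <= sqrt (Re z)" using wedge_Re[OF assms] R by auto
 have "1 * sqrt R <= Re z * sqrt (Re z)" using 1 R by (intro mult_mono) auto
 thus "sqrt R <= Re z * sqrt (Re z)" by simp
 show "1 <= Re z * sqrt (Re z)" using mult_mono[of 1 "Re z" 1 "sqrt (Re z)"] 1 by simp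
qed

lemma damped_sol_exists:
 assumes k: "k holomorphic_on wedge R" "!!z. z : wedge R ==> norm (k z) <= B" shows "EX d u. damped_sol a R k d u &
  (ALL z:wedge R. norm (d z) <= 4*B/sqrt (Re z) & norm (u z) <= 2*B/(Re z * sqrt (Re z)))"
proof -
 obtain u where u: "!!z. z : wedge R ==> (u has_field_derivative 2*dphase a z*u z + k z) (at z)"
  "!!z. z : wedge R ==> norm (u z) <= 2*B/(Re z * sqrt (Re z))" using damped_primitive[OF R k] by blast
 have "u holomorphic_on wedge R" using u(1) by (auto simp: holomorphic_on_open[OF open_wedge])
 from decaying_primitive[OF R this u(2)] obtain d where "!!z. z : wedge R ==> (d has_field_derivative u z) (at z)"
  "!!z. z : wedge R ==> norm (d z) <= 2*(2*B)/sqrt (Re z)" by auto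
 thus ?thesis using u by (intro exI[of _ d] exI[of _ u]) (auto simp: damped_sol_def)
qed

lemma div_le_div_sqrt:
 assumes "z : wedge R" "0 <= C"
 shows "C/sqrt (Re z) <= C/sqrt R" "C/sqrt (Re z) <= C" "C/(Re z * sqrt (Re z)) <= C"
proof -
 note w = wedge_ge[OF assms(1)]
 show "C/sqrt (Re z) <= C/sqrt R" using w assms R by (intro divide_left_mono) auto
 have "C/sqrt (Re z) <= C/1" using w assms by (intro divide_left_mono) auto
 thus "C/sqrt (Re z) <= C" by simp
 have "C/(Re z * sqrt (Re z)) <= C/1" using w assms by (intro divide_left_mono) auto
 thus "C/(Re z * sqrt (Re z)) <= C" by simp
qed

text \<open>Neumann series: the term remainder d of one solution is the source of the next, and 8
  \<open>remainder_bound\<close> <= sqrt R halves the bound on the source in each round. The sum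
  then carries remainder d on its own right-hand side.\<close>

lemma damped_remainder_sol_exists:
 assumes R': "8*remainder_bound a <= sqrt R"
  and k: "k holomorphic_on wedge R" "!!z. z : wedge R ==> norm (k z) <= B"
 shows "EX d u. damped_sol a R (%z. remainder a z*d z + k z) d u &
  (ALL z:wedge R. norm (d z) <= 8*B/sqrt (Re z) & norm (u z) <= 4*B/(Re z * sqrt (Re z)))"
proof -
 define P :: "nat => ((complex => complex) \<times> (complex => complex) \<times> (complex => complex)) => bool" where
  "P n = (%(k', d, u). damped_sol a R k' d u & (n = 0 --> k' = k) &
   (ALL z:wedge R. norm (k' z) <= B*(1/2)^n & norm (d z) <= 4*(B*(1/2)^n)/sqrt (Re z) & norm (u z) <= 2*(B*(1/2)^n)/(Re z * sqrt (Re z))))" for n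
 define Q :: "nat => ((complex => complex) \<times> (complex => complex) \<times> (complex => complex)) => (complex => complex) \<times> (complex => complex) \<times> (complex => complex) => bool" where
  "Q n = (%(k', d, u) (k'', d', u'). k'' = (%z. remainder a z*d z))" for n
 have "of_real (R+1) : wedge R" unfolding of_real_in_wedge by simp
 from k(2)[OF this] have B: "0 <= B" by (rule order_trans[OF norm_ge_zero])
 have "EX f. ALL n. P n (f n) & Q n (f n) (f (Suc n))"
 proof (rule dependent_nat_choice)
  show "EX x. P 0 x" using damped_sol_exists[OF k] by (auto simp: P_def k(2))
  fix x n assume x: "P n x"
  obtain k' d u where xe: "x = (k', d, u)" by (metis prod_cases3)
  define kk where "kk z = remainder a z*d z" for z
  have s: "damped_sol a R k' d u" and dz: "!!z. z : wedge R ==> norm (d z) <= 4*(B*(1/2)^n)/sqrt (Re z)"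
   using x by (auto simp: xe P_def)
  have 1: "kk holomorphic_on wedge R" unfolding kk_def[abs_def]
   using R by (intro holomorphic_intros remainder_holomorphic damped_sol_holomorphic(1)[OF s]) auto
  have 2: "norm (kk z) <= B*(1/2)^Suc n" if z: "z : wedge R" for z
  proof -
   have "norm (kk z) <= remainder_bound a*(4*(B*(1/2)^n)/sqrt (Re z))"
    unfolding kk_def norm_mult remainder_bound_def using dz[OF z] z R
    by (intro mult_mono norm_remainder_le) (auto simp: wedge_def)
   also have "... <= remainder_bound a*(4*(B*(1/2)^n)/sqrt R)"
    using B z remainder_bound_ge[of a] by (intro mult_left_mono div_le_div_sqrt) auto
   also have "... = (8*remainder_bound a/sqrt R)*(B*(1/2)^Suc n)" by simp
   also have "... <= 1*(B*(1/2)^Suc n)" using R' R B by (intro mult_right_mono) (auto)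
   finally show ?thesis by simp
  qed
  from damped_sol_exists[OF 1 2] obtain d' u' where "damped_sol a R kk d' u'"
   "ALL z:wedge R. norm (d' z) <= 4*(B*(1/2)^Suc n)/sqrt (Re z) & norm (u' z) <= 2*(B*(1/2)^Suc n)/(Re z * sqrt (Re z))" by blast
  hence "P (Suc n) (kk, d', u') & Q n x (kk, d', u')" using 2 by (auto simp: P_def Q_def xe kk_def)
  thus "EX y. P (Suc n) y & Q n x y" by blast
 qed
 then obtain f where f: "!!n. P n (f n)" "!!n. Q n (f n) (f (Suc n))" by blast
 define kk d u where "kk n = fst (f n)" and "d n = fst (snd (f n))" and "u n = snd (snd (f n))" for n
 have s: "damped_sol a R (kk n) (d n) (u n)" for n using f(1)[of n] by (auto simp: P_def kk_def d_def u_def)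
 have kd: "kk 0 = k" "kk (Suc n) = (%z. remainder a z*d n z)" for n
  using f(1)[of 0] f(2)[of n] by (auto simp: P_def Q_def kk_def d_def)
 have b: "norm (kk n z) <= B*(1/2)^n" "norm (d n z) <= 4*B/sqrt (Re z)*(1/2)^n" "norm (u n z) <= 2*B/(Re z * sqrt (Re z))*(1/2)^n"
  if "z : wedge R" for n z using f(1)[of n] that by (auto simp: P_def kk_def d_def u_def)
 have geo: "summable (%n. C*(1/2 :: real)^n)" "(\<Sum>n. C*(1/2 :: real)^n) = 2*C" for C
  by (auto simp: suminf_mult suminf_geometric summable_geometric)
 have D: "damped_sol a R (%z. \<Sum>n. kk n z) (%z. \<Sum>n. d n z) (%z. \<Sum>n. u n z)"
 proof (rule damped_sol_series[OF s])
  fix n z assume z: "z : wedge R"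
  show "norm (d n z) <= 4*B*(1/2)^n"
   by (rule order_trans[OF b(2)[OF z]]) (intro mult_right_mono div_le_div_sqrt(2)[OF z], use B in auto)
  have "2*B/(Re z * sqrt (Re z)) <= 2*B" using B by (intro div_le_div_sqrt(3)[OF z]) auto
  hence "2*B/(Re z * sqrt (Re z)) <= 4*B" using B by linarith
  thus "norm (u n z) <= 4*B*(1/2)^n" by (intro order_trans[OF b(3)[OF z]] mult_right_mono) auto
  show "norm (kk n z) <= 4*B*(1/2)^n" by (rule order_trans[OF b(1)[OF z]], intro mult_right_mono) (use B in auto)
 qed (rule geo)
 have sb: "summable g & norm (\<Sum>n. g n) <= 2*C" if "!!n. norm (g n) <= C*(1/2)^n" for g :: "nat => complex" and C
 proof -
  have "norm (suminf g) <= (\<Sum>n. C*(1/2)^n)" by (rule norm_suminf_le[OF that geo(1)])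
  moreover have "summable g" by (rule summable_comparison_test'[OF geo(1)]) (rule that)
  ultimately show ?thesis using geo(2) by simp
 qed
 have K: "(\<Sum>n. kk n z) = remainder a z*(\<Sum>n. d n z) + k z" if z: "z \<in> wedge R" for z
 proof -
  have "summable (%n. kk n z)" using sb[OF b(1)[OF z]] by blast
  from suminf_split_head[OF this] have "(\<Sum>n. kk n z) = (\<Sum>n. remainder a z*d n z) + k z" by (simp add: kd)
  moreover have "(\<Sum>n. remainder a z*d n z) = remainder a z*(\<Sum>n. d n z)"
   using sb[OF b(2)[OF z]] by (simp add: suminf_mult)
  ultimately show ?thesis by simp
 qed
 show ?thesis
 proof (intro exI conjI ballI)
  show "damped_sol a R (%z. remainder a z*(\<Sum>n. d n z) + k z) (%z. \<Sum>n. d n z) (%z. \<Sum>n. u n z)"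
   using D K by (simp add: damped_sol_def)
  show "norm (\<Sum>n. d n z) <= 8*B/sqrt (Re z)" if "z \<in> wedge R" for z using sb[OF b(2)[OF that]] by simp
  show "norm (\<Sum>n. u n z) <= 4*B/(Re z * sqrt (Re z))" if "z \<in> wedge R" for z using sb[OF b(3)[OF that]] by simp
 qed
qed

text \<open>The amplitude is a power series in l: the coefficient w_(n+1) has source w_n, and w_0
  carries the normalisation 1 at infinity. Holomorphy in l is then built in.\<close>

lemma amplitude_exists:
 assumes rh: "0 <= rh" "8*remainder_bound a + 32*rh <= sqrt R"
 shows "EX v U. (ALL l. norm l <= rh --> damped_sol a R (%z. (remainder a z + l) * v l z) (v l) (U l) &
   (ALL z:wedge R. norm (v l z - 1) <= (8*remainder_bound a + 32*rh)/sqrt (Re z) &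
     norm (U l z) <= (8*remainder_bound a + 32*rh)/(Re z * sqrt (Re z)))) &
  (ALL z:wedge R. (%l. v l z) holomorphic_on ball 0 rh & (%l. U l z) holomorphic_on ball 0 rh)"
proof -
 define Ca where "Ca = remainder_bound a"
 have Ca: "2 <= Ca" using remainder_bound_ge by (simp add: Ca_def)
 have R8: "8*remainder_bound a <= sqrt R" using rh by linarith
 have sR: "16 <= sqrt R" using R8 Ca by (simp add: Ca_def)
 \<comment> \<open>Each further coefficient gains the factor q, and |l| q <= 1/2 makes the series
   geometric.\<close>
 define q where "q = 8/sqrt R"
 have "16*rh <= sqrt R" using rh Ca by (simp add: Ca_def)
 hence q: "0 <= q" "q*rh <= 1/2" "q <= 1/2" using sR R by (auto simp: q_def)
 define P :: "nat => ((complex => complex) \<times> (complex => complex) \<times> (complex => complex)) => bool" where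
  "P n = (%(k', w, u). damped_sol a R (%z. remainder a z*w z + k' z) w u & (n = 0 --> k' = (%_. 0)) &
   (ALL z:wedge R. norm (w z) <= 2*q^n & norm (u z) <= 2*Ca*q^n &
    (n = 0 --> norm (w z - 1) <= 8*Ca/sqrt (Re z) & norm (u z) <= 4*Ca/(Re z * sqrt (Re z))) &
    (ALL m. n = Suc m --> norm (w z) <= 16*q^m/sqrt (Re z) & norm (u z) <= 8*q^m/(Re z * sqrt (Re z)))))" for n
 define Q :: "nat => ((complex => complex) \<times> (complex => complex) \<times> (complex => complex)) => (complex => complex) \<times> (complex => complex) \<times> (complex => complex) => bool" where
  "Q n = (%(k', w, u) (k'', w', u'). k'' = w)" for n
 have "EX f. ALL n. P n (f n) & Q n (f n) (f (Suc n))"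
 proof (rule dependent_nat_choice)
  have "norm (remainder a z) <= Ca" if "z : wedge R" for z
   unfolding Ca_def remainder_bound_def using that R by (intro norm_remainder_le) (auto simp: wedge_def)
  from damped_remainder_sol_exists[OF R8 remainder_holomorphic this] R obtain d u where
   d: "damped_sol a R (%z. remainder a z*d z + remainder a z) d u"
   "!!z. z : wedge R ==> norm (d z) <= 8*Ca/sqrt (Re z) & norm (u z) <= 4*Ca/(Re z * sqrt (Re z))" by fastforce
  \<comment> \<open>A solution d with source \<open>remainder\<close> becomes, after adding 1, a
    solution of the equation for l = 0 that tends to 1.\<close>
  have "P 0 (%_. 0, %z. 1 + d z, u)" unfolding P_def case_prod_conv
  proof (intro conjI impI allI ballI)
   show "damped_sol a R (%z. remainder a z*(1 + d z) + 0) (%z. 1 + d z) u"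
    using d(1) by (auto simp: damped_sol_def algebra_simps intro!: derivative_eq_intros)
   fix z assume z: "z : wedge R"
   have "8*Ca/sqrt (Re z) <= 8*Ca/sqrt R" using Ca by (intro div_le_div_sqrt z) auto
   also have "... <= 1" using R8 R by (simp add: Ca_def)
   finally show "norm (1 + d z) <= 2*q^0" using d(2)[OF z] norm_triangle_ineq[of 1 "d z"] by simp
   have "4*Ca/(Re z * sqrt (Re z)) = 4*Ca/sqrt (Re z)/Re z" by simp
   also have "... <= 4*Ca/sqrt R/1" using Ca wedge_ge[OF z] R by (intro frac_le) auto
   also have "... <= 2*Ca" using sR Ca R by (simp add: divide_le_eq)
   finally show "norm (u z) <= 2*Ca*q^0" using d(2)[OF z] by simp
  qed (use d(2) in auto)
  thus "EX x. P 0 x" by blast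
  fix x n assume x: "P n x"
  obtain k' w u where xe: "x = (k', w, u)" by (metis prod_cases3)
  have s: "damped_sol a R (%z. remainder a z*w z + k' z) w u" and wz: "!!z. z : wedge R ==> norm (w z) <= 2*q^n"
   using x by (auto simp: xe P_def)
  from damped_remainder_sol_exists[OF R8 damped_sol_holomorphic(1)[OF s] wz] obtain w' u' where
   d: "damped_sol a R (%z. remainder a z*w' z + w z) w' u'"
   "!!z. z : wedge R ==> norm (w' z) <= 8*(2*q^n)/sqrt (Re z) & norm (u' z) <= 4*(2*q^n)/(Re z * sqrt (Re z))" by fastforce
  have "P (Suc n) (w, w', u')" unfolding P_def case_prod_conv
  proof (intro conjI impI allI ballI d)
   fix z assume z: "z : wedge R"
   have qn: "0 <= q^n" using q by simp
   have "8*(2*q^n)/sqrt (Re z) <= 8*(2*q^n)/sqrt R" using qn by (intro div_le_div_sqrt z) auto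
   thus "norm (w' z) <= 2*q^Suc n" using d(2)[OF z] by (simp add: q_def)
   have "4*(2*q^n)/(Re z * sqrt (Re z)) = 4*(2*q^n)/sqrt (Re z)/Re z" by simp
   also have "... <= 4*(2*q^n)/sqrt R/1" using qn wedge_ge[OF z] R by (intro frac_le) auto
   also have "... = 1*q^Suc n" by (simp add: q_def)
   also have "... <= 2*Ca*q^Suc n" using Ca q by (intro mult_right_mono) auto
   finally show "norm (u' z) <= 2*Ca*q^Suc n" using d(2)[OF z] by simp
  qed (use d(2) in auto)
  thus "EX y. P (Suc n) y & Q n x y" by (auto simp: Q_def xe)
 qed
 then obtain f where f: "!!n. P n (f n)" "!!n. Q n (f n) (f (Suc n))" by blast
 define kk w u where "kk n = fst (f n)" and "w n = fst (snd (f n))" and "u n = snd (snd (f n))" for n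
 have fe: "f n = (kk n, w n, u n)" for n by (simp add: kk_def w_def u_def)
 have s: "damped_sol a R (%z. remainder a z*w n z + kk n z) (w n) (u n)" for n using f(1)[of n] by (simp add: P_def fe)
 have kw: "kk 0 = (%_. 0)" "kk (Suc n) = w n" for n using f(1)[of 0] f(2)[of n] by (auto simp: P_def Q_def fe)
 have b: "norm (w n z) <= 2*q^n" "norm (u n z) <= 2*Ca*q^n" if "z : wedge R" for n z
  using f(1)[of n] that by (auto simp: P_def fe)
 have b0: "norm (w 0 z - 1) <= 8*Ca/sqrt (Re z)" "norm (u 0 z) <= 4*Ca/(Re z * sqrt (Re z))" if "z : wedge R" for z
  using f(1)[of 0] that by (auto simp: P_def fe)
 have bS: "norm (w (Suc n) z) <= 16*q^n/sqrt (Re z)" "norm (u (Suc n) z) <= 8*q^n/(Re z * sqrt (Re z))" if "z : wedge R" for z n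
  using f(1)[of "Suc n"] that by (auto simp: P_def fe)
 have geo: "summable (%n. C*(1/2 :: real)^n)" "(\<Sum>n. C*(1/2 :: real)^n) = 2*C" for C
  by (auto simp: suminf_mult suminf_geometric summable_geometric)
 have sb: "summable g & norm (\<Sum>n. g n) <= 2*C" if "!!n. norm (g n) <= C*(1/2)^n" for g :: "nat => complex" and C
 proof -
  have "norm (suminf g) <= (\<Sum>n. C*(1/2)^n)" by (rule norm_suminf_le[OF that geo(1)])
  moreover have "summable g" by (rule summable_comparison_test'[OF geo(1)]) (rule that)
  ultimately show ?thesis using geo(2) by simp
 qed
 have lq: "norm l^n*q^n <= (1/2)^n" if "norm l <= rh" for l :: complex and n
  unfolding power_mult_distrib[symmetric] using q mult_right_mono[OF that q(1)]
  by (intro power_mono) (auto simp: mult.commute)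
 have lb: "norm (l^n*x) <= C*(1/2)^n" if "norm l <= rh" "norm x <= C*q^n" "0 <= C" for l x :: complex and n C
 proof -
  have "norm (l^n*x) <= norm l^n*(C*q^n)" unfolding norm_mult norm_power using that by (intro mult_left_mono) auto
  also have "... = C*(norm l^n*q^n)" by simp
  also have "... <= C*(1/2)^n" using lq[OF that(1)] that by (intro mult_left_mono) auto
  finally show ?thesis .
 qed
 define v U where "v l z = (\<Sum>n. l^n*w n z)" and "U l z = (\<Sum>n. l^n*u n z)" for l z
 have sw: "summable (%n. l^n*w n z)" and su: "summable (%n. l^n*u n z)" if "norm l <= rh" "z : wedge R" for l z
  using sb[OF lb[OF that(1) b(1)[OF that(2)]]] sb[OF lb[OF that(1) b(2)[OF that(2)]]] Ca by auto
 show ?thesis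
 proof (rule exI[of _ v], rule exI[of _ U], intro conjI allI impI ballI)
  fix l :: complex assume l: "norm l <= rh"
  have D: "damped_sol a R (%z. \<Sum>n. l^n*(remainder a z*w n z + kk n z)) (%z. \<Sum>n. l^n*w n z) (%z. \<Sum>n. l^n*u n z)"
  proof (rule damped_sol_series)
   show "damped_sol a R (%z. l^n*(remainder a z*w n z + kk n z)) (%z. l^n*w n z) (%z. l^n*u n z)" for n
    using s[of n] by (auto simp: damped_sol_def algebra_simps intro!: derivative_eq_intros)
   define A where "A n = (2*Ca*Ca+4*Ca+4*rh)*(1/2 :: real)^n" for n
   show "summable A" unfolding A_def by (rule geo)
   fix n z assume z: "z : wedge R"
   have le: "C*(1/2)^n <= A n" if "C <= 2*Ca*Ca+4*Ca+4*rh" for C unfolding A_def using that by (intro mult_right_mono) auto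
   have C2: "0 <= Ca*Ca" by simp
   show "norm (l^n*w n z) <= A n" by (rule order_trans[OF lb[OF l b(1)[OF z]] le]) (use Ca C2 rh in \<open>linarith+\<close>)
   show "norm (l^n*u n z) <= A n" by (rule order_trans[OF lb[OF l b(2)[OF z]] le]) (use Ca C2 rh in \<open>linarith+\<close>)
   have "norm (remainder a z) <= Ca"
    unfolding Ca_def remainder_bound_def using z R by (intro norm_remainder_le) (auto simp: wedge_def)
   hence "norm (remainder a z*w n z) <= Ca*(2*q^n)" unfolding norm_mult using b(1)[OF z] Ca by (intro mult_mono) auto
   hence 1: "norm (l^n*(remainder a z*w n z)) <= 2*Ca*(1/2)^n" using Ca by (intro lb[OF l]) auto
   have 2: "norm (l^n*kk n z) <= 4*rh*(1/2)^n"
   proof (cases n)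
    case 0 thus ?thesis using kw rh by simp
   next
    case (Suc m)
    have "norm (l^n*kk n z) = norm l*norm (l^m*w m z)" by (simp add: Suc kw norm_mult)
    also have "... <= rh*(2*(1/2)^m)" using l rh by (intro mult_mono lb[OF l b(1)[OF z]]) auto
    finally show ?thesis by (simp add: Suc)
   qed
   have "norm (l^n*(remainder a z*w n z + kk n z)) <= norm (l^n*(remainder a z*w n z)) + norm (l^n*kk n z)"
    unfolding distrib_left by (rule norm_triangle_ineq)
   also have "... <= (2*Ca+4*rh)*(1/2)^n" using 1 2 by (simp add: algebra_simps)
   also have "... <= A n" by (rule le) (use Ca C2 rh in \<open>linarith+\<close>)
   finally show "norm (l^n*(remainder a z*w n z + kk n z)) <= A n" .
  qed
  show "damped_sol a R (%z. (remainder a z + l) * v l z) (v l) (U l)"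
  proof -
   have "(\<Sum>n. l^n*(remainder a z*w n z + kk n z)) = (remainder a z + l) * v l z" if z: "z \<in> wedge R" for z
   proof -
    have k: "(%n. l^n*kk n z) sums (l * v l z)"
    proof -
     have "(%n. l*(l^n*w n z)) sums (l * v l z)" unfolding v_def by (intro sums_mult summable_sums sw l z)
     hence "(%n. l^Suc n*kk (Suc n) z) sums (l * v l z)" by (simp add: kw mult.assoc)
     thus ?thesis by (subst (asm) sums_Suc_iff) (simp add: kw)
    qed
    have "(%n. remainder a z*(l^n*w n z)) sums (remainder a z * v l z)"
     unfolding v_def by (intro sums_mult summable_sums sw l z)
    from sums_add[OF this k] have "(%n. l^n*(remainder a z*w n z + kk n z)) sums ((remainder a z + l) * v l z)"
     by (simp add: algebra_simps)
    thus ?thesis by (rule sums_unique[symmetric])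
   qed
   thus ?thesis using D unfolding damped_sol_def v_def[abs_def] U_def[abs_def] by simp
  qed
  fix z assume z: "z : wedge R"
  have x: "0 < sqrt (Re z)" "0 < Re z * sqrt (Re z)" using wedge_ge[OF z] by auto
  have "v l z = (\<Sum>n. l^Suc n*w (Suc n) z) + w 0 z" using suminf_split_head[OF sw[OF l z]] by (simp add: v_def)
  moreover have "norm (\<Sum>n. l^Suc n*w (Suc n) z) <= 2*(rh*(16/sqrt (Re z)))"
  proof -
   have "norm (l^Suc n*w (Suc n) z) <= rh*(16/sqrt (Re z))*(1/2)^n" for n
   proof -
    have "norm (l^Suc n*w (Suc n) z) = norm l*norm (l^n*w (Suc n) z)" by (simp add: norm_mult)
    also have "... <= rh*(16/sqrt (Re z)*(1/2)^n)"
     using l rh x bS(1)[OF z, of n] by (intro mult_mono lb[OF l]) auto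
    finally show ?thesis by simp
   qed
   from sb[OF this] show ?thesis by simp
  qed
  ultimately have "norm (v l z - 1) <= 2*(rh*(16/sqrt (Re z))) + 8*Ca/sqrt (Re z)"
   using b0(1)[OF z] norm_triangle_ineq[of "\<Sum>n. l^Suc n*w (Suc n) z" "w 0 z - 1"] by (simp add: add_diff_eq)
  thus "norm (v l z - 1) <= (8*remainder_bound a + 32*rh)/sqrt (Re z)" by (simp add: Ca_def add_divide_distrib)
  have "U l z = (\<Sum>n. l^Suc n*u (Suc n) z) + u 0 z" using suminf_split_head[OF su[OF l z]] by (simp add: U_def)
  moreover have "norm (\<Sum>n. l^Suc n*u (Suc n) z) <= 2*(rh*(8/(Re z * sqrt (Re z))))"
  proof -
   have "norm (l^Suc n*u (Suc n) z) <= rh*(8/(Re z * sqrt (Re z)))*(1/2)^n" for n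
   proof -
    have "norm (l^Suc n*u (Suc n) z) = norm l*norm (l^n*u (Suc n) z)" by (simp add: norm_mult)
    also have "... <= rh*(8/(Re z * sqrt (Re z))*(1/2)^n)"
     using l rh x bS(2)[OF z, of n] by (intro mult_mono lb[OF l]) auto
    finally show ?thesis by simp
   qed
   from sb[OF this] show ?thesis by simp
  qed
  ultimately have "norm (U l z) <= 2*(rh*(8/(Re z * sqrt (Re z)))) + 4*Ca/(Re z * sqrt (Re z))"
   using b0(2)[OF z] norm_triangle_ineq[of "\<Sum>n. l^Suc n*u (Suc n) z" "u 0 z"] by simp
  also have "... = (4*Ca+16*rh)/(Re z * sqrt (Re z))" by (simp add: add_divide_distrib)
  also have "... <= (8*remainder_bound a + 32*rh)/(Re z * sqrt (Re z))"
   using x Ca rh by (intro divide_right_mono) (auto simp: Ca_def)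
  finally show "norm (U l z) <= (8*remainder_bound a + 32*rh)/(Re z * sqrt (Re z))" .
 next
  fix z assume z: "z : wedge R"
  show "(%l. v l z) holomorphic_on ball 0 rh" by (rule power_series_holomorphic[where a = "%n. w n z"])
    (use sw[OF _ z] in \<open>auto simp: v_def mult.commute dist_norm intro!: summable_sums\<close>)
  show "(%l. U l z) holomorphic_on ball 0 rh" by (rule power_series_holomorphic[where a = "%n. u n z"])
    (use su[OF _ z] in \<open>auto simp: U_def mult.commute dist_norm intro!: summable_sums\<close>)
 qed
qed
end

section \<open>Sibuya's solution through its data at the origin\<close>

text \<open>The estimates for \<open>ode_sol\<close> concern data of modulus at most 1, so arbitrary
  data enter through the two basic solutions.\<close>

definition lsol :: "complex => complex => complex => complex => complex => complex" where
 "lsol A B a l z = A * ode_sol 1 0 a l z + B * ode_sol 0 1 a l z"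

definition ldsol :: "complex => complex => complex => complex => complex => complex" where
 "ldsol A B a l z = A * ode_dsol 1 0 a l z + B * ode_dsol 0 1 a l z"

lemma lsol_deriv: "(lsol A B a l has_field_derivative ldsol A B a l z) (at z)"
 unfolding lsol_def[abs_def] ldsol_def by (intro DERIV_add DERIV_cmult ode_sol_deriv) auto

lemma ldsol_deriv: "(ldsol A B a l has_field_derivative pot a l z*lsol A B a l z) (at z)"
proof -
 have "(ldsol A B a l has_field_derivative A*(pot a l z * ode_sol 1 0 a l z) + B*(pot a l z * ode_sol 0 1 a l z)) (at z)"
  unfolding ldsol_def[abs_def] by (intro DERIV_add DERIV_cmult ode_dsol_deriv) auto
 thus ?thesis by (simp add: lsol_def algebra_simps)
qed

lemma lsol_0 [simp]: "lsol A B a l 0 = A" and ldsol_0 [simp]: "ldsol A B a l 0 = B"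
 by (simp_all add: lsol_def ldsol_def ode_sol_0 ode_dsol_0)

lemma ode_wronskian: "ode_sol 1 0 a l z * ode_dsol 0 1 a l z - ode_dsol 1 0 a l z * ode_sol 0 1 a l z = 1"
proof -
 let ?W = "%z. ode_sol 1 0 a l z * ode_dsol 0 1 a l z - ode_dsol 1 0 a l z * ode_sol 0 1 a l z"
 have "(?W has_field_derivative 0) (at z)" for z
  by (rule derivative_eq_intros ode_sol_deriv ode_dsol_deriv | simp)+
 hence "?W constant_on UNIV" by (intro has_field_derivative_0_imp_constant_on) auto
 hence "?W z = ?W 0" by (auto simp: constant_on_def)
 also have "... = 1" by (simp add: ode_sol_0 ode_dsol_0)
 finally show ?thesis .
qed

lemma wronskian_lsol:
 "lsol A1 B1 a l z*ldsol A2 B2 a l z - ldsol A1 B1 a l z*lsol A2 B2 a l z = A1*B2-B1*A2"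
proof -
 have "lsol A1 B1 a l z*ldsol A2 B2 a l z - ldsol A1 B1 a l z*lsol A2 B2 a l z =
  (A1*B2 - B1*A2)*(ode_sol 1 0 a l z * ode_dsol 0 1 a l z - ode_dsol 1 0 a l z * ode_sol 0 1 a l z)"
  by (simp add: lsol_def ldsol_def algebra_simps)
 thus ?thesis by (simp add: ode_wronskian)
qed

text \<open>The Wronskians of y with the two basic solutions are constant on the connected set, and
  they are the coordinates of y in that basis.\<close>

lemma ode_solution_unique:
 assumes S: "open S" "connected S" "z0 : S" and y: "!!z. z : S ==> (y has_field_derivative dy z) (at z)"
  and dy: "!!z. z : S ==> (dy has_field_derivative pot a l z*y z) (at z)"
  and A: "A = y z0 * ode_dsol 0 1 a l z0 - dy z0 * ode_sol 0 1 a l z0"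
  and B: "B = ode_sol 1 0 a l z0*dy z0 - ode_dsol 1 0 a l z0*y z0" and z: "z : S"
 shows "y z = lsol A B a l z" "dy z = ldsol A B a l z"
proof -
 let ?A = "%z. y z * ode_dsol 0 1 a l z - dy z * ode_sol 0 1 a l z"
 let ?B = "%z. ode_sol 1 0 a l z*dy z - ode_dsol 1 0 a l z*y z"
 have "(?A has_field_derivative 0) (at z)" if "z : S" for z
  by (rule derivative_eq_intros ode_sol_deriv ode_dsol_deriv y dy that | simp)+
 hence "?A constant_on S" using S by (intro has_field_derivative_0_imp_constant_on) auto
 hence A': "?A z = A" using A z S by (metis (no_types, lifting) constant_on_def)
 have "(?B has_field_derivative 0) (at z)" if "z : S" for z
  by (rule derivative_eq_intros ode_sol_deriv ode_dsol_deriv y dy that | simp)+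
 hence "?B constant_on S" using S by (intro has_field_derivative_0_imp_constant_on) auto
 hence B': "?B z = B" using B z S by (metis (no_types, lifting) constant_on_def)
 have "lsol A B a l z = y z*(ode_sol 1 0 a l z * ode_dsol 0 1 a l z - ode_dsol 1 0 a l z * ode_sol 0 1 a l z)"
  unfolding A'[symmetric] B'[symmetric] lsol_def by (simp add: algebra_simps)
 thus "y z = lsol A B a l z" by (simp add: ode_wronskian)
 have "ldsol A B a l z = dy z*(ode_sol 1 0 a l z * ode_dsol 0 1 a l z - ode_dsol 1 0 a l z * ode_sol 0 1 a l z)"
  unfolding A'[symmetric] B'[symmetric] ldsol_def by (simp add: algebra_simps)
 thus "dy z = ldsol A B a l z" by (simp add: ode_wronskian)
qed

text \<open>In terms of v = exp(phase) y the first condition normalises v to 1 at infinity and the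
  second makes v' tend to 0.\<close>

definition decays_within :: "complex => complex => real => real => complex => complex => bool" where
 "decays_within a l R C A B \<longleftrightarrow> (ALL z:wedge R.
  norm (exp (phase a z)*lsol A B a l z - 1) <= C/sqrt (Re z) &
  norm (exp (phase a z)*(ldsol A B a l z + dphase a z*lsol A B a l z)) <= C/(Re z * sqrt (Re z)))"

definition wide :: "complex => real => real => bool" where
 "wide a rh R \<longleftrightarrow> 1 <= R & 4*norm a <= R & 8*remainder_bound a + 32*rh <= sqrt R"

lemma wide_square:
 assumes "0 <= rh" "4*norm a + 8*remainder_bound a + 32*rh <= t" shows "wide a rh (t^2)"
proof -
 have t: "16 <= t" using assms remainder_bound_ge[of a] norm_ge_zero[of a] by linarith
 have "1*t <= t*t" using t by (intro mult_right_mono) auto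
 hence tt: "t <= t^2" by (simp add: power2_eq_square)
 have "sqrt (t^2) = t" using t by simp
 thus ?thesis unfolding wide_def using assms tt remainder_bound_ge[of a] norm_ge_zero[of a] by linarith
qed

text \<open>The amplitude lives on the wedge only. Matching it at R + 1 with the entire solutions
  moves it to data at 0, and this keeps holomorphy in l.\<close>

lemma decaying_local:
 assumes "0 <= rh" "wide a rh R"
 shows "EX A B. (ALL l. norm l <= rh --> decays_within a l R (8*remainder_bound a + 32*rh) (A l) (B l)) &
  A holomorphic_on ball 0 rh & B holomorphic_on ball 0 rh"
proof -
 have R: "1 <= R" "4*norm a <= R" "8*remainder_bound a + 32*rh <= sqrt R" using assms(2) by (auto simp: wide_def)
 define C where "C = 8*remainder_bound a + 32*rh"
 obtain v U where vU: "!!l. norm l <= rh ==> damped_sol a R (%z. (remainder a z + l) * v l z) (v l) (U l)"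
  "!!l z. norm l <= rh ==> z : wedge R ==> norm (v l z - 1) <= C/sqrt (Re z)"
  "!!l z. norm l <= rh ==> z : wedge R ==> norm (U l z) <= C/(Re z * sqrt (Re z))"
  "!!z. z : wedge R ==> (%l. v l z) holomorphic_on ball 0 rh"
  "!!z. z : wedge R ==> (%l. U l z) holomorphic_on ball 0 rh"
  using amplitude_exists[OF R(1,2) assms(1) R(3)] unfolding C_def by blast
 define z0 :: complex where "z0 = of_real (R+1)"
 have z0: "z0 : wedge R" unfolding z0_def of_real_in_wedge by simp
 define y dy where "y l z = exp (- phase a z) * v l z" and "dy l z = exp (- phase a z)*(U l z - dphase a z * v l z)" for l z
 define A B where "A l = y l z0 * ode_dsol 0 1 a l z0 - dy l z0 * ode_sol 0 1 a l z0"
  and "B l = ode_sol 1 0 a l z0*dy l z0 - ode_dsol 1 0 a l z0*y l z0" for l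
 have pd: "(phase a has_field_derivative dphase a z) (at z)" "(dphase a has_field_derivative dphase a z^2 - z^3 - a*z + remainder a z) (at z)" if "z : wedge R" for z
  using wedge_Re[OF that] R by (auto intro!: phase_deriv dphase_deriv)
 have sol: "y l z = lsol (A l) (B l) a l z & dy l z = ldsol (A l) (B l) a l z" if l: "norm l <= rh" and z: "z : wedge R" for l z
 proof -
  have dv: "(v l has_field_derivative U l z) (at z)"
   "(U l has_field_derivative 2*dphase a z*U l z + (remainder a z + l) * v l z) (at z)" if "z : wedge R" for z
   using vU(1)[OF l] that by (auto simp: damped_sol_def)
  have de: "((%z. exp (- phase a z)) has_field_derivative - exp (- phase a z)*dphase a z) (at z)" if "z : wedge R" for z
   using DERIV_chain2[OF DERIV_exp DERIV_minus[OF pd(1)[OF that]]] by simp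
  have 1: "(y l has_field_derivative dy l z) (at z)" if "z : wedge R" for z
   using DERIV_mult[OF de[OF that] dv(1)[OF that]] unfolding y_def[abs_def] dy_def by (simp add: algebra_simps)
  have 2: "(dy l has_field_derivative pot a l z*y l z) (at z)" if "z : wedge R" for z
  proof -
   let ?e = "exp (- phase a z)" and ?p = "dphase a z"
   have "?e*(2*?p*U l z + (remainder a z + l) * v l z - ((?p^2 - z^3 - a*z + remainder a z) * v l z + U l z*?p))
     + (- ?e*?p)*(U l z - ?p * v l z) = pot a l z*y l z"
    by (simp add: y_def pot_def algebra_simps power2_eq_square)
   moreover have "(dy l has_field_derivative (- ?e*?p)*(U l z - ?p * v l z) +
     (2*?p*U l z + (remainder a z + l) * v l z - ((?p^2 - z^3 - a*z + remainder a z) * v l z + U l z*?p))*?e) (at z)"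
    unfolding dy_def[abs_def] by (intro DERIV_mult DERIV_diff de dv pd that)
   ultimately show ?thesis by (simp add: algebra_simps)
  qed
  show ?thesis
   using ode_solution_unique[OF open_wedge convex_connected[OF convex_wedge] z0 1 2 A_def[of l] B_def[of l] z] by blast
 qed
 show ?thesis unfolding C_def[symmetric]
 proof (rule exI[of _ A], rule exI[of _ B], intro conjI allI impI)
  fix l :: complex assume l: "norm l <= rh"
  show "decays_within a l R C (A l) (B l)" unfolding decays_within_def
  proof (intro ballI)
   fix z assume z: "z : wedge R"
   have e: "exp (phase a z)*(exp (- phase a z)*x) = x" for x by (simp add: exp_add[symmetric])
   have "exp (phase a z)*lsol (A l) (B l) a l z = v l z" using sol[OF l z] e[of "v l z"] by (metis y_def)
   moreover have "exp (phase a z)*(ldsol (A l) (B l) a l z + dphase a z*lsol (A l) (B l) a l z) = U l z"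
   proof -
    have "ldsol (A l) (B l) a l z + dphase a z*lsol (A l) (B l) a l z = exp (- phase a z)*U l z"
     using sol[OF l z] by (simp add: y_def dy_def algebra_simps)
    thus ?thesis using e by simp
   qed
   ultimately show "norm (exp (phase a z)*lsol (A l) (B l) a l z - 1) <= C/sqrt (Re z) &
    norm (exp (phase a z)*(ldsol (A l) (B l) a l z + dphase a z*lsol (A l) (B l) a l z)) <= C/(Re z * sqrt (Re z))"
    using vU(2,3)[OF l z] by simp
  qed
 next
  have "(%l. y l z0) holomorphic_on ball 0 rh" "(%l. dy l z0) holomorphic_on ball 0 rh"
   unfolding y_def dy_def by (intro holomorphic_intros vU z0)+
  thus "A holomorphic_on ball 0 rh" "B holomorphic_on ball 0 rh"
   unfolding A_def[abs_def] B_def[abs_def] by (auto intro!: holomorphic_intros holomorphic_on_ode)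
 qed
qed

text \<open>The Wronskian of the two solutions is constant, yet it equals exp(- 2 phase) times a
  bounded factor and so tends to 0. Hence the solutions are proportional, and the common limit 1 of
  the amplitudes fixes the factor.\<close>

lemma decaying_unique:
 assumes R: "1 <= R" "4*norm a <= R" "1 <= R'" "4*norm a <= R'"
  and d: "decays_within a l R C A B" "decays_within a l R' C' A' B'" shows "A = A' & B = B'"
proof -
 define z where "z n = complex_of_real (max R R' + 1 + real n)" for n :: nat
 have z: "z n : wedge R" "z n : wedge R'" for n unfolding z_def of_real_in_wedge by auto
 have Rez: "Re (z n) = max R R' + 1 + real n" for n by (simp add: z_def)
 define X where "X n = sqrt (Re (z n))" for n
 have X: "filterlim X at_top sequentially" unfolding X_def Rez by real_asymp
 define v v' u u' where "v n = exp (phase a (z n))*lsol A B a l (z n)" and "v' n = exp (phase a (z n))*lsol A' B' a l (z n)"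
  and "u n = exp (phase a (z n))*(ldsol A B a l (z n) + dphase a (z n)*lsol A B a l (z n))"
  and "u' n = exp (phase a (z n))*(ldsol A' B' a l (z n) + dphase a (z n)*lsol A' B' a l (z n))" for n
 have l1: "LIMSEQ v 1" if "decays_within a l R C A B" "!!n. z n : wedge R" "v = (%n. exp (phase a (z n))*lsol A B a l (z n))" for v R C A B
 proof -
  have "LIMSEQ (%n. v n - 1) 0"
  proof (rule Lim_null_comparison[OF always_eventually, OF allI])
   show "norm (v n - 1) <= C/sqrt (Re (z n))" for n using that by (auto simp: decays_within_def)
   show "LIMSEQ (%n. C/sqrt (Re (z n))) 0" unfolding Rez by real_asymp
  qed
  thus ?thesis by (simp add: LIM_zero_iff)
 qed
 have l2: "LIMSEQ u 0" if "decays_within a l R C A B" "!!n. z n : wedge R"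
   "u = (%n. exp (phase a (z n))*(ldsol A B a l (z n) + dphase a (z n)*lsol A B a l (z n)))" for u R C A B
 proof (rule Lim_null_comparison[OF always_eventually, OF allI])
  show "norm (u n) <= C/(Re (z n) * sqrt (Re (z n)))" for n using that by (auto simp: decays_within_def)
  show "LIMSEQ (%n. C/(Re (z n) * sqrt (Re (z n)))) 0" unfolding Rez by real_asymp
 qed
 have vl: "LIMSEQ v 1" "LIMSEQ v' 1" "LIMSEQ u 0" "LIMSEQ u' 0"
  using l1[OF d(1) z(1)] l1[OF d(2) z(2)] l2[OF d(1) z(1)] l2[OF d(2) z(2)]
  by (auto simp: v_def[abs_def] v'_def[abs_def] u_def[abs_def] u'_def[abs_def])
 have E: "LIMSEQ (%n. exp (- 2*phase a (z n))) 0"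
 proof (rule Lim_null_comparison[OF always_eventually, OF allI])
  fix n
  have "Re (phase a (z 0)) + real n/4 <= Re (phase a (z 0 + of_real (real n)))"
   by (rule phase_increasing[OF R(1,2) z(1)]) simp
  moreover have "z 0 + of_real (real n) = z n" by (simp add: z_def)
  ultimately show "norm (exp (- 2*phase a (z n))) <= exp (- 2*Re (phase a (z 0)) - real n/2)" by simp
  show "LIMSEQ (%n. exp (- 2*Re (phase a (z 0)) - real n/2)) 0" by real_asymp
 qed
 have W: "A*B'-B*A' = exp (- 2*phase a (z n))*(v n*u' n - u n * v' n)" for n
 proof -
  have e: "exp (- 2*phase a (z n))*(exp (phase a (z n))*x*(exp (phase a (z n))*y)) = x*y" for x y
  proof -
   have "exp (- 2*phase a (z n))*exp (phase a (z n))*exp (phase a (z n)) = 1" unfolding exp_add[symmetric] by simp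
   thus ?thesis by (metis (no_types, lifting) mult.assoc mult.commute mult.left_commute mult_1)
  qed
  have "exp (- 2*phase a (z n))*(v n*u' n - u n * v' n) =
   lsol A B a l (z n)*(ldsol A' B' a l (z n) + dphase a (z n)*lsol A' B' a l (z n)) -
   (ldsol A B a l (z n) + dphase a (z n)*lsol A B a l (z n))*lsol A' B' a l (z n)"
   unfolding right_diff_distrib v_def v'_def u_def u'_def e ..
  also have "... = lsol A B a l (z n)*ldsol A' B' a l (z n) - ldsol A B a l (z n)*lsol A' B' a l (z n)"
   by (simp add: algebra_simps)
  also have "... = A*B'-B*A'" by (rule wronskian_lsol)
  finally show ?thesis by simp
 qed
 have "LIMSEQ (%n. exp (- 2*phase a (z n))*(v n*u' n - u n * v' n)) (0*(1*0-0*1))" by (intro tendsto_intros E vl)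
 hence "LIMSEQ (%n. A*B'-B*A') 0" unfolding W[symmetric] by simp
 hence w0: "A*B' = B*A'" by (simp add: LIMSEQ_const_iff)
 have "A' * v n = A * v' n" "B' * v n = B * v' n" for n
  using w0 by (auto simp: v_def v'_def lsol_def algebra_simps)
 hence "LIMSEQ (%n. A' * v n) (A*1)" "LIMSEQ (%n. B' * v n) (B*1)"
  by (auto intro!: tendsto_intros vl simp del: mult_1_right)
 moreover have "LIMSEQ (%n. A' * v n) (A'*1)" "LIMSEQ (%n. B' * v n) (B'*1)"
  by (auto intro!: tendsto_intros vl simp del: mult_1_right)
 ultimately show ?thesis using LIMSEQ_unique by fastforce
qed

text \<open>The values at the origin of Sibuya's solution, the one that decays along the positive real axis,
 and of its derivative.\<close>

definition sibuya :: "complex => complex => complex \<times> complex" where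
 "sibuya a l = (SOME AB. EX R C. wide a (norm l) R & decays_within a l R C (fst AB) (snd AB))"

definition sib :: "complex => complex => complex" where "sib a l = fst (sibuya a l)"
definition dsib :: "complex => complex => complex" where "dsib a l = snd (sibuya a l)"

text \<open>By uniqueness every normalised pair, whatever its R and C, is the one chosen in
  \<open>sibuya\<close>. Holomorphy and the conjugation symmetry are transferred to
  \<open>sib\<close> through this.\<close>

lemma sib_eqI:
 assumes "1 <= R" "4*norm a <= R" "decays_within a l R C A B" shows "sib a l = A & dsib a l = B"
proof -
 have "wide a (norm l) ((4*norm a + 8*remainder_bound a + 32*norm l)^2)" by (rule wide_square) auto
 with decaying_local[OF norm_ge_zero this] obtain A' B' R' C' where
  "wide a (norm l) R'" "decays_within a l R' C' (A' l) (B' l)" by blast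
 hence "EX AB. EX R C. wide a (norm l) R & decays_within a l R C (fst AB) (snd AB)" by (metis fst_conv snd_conv)
 hence "EX R C. wide a (norm l) R & decays_within a l R C (sib a l) (dsib a l)"
  unfolding sibuya_def sib_def dsib_def by (rule someI_ex)
 thus ?thesis using decaying_unique assms unfolding wide_def by blast
qed

lemma sib_decays:
 assumes "wide a (norm l) R" shows "decays_within a l R (8*remainder_bound a + 32*norm l) (sib a l) (dsib a l)"
proof -
 obtain A B where AB: "decays_within a l R (8*remainder_bound a + 32*norm l) (A l) (B l)"
  using decaying_local[OF norm_ge_zero assms] by blast
 moreover have "sib a l = A l & dsib a l = B l" by (rule sib_eqI[OF _ _ AB]) (use assms in \<open>auto simp: wide_def\<close>)
 ultimately show ?thesis by simp
qed

text \<open>On each disc \<open>decaying_local\<close> supplies a holomorphic family, and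
  \<open>sib_eqI\<close> identifies it with \<open>sib\<close>.\<close>

lemma sib_holomorphic: "sib a holomorphic_on S" "dsib a holomorphic_on S"
proof -
 have "EX U. open U & l : U & sib a holomorphic_on U & dsib a holomorphic_on U" for l
 proof -
  define rh where "rh = norm l + 1"
  have w: "wide a rh ((4*norm a + 8*remainder_bound a + 32*rh)^2)" by (rule wide_square) (auto simp: rh_def)
  have "0 <= rh" by (simp add: rh_def)
  from decaying_local[OF this w] obtain A B where AB:
   "!!l. norm l <= rh ==> decays_within a l ((4*norm a + 8*remainder_bound a + 32*rh)^2) (8*remainder_bound a + 32*rh) (A l) (B l)"
   "A holomorphic_on ball 0 rh" "B holomorphic_on ball 0 rh" by blast
  have eq: "sib a l = A l & dsib a l = B l" if "l : ball 0 rh" for l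
   by (rule sib_eqI[OF _ _ AB(1)]) (use w that in \<open>auto simp: wide_def\<close>)
  have "sib a holomorphic_on ball 0 rh" "dsib a holomorphic_on ball 0 rh"
   by (rule holomorphic_transform[OF AB(2)], use eq in simp) (rule holomorphic_transform[OF AB(3)], use eq in simp)
  thus ?thesis by (intro exI[of _ "ball 0 rh"]) (auto simp: rh_def)
 qed
 hence "sib a field_differentiable (at l)" "dsib a field_differentiable (at l)" for l
  by (metis holomorphic_on_open field_differentiable_def)+
 thus "sib a holomorphic_on S" "dsib a holomorphic_on S"
  by (auto simp: holomorphic_on_def intro: field_differentiable_at_within)
qed

lemma ode_coeff_cnj: "ode_coeff (cnj A) (cnj B) (cnj a) (cnj l) n = cnj (ode_coeff A B a l n)"
 by (induction A B a l n rule: ode_coeff.induct) (auto)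

lemma ode_sol_cnj:
 assumes "norm A <= 1" "norm B <= 1"
 shows "ode_sol (cnj A) (cnj B) (cnj a) (cnj l) (cnj z) = cnj (ode_sol A B a l z)"
  "ode_dsol (cnj A) (cnj B) (cnj a) (cnj l) (cnj z) = cnj (ode_dsol A B a l z)"
proof -
 have "(%n. cnj (ode_coeff A B a l n*z^n)) sums cnj (ode_sol A B a l z)"
  unfolding sums_cnj ode_sol_def by (rule summable_sums[OF ode_coeff_summable[OF assms]])
 thus "ode_sol (cnj A) (cnj B) (cnj a) (cnj l) (cnj z) = cnj (ode_sol A B a l z)"
  by (simp add: ode_sol_def ode_coeff_cnj sums_iff)
 have "(%n. cnj (diffs (ode_coeff A B a l) n*z^n)) sums cnj (ode_dsol A B a l z)"
  unfolding sums_cnj ode_dsol_def by (rule summable_sums[OF termdiff_converges_all[OF ode_coeff_summable[OF assms]]])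
 thus "ode_dsol (cnj A) (cnj B) (cnj a) (cnj l) (cnj z) = cnj (ode_dsol A B a l z)"
  by (simp add: ode_dsol_def ode_coeff_cnj diffs_def sums_iff)
qed

lemma lsol_cnj: "lsol (cnj A) (cnj B) (cnj a) (cnj l) (cnj z) = cnj (lsol A B a l z)"
 "ldsol (cnj A) (cnj B) (cnj a) (cnj l) (cnj z) = cnj (ldsol A B a l z)"
 using ode_sol_cnj[of 1 0 a l z] ode_sol_cnj[of 0 1 a l z] by (simp_all add: lsol_def ldsol_def)

lemma sib_cnj: "sib (cnj a) (cnj l) = cnj (sib a l)" "dsib (cnj a) (cnj l) = cnj (dsib a l)"
proof -
 define R where "R = (4*norm a + 8*remainder_bound a + 32*norm l)^2"
 define C where "C = 8*remainder_bound a + 32*norm l"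
 have w: "wide a (norm l) R" unfolding R_def by (rule wide_square) auto
 hence R: "1 <= R" "4*norm a <= R" by (auto simp: wide_def)
 have d: "decays_within a l R C (sib a l) (dsib a l)" unfolding C_def by (rule sib_decays[OF w])
 have "decays_within (cnj a) (cnj l) R C (cnj (sib a l)) (cnj (dsib a l))" unfolding decays_within_def
 proof
  fix z assume "z : wedge R"
  hence z: "cnj z : wedge R" by (simp add: wedge_def)
  have zn: "cnj z ~: nonpos_Reals" using wedge_Re[OF z] R by (auto simp: complex_nonpos_Reals_iff)
  have p: "phase (cnj a) z = cnj (phase a (cnj z))" "dphase (cnj a) z = cnj (dphase a (cnj z))"
   using zn by (simp_all add: phase_def dphase_def cnj_csqrt cnj_Ln)
  have s: "lsol (cnj A) (cnj B) (cnj a) (cnj l) z = cnj (lsol A B a l (cnj z))"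
   "ldsol (cnj A) (cnj B) (cnj a) (cnj l) z = cnj (ldsol A B a l (cnj z))" for A B
   using lsol_cnj[of A B a l "cnj z"] by auto
  have n: "norm (cnj w) = norm w" for w by simp
  have "norm (cnj (exp (phase a (cnj z))*lsol (sib a l) (dsib a l) a l (cnj z) - 1)) <= C/sqrt (Re z) &
  norm (cnj (exp (phase a (cnj z))*(ldsol (sib a l) (dsib a l) a l (cnj z) + dphase a (cnj z)*lsol (sib a l) (dsib a l) a l (cnj z)))) <= C/(Re z * sqrt (Re z))"
   using d z unfolding decays_within_def n by fastforce
  thus "norm (exp (phase (cnj a) z)*lsol (cnj (sib a l)) (cnj (dsib a l)) (cnj a) (cnj l) z - 1) <= C/sqrt (Re z) &
  norm (exp (phase (cnj a) z)*(ldsol (cnj (sib a l)) (cnj (dsib a l)) (cnj a) (cnj l) z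
    + dphase (cnj a) z*lsol (cnj (sib a l)) (cnj (dsib a l)) (cnj a) (cnj l) z)) <= C/(Re z * sqrt (Re z))"
   unfolding p s by (simp add: exp_cnj)
 qed
 from sib_eqI[OF R(1) _ this] R show "sib (cnj a) (cnj l) = cnj (sib a l)" "dsib (cnj a) (cnj l) = cnj (dsib a l)" by auto
qed

section \<open>Riccati comparison with the Liouville-Green approximation\<close>

text \<open>The region \<open>|y' + s y| < B |y|\<close> around the Liouville-Green approximation is invariant
 backwards in time.\<close>

lemma riccati_barrier:
 fixes y dy s s' :: "real => complex" and B B' :: "real => real"
 assumes y: "!!t. t : {p..q} ==> (y has_vector_derivative dy t) (at t)"
  and dy: "!!t. t : {p..q} ==> (dy has_vector_derivative s t^2*y t) (at t)"
  and s: "!!t. t : {p..q} ==> (s has_vector_derivative s' t) (at t)"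
  and B: "!!t. t : {p..q} ==> (B has_real_derivative B' t) (at t)"
  and B0: "!!t. t : {p..q} ==> 0 < B t" "!!t. t : {p..q} ==> B' t <= 0"
  and gap: "!!t. t : {p..q} ==> norm (s' t) + (B t)^2 < 2*B t*Re (s t)"
  and nz: "!!t. t : {p..q} ==> y t ~= 0 | dy t ~= 0" and start: "norm (dy q + s q*y q) < B q*norm (y q)"
  and t: "t : {p..q}" shows "norm (dy t + s t*y t) < B t*norm (y t)"
proof (rule ccontr)
 assume neg: "~?thesis"
 define r where "r t = dy t + s t*y t" for t
 define N where "N t = (r t \<bullet> r t) - (B t)^2*(y t \<bullet> y t)" for t
 have N: "N t = (norm (r t))^2 - (B t*norm (y t))^2" for t by (simp add: N_def power_mult_distrib dot_square_norm)
 have r': "(r has_vector_derivative s t*r t + s' t*y t) (at t)" if "t : {p..q}" for t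
 proof -
  have "(r has_vector_derivative s t^2*y t + (s t*dy t + s' t*y t)) (at t)"
   unfolding r_def[abs_def] by (intro has_vector_derivative_add has_vector_derivative_mult y dy s that)
  thus ?thesis by (simp add: r_def algebra_simps power2_eq_square)
 qed
 have inner': "((%t. f t \<bullet> f t) has_real_derivative 2*(f t \<bullet> f' t)) (at t)"
  if "(f has_vector_derivative f' t) (at t)" for f f' :: "real => complex" and t
  using bounded_bilinear.has_vector_derivative[OF bounded_bilinear_inner that that]
  by (simp add: has_real_derivative_iff_has_vector_derivative inner_commute)
 define N' where "N' t = 2*(r t \<bullet> (s t*r t + s' t*y t)) - (2*B t*B' t*(y t \<bullet> y t) + (B t)^2*(2*(y t \<bullet> dy t)))" for t
 have N': "(N has_real_derivative N' t) (at t)" if "t : {p..q}" for t unfolding N_def[abs_def] N'_def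
  by (rule derivative_eq_intros inner' r' y B that refl)+ (simp)
 have Nc: "continuous_on {p..q} N" by (intro continuous_at_imp_continuous_on ballI DERIV_isCont[OF N'])
 \<comment> \<open>On the boundary |r| = B |y| the contributions of s' and B^2 are outweighed by 2 B
   Re s, which is what \<open>gap\<close> provides; so N can cross 0 only upwards.\<close>
 have pos: "0 < N' t" if tt: "t : {p..q}" and "N t = 0" for t
 proof -
  have Bt: "0 < B t" by (rule B0[OF tt])
  have rt: "norm (r t) = B t*norm (y t)"
  proof -
   have "(norm (r t))^2 = (B t*norm (y t))^2" using that by (simp add: N)
   thus ?thesis using Bt by (subst (asm) power2_eq_iff_nonneg) auto
  qed
  have y0: "y t ~= 0"
  proof
   assume "y t = 0" hence "r t = 0" using rt by simp
   thus False using nz[OF tt] \<open>y t = 0\<close> by (simp add: r_def)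
  qed
  have mi: "w \<bullet> (c*w) = Re c*(norm w)^2" for w c :: complex
   unfolding cmod_power2 inner_complex_def by (simp add: algebra_simps power2_eq_square)
  have 1: "r t \<bullet> (s' t*y t) >= - (norm (s' t)*norm (y t)*norm (r t))"
   using Cauchy_Schwarz_ineq2[of "r t" "s' t*y t"] by (simp add: norm_mult mult_ac)
  have 2: "y t \<bullet> dy t <= norm (y t)*norm (r t) - Re (s t)*(norm (y t))^2"
  proof -
   have "y t \<bullet> dy t = y t \<bullet> r t - y t \<bullet> (s t*y t)" by (simp add: r_def inner_add_right)
   thus ?thesis using Cauchy_Schwarz_ineq2[of "y t" "r t"] by (simp add: mi)
  qed
  define n where "n = norm (y t)"
  have n: "0 < n" using y0 by (simp add: n_def)
  have b: "2*(Re (s t)*(B t*n)^2 - norm (s' t)*n*(B t*n)) - (0 + (B t)^2*(2*(n*(B t*n) - Re (s t)*n^2))) <= N' t"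
   unfolding N'_def
  proof (intro diff_mono add_mono mult_left_mono)
   show "Re (s t)*(B t*n)^2 - norm (s' t)*n*(B t*n) <= r t \<bullet> (s t*r t + s' t*y t)"
    using 1 by (simp add: inner_add_right mi rt n_def)
   show "2*B t*B' t*(y t \<bullet> y t) <= 0" using Bt B0(2)[OF tt]
    by (intro mult_nonpos_nonneg mult_nonneg_nonpos) auto
   show "y t \<bullet> dy t <= n*(B t*n) - Re (s t)*n^2" using 2 by (simp add: rt n_def)
  qed auto
  have "2*(Re (s t)*(B t*n)^2 - norm (s' t)*n*(B t*n)) - (0 + (B t)^2*(2*(n*(B t*n) - Re (s t)*n^2)))
   = 2*B t*n^2*(2*B t*Re (s t) - (norm (s' t) + (B t)^2))" by (simp add: power2_eq_square algebra_simps)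
  also have "... > 0" using Bt n gap[OF tt] by (intro mult_pos_pos) auto
  finally show ?thesis using b by linarith
 qed
 have Nq: "N q < 0"
 proof -
  have "(norm (r q))^2 < (B q*norm (y q))^2" using start by (intro power_strict_mono) (auto simp: r_def)
  thus ?thesis by (simp add: N)
 qed
 \<comment> \<open>The last point with N >= 0 would be a zero of N with N positive just after it,
   against its being the last.\<close>
 define T where "T = {p..q} \<inter> N -` {0..}"
 have "closed T" unfolding T_def by (rule continuous_closed_preimage[OF Nc]) auto
 hence cT: "compact T" unfolding T_def by (metis Int_lower1 bounded_closed_interval bounded_subset compact_eq_bounded_closed)
 have "N t >= 0"
 proof -
  have "(B t*norm (y t))^2 <= (norm (r t))^2" using neg B0(1)[OF t] by (intro power_mono) (auto simp: r_def)
  thus ?thesis by (simp add: N)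
 qed
 hence "T ~= {}" using t by (auto simp: T_def)
 then obtain m where m: "m : T" "!!x. x : T ==> x <= m" using compact_attains_sup[OF cT] by blast
 hence mpq: "m : {p..q}" "0 <= N m" by (auto simp: T_def)
 have mq: "m < q" using mpq Nq by (cases "m = q") auto
 have Nm: "N m = 0"
 proof (rule ccontr)
  assume "N m ~= 0"
  obtain x where x: "m <= x" "x <= q" "N x = 0"
   using IVT2'[of N q 0 m] Nq mpq continuous_on_subset[OF Nc, of "{m..q}"] by auto
  hence "x : T" using mpq by (auto simp: T_def)
  thus False using m(2)[of x] x \<open>N m ~= 0\<close> by auto
 qed
 obtain d where d: "d > 0" "!!h. 0 < h ==> h < d ==> N m < N (m+h)"
  using DERIV_pos_inc_right[OF N'[OF mpq(1)] pos[OF mpq(1) Nm]] by blast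
 define h where "h = min (d/2) (q-m)"
 have h: "0 < h" "h < d" "m + h <= q" using d mq by (auto simp: h_def)
 hence "m + h : T" using d(2)[of h] mpq by (auto simp: T_def)
 thus False using m(2)[of "m + h"] h by simp
qed

text \<open>The derivative of ln |y| is Re (y'/y), and the barrier places y'/y within B of -
  s.\<close>

lemma ln_norm_increment:
 fixes y dy s S :: "real => complex" and B be :: "real => real"
 assumes "p <= q" and y: "!!t. t : {p..q} ==> (y has_vector_derivative dy t) (at t)"
  and bar: "!!t. t : {p..q} ==> norm (dy t + s t*y t) < B t*norm (y t)"
  and S: "continuous_on {p..q} S" "!!t. p < t ==> t < q ==> (S has_vector_derivative s t) (at t)"
  and be: "!!t. t : {p..q} ==> (be has_real_derivative B t) (at t)"
 shows "abs (ln (norm (y q)) - ln (norm (y p)) + Re (S q - S p)) <= be q - be p"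
proof -
 have y0: "y t ~= 0" if "t : {p..q}" for t using bar[OF that] by auto
 define G where "G t = ln (norm (y t)) + Re (S t)" for t
 have yc: "continuous_on {p..q} y" by (intro continuous_at_imp_continuous_on ballI has_vector_derivative_continuous[OF y])
 have "norm (complex_of_real (G q) - complex_of_real (G p)) <= be q - be p"
 proof (rule norm_increment_le[OF assms(1), where f' = "%t. of_real ((y t \<bullet> dy t)/(norm (y t))^2 + Re (s t))" and phi' = B])
  show "continuous_on {p..q} (%t. complex_of_real (G t))"
   unfolding G_def using y0 by (intro continuous_intros yc S) auto
  show "continuous_on {p..q} be" by (intro continuous_at_imp_continuous_on ballI DERIV_isCont[OF be])
  fix t assume t: "p < t" "t < q" hence tt: "t : {p..q}" by auto
  show "(be has_real_derivative B t) (at t)" by (rule be[OF tt])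
  have 1: "((%t. norm (y t)) has_real_derivative y t \<bullet> dy t/norm (y t)) (at t)"
  proof -
   have "((%t. y t \<bullet> y t) has_real_derivative 2*(y t \<bullet> dy t)) (at t)"
    using bounded_bilinear.has_vector_derivative[OF bounded_bilinear_inner y[OF tt] y[OF tt]]
    by (simp add: has_real_derivative_iff_has_vector_derivative inner_commute)
   moreover have "y t \<bullet> y t > 0" using y0[OF tt] by simp
   ultimately have "((%t. sqrt (y t \<bullet> y t)) has_real_derivative inverse (sqrt (y t \<bullet> y t))/2*(2*(y t \<bullet> dy t))) (at t)"
    by (intro DERIV_chain2[OF DERIV_real_sqrt]) auto
   thus ?thesis by (simp add: norm_eq_sqrt_inner[symmetric] field_simps)
  qed
  have "((%t. ln (norm (y t))) has_real_derivative 1/norm (y t)*(y t \<bullet> dy t/norm (y t))) (at t)"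
   using y0[OF tt] by (intro DERIV_chain2[OF DERIV_ln_divide 1]) auto
  from DERIV_add[OF this has_real_derivative_Re[OF S(2)[OF t]]]
  have "(G has_real_derivative (y t \<bullet> dy t)/(norm (y t))^2 + Re (s t)) (at t)"
   unfolding G_def[abs_def] by (simp add: power2_eq_square)
  hence "(G has_vector_derivative (y t \<bullet> dy t)/(norm (y t))^2 + Re (s t)) (at t)"
   by (simp add: has_real_derivative_iff_has_vector_derivative)
  from bounded_linear.has_vector_derivative[OF bounded_linear_of_real this] show "((%t. complex_of_real (G t)) has_vector_derivative of_real ((y t \<bullet> dy t)/(norm (y t))^2 + Re (s t))) (at t)" .
  have "y t \<bullet> dy t + Re (s t)*(norm (y t))^2 = y t \<bullet> (dy t + s t*y t)"
   unfolding cmod_power2 inner_complex_def by (simp add: algebra_simps power2_eq_square)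
  hence "abs (y t \<bullet> dy t + Re (s t)*(norm (y t))^2) <= norm (y t)*norm (dy t + s t*y t)"
   using Cauchy_Schwarz_ineq2 by simp
  also have "... <= norm (y t)*(B t*norm (y t))" using bar[OF tt] by (intro mult_left_mono) auto
  finally have "abs (y t \<bullet> dy t + Re (s t)*(norm (y t))^2)/(norm (y t))^2 <= B t"
   using y0[OF tt] by (simp add: divide_le_eq power2_eq_square mult_ac)
  also have "abs (y t \<bullet> dy t + Re (s t)*(norm (y t))^2)/(norm (y t))^2 = abs ((y t \<bullet> dy t)/(norm (y t))^2 + Re (s t))"
  proof -
   have "(y t \<bullet> dy t)/(norm (y t))^2 + Re (s t) = (y t \<bullet> dy t + Re (s t)*(norm (y t))^2)/(norm (y t))^2"
    using y0[OF tt] by (simp add: add_divide_distrib)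
   thus ?thesis by (simp only: abs_divide abs_power2 abs_norm_cancel power2_abs)
  qed
  finally show "norm (complex_of_real ((y t \<bullet> dy t)/(norm (y t))^2 + Re (s t))) <= B t"
   by (simp only: norm_of_real)
 qed
 hence "abs (G q - G p) <= be q - be p" by (metis norm_of_real of_real_diff)
 thus ?thesis by (simp add: G_def)
qed

abbreviation sibuya_sol :: "complex => complex => complex => complex" where
 "sibuya_sol a l == lsol (sib a l) (dsib a l) a l"
abbreviation sibuya_dsol :: "complex => complex => complex => complex" where
 "sibuya_dsol a l == ldsol (sib a l) (dsib a l) a l"

text \<open>Four times the radius of \<open>wide_square\<close>: from there on sqrt Z is twice the
  bound in \<open>decays_within\<close>, so the amplitude is within 1/2 of 1. It grows only
  quadratically in |l|, so its logarithm is negligible against |l|^(2/3).\<close>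

definition far :: "complex => complex => real" where
 "far a l = 4*(4*norm a + 8*remainder_bound a + 32*norm l)^2"

lemma far_ge: "1024 <= far a l"
proof -
 have "16 <= 4*norm a + 8*remainder_bound a + 32*norm l"
  using remainder_bound_ge[of a] norm_ge_zero[of a] norm_ge_zero[of l] by linarith
 from power_mono[OF this, of 2] show ?thesis by (simp add: far_def)
qed

text \<open>The starting value of the backward barrier: far out y'/y is within 1/Z of - dphase, and
  dphase is within 2/Z of the exact root of the potential.\<close>

lemma sibuya_start:
 assumes Z: "far a l <= Z"
 defines "y == sibuya_sol a l (of_real Z)" and "dy == sibuya_dsol a l (of_real Z)" and "s == csqrt (pot a l (of_real Z))"
 shows "norm (dy+s*y) <= 6/(1+Z)*norm y" "abs (ln (norm y) + Re (phase a (of_real Z))) <= ln 2" "y ~= 0"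
proof -
 define T where "T = 4*norm a + 8*remainder_bound a + 32*norm l"
 have T: "16 <= T" using remainder_bound_ge[of a] norm_ge_zero[of a] norm_ge_zero[of l] unfolding T_def by linarith
 have Z1: "1024 <= Z" using far_ge Z by (rule order_trans)
 define x where "x = sqrt Z"
 have xx: "x*x = Z" "0 < x" using Z1 by (auto simp: x_def)
 have "(2*T)^2 = far a l" unfolding far_def T_def power_mult_distrib by simp
 hence "sqrt ((2*T)^2) <= x" unfolding x_def using Z by (intro real_sqrt_le_mono) simp
 hence x2T: "2*T <= x" unfolding real_sqrt_abs by linarith
 have x8: "8*norm a + 16*remainder_bound a + 64*norm l <= x" using x2T by (simp add: T_def)
 have "wide a (norm l) (T^2)" unfolding T_def by (intro wide_square) auto
 note d = sib_decays[OF this, unfolded decays_within_def]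
 have "T^2 < Z"
 proof -
  have "(2*T)*(2*T) <= x*x" using x2T T by (intro mult_mono) auto
  moreover have "0 < T*T" using T by simp
  ultimately show ?thesis unfolding xx(1) power2_eq_square by linarith
 qed
 hence zin: "complex_of_real Z : wedge (T^2)" by (simp add: of_real_in_wedge)
 define C where "C = 8*remainder_bound a + 32*norm l"
 have "C <= T" by (simp add: C_def T_def)
 hence C: "0 <= C" "2*C <= x" using x2T remainder_bound_ge[of a] by (simp_all add: C_def)
 define v where "v = exp (phase a (of_real Z))*y"
 have v: "norm (v-1) <= C/x" and U: "norm (exp (phase a (of_real Z))*(dy + dphase a (of_real Z)*y)) <= C/(Z*x)"
  using d[rule_format, OF zin] by (simp_all add: v_def y_def dy_def C_def x_def)
 have "C/x <= 1/2" using C by (simp add: divide_le_eq)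
 hence v1: "norm (v-1) <= 1/2" using v by linarith
 hence v2: "1/2 <= norm v" "norm v <= 3/2" using norm_triangle_ineq2[of 1 v] norm_triangle_ineq2[of v 1] by (auto simp: norm_minus_commute)
 thus y0: "y ~= 0" by (auto simp: v_def)
 have nv: "norm v = exp (Re (phase a (of_real Z)))*norm y" by (simp add: v_def norm_mult)
 have "ln (norm v) = Re (phase a (of_real Z)) + ln (norm y)" using y0 by (simp add: nv ln_mult)
 moreover have "ln (1/2) <= ln (norm v)" "ln (norm v) <= ln 2" by (subst ln_le_cancel_iff; use v2 in linarith)+
 ultimately show "abs (ln (norm y) + Re (phase a (of_real Z))) <= ln 2" by (simp add: ln_div)
 have "exp (Re (phase a (of_real Z)))*norm (dy + dphase a (of_real Z)*y) <= C/(Z*x)" using U by (simp add: norm_mult)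
 also have "... = (C/x)/Z" by simp
 also have "... <= (1/2)/Z" using \<open>C/x <= 1/2\<close> Z1 by (intro divide_right_mono) auto
 also have "... <= norm v/Z" using v2 Z1 by (intro divide_right_mono) auto
 also have "... = exp (Re (phase a (of_real Z)))*(1/Z*norm y)" by (simp add: nv)
 finally have d1: "norm (dy + dphase a (of_real Z)*y) <= 1/Z*norm y" by (rule mult_left_le_imp_le) simp
 have w: "csqrt (of_real Z) = of_real x" using Z1 by (simp add: x_def)
 \<comment> \<open>This is dphase without 3/(4 Z). Its square misses the potential by a^2/(4 Z) - l,
   at most sqrt Z/2 in modulus, and division by e + s, of size at least Z^(3/2)/2, leaves
   1/Z.\<close>
 define e where "e = of_real x^3 + a/(2 * of_real x)"
 have Qe: "e^2 - pot a l (of_real Z) = a^2/(4 * of_real Z) - l"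
 proof -
  have Zx: "of_real Z = complex_of_real x^2" by (simp add: xx(1)[symmetric] power2_eq_square)
  show ?thesis unfolding e_def pot_def Zx by (simp add: field_simps power2_eq_square power3_eq_cube)
 qed
 have Ree: "Z*x/2 <= Re e"
 proof -
  have "norm (a/(2 * of_real x)) = norm a/(2*x)" using xx by (simp add: norm_divide)
  also have "... <= Z*x/2"
  proof -
   have "norm a <= x" using x8 remainder_bound_ge[of a] norm_ge_zero[of a] norm_ge_zero[of l] by linarith
   hence "norm a/(2*x) <= 1" using xx by (simp)
   moreover have "2*1 <= Z*x" using Z1 x8 remainder_bound_ge[of a] norm_ge_zero[of a] norm_ge_zero[of l]
    by (intro mult_mono) linarith+
   ultimately show ?thesis by simp
  qed
  finally have "norm (a/(2 * of_real x)) <= Z*x/2" .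
  moreover have "Re (of_real x^3) = Z*x" by (simp add: xx(1)[symmetric] power3_eq_cube)
  ultimately show ?thesis using abs_Re_le_cmod[of "a/(2 * of_real x)"] unfolding e_def plus_complex.sel by linarith
 qed
 have Res: "0 <= Re s" using csqrt_principal[of "pot a l (of_real Z)"] by (auto simp: s_def)
 have "norm (e-s)*norm (e+s) = norm (a^2/(4 * of_real Z) - l)"
  unfolding norm_mult[symmetric] Qe[symmetric] by (simp add: s_def algebra_simps power2_eq_square[symmetric])
 also have "... <= norm a^2 + norm l"
 proof -
  have "norm (a^2/(4 * of_real Z)) <= norm a^2/1"
   unfolding norm_divide norm_power using Z1 by (intro divide_left_mono) auto
  thus ?thesis using norm_triangle_ineq4[of "a^2/(4 * of_real Z)" l] by simp
 qed
 also have "... <= x/2"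
 proof -
  have "24*norm a + 16*(norm a)^2 + 32 + 64*norm l <= x" using x8 by (simp add: remainder_bound_def)
  thus ?thesis using norm_ge_zero[of a] norm_ge_zero[of l] zero_le_power2[of "norm a"] by linarith
 qed
 finally have e1: "norm (e-s)*norm (e+s) <= x/2" .
 have "norm (e-s)*(Z*x/2) <= norm (e-s)*norm (e+s)"
  using Ree Res abs_Re_le_cmod[of "e + s"] by (intro mult_left_mono) auto
 hence "norm (e-s)*(Z*x/2) <= x/2" using e1 by linarith
 hence "norm (e-s) <= 1/Z" using xx Z1 by (simp add: field_simps)
 moreover have "dphase a (of_real Z) = e + 3/(4 * of_real Z)" by (simp add: dphase_def w e_def)
 moreover have "norm (3/(4*complex_of_real Z)) <= 1/Z" using Z1 by (simp add: norm_divide field_simps)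
 ultimately have ps: "norm (dphase a (of_real Z) - s) <= 2/Z"
  using norm_triangle_ineq[of "e - s" "3/(4*complex_of_real Z)"] by (simp add: algebra_simps)
 have "dy + s*y = (dy + dphase a (of_real Z)*y) - (dphase a (of_real Z) - s)*y" by (simp add: algebra_simps)
 hence "norm (dy+s*y) <= norm (dy + dphase a (of_real Z)*y) + norm (dphase a (of_real Z) - s)*norm y"
  by (metis norm_mult norm_triangle_ineq4)
 also have "... <= 1/Z*norm y + 2/Z*norm y" by (intro add_mono d1 mult_right_mono ps) auto
 also have "... = 3/Z*norm y" by (simp)
 also have "... <= 6/(1+Z)*norm y" using Z1 by (intro mult_right_mono) (auto simp: field_simps)
 finally show "norm (dy+s*y) <= 6/(1+Z)*norm y" .
qed

lemma lsol_nonzero: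
 assumes "lsol A B a l z ~= 0" shows "lsol A B a l t ~= 0 | ldsol A B a l t ~= 0"
proof (rule ccontr)
 assume "~?thesis"
 hence "A*B'-B*A' = 0" for A' B' using wronskian_lsol[of A B a l t A' B'] by simp
 from this[of 0 1] this[of "-1" 0] have "A = 0" "B = 0" by auto
 thus False using assms by (simp add: lsol_def)
qed

text \<open>The barrier runs from Z back to p with width M/(1+t), whose integral is only M ln (1+Z).
  At Z the width exceeds the starting error 6/(1+Z) because M >= 7; the second term of M pays for
  the derivative of the root, and M < c sqrt |l| for the square of the width.\<close>

lemma sibuya_riccati:
 fixes a l :: complex and c M p Z :: real
 assumes c: "0 < c" and M: "7 + 2*(3 + norm a)/c^2 <= M" and l: "1 <= norm l" "M < c * sqrt (norm l)"
  and pZ: "0 <= p" "p <= Z" "far a l <= Z"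
  and s: "!!t. t : {p..Z} ==> c * sqrt (t^3 + norm l) <= Re (csqrt (pot a l (of_real t)))"
 defines "y == %t. sibuya_sol a l (of_real t)" and "dy == %t. sibuya_dsol a l (of_real t)"
  and "s == %t. csqrt (pot a l (of_real t))" shows "!!t. t : {p..Z} ==> norm (dy t + s t*y t) < M/(1+t)*norm (y t)"
  "!!S. continuous_on {p..Z} S ==> (!!t. p < t ==> t < Z ==> (S has_vector_derivative s t) (at t)) ==>
   abs (ln (norm (y p)) + Re (phase a (of_real Z)) - Re (S Z - S p)) <= M*ln (1 + Z) + 1"
proof -
 have M7: "7 <= M" "2*(3 + norm a)/c^2 <= M"
 proof -
  have "0 <= 2*(3 + norm a)/c^2" by (intro divide_nonneg_nonneg) auto
  thus "7 <= M" "2*(3 + norm a)/c^2 <= M" using M by linarith+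
 qed
 have y: "(y has_vector_derivative dy t) (at t)" for t
  using has_vector_derivative_horizontal[of "sibuya_sol a l" "dy t" 0 t] lsol_deriv by (simp add: y_def dy_def)
 have ss: "s t^2 = pot a l (of_real t)" for t by (simp add: s_def)
 have dy: "(dy has_vector_derivative s t^2*y t) (at t)" for t
  using has_vector_derivative_horizontal[of "sibuya_dsol a l" _ 0 t] ldsol_deriv by (simp add: y_def dy_def ss)
 have rho: "1 <= t^3 + norm l" "(1+t)^3/4 <= t^3 + norm l" if "0 <= t" for t
 proof -
  have "0 <= t^3" using that by simp
  thus "1 <= t^3 + norm l" using l by linarith
  have "0 <= 3*(t+1)*(t-1)^2" using that by simp
  also have "... = 4*(t^3 + 1) - (1+t)^3" by (simp add: power2_eq_square power3_eq_cube algebra_simps)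
  finally show "(1+t)^3/4 <= t^3 + norm l" using l by simp
 qed
 have Res: "0 < Re (s t)" "c * sqrt (t^3 + norm l) <= Re (s t)" if "t : {p..Z}" for t
 proof -
  have "0 < c * sqrt (t^3 + norm l)" using c rho(1)[of t] that pZ by auto
  thus "0 < Re (s t)" "c * sqrt (t^3 + norm l) <= Re (s t)" using s[OF that] unfolding s_def by linarith+
 qed
 have Qn: "pot a l (of_real t) ~: nonpos_Reals" if "t : {p..Z}" for t
 proof
  assume "pot a l (of_real t) : nonpos_Reals"
  hence "Re (s t) = 0" unfolding s_def by (auto elim!: nonpos_Reals_cases)
  thus False using Res(1)[OF that] by simp
 qed
 define s' where "s' t = (3 * of_real t^2 + a)/(2 * s t)" for t
 have s': "(s has_vector_derivative s' t) (at t)" if "t : {p..Z}" for t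
 proof -
  have "((%z. csqrt (pot a l z)) has_field_derivative s' t) (at (0 + of_real t))"
   unfolding s'_def s_def pot_def[abs_def] using Qn[OF that] by (auto intro!: derivative_eq_intros simp: pot_def)
  from has_vector_derivative_horizontal[OF this] show ?thesis by (simp add: s_def)
 qed
 define B where "B t = M/(1+t)" for t
 have gap: "norm (s' t) + (B t)^2 < 2*B t*Re (s t)" if tt: "t : {p..Z}" for t
 proof -
  have t: "0 <= t" using tt pZ by auto
  define X where "X = sqrt (t^3 + norm l)"
  have X: "0 < X" "X*X = t^3 + norm l" "sqrt (norm l) <= X" using rho[OF t] t by (auto simp: X_def)
  have Bt: "0 < B t" using M7 t by (simp add: B_def)
  have "norm (s' t) <= ((3 + norm a)*(1+t)^2)/(2*(c*X))" unfolding s'_def norm_divide norm_mult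
  proof (intro frac_le mult_mono)
   have "norm (3*complex_of_real t^2 + a) <= 3*t^2 + norm a*1"
    using norm_triangle_ineq[of "3*complex_of_real t^2" a] by (simp add: norm_power)
   also have "... <= 3*(1+t)^2 + norm a*(1+t)^2" using t by (intro add_mono mult_left_mono) auto
   finally show "norm (3*complex_of_real t^2 + a) <= (3 + norm a)*(1+t)^2" by (simp add: algebra_simps)
   show "c*X <= norm (s t)" using Res[OF tt] abs_Re_le_cmod[of "s t"] by (simp add: X_def)
  qed (use c X in auto)
  also have "... <= B t*(c*X)"
  proof -
   have "2*(3 + norm a) <= M*c^2" using M7(2) c by (simp add: divide_le_eq)
   moreover have "(1+t)^3 <= 4*(X*X)" using rho(2)[OF t] X(2) by simp
   ultimately have "(2*(3 + norm a))*(1+t)^3 <= (M*c^2)*(4*(X*X))" using t M7 by (rule_tac mult_mono) auto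
   hence "(3 + norm a)*(1+t)^2*(1+t) <= M*(c*X)*(2*(c*X))"
    by (simp add: power2_eq_square power3_eq_cube algebra_simps)
   hence "(3 + norm a)*(1+t)^2 <= M*(c*X)*(2*(c*X))/(1+t)" using t by (subst pos_le_divide_eq) auto
   hence "(3 + norm a)*(1+t)^2 <= B t*(c*X)*(2*(c*X))" by (simp add: B_def)
   thus ?thesis using c X by (subst pos_divide_le_eq) auto
  qed
  finally have 1: "norm (s' t) <= B t*(c*X)" .
  have "B t <= M/1" unfolding B_def using M7 t by (intro divide_left_mono) auto
  also have "M/1 < c*X" using l(2) X(3) c mult_left_mono[of "sqrt (norm l)" X c] by linarith
  finally have 2: "(B t)^2 < B t*(c*X)" using Bt by (simp add: power2_eq_square)
  have "B t*(c*X) <= B t*Re (s t)" using Res(2)[OF tt] Bt by (intro mult_left_mono) (auto simp: X_def)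
  thus ?thesis using 1 2 by linarith
 qed
 have sn: "norm (dy Z + s Z*y Z) <= 6/(1+Z)*norm (y Z)" "abs (ln (norm (y Z)) + Re (phase a (of_real Z))) <= ln 2" "y Z ~= 0"
  using sibuya_start[OF pZ(3)] by (auto simp: y_def dy_def s_def)
 have start: "norm (dy Z + s Z*y Z) < B Z*norm (y Z)"
 proof -
  have "6/(1+Z)*norm (y Z) < M/(1+Z)*norm (y Z)"
   using M7 pZ sn(3) by (intro mult_strict_right_mono divide_strict_right_mono) auto
  thus ?thesis using sn(1) by (simp add: B_def)
 qed
 have B': "(B has_real_derivative - M/(1+t)^2) (at t)" if "t : {p..Z}" for t
  unfolding B_def[abs_def] using that pZ by (auto intro!: derivative_eq_intros simp: power2_eq_square)
 have bar: "norm (dy t + s t*y t) < B t*norm (y t)" if "t : {p..Z}" for t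
 proof (rule riccati_barrier[OF y dy s' B' _ _ gap _ start that])
  show "0 < B t" "- M/(1+t)^2 <= 0" if "t : {p..Z}" for t using that pZ M7 by (auto simp: B_def)
  show "y t ~= 0 | dy t ~= 0" for t using lsol_nonzero[OF sn(3)[unfolded y_def]] by (simp add: y_def dy_def)
 qed
 thus "norm (dy t + s t*y t) < M/(1+t)*norm (y t)" if "t : {p..Z}" for t using that by (simp add: B_def)
 fix S assume S: "continuous_on {p..Z} S" "!!t. p < t ==> t < Z ==> (S has_vector_derivative s t) (at t)"
 have "abs (ln (norm (y Z)) - ln (norm (y p)) + Re (S Z - S p)) <= M*ln (1+Z) - M*ln (1+p)"
  by (rule ln_norm_increment[OF pZ(2) y bar S])
   (use pZ in \<open>auto intro!: derivative_eq_intros simp: B_def field_simps\<close>)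
 moreover have "0 <= M*ln (1+p)" using M7 pZ by simp
 moreover have "ln (2::real) <= 1" using ln_le_minus_one[of "2::real"] by simp
 ultimately show "abs (ln (norm (y p)) + Re (phase a (of_real Z)) - Re (S Z - S p)) <= M*ln (1+Z) + 1"
  using sn(2) by linarith
qed

section \<open>The regularised action integral\<close>

text \<open>The subtracted term is the integral of t^(3/2), so that the limit for large Z exists. It
  is also the leading term of \<open>phase\<close> at Z and will cancel against it.\<close>

definition action :: "real => complex => complex" where
 "action Z l = integral {0..Z} (%t. csqrt (of_real t^3 + l)) - of_real (2/5*Z^2 * sqrt Z)"

lemma shift_not_nonpos:
 fixes l :: complex and t :: real
 assumes "l ~: nonpos_Reals" "0 <= t" shows "of_real t^3 + l ~: nonpos_Reals"
proof
 assume "of_real t^3 + l : nonpos_Reals"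
 hence "Im l = 0" "t^3 + Re l <= 0" by (auto simp: complex_nonpos_Reals_iff)
 moreover have "0 <= t^3" using assms(2) by simp
 ultimately have "Re l <= 0" by linarith
 thus False using assms(1) \<open>Im l = 0\<close> by (simp add: complex_nonpos_Reals_iff)
qed

lemma continuous_csqrt_shift:
 assumes "l ~: nonpos_Reals" shows "continuous_on {0..Z} (%t. csqrt (of_real t^3 + l))"
 by (intro continuous_on_compose2[OF continuous_on_csqrt] continuous_intros)
  (use shift_not_nonpos[OF assms] in auto)

lemma Re_csqrt_nonneg: "0 <= Re (csqrt z)" using csqrt_principal[of z] by auto

lemma integral_interior_derivative:
 fixes f :: "real => 'a::banach"
 assumes "continuous_on {a..b} f" "a < t" "t < b"
 shows "((%u. integral {a..u} f) has_vector_derivative f t) (at t)"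
proof -
 have "((%u. integral {a..u} f) has_vector_derivative f t) (at t within {a..b})"
  by (rule integral_has_vector_derivative) (use assms in auto)
 moreover have "at t within {a..b} = at t" by (rule at_within_interior) (use assms in \<open>simp\<close>)
 ultimately show ?thesis by (simp only:)
qed

lemma x32_deriv:
 assumes "0 < t" shows "((%t. 2/5*t^2 * sqrt t) has_real_derivative t * sqrt t) (at t)"
proof -
 define x where "x = sqrt t"
 have x: "0 < x" "t = x^2" using assms by (auto simp: x_def)
 have "((%t. 2/5*t^2 * sqrt t) has_real_derivative 2/5*t^2*(inverse (sqrt t)/2) + 2/5*(2*t) * sqrt t) (at t)"
  using assms by (auto intro!: derivative_eq_intros)
 moreover have "2/5*t^2*(inverse (sqrt t)/2) + 2/5*(2*t) * sqrt t = t * sqrt t"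
  unfolding x_def[symmetric] x(2) using x(1) by (simp add: power2_eq_square)
 ultimately show ?thesis by simp
qed

text \<open>Rationalising, csqrt (t^3 + l) differs from t^(3/2) by at most |l| t^(-3/2), since the
  root has nonnegative real part.\<close>

lemma action_increment:
 assumes l: "l ~: nonpos_Reals" and Z: "0 < Z" "Z <= Z'" shows "norm (action Z' l - action Z l) <= 2*norm l/sqrt Z"
proof -
 let ?s = "%t. csqrt (of_real t^3 + l)"
 have c: "continuous_on {0..Z' + 1} ?s" by (rule continuous_csqrt_shift[OF l])
 have "norm (action Z' l - action Z l) <= - 2*norm l/sqrt Z' - (- 2*norm l/sqrt Z)"
 proof (rule norm_increment_le[OF Z(2), where f' = "%t. ?s t - of_real (t * sqrt t)" and phi' = "%t. norm l/(t * sqrt t)"])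
  have d: "((%Z. action Z l) has_vector_derivative ?s t - of_real (t * sqrt t)) (at t)" if "Z <= t" "t <= Z'" for t
   unfolding action_def
   using has_vector_derivative_diff[OF integral_interior_derivative[OF c, of t] bounded_linear.has_vector_derivative[OF bounded_linear_of_real x32_deriv[of t, unfolded has_real_derivative_iff_has_vector_derivative]]]
    that Z by simp
  thus "Z < t ==> t < Z' ==> ((%Z. action Z l) has_vector_derivative ?s t - of_real (t * sqrt t)) (at t)" for t by simp
  show "continuous_on {Z..Z'} (%Z. action Z l)"
   by (intro continuous_at_imp_continuous_on ballI has_vector_derivative_continuous[OF d]) auto
  have e: "((%t. - 2*norm l/sqrt t) has_real_derivative norm l/(t * sqrt t)) (at t)" if "Z <= t" for t
   using that Z by (auto intro!: derivative_eq_intros simp: field_simps)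
  thus "Z < t ==> ((%t. - 2*norm l/sqrt t) has_real_derivative norm l/(t * sqrt t)) (at t)" for t by simp
  show "continuous_on {Z..Z'} (%t. - 2*norm l/sqrt t)"
   by (intro continuous_at_imp_continuous_on ballI DERIV_isCont[OF e]) auto
  fix t assume t: "Z < t"
  define x where "x = t * sqrt t"
  have x: "0 < x" "x^2 = t^3" using t Z by (auto simp: x_def power2_eq_square power3_eq_cube)
  have "(?s t - of_real x)*(?s t + of_real x) = ?s t^2 - of_real (x^2)" by (simp add: algebra_simps power2_eq_square)
  also have "... = l" unfolding x(2) by simp
  finally have "norm (?s t - of_real x)*norm (?s t + of_real x) = norm l" by (metis norm_mult)
  moreover have "x <= norm (?s t + of_real x)"
   using abs_Re_le_cmod[of "?s t + of_real x"] Re_csqrt_nonneg[of "of_real t^3 + l"] by (simp del: csqrt.sel)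
  ultimately have "norm (?s t - of_real x)*x <= norm l" by (metis mult_left_mono norm_ge_zero)
  thus "norm (?s t - of_real (t * sqrt t)) <= norm l/(t * sqrt t)" using x(1) by (simp add: x_def[symmetric] pos_le_divide_eq)
 qed
 also have "... <= 2*norm l/sqrt Z" using Z by simp
 finally show ?thesis .
qed

definition reg_action :: "complex => complex" where
 "reg_action l = lim (%n. action (real (Suc n)) l)"

lemma inv_sqrt_null: "LIMSEQ (%n. C/sqrt (real (Suc n))) 0" by real_asymp

lemma action_approx:
 assumes l: "l ~: nonpos_Reals" and Z: "0 < Z" shows "norm (reg_action l - action Z l) <= 2*norm l/sqrt Z"
proof -
 have "Cauchy (%n. action (real (Suc n)) l)"
 proof (rule metric_CauchyI)
  fix e :: real assume "e > 0"
  hence "\<forall>\<^sub>F n in sequentially. 2*norm l/sqrt (real (Suc n)) < e/2"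
   using order_tendstoD(2)[OF inv_sqrt_null[of "2*norm l"], of "e/2"] by simp
  then obtain N where N: "2*norm l/sqrt (real (Suc N)) < e/2" by (auto simp: eventually_sequentially)
  have "dist (action (real (Suc n)) l) (action (real (Suc N)) l) < e/2" if "n >= N" for n
   using action_increment[OF l, of "real (Suc N)" "real (Suc n)"] that N by (simp add: dist_norm)
  thus "EX M. ALL m>=M. ALL n>=M. dist (action (real (Suc m)) l) (action (real (Suc n)) l) < e"
   by (meson dist_triangle_half_l)
 qed
 hence L: "LIMSEQ (%n. action (real (Suc n)) l) (reg_action l)"
  unfolding reg_action_def using Cauchy_convergent convergent_LIMSEQ_iff by blast
 hence "LIMSEQ (%n. norm (action (real (Suc n)) l - action Z l)) (norm (reg_action l - action Z l))"
  by (intro tendsto_intros)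
 moreover have "\<forall>\<^sub>F n in sequentially. norm (action (real (Suc n)) l - action Z l) <= 2*norm l/sqrt Z"
 proof -
  obtain N where "Z <= real N" using real_arch_simple by blast
  hence "norm (action (real (Suc n)) l - action Z l) <= 2*norm l/sqrt Z" if "n >= N" for n
   using that by (intro action_increment l Z) simp
  thus ?thesis by (auto simp: eventually_sequentially)
 qed
 ultimately show ?thesis by (rule tendsto_upperbound) simp
qed

lemma action_limit:
 assumes l: "l ~: nonpos_Reals" and X: "filterlim X at_top sequentially"
 shows "LIMSEQ (%n. action (X n) l) (reg_action l)"
proof -
 have "LIMSEQ (%n. action (X n) l - reg_action l) 0"
 proof (rule Lim_null_comparison)
  show "\<forall>\<^sub>F n in sequentially. norm (action (X n) l - reg_action l) <= 2*norm l/sqrt (X n)"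
   using filterlim_at_top_dense[THEN iffD1, OF X, rule_format, of 0]
   by eventually_elim (metis action_approx[OF l] norm_minus_commute)
  have "tendsto (%x::real. 2*norm l/sqrt x) 0 at_top" by real_asymp
  thus "LIMSEQ (%n. 2*norm l/sqrt (X n)) 0" by (rule filterlim_compose[OF _ X])
 qed
 thus ?thesis by (simp add: LIM_zero_iff)
qed

lemma action_holomorphic:
 assumes "0 < Z" shows "action Z holomorphic_on - nonpos_Reals"
proof -
 have "EX d. (action Z has_field_derivative d) (at l)" if l: "l ~: nonpos_Reals" for l
 proof -
  have "open (- nonpos_Reals :: complex set)" by auto
  then obtain e where e: "e > 0" "ball l e <= - nonpos_Reals" using l open_contains_ball by (metis ComplI)
  have "(%l. integral (cbox 0 Z) (%t. csqrt (of_real t^3 + l))) holomorphic_on ball l e"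
  proof (rule leibniz_rule_holomorphic[where fx = "%l t. 1/(2*csqrt (of_real t^3 + l))"])
   fix x t assume x: "x : ball l e" and t: "t : cbox 0 Z"
   have n: "x ~: nonpos_Reals" using x e by auto
   show "((%x. csqrt (of_real t^3 + x)) has_field_derivative 1/(2*csqrt (of_real t^3 + x))) (at x within ball l e)"
    using shift_not_nonpos[OF n] t by (auto intro!: derivative_eq_intros)
  next
   fix x assume "x : ball l e"
   hence n: "x ~: nonpos_Reals" using e by auto
   show "(%t. csqrt (of_real t^3 + x)) integrable_on cbox 0 Z"
    using continuous_csqrt_shift[OF n] by (simp add: integrable_continuous_real)
  next
   have n: "of_real t^3 + x : - nonpos_Reals" if "x : ball l e" "t : cbox 0 Z" for x t
    using shift_not_nonpos[of x t] e that by auto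
   have "continuous_on (ball l e \<times> cbox 0 Z) (%p. csqrt (of_real (snd p)^3 + fst p))"
    by (intro continuous_on_compose2[OF continuous_on_csqrt] continuous_intros) (use n in auto)
   thus "continuous_on (ball l e \<times> cbox 0 Z) (%(x, t). 1/(2*csqrt (of_real t^3 + x)))"
    unfolding case_prod_unfold using n by (intro continuous_intros) fastforce+
  qed simp
  hence "(%l. integral (cbox 0 Z) (%t. csqrt (of_real t^3 + l)) - of_real (2/5*Z^2 * sqrt Z)) holomorphic_on ball l e"
   by (intro holomorphic_intros)
  hence "action Z holomorphic_on ball l e" by (simp add: action_def[abs_def])
  thus ?thesis using e(1) by (metis centre_in_ball holomorphic_on_open open_ball)
 qed
 thus ?thesis by (subst holomorphic_on_open) auto
qed

lemma reg_action_holomorphic: "reg_action holomorphic_on - nonpos_Reals"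
proof (rule holomorphic_uniform_sequence)
 show "(%n. action (real (Suc n))) n holomorphic_on - nonpos_Reals" for n by (rule action_holomorphic) simp
 fix x :: complex assume "x : - nonpos_Reals"
 then obtain e where e: "e > 0" "cball x e <= - nonpos_Reals" using open_contains_cball[of "- nonpos_Reals :: complex set"] by auto
 show "EX d>0. cball x d <= - nonpos_Reals & uniform_limit (cball x d) (%n. action (real (Suc n))) reg_action sequentially"
 proof (intro exI[of _ e] conjI e)
  show "uniform_limit (cball x e) (%n. action (real (Suc n))) reg_action sequentially" unfolding uniform_limit_iff
  proof (intro allI impI)
   fix ep :: real assume "ep > 0"
   hence "\<forall>\<^sub>F n in sequentially. 2*(norm x + e)/sqrt (real (Suc n)) < ep"
    using order_tendstoD(2)[OF inv_sqrt_null] by blast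
   thus "\<forall>\<^sub>F n in sequentially. ALL y:cball x e. dist (action (real (Suc n)) y) (reg_action y) < ep"
   proof eventually_elim
    case (elim n)
    show ?case
    proof
     fix y assume y: "y : cball x e"
     have "dist (action (real (Suc n)) y) (reg_action y) <= 2*norm y/sqrt (real (Suc n))"
      using action_approx[of y "real (Suc n)"] y e by (auto simp: dist_norm norm_minus_commute)
     also have "norm y <= norm x + e" using y norm_triangle_sub[of y x] by (simp add: dist_norm norm_minus_commute)
     hence "2*norm y/sqrt (real (Suc n)) <= 2*(norm x + e)/sqrt (real (Suc n))" by (intro divide_right_mono) auto
     finally show "dist (action (real (Suc n)) y) (reg_action y) < ep" using elim by simp
    qed
   qed
  qed
 qed
qed auto

definition real_action :: "real => real => real" where
 "real_action Z r = integral {0..Z} (%t. sqrt (t^3 + r)) - 2/5*Z^2 * sqrt Z"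

lemma real_action_integrable: "0 < r ==> ((%t. sqrt (t^3 + r)) has_integral (integral {0..Z} (%t. sqrt (t^3 + r)))) {0..Z}"
 by (intro integrable_integral integrable_continuous_real continuous_intros)

lemma action_of_real:
 assumes "0 < r" shows "action Z (of_real r) = of_real (real_action Z r)"
proof -
 have "((%t. complex_of_real (sqrt (t^3 + r))) has_integral of_real (integral {0..Z} (%t. sqrt (t^3 + r)))) {0..Z}"
  by (rule has_integral_of_real[OF real_action_integrable[OF assms]])
 moreover have "complex_of_real (sqrt (t^3 + r)) = csqrt (of_real t^3 + of_real r)" if "t : {0..Z}" for t
 proof -
  have "0 <= t^3 + r" using that assms by simp
  hence "csqrt (of_real (t^3 + r)) = of_real (sqrt (t^3 + r))" by simp
  thus ?thesis by simp
 qed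
 ultimately have "((%t. csqrt (of_real t^3 + of_real r)) has_integral of_real (integral {0..Z} (%t. sqrt (t^3 + r)))) {0..Z}"
  by (rule has_integral_eq[rotated])
 thus ?thesis by (simp add: action_def real_action_def integral_unique)
qed

text \<open>Replace t by m t. With r = m^3 the factor m^(5/2) is r^(5/6), which is where this
  exponent comes from.\<close>

lemma real_action_scale:
 assumes m: "0 < m" and Z: "0 < Z" shows "real_action (m*Z) (m^3) = m^2 * sqrt m*real_action Z 1"
proof -
 let ?I = "integral {0..m*Z} (%t. sqrt (t^3 + m^3))"
 have "((%t. sqrt ((m*t)^3 + m^3)) has_integral (1/abs m) *\<^sub>R ?I) ((%x. x/m) ` {0..m*Z})"
  using m by (intro has_integral_stretch_real real_action_integrable) auto
 moreover have "(%x. x/m) ` {0..m*Z} = {0..Z}" using m by (simp)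
 moreover have "sqrt ((m*t)^3 + m^3) = m * sqrt m * sqrt (t^3 + 1)" for t
 proof -
  have "(m*t)^3 + m^3 = m^2*(m*(t^3 + 1))" by (simp add: power2_eq_square power3_eq_cube algebra_simps)
  thus ?thesis using m by (simp add: real_sqrt_mult)
 qed
 ultimately have "((%t. m * sqrt m * sqrt (t^3 + 1)) has_integral (1/m)*?I) {0..Z}" using m by simp
 moreover have "((%t. m * sqrt m * sqrt (t^3 + 1)) has_integral m * sqrt m*integral {0..Z} (%t. sqrt (t^3 + 1))) {0..Z}"
  by (intro has_integral_mult_right real_action_integrable) simp
 ultimately have "(1/m)*?I = m * sqrt m*integral {0..Z} (%t. sqrt (t^3 + 1))" by (rule has_integral_unique)
 hence "?I = m^2 * sqrt m*integral {0..Z} (%t. sqrt (t^3 + 1))" using m by (simp add: field_simps power2_eq_square)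
 thus ?thesis by (simp add: real_action_def real_sqrt_mult algebra_simps)
qed

text \<open>The constant K of the overview, a regularised integral of sqrt (t^3 + 1). It cancels in
  the final quotient.\<close>

definition action_const :: real where "action_const = Re (reg_action 1)"

lemma reg_action_1: "reg_action 1 = of_real action_const"
proof -
 have "LIMSEQ (%n. Im (action (real (Suc n)) 1)) (Im (reg_action 1))"
  by (intro tendsto_intros action_limit) (auto simp: complex_nonpos_Reals_iff, real_asymp)
 moreover have "Im (action Z 1) = 0" for Z using action_of_real[of 1 Z] by simp
 ultimately have "Im (reg_action 1) = 0" by (simp add: LIMSEQ_const_iff)
 thus ?thesis by (simp add: action_const_def complex_eq_iff)
qed

text \<open>At Z = 1 the value is at least 1 - 2/5, and from there on it grows with Z because sqrt
  (t^3 + 1) >= t^(3/2).\<close>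

lemma action_const_pos: "0 < action_const"
proof -
 have lim: "LIMSEQ (%n. Re (action (real (Suc n)) 1)) (Re (reg_action 1))"
  by (intro tendsto_intros action_limit) (auto simp: complex_nonpos_Reals_iff, real_asymp)
 have "3/5 <= real_action (real (Suc n)) 1" for n
 proof -
  define Z where "Z = real (Suc n)"
  have c: "continuous_on {0..Z + 1} (%t. sqrt (t^3 + 1))" for Z :: real by (intro continuous_intros)
  have "integral {0..1} (%t::real. 1::real) <= integral {0..1} (%t. sqrt (t^3 + 1))"
   by (intro integral_le integrable_continuous_real continuous_intros) auto
  hence "3/5 <= real_action 1 1" by (simp add: real_action_def)
  also have "real_action 1 1 <= real_action Z 1"
  proof (rule DERIV_nonneg_imp_nondecreasing[where f = "%Z. real_action Z 1"])
   show "1 <= Z" by (simp add: Z_def)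
   fix t assume t: "1 <= t" "t <= Z"
   have "((%Z. real_action Z 1) has_real_derivative sqrt (t^3 + 1) - t * sqrt t) (at t)" unfolding real_action_def
    by (intro DERIV_diff x32_deriv integral_interior_derivative[OF c[of Z], folded has_real_derivative_iff_has_vector_derivative]) (use t in auto)
   moreover have "t * sqrt t <= sqrt (t^3 + 1)"
   proof (rule real_le_rsqrt)
    have "(t * sqrt t)^2 = t^3" using t by (simp add: power2_eq_square power3_eq_cube)
    thus "(t * sqrt t)^2 <= t^3 + 1" by simp
   qed
   ultimately show "EX y. ((%Z. real_action Z 1) has_real_derivative y) (at t) & 0 <= y" by auto
  qed
  finally show ?thesis by (simp add: Z_def)
 qed
 hence "3/5 <= Re (action (real (Suc n)) 1)" for n using action_of_real[of 1 "real (Suc n)"] by simp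
 hence "3/5 <= action_const" unfolding action_const_def by (intro tendsto_lowerbound[OF lim]) auto
 thus ?thesis by simp
qed

lemma reg_action_of_real:
 assumes r: "0 < r" shows "reg_action (of_real r) = of_real (action_const*r powr (5/6))"
proof -
 define m where "m = r powr (1/3)"
 have m: "0 < m" "m^3 = r" using r by (auto simp: m_def powr_powr simp flip: powr_numeral)
 have mm: "m^2 * sqrt m = r powr (5/6)" 
  by (simp add: m_def powr_half_sqrt[symmetric] powr_powr flip: powr_numeral powr_add)
 have n: "of_real r ~: (nonpos_Reals :: complex set)" "1 ~: (nonpos_Reals :: complex set)" using r by (auto)
 have "LIMSEQ (%k. action (m*real (Suc k)) (of_real r)) (reg_action (of_real r))"
  using m(1) by (intro action_limit n) real_asymp
 moreover have "action (m*real (Suc k)) (of_real r) = of_real (r powr (5/6))*action (real (Suc k)) 1" for k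
  using action_of_real[OF r] action_of_real[of 1] real_action_scale[OF m(1), of "real (Suc k)"] by (simp add: m(2) mm)
 moreover have "LIMSEQ (%k. of_real (r powr (5/6))*action (real (Suc k)) 1) (of_real (r powr (5/6))*reg_action 1)"
  by (intro tendsto_intros action_limit n) real_asymp
 ultimately show ?thesis using LIMSEQ_unique by (fastforce simp: reg_action_1)
qed

text \<open>Both sides are holomorphic on the slit plane and agree on the positive axis, where
  scaling computes the left one.\<close>

lemma reg_action_eq:
 assumes l: "l ~: nonpos_Reals" shows "reg_action l = of_real action_const*l powr (5/6)"
proof -
 define f where "f l = reg_action l - of_real action_const*l powr (5/6)" for l :: complex
 have "f l = 0"
 proof (rule analytic_continuation[of f "- nonpos_Reals" "complex_of_real ` {0<..}" 1])
  show "f holomorphic_on - nonpos_Reals" unfolding f_def[abs_def]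
   by (intro holomorphic_intros reg_action_holomorphic) auto
  have "- nonpos_Reals = - (complex_of_real ` {..0})" by (auto simp: nonpos_Reals_def)
  thus "connected (- nonpos_Reals :: complex set)"
   using starlike_imp_connected[OF starlike_slotted_complex_plane_left[of 0]] by simp
  show "complex_of_real ` {0<..} <= - nonpos_Reals" by (auto)
  show "1 islimpt complex_of_real ` {0<..}"
  proof (rule islimptI)
   fix T :: "complex set" assume "1 : T" "open T"
   then obtain e where e: "e > 0" "ball 1 e <= T" using open_contains_ball by blast
   have "of_real (1+e/2) : ball (1::complex) e" using e by (simp add: dist_norm)
   moreover have "complex_of_real (1+e/2) : complex_of_real ` {0<..}" by (rule imageI) (use e in auto)
   moreover have "complex_of_real (1+e/2) ~= 1" using e by simp
   ultimately show "EX y:complex_of_real ` {0<..}. y : T & y ~= 1" using e by blast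
  qed
  fix z assume "z : complex_of_real ` {0<..}"
  then obtain r where r: "z = of_real r" "0 < r" by auto
  have "complex_of_real r powr (5/6) = of_real (r powr (5/6))" using r powr_of_real[of r "5/6"] by simp
  thus "f z = 0" using reg_action_of_real[OF r(2)] r by (simp add: f_def)
 qed (use l in \<open>auto simp: complex_nonpos_Reals_iff\<close>)
 thus ?thesis by (simp add: f_def)
qed

section \<open>Asymptotics of Sibuya's solution on sectors\<close>

text \<open>Rests on Re (csqrt Q) = sqrt ((|Q| + Re Q)/2): the real part is large when Q is large
  and off the negative axis.\<close>

lemma csqrt_lower:
 assumes "0 <= c" "2*c^2*r <= norm Q + Re Q" shows "c * sqrt r <= Re (csqrt Q)"
proof -
 have "c * sqrt r = sqrt (c^2*r)" using assms(1) by (simp add: real_sqrt_mult)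
 also have "... <= sqrt ((norm Q + Re Q)/2)" using assms(2) by (intro real_sqrt_le_mono) simp
 finally show ?thesis by simp
qed

text \<open>The two obvious lower bounds for the modulus, |l| - t^3 and t^3 - k |l|, each fail in
  one regime; a convex combination of them works throughout.\<close>

lemma sector_base:
 fixes l :: complex and t k :: real
 assumes k: "0 <= k" "k < 1" and l: "- k*norm l <= Re l" and t: "0 <= t"
 shows "(1-k)/4*(t^3 + norm l) <= norm (of_real t^3 + l)" "- k*norm (of_real t^3 + l) <= Re (of_real t^3 + l)"
proof -
 define ta X La where "ta = t^3" and "X = norm (of_real t^3 + l)" and "La = norm l"
 have ta: "0 <= ta" "Re (of_real t^3 + l) = ta + Re l" using t by (auto simp: ta_def)
 have La: "0 <= La" by (simp add: La_def)
 have n: "norm (complex_of_real t^3) = ta" using t by (simp add: norm_power ta_def)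
 have A: "La - ta <= X" using norm_triangle_ineq2[of l "- (of_real t^3)"] n by (simp add: X_def La_def add.commute)
 have B: "ta - k*La <= X" using complex_Re_le_cmod[of "of_real t^3 + l"] l ta by (simp add: X_def La_def)
 define ka where "ka = (1-k)/4"
 have ka: "0 < ka" "ka <= 1/4" "k = 1 - 4*ka" using k by (auto simp: ka_def field_simps)
 \<comment> \<open>The weights (1 - ka)/2 and (1 + ka)/2 are tilted just enough to leave at least ka
   (t^3 + |l|).\<close>
 have "(1-ka)/2*(La-ta) <= (1-ka)/2*X" using A ka by (intro mult_left_mono) auto
 moreover have "(1+ka)/2*(ta-k*La) <= (1+ka)/2*X" using B ka by (intro mult_left_mono) auto
 moreover have "(1-ka)/2*(La-ta) + (1+ka)/2*(ta-k*La) = ka*(ta+La) + 2*ka^2*La"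
  unfolding ka(3) by (simp add: field_simps power2_eq_square)
 moreover have "(1-ka)/2*X + (1+ka)/2*X = X" by (simp add: field_simps)
 moreover have "0 <= 2*ka^2*La" using La by simp
 ultimately have "ka*(ta+La) <= X" by linarith
 thus "(1-k)/4*(t^3 + norm l) <= norm (of_real t^3 + l)" by (simp add: X_def ta_def ka_def La_def)
 have "k*(La-ta) <= k*X" using A k by (intro mult_left_mono) auto
 moreover have "k*ta <= 1*ta" using k ta by (intro mult_right_mono) auto
 ultimately show "- k*norm (of_real t^3 + l) <= Re (of_real t^3 + l)"
  using l ta(2) by (simp add: X_def[symmetric] La_def[symmetric] right_diff_distrib)
qed

lemma linear_le_cubic:
 assumes "0 < (e::real)" shows "EX L>=1. ALL t>=0. ALL L'>=L. t <= e*(t^3 + L')"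
proof -
 define K where "K = 1 + 1/e"
 have K: "1 <= K" "1 <= e*K" using assms by (auto simp: K_def field_simps)
 show ?thesis
 proof (intro exI[of _ "max 1 (K/e)"] conjI allI impI)
  fix t L' :: real assume t: "0 <= t" and L': "max 1 (K/e) <= L'"
  have eL: "K <= e*L'" using L' assms by (auto simp: pos_divide_le_eq mult.commute)
  have t3: "0 <= t^3" using t by simp
  show "t <= e*(t^3 + L')"
  proof (cases "t <= K")
   case True
   have "0 <= e*t^3" using t3 assms by simp
   thus ?thesis using True eL by (simp add: distrib_left)
  next
   case False
   hence tK: "K <= t" by simp
   have "K*1 <= t*t" using tK K by (intro mult_mono) auto
   hence "e*K <= e*(t*t)" using assms by simp
   hence "1 <= e*(t*t)" using K by linarith
   hence "t*1 <= t*(e*(t*t))" using t by (intro mult_left_mono) auto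
   hence "t <= e*t^3" by (simp add: power3_eq_cube mult_ac)
   moreover have "0 <= e*L'" using eL K by linarith
   ultimately show ?thesis by (simp add: distrib_left)
  qed
 qed simp
qed

text \<open>As k < 1, the sum |Q| + Re Q for Q = t^3 + l is at least a fixed fraction of t^3 + |l|,
  and for large |l| the linear term a t costs at most half of that.\<close>

lemma sector_csqrt:
 fixes a :: complex and k :: real
 assumes k: "0 <= k" "k < 1" shows "EX L>=1. ALL l t. L <= norm l --> - k*norm l <= Re l --> 0 <= t -->
  (1 - k)/4 * sqrt (t^3 + norm l) <= Re (csqrt (pot a l (of_real t))) &
  (1 - k)/4 * sqrt (t^3 + norm l) <= Re (csqrt (of_real t^3 + l))"
proof -
 define dl where "dl = (1-k)^2/8"
 have dl: "0 < dl" using k by (simp add: dl_def)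
 obtain L where L: "L >= 1" "!!t L'. 0 <= t ==> L <= L' ==> t <= dl/(2*norm a + 1)*(t^3 + L')"
  using linear_le_cubic[of "dl/(2*norm a + 1)"] dl by (metis add_nonneg_pos divide_pos_pos mult_nonneg_nonneg norm_ge_zero zero_le_numeral zero_less_one)
 have *: "(1-k)/4 * sqrt (t^3 + norm l) <= Re (csqrt (of_real t^3 + l + w))"
  if l: "L <= norm l" "- k*norm l <= Re l" and t: "0 <= t" and w: "norm w <= norm a*t" for l w :: complex and t
 proof (rule csqrt_lower)
  define Q where "Q = of_real t^3 + l"
  have Q: "(1-k)/4*(t^3 + norm l) <= norm Q" "- k*norm Q <= Re Q"
   unfolding Q_def by (rule sector_base[OF k l(2) t])+
  have "(1-k)*((1-k)/4*(t^3 + norm l)) <= (1-k)*norm Q" using k Q(1) by (intro mult_left_mono) auto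
  also have "... <= norm Q + Re Q" using Q(2) by (simp add: algebra_simps)
  finally have 1: "2*dl*(t^3 + norm l) <= norm Q + Re Q" by (simp add: dl_def power2_eq_square)
  have "(2*norm a + 1)*t <= (2*norm a + 1)*(dl/(2*norm a + 1)*(t^3 + norm l))"
   using L(2)[OF t l(1)] by (intro mult_left_mono) auto
  also have "... = dl*(t^3 + norm l)" by (simp add: add_nonneg_eq_0_iff)
  finally have 2: "2*(norm a*t) <= dl*(t^3 + norm l)" using t by (simp add: algebra_simps)
  have "norm Q - norm w <= norm (Q+w)" using norm_triangle_ineq2[of Q "- w"] by simp
  moreover have "Re Q - norm w <= Re (Q+w)" using abs_Re_le_cmod[of w] by simp
  ultimately have "dl*(t^3 + norm l) <= norm (Q+w) + Re (Q+w)" using 1 2 w by linarith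
  thus "2*((1-k)/4)^2*(t^3 + norm l) <= norm (of_real t^3 + l + w) + Re (of_real t^3 + l + w)"
   by (simp add: Q_def dl_def power_divide)
 qed (use k in auto)
 show ?thesis
 proof (intro exI[of _ L] conjI allI impI L(1))
  fix l t assume h: "L <= norm l" "- k*norm l <= Re l" "0 <= (t::real)"
  show "(1-k)/4 * sqrt (t^3 + norm l) <= Re (csqrt (pot a l (of_real t)))"
   using *[OF h, of "a * of_real t"] h by (simp add: pot_def norm_mult add_ac del: csqrt.sel)
  show "(1-k)/4 * sqrt (t^3 + norm l) <= Re (csqrt (of_real t^3 + l))"
   using *[OF h, of 0] h by (simp del: csqrt.sel)
 qed
qed

text \<open>With |l| = m^3 it bounds (t + |l|)/(t^3 + |l|) by a multiple of m^2/(1+t). The factor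
  m^2 = |l|^(2/3) is the origin of that error exponent.\<close>

lemma cubic_kernel_le:
 fixes m t :: real
 assumes m: "1 <= m" and t: "0 <= t" shows "(t + m^3)*(1+t) <= 4*m^2*(t^3 + m^3)"
proof -
 define X where "X = t^3 + m^3"
 have m3: "1 <= m^3" "1 <= m^2" "m <= m^2" using m by (auto simp: self_le_power)
 have t3: "0 <= t^3" using t by simp
 have X0: "0 <= X" unfolding X_def using m3(1) t3 by linarith
 have up: "y <= m^2*X" if "y <= X" for y using that mult_right_mono[OF m3(2) X0] by simp
 have tX: "t <= X" "t^2 <= X"
 proof -
  have "t <= 1 + t^3 & t^2 <= 1 + t^3"
  proof (cases "t <= 1")
   case True
   have "t^2 <= 1" using power_mono[OF True t, of 2] by simp
   thus ?thesis using t3 True by linarith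
  next
   case False
   hence "t^1 <= t^3" "t^2 <= t^3" by (intro power_increasing; simp)+
   thus ?thesis by auto
  qed
  thus "t <= X" "t^2 <= X" using m3 by (auto simp: X_def)
 qed
 have mt: "m*t <= X"
 proof (cases "t <= m")
  case True
  hence "m*t <= m*m" using m by (intro mult_left_mono) auto
  also have "... <= m^3" using power_increasing[of 2 3 m] m by (simp add: power2_eq_square)
  finally show ?thesis using t3 unfolding X_def by linarith
 next
  case False
  hence "m*t <= t*t" using t by (intro mult_right_mono) auto
  also have "... <= t^3" using power_increasing[of 2 3 t] False m by (simp add: power2_eq_square)
  finally show ?thesis using m3 unfolding X_def by linarith
 qed
 have "m^3*t = m^2*(m*t)" by (simp add: power2_eq_square power3_eq_cube)
 also have "... <= m^2*X" using mt by (intro mult_left_mono) auto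
 finally have "m^3*t <= m^2*X" .
 moreover have "m^3 <= X" using t3 unfolding X_def by linarith
 moreover have "(t + m^3)*(1+t) = t + t^2 + m^3 + m^3*t" by (simp add: algebra_simps power2_eq_square)
 ultimately show ?thesis using up[OF tX(1)] up[OF tX(2)] up[of "m^3"] by (simp add: X_def[symmetric])
qed

lemma powr_third:
 fixes L :: real
 assumes "0 <= L" shows "(L powr (1/3))^3 = L" "(L powr (1/3))^2 = L powr (2/3)"
proof -
 have "(L powr (1/3))^n = L powr (real n/3)" if "n ~= 0" for n
  using that by (cases "L = 0") (simp_all add: powr_power)
 from this[of 3] this[of 2] show "(L powr (1/3))^3 = L" "(L powr (1/3))^2 = L powr (2/3)" using assms by simp_all
qed

lemma continuous_csqrt_pot:
 assumes "!!t. t : {p..q} ==> 0 < Re (csqrt (pot a l (of_real t)))"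
 shows "continuous_on {p..q} (%t. csqrt (pot a l (of_real t)))"
proof -
 have "pot a l (of_real t) : - nonpos_Reals" if "t : {p..q}" for t
 proof
  assume "pot a l (of_real t) : nonpos_Reals"
  hence "Re (csqrt (pot a l (of_real t))) = 0" by (auto elim!: nonpos_Reals_cases)
  thus False using assms[OF that] by simp
 qed
 thus ?thesis
  by (intro continuous_on_compose2[OF continuous_on_csqrt]) (auto simp: pot_def intro!: continuous_intros)
qed

text \<open>The difference of the roots, a t/(s + s0), is close to a/(2 sqrt t), the derivative of
  the middle term a sqrt t of \<open>phase\<close>. The error is O(|l|^(2/3)) times 1/((1+t) sqrt
  t), the derivative of 2 arctan (sqrt t), whence the factor pi.\<close>

lemma action_perturbation:
 fixes a l :: complex and c Z :: real
 assumes c: "0 < c" and l: "1 <= norm l" and Z: "0 < Z"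
  and b: "!!t. 0 <= t ==> c * sqrt (t^3 + norm l) <= Re (csqrt (pot a l (of_real t)))"
   "!!t. 0 <= t ==> c * sqrt (t^3 + norm l) <= Re (csqrt (of_real t^3 + l))"
 shows "norm (integral {0..Z} (%t. csqrt (pot a l (of_real t))) - integral {0..Z} (%t. csqrt (of_real t^3 + l)) - a * of_real (sqrt Z))
  <= pi*(norm a*(norm a + 2)/c^2)*norm l powr (2/3)"
proof -
 define m where "m = norm l powr (1/3)"
 have m3: "m^3 = norm l" "m^2 = norm l powr (2/3)" using powr_third[of "norm l"] by (auto simp: m_def)
 have m1: "1 <= m" unfolding m_def using l by (intro ge_one_powr_ge_zero) auto
 define s s0 where "s t = csqrt (pot a l (of_real t))" and "s0 t = csqrt (pot 0 l (of_real t))" for t :: real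
 have s0: "s0 = (%t. csqrt (of_real t^3 + l))" by (rule ext) (simp add: s0_def pot_def)
 define X where "X t = sqrt (t^3 + norm l)" for t
 have X: "0 < X t" "X t*X t = t^3 + norm l" if "0 <= t" for t
 proof -
  have "0 < t^3 + norm l" using that l by (intro add_nonneg_pos) auto
  thus "0 < X t" "X t*X t = t^3 + norm l" by (auto simp: X_def)
 qed
 have Re: "c*X t <= Re (s t)" "c*X t <= Re (s0 t)" "0 < Re (s t)" "0 < Re (s0 t)" if "0 <= t" for t
 proof -
  have "0 < c*X t" using X[OF that] c by simp
  thus "c*X t <= Re (s t)" "c*X t <= Re (s0 t)" "0 < Re (s t)" "0 < Re (s0 t)"
   using b[OF that] unfolding s_def s0 X_def by (linarith+)
 qed
 have sc: "continuous_on {0..Z'} s" "continuous_on {0..Z'} s0" for Z'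
  unfolding s_def[abs_def] s0_def[abs_def] using Re by (auto intro!: continuous_csqrt_pot simp: s_def s0_def simp del: csqrt.sel)
 define C where "C = norm a*(norm a + 2)/c^2*m^2"
 have C: "0 <= C" by (simp add: C_def)
 let ?F = "%Z. integral {0..Z} s - integral {0..Z} s0 - a * of_real (sqrt Z)"
 have "norm (?F Z - ?F 0) <= 2*C*arctan (sqrt Z) - 2*C*arctan (sqrt 0)"
 proof (rule norm_increment_le[where f' = "%t. s t - s0 t - a * of_real (inverse (sqrt t)/2)" and phi' = "%t. 2*C*(inverse (1 + (sqrt t)^2)*(inverse (sqrt t)/2))"])
  show "continuous_on {0..Z} ?F"
   by (intro continuous_intros indefinite_integral_continuous_1 integrable_continuous_real sc)
  show "continuous_on {0..Z} (%Z. 2*C*arctan (sqrt Z))" by (intro continuous_intros)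
  fix t :: real assume t: "0 < t" "t < Z"
  show "(?F has_vector_derivative s t - s0 t - a * of_real (inverse (sqrt t)/2)) (at t)"
  proof (intro has_vector_derivative_diff)
   show "((%Z. integral {0..Z} s) has_vector_derivative s t) (at t)" "((%Z. integral {0..Z} s0) has_vector_derivative s0 t) (at t)"
    by (rule integral_interior_derivative[OF _ t], rule sc)+
   have "((%t. complex_of_real (sqrt t)) has_vector_derivative of_real (inverse (sqrt t)/2)) (at t)"
    using bounded_linear.has_vector_derivative[OF bounded_linear_of_real DERIV_real_sqrt[OF t(1), unfolded has_real_derivative_iff_has_vector_derivative]] .
   thus "((%Z. a * of_real (sqrt Z)) has_vector_derivative a * of_real (inverse (sqrt t)/2)) (at t)"
    by (rule has_vector_derivative_mult_right)
  qed
  show "((%Z. 2*C*arctan (sqrt Z)) has_real_derivative 2*C*(inverse (1 + (sqrt t)^2)*(inverse (sqrt t)/2))) (at t)"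
   using t by (intro DERIV_cmult DERIV_chain2[OF DERIV_arctan] DERIV_real_sqrt)
  define r where "r = sqrt t"
  have r: "0 < r" "r^2 = t" using t by (auto simp: r_def)
  define x where "x = X t"
  have x: "0 < x" "x*x = t^3 + m^3" using X[of t] t by (auto simp: x_def m3)
  have S: "s t^2 = of_real t^3 + a * of_real t + l" "s0 t^2 = of_real t^3 + l" by (simp_all add: s_def s0 pot_def)
  \<comment> \<open>h = t^(3/2). The error turns out proportional to 2 h - s - s0, and both s - h
    and s0 - h are controlled by rationalising.\<close>
  define h where "h = complex_of_real (r^3)"
  have h2: "h^2 = of_real t^3" unfolding h_def r(2)[symmetric] by (simp)
  have ge: "c*x <= norm (w+h)" if "c*x <= Re w" for w
  proof -
   have "Re (w+h) = Re w + r^3" by (simp add: h_def)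
   moreover have "0 <= r^3" using r by simp
   ultimately show ?thesis using that abs_Re_le_cmod[of "w + h"] by linarith
  qed
  have d: "norm (w-h) <= norm (w^2 - h^2)/(c*x)" if "c*x <= Re w" for w
  proof -
   have "norm (w-h)*(c*x) <= norm (w-h)*norm (w+h)" using ge[OF that] by (intro mult_left_mono) auto
   also have "... = norm (w^2 - h^2)" unfolding norm_mult[symmetric] by (simp add: algebra_simps power2_eq_square)
   finally show ?thesis using c x by (simp add: pos_le_divide_eq)
  qed
  have R: "c*x <= Re (s t)" "c*x <= Re (s0 t)" using Re[of t] t by (auto simp: x_def)
  have "norm (s t^2 - h^2) <= norm a*t + norm l"
   using norm_triangle_ineq[of "a * of_real t" l] t by (simp add: S h2 norm_mult)
  hence "norm (s t^2 - h^2)/(c*x) <= (norm a*t + norm l)/(c*x)" using c x by (intro divide_right_mono) auto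
  hence "norm (s t - h) <= (norm a*t + norm l)/(c*x)" using d[OF R(1)] by linarith
  moreover have "norm (s0 t - h) <= norm l/(c*x)" using d[OF R(2)] by (simp add: S h2)
  ultimately have dd: "norm (2*h - s t - s0 t) <= (norm a + 2)*(t + m^3)/(c*x)"
  proof -
   assume 1: "norm (s t - h) <= (norm a*t + norm l)/(c*x)" and 2: "norm (s0 t - h) <= norm l/(c*x)"
   have "norm (2*h - s t - s0 t) <= norm (s t - h) + norm (s0 t - h)"
    using norm_triangle_ineq[of "h - s t" "h - s0 t"] by (simp add: norm_minus_commute algebra_simps)
   also have "... <= (norm a*t + norm l)/(c*x) + norm l/(c*x)" using 1 2 by linarith
   also have "... = (norm a*t+2*norm l)/(c*x)" by (simp add: add_divide_distrib)
   also have "... <= (norm a + 2)*(t + m^3)/(c*x)"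
    using c x t unfolding m3 by (intro divide_right_mono) (auto simp: algebra_simps)
   finally show ?thesis .
  qed
  have ss: "2*(c*x) <= norm (s t + s0 t)" using R abs_Re_le_cmod[of "s t + s0 t"] by simp
  have "0 < 2*(c*x)" using c x by simp
  with ss have ne: "s t + s0 t ~= 0" by (metis norm_zero not_less order.strict_trans2)
  have ft: "(s t - s0 t)*(s t + s0 t) = a * of_real t" using S by (simp add: algebra_simps power2_eq_square)
  have "s t - s0 t - a * of_real (inverse r/2) = a*(2*h - s t - s0 t)/(2 * of_real r*(s t + s0 t))"
  proof -
   have e1: "s t - s0 t = a*(of_real r)^2/(s t + s0 t)" using ft ne r by (simp add: eq_divide_eq flip: of_real_power)
   have gen: "a*rh^2/Sg-a*(inverse rh/2) = a*(2*rh ^ 3 - Sg)/(2*rh*Sg)" if "Sg ~= 0" "rh ~= 0" for rh Sg :: complex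
    using that by (simp add: field_simps power2_eq_square power3_eq_cube)
   have e2: "s t - s0 t - a * of_real (inverse r/2) = a*(of_real r)^2/(s t + s0 t) - a*(inverse (of_real r)/2)" unfolding e1 by simp
   show ?thesis unfolding e2 using gen[OF ne, of "of_real r"] r by (simp add: h_def)
  qed
  hence "norm (s t - s0 t - a * of_real (inverse r/2)) = norm a*norm (2*h - s t - s0 t)/(2*r*norm (s t + s0 t))"
   using r by (simp add: norm_mult norm_divide)
  also have "... <= norm a*((norm a + 2)*(t + m^3)/(c*x))/(2*r*(2*(c*x)))" using dd ss r(1) c x(1) m1 t
   by (intro frac_le mult_mono mult_left_mono) (auto intro!: mult_nonneg_nonneg add_nonneg_nonneg)
  also have "... = norm a*(norm a + 2)/c^2*((t + m^3)/(4*(x*x)))/r" by (simp add: field_simps power2_eq_square)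
  also have "(t + m^3)/(4*(x*x)) <= m^2/(1+t)"
  proof -
   have "(t + m^3)*(1+t) <= m^2*(4*(x*x))"
    using cubic_kernel_le[OF m1 less_imp_le[OF t(1)]] unfolding x(2)[symmetric] by (simp only: mult_ac)
   hence "t + m^3 <= m^2*(4*(x*x))/(1+t)" using t by (subst pos_le_divide_eq) auto
   thus ?thesis using x(1) by (subst pos_divide_le_eq) auto
  qed
  hence "norm a*(norm a + 2)/c^2*((t + m^3)/(4*(x*x)))/r <= norm a*(norm a + 2)/c^2*(m^2/(1+t))/r"
   using r by (intro divide_right_mono mult_left_mono) auto
  also have "... = 2*C*(inverse (1 + r^2)*(inverse r/2))" by (simp add: C_def r(2) inverse_eq_divide)
  finally show "norm (s t - s0 t - a * of_real (inverse (sqrt t)/2)) <= 2*C*(inverse (1 + (sqrt t)^2)*(inverse (sqrt t)/2))"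
   by (simp add: r_def)
 qed (use Z in auto)
 hence "norm (?F Z) <= 2*C*arctan (sqrt Z)" by simp
 also have "... <= 2*C*(pi/2)" using C arctan_ubound[of "sqrt Z"] by (intro mult_left_mono) auto
 finally show ?thesis unfolding s_def[abs_def] s0 C_def m3 by (simp add: mult_ac)
qed

lemma ln_far_le: "EX C>=1. ALL l. 1 <= norm l --> ln (1 + far a l) <= C*norm l powr (2/3)"
proof -
 define A where "A = 4*norm a + 8*remainder_bound a + 32"
 define D where "D = 1 + 4*A^2"
 have A: "0 <= A" using remainder_bound_ge[of a] norm_ge_zero[of a] unfolding A_def by linarith
 have D: "1 <= D" by (simp add: D_def)
 show ?thesis
 proof (intro exI[of _ "ln D + 3"] conjI allI impI)
  show "1 <= ln D + 3" using ln_ge_zero[OF D] by linarith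
  fix l :: complex assume l: "1 <= norm l"
  define L where "L = norm l"
  have L: "1 <= L" using l by (simp add: L_def)
  define B where "B = 4*norm a + 8*remainder_bound a"
  have B: "0 <= B" "A = B + 32" using remainder_bound_ge[of a] by (auto simp: A_def B_def)
  have "B*1 <= B*L" using B L by (intro mult_left_mono) auto
  hence "B + 32*L <= A*L" by (simp add: B(2) algebra_simps)
  hence "(B+32*L)^2 <= (A*L)^2" using B L by (intro power_mono) auto
  moreover have "1 <= L^2" using L by (simp)
  ultimately have "1 + far a l <= D*L^2"
   by (simp add: far_def D_def power_mult_distrib distrib_right B_def[symmetric] L_def[symmetric])
  moreover have "0 < 1 + far a l" using far_ge[of a l] by linarith
  ultimately have "ln (1 + far a l) <= ln (D*L^2)" by (subst ln_le_cancel_iff) auto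
  also have "... = ln D + 2*ln L" using D L by (simp add: ln_mult ln_realpow)
  also have "... <= ln D*L powr (2/3) + 3*L powr (2/3)"
  proof (intro add_mono)
   have "1 <= L powr (2/3)" using L by (intro ge_one_powr_ge_zero) auto
   thus "ln D <= ln D*L powr (2/3)" using ln_ge_zero[OF D] by (simp add: mult_le_cancel_left1)
   have "ln (L powr (2/3)) <= L powr (2/3) - 1" using L by (intro ln_le_minus_one) auto
   thus "2*ln L <= 3*L powr (2/3)" by (simp)
  qed
  finally show "ln (1 + far a l) <= (ln D + 3)*norm l powr (2/3)" by (simp add: L_def distrib_right)
 qed
qed

lemma phase_of_real: "0 < Z ==> phase a (of_real Z) = of_real (2/5*Z^2 * sqrt Z) + a * of_real (sqrt Z) + of_real (3/4*ln Z)"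
proof -
 assume Z: "0 < Z"
 have "csqrt (of_real Z) = of_real (sqrt Z)" using Z by simp
 moreover have "(sqrt Z)^5 = Z^2 * sqrt Z"
 proof -
  have "x^5 = (x^2)^2*x" for x :: real by (simp add: eval_nat_numeral)
  from this[of "sqrt Z"] show ?thesis using Z by simp
 qed
 moreover have "Ln (of_real Z) = of_real (ln Z)" using Z by (rule Ln_of_real)
 ultimately show ?thesis by (simp add: phase_def flip: of_real_power)
qed

text \<open>The comparison runs from Z = \<open>far a l\<close> down to 0. The growing parts of
  \<open>phase\<close> at Z cancel against those of the integral of the root, so
  \<open>reg_action\<close> remains with an error O(|l|^(2/3)). The bound on \<open>dsib\<close> is
  the barrier read off at t = 0.\<close>

theorem sib_asymptotics:
 fixes a :: complex and k :: real
 assumes k: "0 <= k" "k < 1" shows "EX C>=1. ALL l. C <= norm l --> - k*norm l <= Re l --> sib a l ~= 0 &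
  abs (ln (norm (sib a l)) - action_const*Re (l powr (5/6))) <= C*norm l powr (2/3) &
  norm (dsib a l) <= C * sqrt (norm l)*norm (sib a l)"
proof -
 obtain L where L: "L >= 1" "!!l t. L <= norm l ==> - k*norm l <= Re l ==> 0 <= t ==>
  (1 - k)/4 * sqrt (t^3 + norm l) <= Re (csqrt (pot a l (of_real t))) &
  (1 - k)/4 * sqrt (t^3 + norm l) <= Re (csqrt (of_real t^3 + l))" using sector_csqrt[OF k] by blast
 obtain C1 where C1: "C1 >= 1" "!!l. 1 <= norm l ==> ln (1 + far a l) <= C1*norm l powr (2/3)"
  using ln_far_le by blast
 define c where "c = (1-k)/4"
 have c: "0 < c" using k by (simp add: c_def)
 define M where "M = 7 + 2*(3 + norm a)/c^2"
 have M: "7 <= M" by (simp add: M_def)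
 define P where "P = pi*(norm a*(norm a + 2)/c^2)"
 have P: "0 <= P" by (simp add: P_def)
 define C where "C = L + (M/c)^2 + 1 + (P + 3 + C1 + M*C1) + (1+M)"
 have C: "L <= C" "(M/c)^2 < C" "P + 3 + C1 + M*C1 <= C" "1 + M <= C" "1 <= C"
 proof -
  have "0 <= M*C1" "0 <= (M/c)^2" using M C1 by auto
  thus "L <= C" "(M/c)^2 < C" "P + 3 + C1 + M*C1 <= C" "1 + M <= C" "1 <= C"
   using L C1 M P unfolding C_def by linarith+
 qed
 show ?thesis
 proof (rule exI[of _ C], intro conjI allI impI)
  fix l assume l: "C <= norm l" "- k*norm l <= Re l"
  have l1: "1 <= norm l" using l C by linarith
  \<comment> \<open>Far enough for 2 |l|/sqrt Z <= 1, near enough for ln Z = O(|l|^(2/3)).\<close>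
  define Z where "Z = far a l"
  have Z: "1024 <= Z" using far_ge by (simp add: Z_def)
  have bb: "c * sqrt (t^3 + norm l) <= Re (csqrt (pot a l (of_real t)))"
   "c * sqrt (t^3 + norm l) <= Re (csqrt (of_real t^3 + l))" if "0 <= t" for t
   using L(2)[of l t] l C that by (auto simp: c_def simp del: csqrt.sel)
  have Mc: "M < c * sqrt (norm l)"
  proof -
   have "sqrt ((M/c)^2) < sqrt (norm l)" using C l by (intro real_sqrt_less_mono) linarith
   thus ?thesis using c by (simp add: divide_less_eq mult.commute)
  qed
  have M': "7 + 2*(3 + norm a)/c^2 <= M" by (simp add: M_def)
  note ric = sibuya_riccati[OF c M' l1 Mc order_refl, of Z]
  have r1: "norm (sibuya_dsol a l 0 + csqrt l * sibuya_sol a l 0) < M/(1+0)*norm (sibuya_sol a l 0)"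
   using ric(1)[of 0] Z bb by (simp add: Z_def pot_def del: csqrt.sel)
  hence n0: "sib a l ~= 0" and r1': "norm (dsib a l + csqrt l * sib a l) <= M*norm (sib a l)" by auto
  let ?S = "%t. integral {0..t} (%t. csqrt (pot a l (of_real t)))"
  have sc: "continuous_on {0..Z} (%t. csqrt (pot a l (of_real t)))"
  proof (rule continuous_csqrt_pot)
   fix t assume t: "t : {0..Z}"
   hence "0 < t^3 + norm l" using l1 by (intro add_nonneg_pos) auto
   hence "0 < c * sqrt (t^3 + norm l)" using c by simp
   thus "0 < Re (csqrt (pot a l (of_real t)))" using bb(1)[of t] t by (auto simp del: csqrt.sel)
  qed
  have r2: "abs (ln (norm (sib a l)) + Re (phase a (of_real Z)) - Re (?S Z)) <= M*ln (1+Z) + 1"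
  proof -
   have "abs (ln (norm (sibuya_sol a l (of_real 0))) + Re (phase a (of_real Z)) - Re (?S Z - ?S 0)) <= M*ln (1+Z) + 1"
   proof (rule ric(2))
    show "continuous_on {0..Z} ?S" by (intro indefinite_integral_continuous_1 integrable_continuous_real sc)
    show "(?S has_vector_derivative csqrt (pot a l (of_real t))) (at t)" if "0 < t" "t < Z" for t
     by (rule integral_interior_derivative[OF sc that])
   qed (use Z bb in \<open>auto simp: Z_def simp del: csqrt.sel\<close>)
   thus ?thesis by simp
  qed
  have ln: "l ~: nonpos_Reals"
  proof
   assume "l : nonpos_Reals"
   hence "csqrt l = csqrt (of_real 0^3 + l)" "Re (csqrt l) = 0" by (auto elim!: nonpos_Reals_cases)
   thus False using bb(2)[of 0] c l1 by (simp del: csqrt.sel add: mult_le_0_iff)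
  qed
  have p1: "norm (?S Z - integral {0..Z} (%t. csqrt (of_real t^3 + l)) - a * of_real (sqrt Z)) <= P*norm l powr (2/3)"
   unfolding P_def by (rule action_perturbation[OF c l1 _ bb]) (use Z in auto)
  have p2: "norm (reg_action l - action Z l) <= 1"
  proof -
   have "2*norm l <= sqrt Z"
   proof (rule real_le_rsqrt)
    have "(2*norm l)^2 = 4*(norm l)^2" by (simp)
    also have "... <= 4*(4*norm a + 8*remainder_bound a + 32*norm l)^2"
     using remainder_bound_ge[of a] norm_ge_zero[of a] norm_ge_zero[of l] by (intro mult_left_mono power_mono) linarith+
    finally show "(2*norm l)^2 <= Z" by (simp add: Z_def far_def)
   qed
   hence "2*norm l/sqrt Z <= 1" using Z by (simp)
   thus ?thesis using action_approx[OF ln, of Z] Z by linarith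
  qed
  define x where "x = norm l powr (2/3)"
  have x1: "1 <= x" unfolding x_def using l1 by (intro ge_one_powr_ge_zero) auto
  have lnZ: "ln Z <= C1*x" "0 <= ln Z" "ln (1+Z) <= C1*x"
  proof -
   show 1: "ln (1+Z) <= C1*x" using C1(2)[OF l1] by (simp add: Z_def x_def)
   have "ln Z <= ln (1+Z)" using Z by (subst ln_le_cancel_iff) auto
   thus "ln Z <= C1*x" using 1 by linarith
   show "0 <= ln Z" using Z by (intro ln_ge_zero) auto
  qed
  have "reg_action l = of_real action_const*l powr (5/6)" by (rule reg_action_eq[OF ln])
  hence ra: "Re (reg_action l) = action_const*Re (l powr (5/6))" by simp
  have ph: "Re (phase a (of_real Z)) = 2/5*Z^2 * sqrt Z + Re (a * of_real (sqrt Z)) + 3/4*ln Z"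
   using Z by (subst phase_of_real) auto
  have q1: "abs (Re (?S Z) - Re (integral {0..Z} (%t. csqrt (of_real t^3 + l))) - Re (a * of_real (sqrt Z))) <= P*x"
   using order_trans[OF abs_Re_le_cmod p1] by (simp add: x_def)
  have q2: "abs (Re (reg_action l) - (Re (integral {0..Z} (%t. csqrt (of_real t^3 + l))) - 2/5*Z^2 * sqrt Z)) <= 1"
   using order_trans[OF abs_Re_le_cmod p2] by (simp add: action_def)
  have q3: "M*ln (1+Z) <= M*(C1*x)" using lnZ M by (intro mult_left_mono) auto
  have "abs (ln (norm (sib a l)) - Re (reg_action l)) <= P*x + 1 + (M*(C1*x) + 1) + 3/4*(C1*x)"
   using q1 q2 q3 r2 lnZ unfolding ph by linarith
  also have "... <= (P + 3 + C1 + M*C1)*x"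
  proof -
   have "0 <= C1*x" using C1 x1 by simp
   thus ?thesis using x1 by (simp add: algebra_simps)
  qed
  also have "... <= C*x" using C x1 by (intro mult_right_mono) auto
  finally show "abs (ln (norm (sib a l)) - action_const*Re (l powr (5/6))) <= C*norm l powr (2/3)"
   by (simp add: ra x_def)
  show "sib a l ~= 0" by (rule n0)
  have "norm (dsib a l) <= norm (dsib a l + csqrt l * sib a l) + norm (csqrt l)*norm (sib a l)"
   using norm_triangle_ineq4[of "dsib a l + csqrt l * sib a l" "csqrt l * sib a l"] by (simp add: norm_mult)
  also have "... <= M*norm (sib a l) + sqrt (norm l)*norm (sib a l)" using r1' by simp
  also have "... <= M * sqrt (norm l)*norm (sib a l) + sqrt (norm l)*norm (sib a l)"
  proof -
   have "M*1 <= M * sqrt (norm l)" using l1 M by (intro mult_left_mono) auto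
   thus ?thesis by (intro add_right_mono mult_right_mono) auto
  qed
  also have "... = (1+M)*(sqrt (norm l)*norm (sib a l))" by (simp add: algebra_simps)
  also have "... <= C*(sqrt (norm l)*norm (sib a l))" using C by (intro mult_right_mono) auto
  finally show "norm (dsib a l) <= C * sqrt (norm l)*norm (sib a l)" by (simp)
 qed (rule C(5))
qed

lemma has_vector_derivative_complex_of_real:
 "(f has_real_derivative f') (at t) ==> ((%t. complex_of_real (f t)) has_vector_derivative of_real f') (at t)"
 using bounded_linear.has_vector_derivative[OF bounded_linear_of_real]
 by (simp add: has_real_derivative_iff_has_vector_derivative)

section \<open>A crude growth bound in all directions of l\<close>

text \<open>With the weight La^2 on |y|^2 the energy changes only through Q + La^2. It is used
  without cancellation for the crude growth bound, and with Q close to - La^2 for eigenfunctions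
  near the origin, where k then does not depend on the eigenvalue.\<close>

lemma energy_gronwall:
 fixes y dy Q :: "real => complex" and p q k La :: real
 assumes "p <= q" "0 < La" and y: "!!t. t : {p..q} ==> (y has_vector_derivative dy t) (at t)"
  and dy: "!!t. t : {p..q} ==> (dy has_vector_derivative Q t*y t) (at t)"
  and Q: "!!t. t : {p..q} ==> norm (Q t + of_real (La^2)) <= k*La"
 defines "e == %t. (norm (dy t))^2 + La^2*(norm (y t))^2"
 shows "e p <= e q*exp (k*(q-p))" "e q <= e p*exp (k*(q-p))"
proof -
 define e' where "e' t = 2*(dy t \<bullet> (Q t*y t)) + La^2*(2*(y t \<bullet> dy t))" for t
 have inner': "((%t. (norm (f t))^2) has_real_derivative 2*(f t \<bullet> f' t)) (at t)"
  if "(f has_vector_derivative f' t) (at t)" for f f' :: "real => complex" and t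
  using bounded_bilinear.has_vector_derivative[OF bounded_bilinear_inner that that]
  by (simp add: has_real_derivative_iff_has_vector_derivative inner_commute dot_square_norm)
 have e': "(e has_real_derivative e' t) (at t)" if "t : {p..q}" for t
  unfolding e_def e'_def by (intro DERIV_add DERIV_cmult inner' y dy that)
 have b: "abs (e' t) <= k*e t" if t: "t : {p..q}" for t
 proof -
  have "e' t = 2*(dy t \<bullet> ((Q t + of_real (La^2))*y t))"
   by (simp add: e'_def distrib_right inner_add_right inner_commute scaleR_conv_of_real[symmetric] del: of_real_power)
  also have "abs ... <= 2*(norm (dy t)*(norm (Q t + of_real (La^2))*norm (y t)))"
   using Cauchy_Schwarz_ineq2[of "dy t" "(Q t + of_real (La^2))*y t"] by (simp add: norm_mult del: of_real_power)
  also have "... <= 2*(norm (dy t)*(k*La*norm (y t)))" using Q[OF t] by (intro mult_left_mono mult_right_mono) auto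
  also have "... = k*(2*norm (dy t)*(La*norm (y t)))" by simp
  also have "... <= k*e t"
  proof (rule mult_left_mono)
   have "0 <= k*La" using Q[OF t] norm_ge_zero order_trans by blast
   thus "0 <= k" using assms(2) by (simp add: zero_le_mult_iff)
   show "2*norm (dy t)*(La*norm (y t)) <= e t"
    using sum_squares_bound[of "norm (dy t)" "La*norm (y t)"] by (simp add: e_def power_mult_distrib)
  qed
  finally show ?thesis .
 qed
 have mono: "s*(e p*exp (s*k*p)) <= s*(e q*exp (s*k*q))" if s: "s = 1 | s = - 1" for s :: real
 proof (rule DERIV_nonneg_imp_nondecreasing[OF assms(1), where f = "%t. s*(e t*exp (s*k*t))"])
  fix t assume t: "p <= t" "t <= q"
  have "((%t. s*(e t*exp (s*k*t))) has_real_derivative (s*e' t + s^2*k*e t)*exp (s*k*t)) (at t)"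
   using t by (auto intro!: derivative_eq_intros e' simp: algebra_simps power2_eq_square)
  moreover have "0 <= (s*e' t + s^2*k*e t)*exp (s*k*t)" using b[of t] t s by (intro mult_nonneg_nonneg) auto
  ultimately show "EX y. ((%t. s*(e t*exp (s*k*t))) has_real_derivative y) (at t) & 0 <= y" by blast
 qed
 from mult_right_mono[OF mono[of 1], of "exp (- (k*p))"] show "e p <= e q*exp (k*(q-p))"
  by (simp add: exp_add[symmetric] algebra_simps)
 from mult_right_mono[OF mono[of "- 1"], of "exp (k*q)"] show "e q <= e p*exp (k*(q-p))"
  by (simp add: exp_add[symmetric] algebra_simps)
qed

lemma lsol_ray_deriv:
 "((%t. lsol A B a l (w * of_real t)) has_vector_derivative w*ldsol A B a l (w * of_real t)) (at t)"
 "((%t. w*ldsol A B a l (w * of_real t)) has_vector_derivative (w^2)*pot a l (w * of_real t)*lsol A B a l (w * of_real t)) (at t)"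
proof -
 have w: "((%t. w * of_real t) has_vector_derivative w) (at t)" by (auto intro!: derivative_eq_intros)
 show "((%t. lsol A B a l (w * of_real t)) has_vector_derivative w*ldsol A B a l (w * of_real t)) (at t)"
  using field_vector_diff_chain_at[OF w lsol_deriv] by (simp add: o_def)
 have "((%t. ldsol A B a l (w * of_real t)) has_vector_derivative w*(pot a l (w * of_real t)*lsol A B a l (w * of_real t))) (at t)"
  using field_vector_diff_chain_at[OF w ldsol_deriv] by (simp add: o_def)
 from has_vector_derivative_mult_right[OF this, of w]
 show "((%t. w*ldsol A B a l (w * of_real t)) has_vector_derivative (w^2)*pot a l (w * of_real t)*lsol A B a l (w * of_real t)) (at t)"
  by (simp add: power2_eq_square mult.assoc)
qed

lemma phase_of_real_norm_le:
 assumes "1 <= t" shows "abs (Re (phase a (of_real (t^2)))) <= t^5 + norm a*t+2*t"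
proof -
  have "phase a (of_real (t^2)) = of_real (2/5*t^5) + a * of_real t + of_real (3/4*(2*ln t))"
  using assms by (simp add: phase_def Ln_of_real ln_realpow flip: of_real_power)
 moreover have "abs (Re (a * of_real t)) <= norm a*t"
  using abs_Re_le_cmod[of "a * of_real t"] assms by (simp add: norm_mult)
 moreover have "0 <= ln t" "ln t <= t - 1" using assms ln_le_minus_one[of t] by auto
 moreover have "0 <= t^5" using assms by simp
 ultimately show ?thesis by (simp only: plus_complex.sel Re_complex_of_real)
qed

text \<open>Far out on the positive axis the asymptotics of the decaying solution are explicit; the energy
 estimate transports the bound back to the origin.\<close>
lemma sib_crude_growth: "EX C>=1. ALL l. norm (sib a l) <= exp (C*(1 + norm l)^5)"
proof -
 define B where "B = 4*norm a + 8*remainder_bound a + 32"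
 have B: "48 <= B" "4*norm a + 48 <= B" using remainder_bound_ge[of a] norm_ge_zero[of a] unfolding B_def by linarith+
 show ?thesis
 proof (intro exI[of _ "512*B^5"] conjI allI)
  have "1 <= B^5" using B by (intro one_le_power) simp
  thus "1 <= 512*B^5" by simp
  fix l :: complex
  \<comment> \<open>The point t^2 lies beyond \<open>far a l\<close> although t is only linear in
    |l|. All exponents below are multiples of t^5, the size of \<open>phase\<close> at t^2.\<close>
  define t where "t = 2*B*(1 + norm l)"
  define Z where "Z = t^2"
  have "0 <= norm l*(B-32)" using B by simp
  hence "B - 32 + 32*norm l <= B*(1 + norm l)" by (simp add: algebra_simps)
  hence tl: "2*(B - 32 + 32*norm l) <= t" by (simp add: t_def)
    have t: "32 <= t" using tl B norm_ge_zero[of l] by argo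
  have t2: "norm a <= t" "norm l <= t" using tl B norm_ge_zero[of l] norm_ge_zero[of a] by argo+
  have "(2*(B - 32 + 32*norm l))^2 <= t^2" using tl B by (intro power_mono) auto
  hence far: "far a l <= Z" by (simp add: far_def Z_def B_def power2_eq_square algebra_simps)
  define y dy s where "y u = sibuya_sol a l (of_real u)" and "dy u = sibuya_dsol a l (of_real u)" and "s = csqrt (pot a l (of_real Z))" for u
  note st = sibuya_start[OF far, folded y_def dy_def s_def]
  have tp: "1 <= t^k" for k using t by (intro one_le_power) simp
  have tm: "t^j <= t^k" if "j <= k" for j k using t that by (intro power_increasing) auto
  \<comment> \<open>La^2 = 4 t^6 dominates the potential on [0, Z], so k = 2 La is admissible in the
    energy estimate, and La Z = 2 t^5.\<close>
  define La where "La = 2*t^3"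
  have La: "2 <= La" "La^2 = 4*t^6" using tp[of 3] by (simp_all add: La_def power_mult_distrib)
  have Q: "norm (pot a l (of_real u)) <= La^2" if u: "0 <= u" "u <= Z" for u
  proof -
   have "norm (pot a l (of_real u)) <= u^3 + norm a*u + norm l"
    using norm_triangle_ineq[of "of_real u^3 + a * of_real u" l] norm_triangle_ineq[of "of_real u^3" "a * of_real u"] u
    by (simp add: pot_def norm_mult norm_power)
   also have "... <= Z^3 + t*Z + t" using t2 u t by (intro add_mono mult_mono) auto
   also have "... = t^6 + t^3 + t" by (simp add: Z_def flip: power_Suc)
   also have "... <= La^2" using tm[of 3 6] tm[of 1 6] tp[of 6] La(2) by simp
   finally show ?thesis .
  qed
  have "(norm (dy 0))^2 + La^2*(norm (y 0))^2 <= ((norm (dy Z))^2 + La^2*(norm (y Z))^2)*exp (2*La*(Z-0))"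
  proof (rule energy_gronwall(1)[where Q = "%u. pot a l (of_real u)"])
   show "(y has_vector_derivative dy u) (at u)" "(dy has_vector_derivative pot a l (of_real u)*y u) (at u)" for u
    using lsol_ray_deriv[where A = "sib a l" and B = "dsib a l" and a = a and l = l and w = 1 and t = u] by (simp_all add: y_def[abs_def] dy_def[abs_def])
   show "norm (pot a l (of_real u) + of_real (La^2)) <= 2*La*La" if "u : {0..Z}" for u
    using norm_triangle_ineq[of "pot a l (of_real u)" "of_real (La^2)"] Q[of u] that by (simp add: norm_mult power2_eq_square)
  qed (use La in \<open>auto simp: Z_def\<close>)
    moreover have "((norm (dy Z))^2 + La^2*(norm (y Z))^2)*exp (2*La*Z) <= La^2*(17*(norm (y Z))^2*exp (2*La*Z))"
  proof -
   have "(norm s)^2 = norm (pot a l (of_real Z))" by (simp add: s_def)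
   also have "... <= La^2" by (rule Q) (simp_all add: Z_def)
   finally have "norm s <= La" by (rule power2_le_imp_le) (use La in simp)
   moreover have "6/(1+Z) <= 6/2" using tp[of 2] by (simp add: Z_def field_simps)
   hence "6/(1+Z)*norm (y Z) <= 3*norm (y Z)" by (intro mult_right_mono) auto
   moreover have "norm (dy Z) <= norm (dy Z + s*y Z) + norm s*norm (y Z)"
   using norm_triangle_ineq4[of "dy Z + s*y Z" "s*y Z"] by (simp add: norm_mult)
   ultimately have "norm (dy Z) <= 3*norm (y Z) + La*norm (y Z)" using st(1) mult_right_mono[of "norm s" La "norm (y Z)"] by simp
   also have "... <= 4*La*norm (y Z)" using La mult_right_mono[of 1 La "norm (y Z)"] by simp
   finally have "(norm (dy Z))^2 <= (4*La*norm (y Z))^2" by (intro power_mono) auto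
   hence "(norm (dy Z))^2 + La^2*(norm (y Z))^2 <= La^2*(17*(norm (y Z))^2)" by (simp add: power_mult_distrib)
   from mult_right_mono[OF this exp_ge_zero, of "2*La*Z"] show ?thesis by (simp only: mult.assoc)
  qed
  ultimately have "La^2*(norm (y 0))^2 <= La^2*(17*(norm (y Z))^2*exp (2*La*Z))"
   using zero_le_power2[of "norm (dy 0)"] unfolding diff_zero by linarith
  hence "(norm (y 0))^2 <= 17*(norm (y Z))^2*exp (2*La*Z)" by (rule mult_left_le_imp_le) (use La(1) in auto)
  also have "... <= (5*norm (y Z)*exp (La*Z))^2" by (simp add: power_mult_distrib exp_double[symmetric] mult.assoc)
  finally have n0: "norm (y 0) <= 5*norm (y Z)*exp (La*Z)" by (rule power2_le_imp_le) simp
  have nZ: "norm (y Z) <= exp (6*t^5)"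
  proof -
   have "norm a*t+2*t <= t^2 + t^2" unfolding power2_eq_square using t t2 by (intro add_mono) auto
      moreover have "t^2 <= t^5" by (rule tm) simp
   moreover have "abs (Re (phase a (of_real (t^2)))) <= t^5 + norm a*t+2*t"
    by (rule phase_of_real_norm_le) (use t in simp)
   ultimately have "ln (norm (y Z)) <= 6*t^5" using st(2) tp[of 5] ln_2_less_1 unfolding Z_def by linarith
   thus ?thesis using st(3) by (metis exp_le_cancel_iff exp_ln zero_less_norm_iff)
  qed
  have LZ: "La*Z = 2*t^5" by (simp add: La_def Z_def)
  have five: "5 <= exp (8*t^5)" using exp_ge_add_one_self[of "8*t^5"] tp[of 5] by linarith
  have "norm (y 0) <= exp (8*t^5)*exp (6*t^5)*exp (2*t^5)"
   unfolding LZ[symmetric] by (rule order_trans[OF n0]) (intro mult_mono nZ five; simp)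
  also have "... = exp (512*B^5*(1 + norm l)^5)" by (simp add: t_def power_mult_distrib flip: exp_add)
  finally show "norm (sib a l) <= exp (512*B^5*(1 + norm l)^5)" by (simp add: y_def)
 qed
qed

section \<open>Decay along rays and Green's formula\<close>

lemma csqrt_ray:
 assumes "0 < t" "abs th < pi" shows "csqrt (cis th * of_real t) = of_real (sqrt t)*cis (th/2)"
proof -
 have "0 < cos (th/2)" using assms by (intro cos_gt_zero_pi) auto
 hence "csqrt ((of_real (sqrt t)*cis (th/2))^2) = of_real (sqrt t)*cis (th/2)"
  using assms by (intro csqrt_square) auto
 moreover have "(of_real (sqrt t)*cis (th/2))^2 = cis th * of_real t"
  using assms by (simp add: power_mult_distrib Complex.DeMoivre flip: of_real_power)
 ultimately show ?thesis by simp
qed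

lemma abs_sin_less_cos:
 assumes "abs th <= pi/5" shows "abs (sin th) < cos th" "0 < cos th"
proof -
 have "sin (abs th) < sin (pi/4)" using assms pi_gt_zero by (intro sin_monotone_2pi) linarith+
 moreover have "cos (pi/4) < cos (abs th)" using assms pi_gt_zero by (intro cos_monotone_0_pi) linarith+
 moreover have "abs (sin th) = sin (abs th)"
 proof -
  have "0 <= sin (abs th)" using assms by (intro sin_ge_zero) auto
  thus ?thesis by (cases "th >= 0") auto
 qed
 ultimately show "abs (sin th) < cos th" by (simp add: sin_45 cos_45)
 thus "0 < cos th" by linarith
qed

lemma ray_in_wedge:
 assumes "abs th <= pi/5" shows "\<forall>\<^sub>F t in at_top. cis th * of_real t : wedge R"
proof -
 define d where "d = cos th - abs (sin th)"
 have d: "0 < d" using abs_sin_less_cos[OF assms] by (simp add: d_def)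
 have "\<forall>\<^sub>F t in at_top. max 0 (R/d) < t" by (rule eventually_gt_at_top)
 thus ?thesis
 proof eventually_elim
  case (elim t)
  hence "R < t*d" "0 < t" using d by (auto simp: pos_divide_less_eq)
  thus ?case by (simp add: wedge_def d_def abs_mult algebra_simps)
 qed
qed

text \<open>Includes the boundary rays of angle pi/5 and - pi/5, which
  \<open>stokes_wronskian\<close> uses.\<close>

lemma decaying_ray_bounds:
 assumes th: "abs th <= pi/5" and e: "0 < e"
 defines "z == %t. cis th * of_real t"
 shows "\<forall>\<^sub>F t in at_top. norm (exp (phase a (z t)) * sibuya_sol a l (z t) - 1) <= e &
  norm (exp (phase a (z t))*(sibuya_dsol a l (z t) + dphase a (z t) * sibuya_sol a l (z t))) <= e"
proof -
 define R where "R = (4*norm a + 8*remainder_bound a + 32*norm l)^2"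
 define C where "C = 8*remainder_bound a + 32*norm l"
 have w: "wide a (norm l) R" unfolding R_def by (rule wide_square) auto
 note d = sib_decays[OF w, folded C_def, unfolded decays_within_def, rule_format]
 define c where "c = cos th"
 have c: "0 < c" using abs_sin_less_cos[OF th] by (simp add: c_def)
 have "tendsto (%t. C/sqrt (t*c)) 0 at_top" using c by real_asymp
 hence 1: "\<forall>\<^sub>F t in at_top. C/sqrt (t*c) < e" using e by (rule order_tendstoD)
 have "tendsto (%t. C/(t*c * sqrt (t*c))) 0 at_top" using c by real_asymp
 hence 2: "\<forall>\<^sub>F t in at_top. C/(t*c * sqrt (t*c)) < e" using e by (rule order_tendstoD)
 show ?thesis using 1 2 ray_in_wedge[OF th, of R]
 proof eventually_elim
  case (elim t)
  have r: "Re (z t) = t*c" by (simp add: z_def c_def)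
  show ?case using d[of "z t"] elim unfolding r by (auto simp: z_def)
 qed
qed

text \<open>Along the ray the logarithmic derivative is - cis th times dphase, hence about - t^(3/2)
  cis (5 th/2), and |5 th/2| < pi/2 makes its real part tend to minus infinity.\<close>

lemma sibuya_ray:
 assumes th: "abs th < pi/5" shows "EX X C. 1 <= X & (ALL t>=X. sibuya_sol a l (cis th * of_real t) ~= 0 &
  Re (cis th * sibuya_dsol a l (cis th * of_real t)/sibuya_sol a l (cis th * of_real t)) <= - 2 &
  norm (cis th * sibuya_dsol a l (cis th * of_real t)/sibuya_sol a l (cis th * of_real t)) <= C*t^2)"
proof -
 define c where "c = cos (5*th/2)"
 have c: "0 < c" unfolding c_def using th by (intro cos_gt_zero_pi) auto
 have th': "abs th <= pi/5" "abs th < pi" using th pi_gt_zero by linarith+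
 have "filterlim (%t::real. t * sqrt t*c) at_top at_top" using c by real_asymp
 hence E: "\<forall>\<^sub>F t in at_top. norm a + 5 <= t * sqrt t*c" by (auto simp: filterlim_at_top)
 have half: "0 < (1/2 :: real)" by simp
 have "\<forall>\<^sub>F t in at_top. sibuya_sol a l (cis th * of_real t) ~= 0 &
  Re (cis th * sibuya_dsol a l (cis th * of_real t)/sibuya_sol a l (cis th * of_real t)) <= - 2 &
  norm (cis th * sibuya_dsol a l (cis th * of_real t)/sibuya_sol a l (cis th * of_real t)) <= (norm a + 4)*t^2"
  using E decaying_ray_bounds[OF th'(1) half, of a l] eventually_ge_at_top[of 1]
 proof eventually_elim
  case (elim t)
  define w z where "w = cis th" and "z = w * of_real t"
  define y dy e where "y = sibuya_sol a l z" and "dy = sibuya_dsol a l z" and "e = exp (phase a z)"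
  define v u where "v = e*y" and "u = e*(dy + dphase a z*y)"
  have nw: "norm w = 1" by (simp add: w_def)
  have v: "norm (v-1) <= 1/2" and u: "norm u <= 1/2" using elim by (auto simp: v_def u_def y_def dy_def e_def z_def w_def)
  have v2: "1/2 <= norm v" using v norm_triangle_ineq2[of 1 v] by (simp add: norm_minus_commute)
  hence y0: "y ~= 0" by (auto simp: v_def)
  have e0: "e ~= 0" by (simp add: e_def)
  have q: "w*dy/y = w*(u/v) - w*dphase a z" using y0 e0 by (simp add: u_def v_def field_simps)
  have uv: "norm (w*(u/v)) <= 1"
  proof -
   have "norm u/norm v <= (1/2)/(1/2)" using u v2 by (intro frac_le) auto
   thus ?thesis by (simp add: norm_mult norm_divide nw)
  qed
  define s where "s = csqrt z"
  have s: "s = of_real (sqrt t)*cis (th/2)" unfolding s_def z_def w_def using elim th' by (intro csqrt_ray) auto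
  have ns: "1 <= norm s" using elim by (simp add: s norm_mult)
  have ws: "w * s^3 = of_real (t * sqrt t)*cis (5*th/2)"
  proof -
   have "s^3 = of_real (sqrt t^3)*cis (3*(th/2))" by (simp add: s power_mult_distrib Complex.DeMoivre)
   moreover have "sqrt t^3 = t * sqrt t" using elim by (simp add: power3_eq_cube)
   moreover have "w*cis (3*(th/2)) = cis (5*th/2)" unfolding w_def cis_mult by (rule arg_cong[where f = cis]) simp
   ultimately show ?thesis by (simp)
  qed
  define E where "E = w*(a/(2 * s)) + w*(3/(4*z))"
  have E: "norm E <= norm a + 1"
  proof -
   have "norm (a/(2 * s)) <= norm a/1" unfolding norm_divide norm_mult using ns by (intro divide_left_mono) auto
   moreover have "norm (3/(4*z)) <= 1" using elim by (simp add: z_def norm_divide norm_mult nw)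
   moreover have "norm E <= norm (a/(2 * s)) + norm (3/(4*z))" unfolding E_def
    by (rule order_trans[OF norm_triangle_ineq]) (simp only: norm_mult nw mult_1 order_refl)
   ultimately show ?thesis by simp
  qed
  have p: "w*dphase a z = of_real (t * sqrt t)*cis (5*th/2) + E"
   unfolding ws[symmetric] by (simp add: dphase_def s_def[symmetric] E_def algebra_simps)
  have "Re (w*dy/y) <= 1 - t * sqrt t*c + (norm a + 1)"
  proof -
   have "Re (w*dy/y) = Re (w*(u/v)) - t * sqrt t*c - Re E" unfolding q p by (simp add: c_def)
   thus ?thesis using uv E abs_Re_le_cmod[of "w*(u/v)"] abs_Re_le_cmod[of E] by linarith
  qed
  hence R: "Re (w*dy/y) <= - 2" using elim by linarith
  have "norm (w*dy/y) <= norm (w*(u/v)) + norm (w*dphase a z)" unfolding q by (rule norm_triangle_ineq4)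
  also have "norm (w*dphase a z) <= t * sqrt t + (norm a + 1)"
   unfolding p using norm_triangle_ineq[of "of_real (t * sqrt t)*cis (5*th/2)" E] E elim by (simp add: norm_mult)
  finally have "norm (w*dy/y) <= 1 + (t * sqrt t + (norm a + 1))" using uv by linarith
  also have "... <= (norm a + 4)*t^2"
  proof -
   have "sqrt t <= sqrt (t*t)" using elim by (intro real_sqrt_le_mono) simp
   hence "sqrt t <= t" using elim by simp
   hence "t * sqrt t <= t*t" using elim by (intro mult_left_mono) auto
   moreover have "1 <= t*t" using mult_mono[of 1 t 1 t] elim by simp
   moreover have "norm a*1 <= norm a*(t*t)" using \<open>1 <= t*t\<close> by (intro mult_left_mono) auto
   ultimately show ?thesis by (simp add: power2_eq_square distrib_right)
  qed
  finally show ?case using R y0 by (simp add: y_def dy_def z_def w_def)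
 qed
 then obtain X where "!!t. t >= X ==> sibuya_sol a l (cis th * of_real t) ~= 0 &
  Re (cis th * sibuya_dsol a l (cis th * of_real t)/sibuya_sol a l (cis th * of_real t)) <= - 2 &
  norm (cis th * sibuya_dsol a l (cis th * of_real t)/sibuya_sol a l (cis th * of_real t)) <= (norm a + 4)*t^2"
  by (auto simp: eventually_at_top_linorder)
 thus ?thesis by (intro exI[of _ "max 1 X"] exI[of _ "norm a + 4"]) auto
qed

text \<open>|psi|^2 exp (4 t) is nonincreasing, because |psi|^2 has logarithmic derivative 2 Re
  (psi'/psi).\<close>

lemma decreasing_ratio:
 fixes psi psi' :: "real => complex"
 assumes d: "!!t. X <= t ==> (psi has_vector_derivative psi' t) (at t)" and nz: "!!t. X <= t ==> psi t ~= 0"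
  and r: "!!t. X <= t ==> Re (psi' t/psi t) <= - 2" and st: "X <= s" "s <= t"
 shows "norm (psi t) <= exp (- 2*(t-s))*norm (psi s)"
proof -
 define g where "g t = (psi t \<bullet> psi t)*exp (4*t)" for t
 have "g t <= g s"
 proof (rule DERIV_nonpos_imp_nonincreasing[OF st(2)])
  fix x assume x: "s <= x" "x <= t"
  hence xX: "X <= x" using st by simp
  have "((%t. psi t \<bullet> psi t) has_real_derivative 2*(psi x \<bullet> psi' x)) (at x)"
   using bounded_bilinear.has_vector_derivative[OF bounded_bilinear_inner d[OF xX] d[OF xX]]
   by (simp add: has_real_derivative_iff_has_vector_derivative inner_commute)
  hence "(g has_real_derivative (2*(psi x \<bullet> psi' x) + 4*(psi x \<bullet> psi x))*exp (4*x)) (at x)"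
   unfolding g_def by (auto intro!: derivative_eq_intros simp: algebra_simps)
  moreover have "2*(psi x \<bullet> psi' x) + 4*(psi x \<bullet> psi x) <= 0"
  proof -
   have "psi x \<bullet> (c*psi x) = Re c*(psi x \<bullet> psi x)" for c by (simp add: inner_complex_def algebra_simps)
   from this[of "psi' x/psi x"] have "psi x \<bullet> psi' x = Re (psi' x/psi x)*(psi x \<bullet> psi x)" using nz[OF xX] by simp
   also have "... <= - 2*(psi x \<bullet> psi x)" using r[OF xX] by (intro mult_right_mono) auto
   finally show ?thesis by simp
  qed
  ultimately show "EX y. (g has_real_derivative y) (at x) & y <= 0" by (auto intro!: mult_nonpos_nonneg)
 qed
 hence "(norm (psi t))^2*exp (4*t)*exp (- 4*t) <= (norm (psi s))^2*exp (4 * s)*exp (- 4*t)"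
  by (intro mult_right_mono) (auto simp: g_def dot_square_norm)
 hence "(norm (psi t))^2 <= (norm (psi s))^2*exp (4 * s - 4*t)" by (simp add: mult.assoc exp_add[symmetric])
 also have "... = (exp (- 2*(t-s))*norm (psi s))^2" by (simp add: exp_double[symmetric] algebra_simps)
 finally show ?thesis by (rule power2_le_imp_le) simp
qed

lemma sibuya_ray_decay:
 assumes th: "abs th < pi/5"
 shows "EX C. ALL t>=0. norm (sibuya_sol a l (cis th * of_real t)) <= C*exp (- t) & norm (sibuya_dsol a l (cis th * of_real t)) <= C*exp (- t)"
proof -
 define psi d where "psi t = sibuya_sol a l (cis th * of_real t)" and "d t = cis th * sibuya_dsol a l (cis th * of_real t)" for t
 obtain X C where X: "1 <= X" "!!t. t >= X ==> psi t ~= 0 & Re (d t/psi t) <= - 2 & norm (d t/psi t) <= C*t^2"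
  using sibuya_ray[OF th, of a l] unfolding psi_def d_def by blast
 have psi': "(psi has_vector_derivative d t) (at t)" for t
  unfolding psi_def[abs_def] d_def by (rule lsol_ray_deriv)
 have d': "(d has_vector_derivative ((cis th)^2)*pot a l (cis th * of_real t)*psi t) (at t)" for t
  unfolding psi_def d_def[abs_def] by (rule lsol_ray_deriv)
 have C: "0 <= C"
 proof -
  have "0 <= C*X^2" using X(2)[of X] norm_ge_zero order_trans by blast
  thus ?thesis using X(1) by (simp add: zero_le_mult_iff)
 qed
 define N where "N = norm (psi X)*exp (2*X)"
 have N: "0 <= N" by (simp add: N_def)
 have far1: "norm (psi t) <= N*exp (- 2*t)" if "t >= X" for t
 proof -
  have "norm (psi t) <= exp (- 2*(t-X))*norm (psi X)"
   by (rule decreasing_ratio[where psi' = d and X = X]) (use X psi' that in auto)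
  also have "... = N*exp (- 2*t)" by (simp add: N_def exp_add[symmetric] algebra_simps)
  finally show ?thesis .
 qed
 have far2: "norm (psi t) <= N*exp (- t) & norm (d t) <= 2*C*N*exp (- t)" if t: "t >= X" for t
 proof
  have t0: "0 <= t" using t X by simp
  have "N*exp (- 2*t) <= N*exp (- t)" using N t0 by (intro mult_left_mono) auto
  thus "norm (psi t) <= N*exp (- t)" using far1[OF t] by linarith
  have "norm (d t) = norm (d t/psi t)*norm (psi t)" using X(2)[OF t] by (simp add: norm_divide)
  also have "... <= (C*t^2)*(N*exp (- 2*t))" using X(2)[OF t] far1[OF t] C by (intro mult_mono) auto
  also have "... <= (C*(2*exp t))*(N*exp (- 2*t))"
  proof -
   have "t^2 <= 2*exp t" using exp_lower_Taylor_quadratic[OF t0] t0 by linarith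
   thus ?thesis using C N by (intro mult_right_mono mult_left_mono) auto
  qed
  also have "... = 2*C*N*(exp t*exp (- 2*t))" by simp
  also have "exp t*exp (- 2*t) = exp (- t)" by (simp add: exp_add[symmetric])
  finally show "norm (d t) <= 2*C*N*exp (- t)" .
 qed
 have "continuous_on {0..X} psi" "continuous_on {0..X} d"
  by (intro continuous_at_imp_continuous_on ballI has_vector_derivative_continuous[OF psi'] has_vector_derivative_continuous[OF d'])+
 hence "continuous_on {0..X} (%t. (norm (psi t) + norm (d t))*exp t)" by (intro continuous_intros)
 from continuous_attains_sup[OF compact_Icc _ this] X(1) obtain m where
  m: "!!t. 0 <= t ==> t <= X ==> (norm (psi t) + norm (d t))*exp t <= (norm (psi m) + norm (d m))*exp m" by fastforce
 define M where "M = (norm (psi m) + norm (d m))*exp m"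
 have near: "norm (psi t) + norm (d t) <= M*exp (- t)" if "0 <= t" "t <= X" for t
 proof -
  have "(norm (psi t) + norm (d t))*exp t*exp (- t) <= M*exp (- t)" using m[OF that] by (intro mult_right_mono) (auto simp: M_def)
  thus ?thesis by (simp add: mult.assoc exp_add[symmetric])
 qed
 define D where "D = N + 2*C*N + M"
 have M: "0 <= M" by (simp add: M_def)
 have CN: "0 <= C*N" using C N by simp
 have le: "c*exp (- t) <= D*exp (- t)" if "c <= D" for c t using that by (intro mult_right_mono) auto
 have nd: "norm (sibuya_dsol a l (cis th * of_real t)) = norm (d t)" for t by (simp add: d_def norm_mult)
 show ?thesis
 proof (intro exI[of _ D] allI impI)
  fix t :: real assume t: "0 <= t"
  show "norm (sibuya_sol a l (cis th * of_real t)) <= D*exp (- t) & norm (sibuya_dsol a l (cis th * of_real t)) <= D*exp (- t)"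
   unfolding nd psi_def[symmetric]
  proof (cases "t <= X")
   case True
   have "norm (psi t) + norm (d t) <= D*exp (- t)"
   proof -
    have "M <= D" using N CN by (simp add: D_def)
    from le[OF this, of t] near[OF t True] show ?thesis by linarith
   qed
   thus "norm (psi t) <= D*exp (- t) & norm (d t) <= D*exp (- t)" using norm_ge_zero[of "psi t"] norm_ge_zero[of "d t"] by linarith
  next
   case False
   thus "norm (psi t) <= D*exp (- t) & norm (d t) <= D*exp (- t)"
   proof -
    have "N <= D" "2*C*N <= D" using N CN M by (simp_all add: D_def)
    thus ?thesis using far2[of t] le[of N t] le[of "2*C*N" t] False by linarith
   qed
  qed
 qed
qed

text \<open>The real part of et cnj(y) y' along the ray has derivative Re et |y'|^2 + Re (et q)
  |y|^2, so it increases, and it tends to 0 at infinity. The multiplier et serves to turn both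
  coefficients into the right half-plane.\<close>

lemma green_transform:
 assumes th: "abs th < pi/5" and et: "0 < Re et"
  and Q: "!!t. 0 < t ==> 0 < Re (et*((cis th)^2*pot a l (cis th * of_real t)))"
 shows "Re (et*(cnj (sib a l)*(cis th*dsib a l))) < 0"
proof -
 define psi d where "psi t = sibuya_sol a l (cis th * of_real t)" and "d t = cis th * sibuya_dsol a l (cis th * of_real t)" for t
 define q where "q t = (cis th)^2*pot a l (cis th * of_real t)" for t
 have psi': "(psi has_vector_derivative d t) (at t)" and d': "(d has_vector_derivative q t*psi t) (at t)" for t
  unfolding psi_def[abs_def] d_def[abs_def] q_def by (rule lsol_ray_deriv)+
 define g where "g t = Re (et*(cnj (psi t)*d t))" for t
 define g' where "g' t = Re et*(norm (d t))^2 + Re (et*q t)*(norm (psi t))^2" for t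
 have g': "(g has_real_derivative g' t) (at t)" for t
 proof -
  have "((%t. et*(cnj (psi t)*d t)) has_vector_derivative et*(cnj (psi t)*(q t*psi t) + cnj (d t)*d t)) (at t)"
   by (intro has_vector_derivative_mult_right has_vector_derivative_mult d' has_vector_derivative_cnj psi')
  from has_real_derivative_Re[OF this] show ?thesis
   unfolding g_def[abs_def] g'_def cmod_power2 by (rule DERIV_cong) (simp add: algebra_simps power2_eq_square)
 qed
 have g'0: "0 <= g' t" if "0 < t" for t unfolding g'_def using et Q[OF that] by (simp add: q_def)
 have mono: "g s <= g t" if "0 <= s" "s <= t" for s t
 proof (rule DERIV_nonneg_imp_increasing_open[OF that(2)])
  show "continuous_on {s..t} g" by (intro continuous_at_imp_continuous_on ballI DERIV_isCont[OF g'])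
  show "EX y. (g has_real_derivative y) (at x) & 0 <= y" if "s < x" "x < t" for x using g' g'0[of x] that \<open>0 <= s\<close> by auto
 qed
 obtain C where C: "!!t. 0 <= t ==> norm (sibuya_sol a l (cis th * of_real t)) <= C*exp (- t) & norm (sibuya_dsol a l (cis th * of_real t)) <= C*exp (- t)"
  using sibuya_ray_decay[OF th] by blast
 have lim: "tendsto g 0 at_top"
 proof (rule Lim_null_comparison)
  show "\<forall>\<^sub>F t in at_top. norm (g t) <= norm et*(C*exp (- t)*(C*exp (- t)))"
   using eventually_ge_at_top[of 0]
  proof eventually_elim
   case (elim t)
   have "norm (g t) <= norm (et*(cnj (psi t)*d t))" unfolding g_def real_norm_def by (rule abs_Re_le_cmod)
   also have "... = norm et*(norm (psi t)*norm (sibuya_dsol a l (cis th * of_real t)))" by (simp add: norm_mult d_def)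
   also have "... <= norm et*(C*exp (- t)*(C*exp (- t)))"
    using C[OF elim] order_trans[OF norm_ge_zero conjunct1[OF C[OF elim]]] by (intro mult_mono) (auto simp: psi_def)
   finally show ?case .
  qed
  show "tendsto (%t. norm et*(C*exp (- t)*(C*exp (- t)))) 0 at_top" by real_asymp
 qed
 have le0: "g t <= 0" if "0 <= t" for t
  by (rule tendsto_lowerbound[OF lim]) (use mono[OF that] in \<open>auto intro: eventually_at_top_linorderI[of t]\<close>)
 \<comment> \<open>If g were 0 at the origin it would vanish on the whole half-line, but its
   derivative at 1 is strictly positive.\<close>
 have "g 0 < 0"
 proof (rule ccontr)
  assume "~g 0 < 0"
  hence g0: "g t = 0" if "0 <= t" for t using mono[of 0 t] le0[OF that] that by simp
  have "psi 1 ~= 0 | d 1 ~= 0"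
  proof -
   obtain X where "sibuya_sol a l (cis th * of_real X) ~= 0" using sibuya_ray[OF th, of a l] by blast
   from lsol_nonzero[OF this] show ?thesis by (auto simp: psi_def d_def)
  qed
  moreover have q1: "0 < Re (et*q 1)" using Q[OF zero_less_one, folded q_def] .
  ultimately have "0 < Re (et*q 1)*(norm (psi 1))^2 | 0 < Re et*(norm (d 1))^2"
   using et by (auto simp del: times_complex.sel)
  moreover have "0 <= Re (et*q 1)*(norm (psi 1))^2" "0 <= Re et*(norm (d 1))^2"
   using et q1 by (auto simp del: times_complex.sel)
  ultimately have "0 < g' 1" unfolding g'_def by linarith
  then obtain h where h: "h > 0" "!!k. 0 < k ==> k < h ==> g 1 < g (1+k)" using DERIV_pos_inc_right[OF g'] by blast
  thus False using h(2)[of "h/2"] g0[of 1] g0[of "1 + h/2"] by simp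
 qed
 thus ?thesis by (simp add: g_def psi_def d_def)
qed

section \<open>Rotated solutions and the spectral determinant\<close>

text \<open>On z = i x the eigenvalue equation is the cubic equation with a = - al. Rotating z by
  cis (- 2 pi/5), a fifth root of unity, preserves its form but changes the parameters to
  \<open>rot_coupling al\<close> and cis (4 pi/5) l. The functions \<open>rot_sib\<close> and
  \<open>rot_dsib\<close> are the data at 0 of the rotated solution, as \<open>rot_solution\<close>
  confirms.\<close>

definition rot_coupling :: "real => complex" where "rot_coupling al = of_real al*cis (pi/5)"
definition rot_sib :: "real => complex => complex" where
 "rot_sib al l = sib (rot_coupling al) (cis (4*pi/5)*l)"
definition rot_dsib :: "real => complex => complex" where
 "rot_dsib al l = cis (- (2*pi/5))*dsib (rot_coupling al) (cis (4*pi/5)*l)"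

lemma rot_holomorphic: "rot_sib al holomorphic_on S" "rot_dsib al holomorphic_on S"
proof -
 have 1: "sib a \<circ> (%l. cis (4*pi/5)*l) holomorphic_on S" "dsib a \<circ> (%l. cis (4*pi/5)*l) holomorphic_on S" for a
  by (intro holomorphic_on_compose holomorphic_intros sib_holomorphic)+
 show "rot_sib al holomorphic_on S" using 1(1) by (simp add: rot_sib_def[abs_def] o_def)
 show "rot_dsib al holomorphic_on S" unfolding rot_dsib_def[abs_def] using 1(2) by (intro holomorphic_intros) (simp add: o_def)
qed

lemma rot_solution:
 "lsol (rot_sib al l) (rot_dsib al l) (- of_real al) l z = sibuya_sol (rot_coupling al) (cis (4*pi/5)*l) (cis (- (2*pi/5))*z)"
 "ldsol (rot_sib al l) (rot_dsib al l) (- of_real al) l z = cis (- (2*pi/5)) * sibuya_dsol (rot_coupling al) (cis (4*pi/5)*l) (cis (- (2*pi/5))*z)"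
proof -
 let ?a = "rot_coupling al" and ?l = "cis (4*pi/5)*l" and ?w = "cis (- (2*pi/5))"
 define y dy where "y z = sibuya_sol ?a ?l (?w*z)" and "dy z = ?w * sibuya_dsol ?a ?l (?w*z)" for z
 have w: "((%z. ?w*z) has_field_derivative ?w) (at z)" for z by (auto)
 have 1: "(y has_field_derivative dy z) (at z)" for z
  unfolding y_def dy_def using DERIV_chain2[OF lsol_deriv w] by (simp add: mult.commute)
 have pq: "?w*(?w*pot ?a ?l (?w*z)) = pot (- of_real al) l z" for z
 proof -
  have c: "?w^5 = 1" "?w^3*cis (pi/5) = - 1" "?w^2*cis (4*pi/5) = 1"
  proof -
   show "?w^5 = 1" unfolding Complex.DeMoivre by (simp add: complex_eq_iff)
   show "?w^3*cis (pi/5) = - 1" unfolding Complex.DeMoivre cis_mult by (simp add: complex_eq_iff)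
   show "?w^2*cis (4*pi/5) = 1" unfolding Complex.DeMoivre by (simp add: complex_eq_iff)
  qed
  have "?w*(?w*pot ?a ?l (?w*z)) = ?w^5*z^3 + of_real al*(?w^3*cis (pi/5))*z + ?w^2*cis (4*pi/5)*l"
   by (simp add: pot_def rot_coupling_def algebra_simps eval_nat_numeral)
  thus ?thesis unfolding c by (simp add: pot_def)
 qed
 have 2: "(dy has_field_derivative pot (- of_real al) l z*y z) (at z)" for z
 proof -
  have "(dy has_field_derivative ?w*(pot ?a ?l (?w*z) * sibuya_sol ?a ?l (?w*z)*?w)) (at z)"
   unfolding dy_def by (intro DERIV_cmult DERIV_chain2[OF ldsol_deriv w])
  thus ?thesis unfolding pq[symmetric] y_def by (simp add: mult_ac)
 qed
 have 0: "rot_sib al l = y 0 * ode_dsol 0 1 (- of_real al) l 0 - dy 0 * ode_sol 0 1 (- of_real al) l 0"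
  "rot_dsib al l = ode_sol 1 0 (- of_real al) l 0*dy 0 - ode_dsol 1 0 (- of_real al) l 0*y 0"
  by (simp_all add: y_def dy_def rot_sib_def rot_dsib_def ode_sol_0 ode_dsol_0)
 have "y z = lsol (rot_sib al l) (rot_dsib al l) (- of_real al) l z & dy z = ldsol (rot_sib al l) (rot_dsib al l) (- of_real al) l z"
  using ode_solution_unique[OF open_UNIV connected_UNIV UNIV_I 1 2 0 UNIV_I] by simp
 thus "lsol (rot_sib al l) (rot_dsib al l) (- of_real al) l z = sibuya_sol (rot_coupling al) (cis (4*pi/5)*l) (cis (- (2*pi/5))*z)"
  "ldsol (rot_sib al l) (rot_dsib al l) (- of_real al) l z = cis (- (2*pi/5)) * sibuya_dsol (rot_coupling al) (cis (4*pi/5)*l) (cis (- (2*pi/5))*z)"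
  by (simp_all add: y_def dy_def)
qed

lemma dphase_ray_limit:
 assumes "abs th < pi"
 shows "tendsto (%t. dphase a (cis th * of_real t)/of_real (t * sqrt t)) (cis (3*th/2)) at_top"
proof (rule Lim_transform_eventually)
 let ?f = "%t. cis (3*th/2) + a/(2*cis (th/2)) * of_real (1/t^2) + 3/(4*cis th) * of_real (1/(t^2 * sqrt t))"
 have "tendsto (%t::real. 1/t^2) 0 at_top" "tendsto (%t::real. 1/(t^2 * sqrt t)) 0 at_top" by real_asymp+
 hence "tendsto ?f (cis (3*th/2) + a/(2*cis (th/2)) * of_real 0 + 3/(4*cis th) * of_real 0) at_top"
  by (intro tendsto_intros)
 thus "tendsto ?f (cis (3*th/2)) at_top" by simp
 show "\<forall>\<^sub>F t in at_top. ?f t = dphase a (cis th * of_real t)/of_real (t * sqrt t)"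
  using eventually_gt_at_top[of 0]
 proof eventually_elim
  case (elim t)
  define r where "r = sqrt t"
  have r: "0 < r" "t = r^2" using elim by (auto simp: r_def)
  have s: "csqrt (cis th * of_real t) = of_real r*cis (th/2)" unfolding r_def by (rule csqrt_ray[OF elim assms])
  have "(of_real r*cis (th/2))^3 = of_real (r^3)*cis (3*th/2)" by (simp add: power_mult_distrib Complex.DeMoivre)
  hence "dphase a (cis th * of_real t) = of_real (r^3)*cis (3*th/2) + a/(2*(of_real r*cis (th/2))) + 3/(4*(cis th * of_real (r^2)))"
   unfolding dphase_def s by (simp add: r(2))
  moreover have "t * sqrt t = r^3" using r(1) by (simp add: r(2) power2_eq_square power3_eq_cube)
  moreover have "1/t^2 = 1/r^4" "1/(t^2 * sqrt t) = 1/r^5" using r(1) by (simp_all add: r(2) eval_nat_numeral)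
  moreover have gen: "(R^3*e+a/(2*(R*c)) + 3/(4*(d*R^2)))/R^3 = e + a/(2*c)*(1/R^4) + 3/(4*d)*(1/R^5)"
   if "R ~= 0" "c ~= 0" "d ~= 0" for R e c d :: complex using that by (simp add: field_simps eval_nat_numeral)
  ultimately show ?case using r(1) by simp
 qed
qed

text \<open>On these two conjugate rays the powers 5/2 are purely imaginary and opposite, the terms
  in \<open>al\<close> cancel by the form of \<open>rot_coupling\<close>, and the logarithms add up
  to that of t^(3/2).\<close>

lemma phase_ray_sum:
 assumes "0 < t"
 shows "exp (phase (- of_real al) (cis (pi/5) * of_real t))*exp (phase (rot_coupling al) (cis (- (pi/5)) * of_real t)) = of_real (t * sqrt t)"
proof -
 define r where "r = sqrt t"
 define z where "z = cis (pi/5)*complex_of_real t"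
 have cz: "cis (- (pi/5)) * of_real t = cnj z" by (simp add: z_def cis_cnj)
 have s: "csqrt z = of_real r*cis (pi/10)" "csqrt (cnj z) = of_real r*cis (- (pi/10))"
  using csqrt_ray[OF assms, of "pi/5"] csqrt_ray[OF assms, of "- (pi/5)"] by (auto simp: z_def r_def cis_cnj)
 have "0 < Re z" using assms abs_sin_less_cos(2)[of "pi/5"] by (simp add: z_def)
 hence zn: "z ~: nonpos_Reals" "z ~= 0" by (auto simp: complex_nonpos_Reals_iff)
 have "Ln z + Ln (cnj z) = of_real (2*Re (Ln z))" using zn by (simp add: cnj_Ln[symmetric] complex_add_cnj)
 also have "Re (Ln z) = ln t" using assms by (simp add: z_def norm_mult)
 finally have L: "Ln z + Ln (cnj z) = of_real (2*ln t)" .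
 have 5: "csqrt z^5 + csqrt (cnj z)^5 = 0"
 proof -
  have "cis (pi/10)^5 = \<i>" "cis (- (pi/10))^5 = - \<i>" unfolding Complex.DeMoivre by (simp_all)
  thus ?thesis unfolding s power_mult_distrib by simp
 qed
 have 1: "- of_real al*csqrt z + rot_coupling al*csqrt (cnj z) = 0"
 proof -
  have "cis (pi/5)*cis (- (pi/10)) = cis (pi/10)" unfolding cis_mult by (rule arg_cong[where f = cis]) simp
  thus ?thesis unfolding s rot_coupling_def by (simp)
 qed
 have "phase (- of_real al) z + phase (rot_coupling al) (cnj z) =
  2/5*(csqrt z^5 + csqrt (cnj z)^5) + (- of_real al*csqrt z + rot_coupling al*csqrt (cnj z)) + 3/4*(Ln z + Ln (cnj z))"
  by (simp add: phase_def algebra_simps)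
 also have "... = of_real (3/2*ln t)" unfolding 5 1 L by simp
 finally have S: "phase (- of_real al) z + phase (rot_coupling al) (cnj z) = of_real (3/2*ln t)" .
 have "exp (phase (- of_real al) z)*exp (phase (rot_coupling al) (cnj z)) = exp (of_real (3/2*ln t))"
  unfolding exp_add[symmetric] S ..
 also have "... = of_real (exp (3/2*ln t))" by (rule exp_of_real)
 finally have "exp (phase (- of_real al) z)*exp (phase (rot_coupling al) (cnj z)) = of_real (exp (3/2*ln t))" .
 moreover have "exp (3/2*ln t) = t * sqrt t"
 proof -
  have "exp (3/2*ln t) = t powr 1*t powr (1/2)" unfolding powr_add[symmetric] using assms by (simp add: powr_def)
  thus ?thesis using assms by (simp add: powr_half_sqrt)
 qed
 ultimately show ?thesis by (simp add: cz z_def[symmetric])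
qed

text \<open>Evaluated at infinity on the ray of angle pi/5, where the asymptotics of both solutions
  hold. The exponentials combine to t^(3/2), and only the difference of the logarithmic derivatives
  survives, the two limits being cis (3 pi/10) and - cis (3 pi/10).\<close>

lemma stokes_wronskian:
 "sib (- of_real al) l*rot_dsib al l - dsib (- of_real al) l*rot_sib al l = 2*cis (3*pi/10)"
proof -
 let ?a = "- complex_of_real al" and ?b = "rot_coupling al" and ?m = "cis (4*pi/5)*l" and ?w = "cis (- (2*pi/5))"
 define W where "W = sib ?a l*rot_dsib al l - dsib ?a l*rot_sib al l"
 define z z1 where "z t = cis (pi/5)*complex_of_real t" and "z1 t = cis (- (pi/5))*complex_of_real t" for t
 have wz: "?w*z t = z1 t" for t
 proof -
  have "?w*cis (pi/5) = cis (- (pi/5))" unfolding cis_mult by (rule arg_cong[where f = cis]) simp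
  thus ?thesis by (simp add: z_def z1_def)
 qed
 define v0 u0 v1 u1 where "v0 t = exp (phase ?a (z t)) * sibuya_sol ?a l (z t)"
  and "u0 t = exp (phase ?a (z t))*(sibuya_dsol ?a l (z t) + dphase ?a (z t) * sibuya_sol ?a l (z t))"
  and "v1 t = exp (phase ?b (z1 t)) * sibuya_sol ?b ?m (z1 t)"
  and "u1 t = exp (phase ?b (z1 t))*(sibuya_dsol ?b ?m (z1 t) + dphase ?b (z1 t) * sibuya_sol ?b ?m (z1 t))" for t
 have five: "abs (pi/5) <= pi/5" "abs (- (pi/5)) <= pi/5" "abs (pi/5) < pi" "abs (- (pi/5)) < pi" by auto
 have lims: "tendsto v0 1 at_top" "tendsto u0 0 at_top" "tendsto v1 1 at_top" "tendsto u1 0 at_top"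
 proof -
  have *: "tendsto f c at_top" if "!!e. 0 < e ==> \<forall>\<^sub>F t in at_top. norm (f t - c) <= e" for f :: "real => complex" and c
  proof (rule tendstoI)
   fix e :: real assume "e > 0"
   hence "\<forall>\<^sub>F t in at_top. norm (f t - c) <= e/2" by (intro that) auto
   thus "\<forall>\<^sub>F t in at_top. dist (f t) c < e" by eventually_elim (use \<open>e > 0\<close> in \<open>auto simp: dist_norm\<close>)
  qed
  note d0 = decaying_ray_bounds[OF five(1), of _ ?a l, folded z_def] and d1 = decaying_ray_bounds[OF five(2), of _ ?b ?m, folded z1_def]
  show "tendsto v0 1 at_top" by (rule *, drule d0, elim eventually_mono) (simp add: v0_def)
  show "tendsto u0 0 at_top" by (rule *, drule d0, elim eventually_mono) (simp add: u0_def)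
  show "tendsto v1 1 at_top" by (rule *, drule d1, elim eventually_mono) (simp add: v1_def)
  show "tendsto u1 0 at_top" by (rule *, drule d1, elim eventually_mono) (simp add: u1_def)
 qed
 let ?g = "%t. ?w * v0 t*u1 t * of_real (1/(t * sqrt t)) - u0 t * v1 t * of_real (1/(t * sqrt t)) +
   v0 t * v1 t*(dphase ?a (z t)/of_real (t * sqrt t) - ?w*(dphase ?b (z1 t)/of_real (t * sqrt t)))"
 have "tendsto (%t::real. 1/(t * sqrt t)) 0 at_top" by real_asymp
 moreover have "tendsto (%t. dphase ?a (z t)/of_real (t * sqrt t)) (cis (3*(pi/5)/2)) at_top"
  "tendsto (%t. dphase ?b (z1 t)/of_real (t * sqrt t)) (cis (3*(- (pi/5))/2)) at_top"
  unfolding z_def z1_def by (rule dphase_ray_limit[OF five(3)] dphase_ray_limit[OF five(4)])+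
 ultimately have lim1: "tendsto ?g (?w*1*0 * of_real 0 - 0*1 * of_real 0 + 1*1*(cis (3*(pi/5)/2) - ?w*cis (3*(- (pi/5))/2))) at_top"
  by (intro tendsto_intros lims)
 have cX: "cis (3*(pi/5)/2) - ?w*cis (3*(- (pi/5))/2) = 2*cis (3*pi/10)"
 proof -
  have "?w*cis (3*(- (pi/5))/2) = cis (3*pi/10-pi)" unfolding cis_mult by (rule arg_cong[where f = cis]) simp
  also have "... = cis (3*pi/10)/cis pi" by (rule cis_divide[symmetric])
  also have "... = - cis (3*pi/10)" by simp
  finally show ?thesis by simp
 qed
 have e: "?w*1*0 * of_real 0 - 0*1 * of_real 0 + 1*1*(2*cis (3*pi/10)) = 2*cis (3*pi/10)" by simp
 have L: "tendsto ?g (2*cis (3*pi/10)) at_top" using lim1 unfolding cX e .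
 have "\<forall>\<^sub>F t in at_top. ?g t = W" using eventually_gt_at_top[of 0]
 proof eventually_elim
  case (elim t)
  define y0 d0 y1 d1 e0 e1 p0 p1 where "y0 = sibuya_sol ?a l (z t)" and "d0 = sibuya_dsol ?a l (z t)"
   and "y1 = sibuya_sol ?b ?m (z1 t)" and "d1 = sibuya_dsol ?b ?m (z1 t)"
   and "e0 = exp (phase ?a (z t))" and "e1 = exp (phase ?b (z1 t))" and "p0 = dphase ?a (z t)" and "p1 = dphase ?b (z1 t)"
  define T where "T = complex_of_real (t * sqrt t)"
  have T: "e0*e1 = T" "T ~= 0" using phase_ray_sum[OF elim, of al] by (auto simp: e0_def e1_def z_def z1_def T_def)
  have W: "W = y0*(?w*d1) - d0*y1"
   unfolding W_def wronskian_lsol[of "sib ?a l" "dsib ?a l" ?a l "z t", symmetric] rot_solution wz y0_def d0_def y1_def d1_def ..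
  have "?g t = (?w * v0 t*u1 t - u0 t * v1 t + v0 t * v1 t*(p0 - ?w*p1))/T"
  proof -
   have o: "of_real (1/(t * sqrt t)) = 1/T" by (simp add: T_def)
   show ?thesis unfolding o T_def[symmetric] p0_def p1_def using T(2) by (simp add: field_simps)
  qed
  also have "?w * v0 t*u1 t - u0 t * v1 t + v0 t * v1 t*(p0 - ?w*p1) = e0*e1*(y0*(?w*d1) - d0*y1)"
   unfolding v0_def u0_def v1_def u1_def y0_def[symmetric] d0_def[symmetric] y1_def[symmetric] d1_def[symmetric]
    e0_def[symmetric] e1_def[symmetric] p0_def[symmetric] p1_def[symmetric] by (simp add: algebra_simps)
  finally show ?case using T W by simp
 qed
 hence "tendsto (%t::real. W) (2*cis (3*pi/10)) at_top" by (rule iffD1[OF tendsto_cong L])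
 hence "W = 2*cis (3*pi/10)" using tendsto_unique[OF trivial_limit_at_top_linorder tendsto_const] by blast
 thus ?thesis by (simp add: W_def)
qed

text \<open>Up to the factor i, the Wronskian of the copies of Y rotated by 2 pi/5 and - 2 pi/5; see
  \<open>jost_wronskian\<close>. Conjugating both inside and outside keeps it entire in l.\<close>

definition spec_det :: "real => complex => complex" where
 "spec_det al l = cnj (rot_sib al (cnj l))*rot_dsib al l - cnj (rot_dsib al (cnj l))*rot_sib al l"

lemma rot_cnj_holomorphic:
 "(%l. cnj (rot_sib al (cnj l))) holomorphic_on S" "(%l. cnj (rot_dsib al (cnj l))) holomorphic_on S"
proof -
 have "cnj \<circ> rot_sib al \<circ> cnj holomorphic_on UNIV" "cnj \<circ> rot_dsib al \<circ> cnj holomorphic_on UNIV"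
  by (intro holomorphic_on_compose_cnj_cnj rot_holomorphic open_UNIV)+
 thus "(%l. cnj (rot_sib al (cnj l))) holomorphic_on S" "(%l. cnj (rot_dsib al (cnj l))) holomorphic_on S"
  by (auto simp: o_def)
qed

lemma spec_det_holomorphic: "spec_det al holomorphic_on S"
 unfolding spec_det_def[abs_def] by (intro holomorphic_intros rot_cnj_holomorphic rot_holomorphic)

lemma spec_det_cnj: "spec_det al (cnj l) = - cnj (spec_det al l)" by (simp add: spec_det_def)

text \<open>The Pluecker relation between three solutions of one second-order equation: two of the
  Wronskians are known from \<open>stokes_wronskian\<close> and its conjugate, the third is the
  determinant.\<close>

lemma spec_det_mult_sib:
 "spec_det al l * sib (- of_real al) l = 2*cis (3*pi/10)*cnj (rot_sib al (cnj l)) - 2*cis (- (3*pi/10))*rot_sib al l"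
proof -
 define c f e where "c = cis (3*pi/10)" and "f = sib (- of_real al) l" and "e = dsib (- of_real al) l"
 have c': "cis (- (3*pi/10)) = cnj c" by (simp add: c_def cis_cnj)
 have 1: "f*rot_dsib al l - e*rot_sib al l = 2*c" unfolding f_def e_def c_def by (rule stokes_wronskian)
 have "cnj (sib (- of_real al) (cnj l)) = f" "cnj (dsib (- of_real al) (cnj l)) = e"
  using sib_cnj[of "- of_real al" l] by (simp_all add: f_def e_def)
 hence 2: "f*cnj (rot_dsib al (cnj l)) - e*cnj (rot_sib al (cnj l)) = 2*cnj c"
  using arg_cong[OF stokes_wronskian[of al "cnj l"], of cnj] by (simp add: c_def)
 show ?thesis unfolding spec_det_def c' f_def[symmetric] c_def[symmetric] using 1 2 by algebra
qed

text \<open>The rotated equation on the ray of angle pi/10 is the eigenvalue equation of the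
  oscillator on the right half-line.\<close>

lemma rot_pot:
 "(cis (pi/10))^2*pot (rot_coupling al) (cis (4*pi/5)*l) (cis (pi/10) * of_real t) = \<i> * of_real (t^3) + \<i> * of_real al * of_real t - l"
proof -
 let ?w = "cis (pi/10)"
 have c: "?w^5 = \<i>" "?w^3*cis (pi/5) = \<i>" "?w^2*cis (4*pi/5) = - 1"
  unfolding Complex.DeMoivre cis_mult by (simp_all)
 have "?w^2*pot (rot_coupling al) (cis (4*pi/5)*l) (?w * of_real t) = ?w^5 * of_real t^3 + of_real al*(?w^3*cis (pi/5)) * of_real t + ?w^2*cis (4*pi/5)*l"
  by (simp add: pot_def rot_coupling_def algebra_simps eval_nat_numeral)
 thus ?thesis unfolding c by simp
qed

text \<open>Multiplying by cis (- 3 pi/10) moves the coefficients of t^3, al t and l to the angles -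
  3 pi/10, - pi/10 and pi/2. For Im l <= 0 all real parts are nonnegative, the first one positive,
  and Green's formula excludes a zero.\<close>

lemma rot_sib_nonzero:
 assumes "0 <= al" "Im l <= 0" shows "rot_sib al l ~= 0"
proof
 assume 0: "rot_sib al l = 0"
 define et where "et = cis (- (3*pi/10))"
 have c: "et*cis (pi/5) = cis (- (pi/10))" "et*cis (4*pi/5) = \<i>" unfolding et_def cis_mult by (simp_all)
 have p: "0 < cos (3*pi/10)" "0 < cos (pi/10)" by (rule cos_gt_zero; simp)+
 have "Re (et*(cnj (sib (rot_coupling al) (cis (4*pi/5)*l))*(cis 0*dsib (rot_coupling al) (cis (4*pi/5)*l)))) < 0"
 proof (rule green_transform)
  show "0 < Re et" using p by (simp add: et_def)
  fix t :: real assume t: "0 < t"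
    have eq: "et*((cis 0)^2*pot (rot_coupling al) (cis (4*pi/5)*l) (cis 0 * of_real t)) =
   et * of_real (t^3) + of_real (al*t)*(et*cis (pi/5)) + et*cis (4*pi/5)*l"
   by (simp add: pot_def rot_coupling_def algebra_simps)
    have "Re (et * of_real (t^3) + of_real (al*t)*(et*cis (pi/5)) + et*cis (4*pi/5)*l) = cos (3*pi/10)*t^3 + al*t*cos (pi/10) - Im l" unfolding c by (simp add: et_def)
  moreover have "0 < cos (3*pi/10)*t^3" "0 <= al*t*cos (pi/10)" using p t assms by simp_all
  ultimately show "0 < Re (et*((cis 0)^2*pot (rot_coupling al) (cis (4*pi/5)*l) (cis 0 * of_real t)))" unfolding eq using assms by linarith
 qed simp
 thus False using 0 by (simp add: rot_sib_def)
qed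

lemma spec_det_real:
 assumes "Im l = 0" shows "spec_det al l = 2*\<i> * of_real (Im (cnj (rot_sib al l)*rot_dsib al l))"
proof -
 have "cnj l = l" using assms by (simp add: complex_eq_iff)
 thus ?thesis unfolding spec_det_def complex_eq_iff \<open>cnj l = l\<close> by (simp)
qed

text \<open>For l < 0 the potential minus l has positive real part, so Green's formula on the
  half-line gives \<open>rot_dsib\<close>/\<open>rot_sib\<close> a positive imaginary part; by
  \<open>spec_det_real\<close> that is all that is asked.\<close>

lemma spec_det_negative:
 assumes "l < 0" shows "spec_det al (of_real l) ~= 0"
proof -
 define F where "F = rot_sib al (of_real l)"
 have "Re (1*(cnj F*(cis (pi/10)*dsib (rot_coupling al) (cis (4*pi/5) * of_real l)))) < 0"
  unfolding F_def rot_sib_def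
  by (rule green_transform) (use assms in \<open>auto simp only: rot_pot mult_1, simp_all\<close>)
 moreover have "cis (pi/10)*dsib (rot_coupling al) (cis (4*pi/5) * of_real l) = \<i>*rot_dsib al (of_real l)"
 proof -
  have "\<i>*cis (- (2*pi/5)) = cis (pi/10)" unfolding cis_pi_half[symmetric] cis_mult by (rule arg_cong[where f = cis]) simp
  thus ?thesis by (simp add: rot_dsib_def)
 qed
 ultimately have "0 < Im (cnj F*rot_dsib al (of_real l))" by simp
 thus ?thesis by (subst spec_det_real) (auto simp: F_def[symmetric] complex_eq_iff)
qed

section \<open>Phragmen-Lindelof and the reality of the zeros\<close>

lemma powr_cis:
 assumes "0 < R" "- pi < th" "th <= pi" shows "(cis th * of_real R) powr of_real s = of_real (R powr s)*cis (s*th)"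
proof -
 have "Ln (cis th * of_real R) = of_real (ln R) + \<i> * of_real th"
  using assms by (simp add: Ln_times_of_real[of R "cis th"] mult.commute[of "cis th"] Ln_cis Ln_of_real)
 hence "(cis th * of_real R) powr of_real s = exp (of_real (s*ln R))*cis (s*th)"
  using assms by (simp add: powr_def cis_conv_exp exp_add[symmetric] algebra_simps)
 thus ?thesis using assms by (simp add: powr_def exp_of_real[symmetric])
qed

lemma Re_powr_ge:
 assumes "0 < Re z" "0 <= s" "s <= 1" shows "cos (s*(pi/2))*norm z powr s <= Re (z powr of_real s)"
proof -
 have z: "z ~= 0" using assms by auto
 have I: "abs (Im (Ln z)) < pi/2" using assms(1) z Re_Ln_pos_lt by blast
 have "z powr of_real s = exp (of_real s*Ln z)" using z by (simp add: powr_def)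
 hence "Re (z powr of_real s) = norm z powr s*cos (s*Im (Ln z))" using z by (simp add: Re_exp powr_def)
 moreover have "cos (s*(pi/2)) <= cos (abs (s*Im (Ln z)))"
 proof (rule cos_monotone_0_pi_le)
  show "abs (s*Im (Ln z)) <= s*(pi/2)" using mult_left_mono[OF less_imp_le[OF I] assms(2)] assms by (simp add: abs_mult)
  show "s*(pi/2) <= pi" using assms by simp
 qed simp
 ultimately show ?thesis by (simp add: mult.commute[of _ "norm z powr s"] mult_left_mono)
qed

lemma interior_halfspace_Im_ge: "interior {z. c <= Im z} = {z. c < Im z}"
 using interior_halfspace_ge[of \<i> c] by (simp)

text \<open>The exponent 11/12 lies strictly between 5/6 and 1: exp (- ep (1 - i z)^(11/12)) decays
  in the closed half-plane and beats the growth of h for every ep > 0, after which ep tends to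
  0.\<close>

lemma phragmen_lindelof_half_plane:
 assumes hol: "h holomorphic_on {z. 0 < Im z}" and cont: "continuous_on {z. 0 <= Im z} h"
  and real: "!!z. Im z = 0 ==> norm (h z) <= 1"
  and growth: "!!z. 0 <= Im z ==> norm (h z) <= M*exp (C*norm z powr (5/6))"
  and M: "0 < M" and C: "0 < C" and z: "0 <= Im z" shows "norm (h z) <= 1"
proof -
 define c where "c = cos (11/12*(pi/2))"
 have c: "0 < c" unfolding c_def by (rule cos_gt_zero) auto
 have key: "norm (h z) <= exp (ep*Re ((1 - \<i>*z) powr of_real (11/12)))" if e: "0 < ep" for ep
 proof -
  define g where "g z = h z*exp (- of_real ep*(1 - \<i>*z) powr of_real (11/12))" for z
  have ng: "norm (g z) = norm (h z)*exp (- ep*Re ((1 - \<i>*z) powr of_real (11/12)))" for z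
   by (simp add: g_def norm_mult)
  have pos: "1 <= Re (1 - \<i>*z)" if "0 <= Im z" for z using that by simp
  have ge: "c*(norm z - 1) powr (11/12) <= Re ((1 - \<i>*z) powr of_real (11/12))" if "0 <= Im z" "1 <= norm z" for z
  proof -
   have "norm z - 1 <= norm (1 - \<i>*z)" using norm_triangle_ineq3[of 1 "\<i>*z"] by (simp add: norm_mult)
   hence "c*(norm z - 1) powr (11/12) <= c*norm (1 - \<i>*z) powr (11/12)"
    using that c by (intro mult_left_mono powr_mono2) auto
   also have "... <= Re ((1 - \<i>*z) powr of_real (11/12))" unfolding c_def using pos[OF that(1)] by (intro Re_powr_ge) auto
   finally show ?thesis .
  qed
  have "tendsto (%R::real. M*exp (C*R powr (5/6))*exp (- ep*(c*(R-1) powr (11/12)))) 0 at_top"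
   using e c M C by real_asymp
  hence "\<forall>\<^sub>F R in at_top. M*exp (C*R powr (5/6))*exp (- ep*(c*(R-1) powr (11/12))) < 1"
   by (rule order_tendstoD) simp
  hence "\<forall>\<^sub>F R in at_top. M*exp (C*R powr (5/6))*exp (- ep*(c*(R-1) powr (11/12))) < 1 & 1 + norm z <= R"
   using eventually_ge_at_top[of "1 + norm z"] by eventually_elim auto
  then obtain R where R: "M*exp (C*R powr (5/6))*exp (- ep*(c*(R-1) powr (11/12))) < 1" "1 + norm z <= R"
   using eventually_happens'[OF trivial_limit_at_top_linorder] by blast
  define S where "S = cball 0 R \<inter> {z. 0 <= Im z}"
  have "norm (g z) <= 1"
  proof (rule maximum_modulus_frontier[where f = g and S = S])
   have "interior S <= {z. 0 < Im z}" unfolding S_def by (simp add: interior_halfspace_Im_ge)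
   moreover have "(%z. exp (- of_real ep*(1 - \<i>*z) powr of_real (11/12))) holomorphic_on {z. 0 < Im z}"
    by (intro holomorphic_intros) (force simp: complex_nonpos_Reals_iff)+
   ultimately show "g holomorphic_on interior S"
    unfolding g_def by (intro holomorphic_on_mult) (auto intro: holomorphic_on_subset hol)
   have "closed S" unfolding S_def by (intro closed_Int closed_cball closed_halfspace_Im_ge)
   hence S: "closure S = S" by simp
   have "(%z. exp (- of_real ep*(1 - \<i>*z) powr of_real (11/12))) holomorphic_on {z. - 1 < Im z}"
    by (intro holomorphic_intros) (force simp: complex_nonpos_Reals_iff)+
   thus "continuous_on (closure S) g" unfolding S g_def
    by (intro continuous_on_mult continuous_on_subset[OF cont] continuous_on_subset[OF holomorphic_on_imp_continuous_on])
     (auto simp: S_def)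
   show "bounded S" unfolding S_def by (intro bounded_Int) auto
   show "z : S" using z R by (simp add: S_def)
   fix x assume "x : frontier S"
   hence x: "0 <= Im x" "norm x = R | Im x = 0"
    unfolding frontier_def S unfolding S_def by (auto simp: interior_halfspace_Im_ge)
   from x(2) show "norm (g x) <= 1"
   proof
    assume xR: "norm x = R"
    have "1 <= norm x" using xR R(2) norm_ge_zero[of z] by linarith
    from ge[OF x(1) this] have "exp (- ep*Re ((1 - \<i>*x) powr of_real (11/12))) <= exp (- ep*(c*(R-1) powr (11/12)))"
     using e xR by simp
    hence "norm (g x) <= M*exp (C*R powr (5/6))*exp (- ep*(c*(R-1) powr (11/12)))"
     unfolding ng using growth[OF x(1)] xR M by (intro mult_mono) auto
    thus ?thesis using R(1) by linarith
   next
    assume "Im x = 0"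
    hence "norm (h x) <= 1" by (rule real)
    moreover have "0 <= Re ((1 - \<i>*x) powr of_real (11/12))" using pos[OF x(1)] c
     by (intro order_trans[OF _ Re_powr_ge]) (auto simp: c_def intro!: mult_nonneg_nonneg)
    hence "exp (- ep*Re ((1 - \<i>*x) powr of_real (11/12))) <= 1" using e by simp
    ultimately have "norm (g x) <= 1*1" unfolding ng by (intro mult_mono) auto
    thus ?thesis by simp
   qed
  qed
  hence "norm (h z)*exp (- (ep*Re ((1 - \<i>*z) powr of_real (11/12)))) <= 1" by (simp add: ng)
  thus ?thesis by (simp add: exp_minus field_simps)
 qed
 have "tendsto (%ep. exp (ep*Re ((1 - \<i>*z) powr of_real (11/12)))) (exp (0*Re ((1 - \<i>*z) powr of_real (11/12)))) (at_right 0)"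
  by (intro tendsto_intros)
 hence "norm (h z) <= exp (0*Re ((1 - \<i>*z) powr of_real (11/12)))"
  by (rule tendsto_lowerbound) (use key in \<open>auto simp: eventually_at_filter\<close>)
 thus ?thesis by simp
qed

text \<open>As pi/13 < pi/12, the sixth power sends this sector into the open right half-plane, and
  the principal sixth root brings it back.\<close>

lemma sector_sixth_power:
 assumes "cos (pi/13)*norm z < Re z" shows "cos (6*pi/13)*norm z^6 <= Re (z^6)" "(z^6) powr (1/6) = z"
proof -
 have c: "0 < cos (pi/13)" by (rule cos_gt_zero) auto
 have z: "z ~= 0" using assms by auto
 define th where "th = Arg z"
 have e: "z = rcis (norm z) th" by (simp add: th_def rcis_cmod_Arg)
 hence "Re z = norm z*cos th" by (metis Re_rcis)
 hence k: "cos (pi/13) < cos (abs th)" using assms z by (simp)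
 have T: "abs th < pi/13"
 proof (rule ccontr)
  assume "~?thesis"
  hence "cos (abs th) <= cos (pi/13)" using Arg_bounded[of z] by (intro cos_monotone_0_pi_le) (auto simp: th_def)
  thus False using k by simp
 qed
 have "Re (z^6) = norm z^6*cos (6*th)" by (subst e) (simp add: DeMoivre2)
 moreover have "cos (6*pi/13) <= cos (abs (6*th))" using T by (intro cos_monotone_0_pi_le) auto
 ultimately show "cos (6*pi/13)*norm z^6 <= Re (z^6)" by (simp add: mult.commute mult_left_mono)
 have "Ln (z^6) = 6*Ln z"
  using T z Arg_eq_Im_Ln[of z] by (intro Ln_unique) (auto simp: th_def exp_of_nat_mult[of 6, simplified])
 thus "(z^6) powr (1/6) = z" by (simp add: powr_def)
qed

text \<open>The asymptotics leave out a sector around the negative axis. The substitution l = - (1 -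
  i w)^(1/6) reaches it from a half-plane of w, and the crude bound with exponent (1 + |l|)^5 then
  has order 5/6 < 1 in w, so that Phragmen-Lindelof carries the good bound from the boundary
  inside.\<close>

theorem sib_growth:
 fixes a :: complex shows "EX M C. 0 < M & 0 < C & (ALL l. norm (sib a l) <= M*exp (C*norm l powr (5/6)))"
proof -
 define k where "k = cos (pi/13)"
 have k: "0 <= k" "k < 1" unfolding k_def using cos_monotone_0_pi[of 0 "pi/13"] by (auto intro!: less_imp_le cos_gt_zero)
 obtain C where C: "1 <= C" "!!l. C <= norm l ==> - k*norm l <= Re l ==> sib a l ~= 0 &
  abs (ln (norm (sib a l)) - action_const*Re (l powr (5/6))) <= C*norm l powr (2/3)"
  using sib_asymptotics[OF k] by blast
 obtain G where G: "1 <= G" "!!l. norm (sib a l) <= exp (G*(1 + norm l)^5)" using sib_crude_growth by blast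
 define A where "A = action_const + C"
 have A: "0 < A" using action_const_pos C by (simp add: A_def)
 have good: "norm (sib a l) <= exp (A*norm l powr (5/6))" if "C <= norm l" "- k*norm l <= Re l" for l
 proof -
  have "action_const*Re (l powr (5/6)) <= action_const*norm l powr (5/6)"
   using complex_Re_le_cmod[of "l powr (5/6)"] norm_powr_real_powr'[of "5/6" l] action_const_pos by simp
  moreover have "C*norm l powr (2/3) <= C*norm l powr (5/6)" using C that by (intro mult_left_mono powr_mono) auto
  ultimately have "ln (norm (sib a l)) <= A*norm l powr (5/6)" using C(2)[OF that] by (auto simp: A_def distrib_right)
  thus ?thesis using C(2)[OF that] by (metis exp_le_cancel_iff exp_ln zero_less_norm_iff)
 qed
 define c where "c = cos (6*pi/13)"
 have c: "0 < c" unfolding c_def by (rule cos_gt_zero) auto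
 define B where "B = C + 1/c"
 have B: "C <= B" "1/c < B" "1 <= B" using c C by (auto simp: B_def intro: add_increasing2)
 define N where "N = exp (G*(1+B)^5)"
 have N: "1 <= N" "!!l. norm l <= B ==> norm (sib a l) <= N" using G B by (auto simp: N_def intro!: order_trans[OF G(2)] power_mono)
 have sixth: "1 < Re ((- l)^6)" if "B <= norm l" "Re l < - k*norm l" for l
 proof -
  have "norm l^1 <= norm l^6" using that B by (intro power_increasing) auto
  hence "1/c < norm l^6" using that B by simp
  hence "1 < c*norm l^6" using c by (simp add: field_simps)
  thus ?thesis using sector_sixth_power(1)[of "- l"] that(2) by (simp add: k_def c_def)
 qed
 define d where "d = cos (5/36*(pi/2))"
 have d: "0 < d" unfolding d_def by (rule cos_gt_zero) auto
 \<comment> \<open>The exponential divides out the expected growth, as |l|^(5/6) = |1 - i w|^(5/36),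
   and N takes care of small l.\<close>
 define h where "h w = sib a (- ((1 - \<i>*w) powr (1/6)))*exp (- of_real (A/d)*(1 - \<i>*w) powr (5/36))/of_real N" for w
 have nh: "norm (h w) = norm (sib a (- ((1 - \<i>*w) powr (1/6))))*exp (- (A/d)*Re ((1 - \<i>*w) powr (5/36)))/N" for w
  using N(1) by (simp add: h_def norm_mult norm_divide)
 have Re1: "1 <= Re (1 - \<i>*w)" if "0 <= Im w" for w using that by simp
 have nl: "norm ((1 - \<i>*w) powr (1/6)) = norm (1 - \<i>*w) powr (1/6)" for w by (simp add: norm_powr_real_powr')
 have ge: "d*norm (1 - \<i>*w) powr (5/36) <= Re ((1 - \<i>*w) powr (5/36))" if "0 <= Im w" for w
  using Re_powr_ge[of "1 - \<i>*w" "5/36"] Re1[OF that] by (simp add: d_def)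
  have e1: "exp (- (A/d)*Re ((1 - \<i>*w) powr (5/36))) <= exp (- (A*norm (1 - \<i>*w) powr (5/36)))" if "0 <= Im w" for w
  using mult_left_mono[OF ge[OF that], of "A/d"] A d by simp
 have hol: "h holomorphic_on {w. - 1 < Im w}" unfolding h_def
  by (intro holomorphic_intros holomorphic_on_compose_gen[OF _ sib_holomorphic(1)[where S = UNIV], unfolded o_def])
   (use N(1) in \<open>force simp: complex_nonpos_Reals_iff\<close>)+
 have bound: "norm (h w) <= 1" if "0 <= Im w" for w
 proof (rule phragmen_lindelof_half_plane[OF _ _ _ _ _ _ that])
  show "h holomorphic_on {w. 0 < Im w}" by (rule holomorphic_on_subset[OF hol]) auto
  show "continuous_on {w. 0 <= Im w} h"
   by (rule continuous_on_subset[OF holomorphic_on_imp_continuous_on[OF hol]]) auto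
  show "0 < exp (64*G)" "0 < 64*G" using G by auto
  fix w :: complex
  define l where "l = - ((1 - \<i>*w) powr (1/6))"
  have l: "norm l = norm (1 - \<i>*w) powr (1/6)" by (simp add: l_def nl)
  {
   assume "Im w = 0"
   have "norm (sib a l)*exp (- (A*norm l powr (5/6))) <= N"
   proof (cases "norm l <= B")
    case True
    have "norm (sib a l)*exp (- (A*norm l powr (5/6))) <= N*1" using N(1) N(2)[OF True] A by (intro mult_mono) auto
    thus ?thesis by simp
   next
    case False
    have "(- l)^6 = 1 - \<i>*w" by (simp add: l_def powr_def exp_of_nat_mult[of 6, simplified, symmetric])
    \<comment> \<open>On the boundary (- l)^6 has real part 1, whereas \<open>sixth\<close> makes it
      exceed 1 in the bad sector; so \<open>good\<close> applies.\<close>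
    hence "- k*norm l <= Re l" using sixth[of l] False \<open>Im w = 0\<close> by force
    hence "norm (sib a l)*exp (- (A*norm l powr (5/6))) <= exp (A*norm l powr (5/6))*exp (- (A*norm l powr (5/6)))"
     using good[of l] False B by (intro mult_right_mono) auto
    also have "... = 1" by (simp flip: exp_add)
    finally show ?thesis using N by simp
   qed
   moreover have "norm (sib a l)*exp (- (A/d)*Re ((1 - \<i>*w) powr (5/36))) <= norm (sib a l)*exp (- (A*norm l powr (5/6)))"
    using e1[of w] \<open>Im w = 0\<close> by (intro mult_left_mono) (auto simp: l powr_powr)
   ultimately show "norm (h w) <= 1" unfolding nh l_def[symmetric] using N by simp
  }
  assume w: "0 <= Im w"
  define r where "r = norm (1 - \<i>*w)"
  have r: "1 <= r" "r <= 1 + norm w" using complex_Re_le_cmod[of "1 - \<i>*w"] Re1[OF w] norm_triangle_ineq4[of 1 "\<i>*w"] by (auto simp: r_def norm_mult)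
  have "1 <= r powr (1/6)" using r by (simp add: ge_one_powr_ge_zero)
  hence "(1 + norm l)^5 <= (2*r powr (1/6))^5" by (intro power_mono) (auto simp: l r_def)
  also have "... = 32*r powr (5/6)" using r by (simp add: powr_power)
  also have "r powr (5/6) <= 2 + 2*norm w powr (5/6)"
  proof (cases "norm w <= 1")
   case True
   have "r powr (5/6) <= 2 powr 1" using r True by (intro powr_mono_both) auto
   thus ?thesis by (intro add_increasing2) auto
  next
   case False
   have "r powr (5/6) <= (2*norm w) powr (5/6)" using r False by (intro powr_mono2) auto
   also have "... <= 2 powr 1*norm w powr (5/6)" unfolding powr_mult by (intro mult_right_mono powr_mono) auto
   finally show ?thesis by simp
  qed
  finally have "G*(1 + norm l)^5 <= G*(64+64*norm w powr (5/6))" using G by (intro mult_left_mono) auto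
  hence "norm (sib a l) <= exp (64*G)*exp (64*G*norm w powr (5/6))"
   using G(2)[of l] by (auto simp: algebra_simps simp flip: exp_add intro: order_trans)
  moreover have "exp (- (A/d)*Re ((1 - \<i>*w) powr (5/36))) <= 1"
   by (rule order_trans[OF e1[OF w]]) (use A in simp)
  ultimately have "norm (sib a l)*exp (- (A/d)*Re ((1 - \<i>*w) powr (5/36))) <= exp (64*G)*exp (64*G*norm w powr (5/6))*1"
   by (intro mult_mono) auto
  thus "norm (h w) <= exp (64*G)*exp (64*G*norm w powr (5/6))"
   unfolding nh l_def[symmetric] using N(1) by (auto simp: divide_le_eq intro!: order_trans[OF _ mult_left_mono[OF N(1)]])
 qed
 have "norm (sib a l) <= N*exp (A/d*norm l powr (5/6))" for l
 proof (cases "norm l <= B | - k*norm l <= Re l")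
  case True
  have "1 <= exp (A/d*norm l powr (5/6))" "A*norm l powr (5/6) <= A/d*norm l powr (5/6)"
   using A d by (auto simp: d_def field_simps mult_left_le)
  thus ?thesis
  proof (cases "norm l <= B")
   case True
   show ?thesis using mult_mono[OF N(2)[OF True] \<open>1 <= exp _\<close>] N(1) by simp
  next
   case False
   hence "norm (sib a l) <= exp (A*norm l powr (5/6))" using good True B by auto
   also have "... <= 1*exp (A/d*norm l powr (5/6))" using \<open>A*_ <= _\<close> by simp
   also have "... <= N*exp (A/d*norm l powr (5/6))" using N(1) by (intro mult_right_mono) auto
   finally show ?thesis .
  qed
 next
  case False
  define w where "w = \<i>*((- l)^6 - 1)"
  have "0 <= Im w" using sixth[of l] False by (simp add: w_def)
  have z: "1 - \<i>*w = (- l)^6" by (simp add: w_def)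
  have "cos (pi/13)*norm (- l) < Re (- l)" using False by (simp add: k_def)
  note p = sector_sixth_power(2)[OF this]
  have "norm (sib a l)*exp (- (A/d)*Re ((l^6) powr (5/36))) <= N"
   using bound[OF \<open>0 <= Im w\<close>] N(1) p unfolding nh z by (simp add: divide_le_eq)
  hence "norm (sib a l) <= N*exp (A/d*Re ((l^6) powr (5/36)))" by (simp add: exp_minus field_simps)
  also have "Re ((l^6) powr (5/36)) <= norm l powr (5/6)"
   using complex_Re_le_cmod[of "(l^6) powr (5/36)"] norm_powr_real_powr'[of "5/36" "l^6"]
   by (simp add: norm_power powr_powr flip: powr_numeral)
  hence "N*exp (A/d*Re ((l^6) powr (5/36))) <= N*exp (A/d*norm l powr (5/6))"
   using A d N(1) by (intro mult_left_mono) (auto intro: divide_right_mono)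
  finally show ?thesis .
 qed
 thus ?thesis using N A d by (intro exI[of _ N] exI[of _ "A/d"]) auto
qed

definition unimodular_quotient :: "real => complex => complex" where
 "unimodular_quotient al l = rot_sib al l/cnj (rot_sib al (cnj l))"

lemma pi_5_cos: "0 <= cos (pi/5)" "cos (pi/5) < 1" "0 < sin (pi/5)"
proof -
 show "0 <= cos (pi/5)" by (rule less_imp_le, rule cos_gt_zero) auto
 show "cos (pi/5) < 1" using cos_monotone_0_pi[of 0 "pi/5"] by simp
 show "0 < sin (pi/5)" by (rule sin_gt_zero) auto
qed

text \<open>For Im l >= 0 the denominator of \<open>unimodular_quotient\<close> involves
  \<open>sib\<close> at angles between - pi/5 and 4 pi/5 only, where the asymptotics with k = cos
  (pi/5) are available.\<close>

lemma rot_Re_ge: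
 assumes "0 <= Im l" shows "- cos (pi/5)*norm l <= Re (cis (4*pi/5)*cnj l)"
proof -
 have "cis (4*pi/5) = - cis (- (pi/5))" unfolding minus_cis by (rule arg_cong[where f = cis]) simp
 hence "Re (cis (4*pi/5)*cnj l) = sin (pi/5)*Im l - cos (pi/5)*Re l" by simp
 moreover have "cos (pi/5)*Re l <= cos (pi/5)*norm l" using pi_5_cos by (intro mult_left_mono complex_Re_le_cmod)
 moreover have "0 <= sin (pi/5)*Im l" using assms pi_5_cos by simp
 ultimately show ?thesis by linarith
qed

text \<open>The numerator meets all angles and needs \<open>sib_growth\<close>; the denominator is
  bounded below by the asymptotics far out, and near 0 compactness suffices since it has no
  zeros.\<close>

lemma unimodular_quotient_growth:
 assumes "0 <= al"
 shows "EX M C. 0 < M & 0 < C & (ALL l. 0 <= Im l --> norm (unimodular_quotient al l) <= M*exp (C*norm l powr (5/6)))"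
proof -
 obtain M1 C1 where C1: "0 < M1" "0 < C1" "!!l. norm (sib (rot_coupling al) l) <= M1*exp (C1*norm l powr (5/6))"
  using sib_growth by blast
 obtain C2 where C2: "1 <= C2" "!!l. C2 <= norm l ==> - cos (pi/5)*norm l <= Re l ==> sib (rot_coupling al) l ~= 0 &
  abs (ln (norm (sib (rot_coupling al) l)) - action_const*Re (l powr (5/6))) <= C2*norm l powr (2/3)"
  using sib_asymptotics[OF pi_5_cos(1,2)] by blast
 define C where "C = C1 + (action_const+C2)"
 have C: "0 < C" using C1 C2 action_const_pos by (simp add: C_def)
 define S where "S = cball 0 C2 \<inter> {z. 0 <= Im z}"
 have hc: "continuous_on {z. 0 <= Im z} (unimodular_quotient al)" unfolding unimodular_quotient_def[abs_def]
  using assms by (intro continuous_on_divide holomorphic_on_imp_continuous_on rot_holomorphic rot_cnj_holomorphic) (auto simp: rot_sib_nonzero)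
 have "compact S" unfolding S_def by (intro compact_Int_closed closed_halfspace_Im_ge) auto
 moreover have "continuous_on S (unimodular_quotient al)" using hc by (rule continuous_on_subset) (auto simp: S_def)
 ultimately have "bounded (unimodular_quotient al ` S)" by (intro compact_imp_bounded compact_continuous_image)
 then obtain M where M: "!!l. l : S ==> norm (unimodular_quotient al l) <= M" by (auto simp: bounded_iff)
 have "norm (unimodular_quotient al l) <= max M1 M*exp (C*norm l powr (5/6))" if l: "0 <= Im l" for l
 proof (cases "norm l <= C2")
  case True
  hence "norm (unimodular_quotient al l) <= max M1 M" using M[of l] l by (auto simp: S_def)
  also have "... <= max M1 M*exp (C*norm l powr (5/6))"
   using C C1(1) mult_left_mono[of 1 "exp (C*norm l powr (5/6))" "max M1 M"] by simp
  finally show ?thesis .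
 next
  case False
  hence b: "C2 <= norm l" "1 <= norm l" using C2 by auto
  define m where "m = cis (4*pi/5)*cnj l"
  have nm: "norm m = norm l" by (simp add: m_def norm_mult)
  have up: "norm (rot_sib al l) <= M1*exp (C1*norm l powr (5/6))"
   using C1(3)[of "cis (4*pi/5)*l"] by (simp add: rot_sib_def norm_mult)
  have lo: "sib (rot_coupling al) m ~= 0 & abs (ln (norm (sib (rot_coupling al) m)) - action_const*Re (m powr (5/6))) <= C2*norm l powr (2/3)"
   using C2(2)[of m] b rot_Re_ge[OF l, folded m_def] by (simp add: nm)
  have "abs (Re (m powr (5/6))) <= norm l powr (5/6)"
   using abs_Re_le_cmod[of "m powr (5/6)"] norm_powr_real_powr'[of "5/6" m] by (simp add: nm)
  hence "action_const*Re (m powr (5/6)) >= action_const*- (norm l powr (5/6))"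
   using action_const_pos by (intro mult_left_mono) auto
  moreover have "C2*norm l powr (2/3) <= C2*norm l powr (5/6)" using C2 b by (intro mult_left_mono powr_mono) auto
  ultimately have "- ((action_const+C2)*norm l powr (5/6)) <= ln (norm (sib (rot_coupling al) m))"
   using lo by (simp add: distrib_right) linarith
  hence lo': "exp (- ((action_const+C2)*norm l powr (5/6))) <= norm (sib (rot_coupling al) m)"
   using lo by (simp add: ln_ge_iff)
  have "norm (unimodular_quotient al l) = norm (rot_sib al l)/norm (sib (rot_coupling al) m)"
   by (simp add: unimodular_quotient_def norm_divide rot_sib_def m_def)
  also have "... <= M1*exp (C1*norm l powr (5/6))/exp (- ((action_const+C2)*norm l powr (5/6)))"
   using up lo' C1(1) by (intro frac_le) auto
  also have "... = M1*exp (C*norm l powr (5/6))"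
   unfolding times_divide_eq_right[symmetric] exp_diff[symmetric] by (simp add: C_def distrib_right)
  also have "... <= max M1 M*exp (C*norm l powr (5/6))" by simp
  finally show ?thesis .
 qed
 thus ?thesis using C C1(1) by (intro exI[of _ "max M1 M"] exI[of _ C]) auto
qed

lemma powr_cis_5_6:
 assumes "0 < R" "- pi < th" "th <= pi" shows "Re ((cis th * of_real R) powr (5/6)) = R powr (5/6)*cos (5/6*th)"
 using powr_cis[OF assms, of "5/6"] by simp

text \<open>Serves to exclude the constant case of the maximum principle. At i t numerator and
  denominator sit at the angles - 7 pi/10 and 3 pi/10, and five sixths of these give the rates cos
  (7 pi/12) < cos (pi/4).\<close>

lemma unimodular_quotient_imaginary: "EX t>0. norm (unimodular_quotient al (\<i> * of_real t)) < 1"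
proof -
 obtain C where C: "1 <= C" "!!l. C <= norm l ==> - cos (pi/5)*norm l <= Re l ==> sib (rot_coupling al) l ~= 0 &
  abs (ln (norm (sib (rot_coupling al) l)) - action_const*Re (l powr (5/6))) <= C*norm l powr (2/3)"
  using sib_asymptotics[OF pi_5_cos(1,2)] by blast
 define d where "d = action_const*(cos (pi/4) - cos (7*pi/12))"
 have "cos (7*pi/12) < cos (pi/4)" by (intro cos_monotone_0_pi) auto
 hence d: "0 < d" using action_const_pos by (simp add: d_def)
 have "filterlim (%t::real. d*t powr (5/6) - 2*C*t powr (2/3)) at_top at_top" using d C(1) by real_asymp
 hence "\<forall>\<^sub>F t in at_top. 1 <= d*t powr (5/6) - 2*C*t powr (2/3)" by (auto simp: filterlim_at_top)
 hence "\<forall>\<^sub>F t in at_top. 1 <= d*t powr (5/6) - 2*C*t powr (2/3) & C <= t"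
  using eventually_ge_at_top[of C] by eventually_elim auto
 then obtain t where t: "1 <= d*t powr (5/6) - 2*C*t powr (2/3)" "C <= t"
  using eventually_happens'[OF trivial_limit_at_top_linorder] by blast
 hence t0: "0 < t" using C by simp
 let ?f = "%th. sib (rot_coupling al) (cis th * of_real t)"
 have e: "cis (4*pi/5)*(\<i> * of_real t) = cis (- (7*pi/10)) * of_real t"
  "cis (4*pi/5)*cnj (\<i> * of_real t) = cis (3*pi/10) * of_real t"
 proof -
  have 1: "cis (4*pi/5)*\<i> = cis (- (7*pi/10) + 2*pi)" unfolding cis_pi_half[symmetric] cis_mult by (rule arg_cong[where f = cis]) simp
  show "cis (4*pi/5)*(\<i> * of_real t) = cis (- (7*pi/10)) * of_real t"
   unfolding mult.assoc[symmetric] 1 cis_2pi cis_mult[symmetric] by simp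
  have 2: "cis (4*pi/5)*- \<i> = cis (3*pi/10)" unfolding cis_minus_pi_half[symmetric] cis_mult by (rule arg_cong[where f = cis]) simp
  show "cis (4*pi/5)*cnj (\<i> * of_real t) = cis (3*pi/10) * of_real t" unfolding 2[symmetric] by simp
 qed
 have c7: "- cos (pi/5) <= cos (7*pi/10)"
  using cos_monotone_0_pi[of "7*pi/10" "4*pi/5"] cos_periodic_pi2[of "- (pi/5)"] by (simp)
  have "- (7*pi/10) <= pi" using pi_gt_zero by linarith
 hence p7: "Re ((cis (- (7*pi/10)) * of_real t) powr (5/6)) = t powr (5/6)*cos (7*pi/12)"
  using powr_cis_5_6[of t "- (7*pi/10)"] t0 by simp
 have n7: "?f (- (7*pi/10)) ~= 0 & abs (ln (norm (?f (- (7*pi/10)))) - action_const*(t powr (5/6)*cos (7*pi/12))) <= C*t powr (2/3)"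
  using C(2)[of "cis (- (7*pi/10)) * of_real t"] t t0 mult_right_mono[OF c7, of t] p7 by (simp add: norm_mult)
 have c3: "0 < cos (3*pi/10)" by (rule cos_gt_zero; simp)
 have n3: "?f (3*pi/10) ~= 0 & abs (ln (norm (?f (3*pi/10))) - action_const*(t powr (5/6)*cos (pi/4))) <= C*t powr (2/3)"
  using C(2)[of "cis (3*pi/10) * of_real t"] t t0 mult_nonneg_nonneg[OF pi_5_cos(1) less_imp_le[OF t0]] mult_pos_pos[OF c3 t0]
  by (simp add: norm_mult powr_cis_5_6)
 have "d*t powr (5/6) = action_const*(t powr (5/6)*cos (pi/4)) - action_const*(t powr (5/6)*cos (7*pi/12))"
  by (simp add: d_def algebra_simps)
 hence "ln (norm (?f (- (7*pi/10)))) < ln (norm (?f (3*pi/10)))" using n7 n3 t(1) by linarith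
 hence "norm (?f (- (7*pi/10))) < norm (?f (3*pi/10))" using n7 n3 by simp
 hence "norm (unimodular_quotient al (\<i> * of_real t)) < 1"
  unfolding unimodular_quotient_def norm_divide rot_sib_def e by (simp add: divide_less_eq)
 thus ?thesis using t0 by blast
qed

text \<open>On the real axis numerator and denominator are conjugate, so Phragmen-Lindelof gives
  modulus at most 1; an interior value of modulus 1 would make the quotient constant.\<close>

lemma unimodular_quotient_less_1:
 assumes al: "0 <= al" and l: "0 < Im l" shows "norm (unimodular_quotient al l) < 1"
proof -
 let ?h = "unimodular_quotient al" and ?U = "{z. 0 < Im z}"
 obtain M C where MC: "0 < M" "0 < C" "!!l. 0 <= Im l ==> norm (?h l) <= M*exp (C*norm l powr (5/6))"
  using unimodular_quotient_growth[OF al] by blast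
 have hol: "?h holomorphic_on ?U" unfolding unimodular_quotient_def[abs_def]
  using al by (intro holomorphic_intros rot_holomorphic rot_cnj_holomorphic) (auto simp: rot_sib_nonzero)
 have cont: "continuous_on {z. 0 <= Im z} ?h" unfolding unimodular_quotient_def[abs_def]
  using al by (intro continuous_on_divide holomorphic_on_imp_continuous_on rot_holomorphic rot_cnj_holomorphic) (auto simp: rot_sib_nonzero)
 have real: "norm (?h z) <= 1" if "Im z = 0" for z
 proof -
  have "cnj z = z" using that by (simp add: complex_eq_iff)
  thus ?thesis by (simp add: unimodular_quotient_def norm_divide)
 qed
 have le: "norm (?h z) <= 1" if "0 <= Im z" for z
  by (rule phragmen_lindelof_half_plane[OF hol cont real MC(3) MC(1,2) that])
 show ?thesis
 proof (rule ccontr)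
  assume "~?thesis"
  hence h1: "norm (?h l) = 1" using le[of l] l by simp
  have "?h constant_on ?U"
  proof (rule maximum_modulus_principle[OF hol])
   show "open ?U" by (rule open_halfspace_Im_gt)
   show "connected ?U" by (intro convex_connected convex_halfspace_Im_gt)
   show "open ?U" by (rule open_halfspace_Im_gt)
   show "l : ?U" using l by simp
   show "norm (?h z) <= norm (?h l)" if "z : ?U" for z using le[of z] that h1 by simp
  qed simp
  then obtain c where c: "!!z. z : ?U ==> ?h z = c" by (auto simp: constant_on_def)
  obtain t where "0 < t" "norm (?h (\<i> * of_real t)) < 1" using unimodular_quotient_imaginary by blast
  thus False using c[of l] c[of "\<i> * of_real t"] l h1 by simp
 qed
qed

lemma spec_det_nonreal:
 assumes al: "0 <= al" and l: "Im l ~= 0" shows "spec_det al l ~= 0"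
proof -
 have up: "spec_det al l ~= 0" if "0 < Im l" for l
 proof
  assume "spec_det al l = 0"
  hence "cis (3*pi/10)*cnj (rot_sib al (cnj l)) = cis (- (3*pi/10))*rot_sib al l"
   using spec_det_mult_sib[of al l] by simp
  hence "norm (cnj (rot_sib al (cnj l))) = norm (rot_sib al l)" by (metis norm_mult norm_cis mult_1)
  moreover have "rot_sib al (cnj l) ~= 0" using al that by (intro rot_sib_nonzero) auto
  moreover have "rot_sib al l ~= 0" using calculation by auto
  ultimately have "norm (unimodular_quotient al l) = 1" by (simp add: unimodular_quotient_def norm_divide)
  thus False using unimodular_quotient_less_1[OF al that] by simp
 qed
 show ?thesis
 proof (cases "0 < Im l")
  case False
  hence "spec_det al (cnj l) ~= 0" using l by (intro up) simp
  thus ?thesis by (simp add: spec_det_cnj)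
 qed (rule up)
qed

section \<open>Phase on the positive axis and counting of the zeros\<close>

text \<open>A whole sector around the positive axis, and not just the axis, must be rotated into the
  region of the asymptotics, to leave room for the discs of a Cauchy estimate; hence k halfway
  between cos (pi/5) and 1.\<close>

lemma rot_sector:
 fixes z :: complex
 defines "dl == (1 - cos (pi/5))/2" and "k == (1 + cos (pi/5))/2"
 assumes z: "abs (Im z) <= dl*Re z" "0 < Re z"
 shows "- k*norm z <= Re (cis (4*pi/5)*z)" "cis (4*pi/5)*z ~: nonpos_Reals"
proof -
 have "cis (4*pi/5) = - cis (- (pi/5))" unfolding minus_cis by (rule arg_cong[where f = cis]) simp
 hence R: "Re (cis (4*pi/5)*z) = - cos (pi/5)*Re z - sin (pi/5)*Im z" by simp
 have dl: "0 < dl" using pi_5_cos by (simp add: dl_def)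
 have "sin (pi/5)*Im z <= dl*norm z"
 proof -
  have "sin (pi/5)*Im z <= abs (sin (pi/5))*abs (Im z)" by (metis abs_ge_self abs_mult)
  also have "... <= 1*abs (Im z)" by (intro mult_right_mono) auto
  also have "... <= dl*Re z" using z by simp
  also have "... <= dl*norm z" using dl by (intro mult_left_mono complex_Re_le_cmod) auto
  finally show ?thesis .
 qed
 moreover have "cos (pi/5)*Re z <= cos (pi/5)*norm z" using pi_5_cos by (intro mult_left_mono complex_Re_le_cmod)
 moreover have "k = cos (pi/5) + dl" by (simp add: k_def dl_def field_simps)
 ultimately show 1: "- k*norm z <= Re (cis (4*pi/5)*z)" unfolding R by (simp add: algebra_simps)
 show "cis (4*pi/5)*z ~: nonpos_Reals"
 proof
  assume "cis (4*pi/5)*z : nonpos_Reals"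
  hence "Re (cis (4*pi/5)*z) = - norm (cis (4*pi/5)*z)"
   by (simp add: complex_nonpos_Reals_iff cmod_eq_Re del: times_complex.sel)
  hence "(1-k)*norm z <= 0" using 1 by (simp add: norm_mult left_diff_distrib)
  moreover have "0 < (1-k)*norm z" using pi_5_cos z by (intro mult_pos_pos) (auto simp: k_def)
  ultimately show False by simp
 qed
qed

text \<open>Cauchy's inequality for exp (f/B), whose modulus lies between 1/e and e on the disc:
  control of the real part alone is enough for the derivative.\<close>

lemma norm_deriv_le_of_Re:
 assumes hol: "f holomorphic_on S" and S: "open S" "cball z r <= S" and r: "0 < r" and B: "0 < B"
  and Re: "!!w. w : cball z r ==> abs (Re (f w)) <= B" shows "norm (deriv f z) <= (exp 1)^2*B/r"
proof -
 define g where "g w = exp (f w/of_real B)" for w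
 have hg: "g holomorphic_on S" unfolding g_def using B by (intro holomorphic_intros hol) auto
 have ng: "norm (g w) = exp (Re (f w)/B)" for w by (simp add: g_def)
 have z: "z : S" using S r by auto
 have "norm ((deriv ^^ 1) g z) <= fact 1*exp 1/r^1"
 proof (rule Cauchy_inequality)
  show "g holomorphic_on ball z r" using hg S ball_subset_cball by (blast intro: holomorphic_on_subset)
  show "continuous_on (cball z r) g" using hg S by (blast intro: holomorphic_on_imp_continuous_on continuous_on_subset)
  fix x assume "norm (z-x) = r"
  hence "abs (Re (f x)) <= B" by (intro Re) (simp add: dist_norm)
  thus "norm (g x) <= exp 1" unfolding ng using B by (simp)
 qed (rule r)
 moreover have "deriv g z = deriv f z/of_real B*g z" unfolding g_def using holomorphic_derivI[OF hol S(1) z] B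
  by (intro DERIV_imp_deriv) (auto intro!: derivative_eq_intros)
 moreover have "exp (- 1) <= norm (g z)"
 proof -
  have "- B <= Re (f z)" using Re[of z] r by simp
  thus ?thesis unfolding ng using B by (simp add: le_divide_eq)
 qed
 ultimately have "norm (deriv f z)/B*norm (g z) <= exp 1/r" using B by (simp add: norm_mult norm_divide)
 moreover have "norm (deriv f z)/B*exp (- 1) <= norm (deriv f z)/B*norm (g z)"
  using B \<open>exp (- 1) <= norm (g z)\<close> by (intro mult_left_mono) auto
 ultimately have "norm (deriv f z)/B*exp (- 1)*(exp 1*B) <= exp 1/r*(exp 1*B)"
  using B by (intro mult_right_mono) auto
 moreover have "norm (deriv f z)/B*exp (- 1)*(exp 1*B) = norm (deriv f z)" using B by (simp add: exp_minus)
 ultimately show ?thesis by (simp add: power2_eq_square)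
qed

text \<open>On a sector \<open>rot_sib\<close> has a holomorphic logarithm F, whose real part is
  known up to O(|z|^(2/3)). So the error term has derivative O(t^(-1/3)) on the axis, and
  integration gives the imaginary part, which is the phase. The angle 2 pi/3 is five sixths of 4
  pi/5.\<close>

theorem phase_function: shows "EX R C Th Th'. 1 <= R & 0 < C & (ALL t>=R.
  rot_sib al (of_real t) = of_real (norm (rot_sib al (of_real t)))*cis (3*pi/10 + Th t) &
  rot_sib al (of_real t) ~= 0 &
  (Th has_real_derivative Th' t) (at t) &
  abs (Th' t - 5/6*action_const * sin (2*pi/3)*t powr (- 1/6)) <= C*t powr (- 1/3) &
  abs (Th t - action_const * sin (2*pi/3)*t powr (5/6)) <= C*t powr (2/3) &
  abs (ln (norm (rot_sib al (of_real t))) - action_const*cos (2*pi/3)*t powr (5/6)) <= C*t powr (2/3) &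
  norm (rot_dsib al (of_real t)) <= C * sqrt t*norm (rot_sib al (of_real t)))"
proof -
 define dl k where "dl = (1 - cos (pi/5))/2" and "k = (1 + cos (pi/5))/2"
 have dl: "0 < dl" "dl < 1" and k: "0 <= k" "k < 1" using pi_5_cos by (auto simp: dl_def k_def)
 let ?c = "cis (4*pi/5)"
 obtain C where C: "1 <= C" "!!l. C <= norm l ==> - k*norm l <= Re l ==> sib (rot_coupling al) l ~= 0 &
  abs (ln (norm (sib (rot_coupling al) l)) - action_const*Re (l powr (5/6))) <= C*norm l powr (2/3) &
  norm (dsib (rot_coupling al) l) <= C * sqrt (norm l)*norm (sib (rot_coupling al) l)"
  using sib_asymptotics[OF k] by blast
 \<comment> \<open>Convexity provides the logarithm, and the apex at C keeps every point in the
   range of the asymptotics.\<close>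
 define V where "V = {z. abs (Im z) < dl*(Re z - C)}"
 have V: "open V" "convex V"
 proof -
  have e: "V = {z. Im z - dl*Re z < - dl*C} \<inter> {z. - Im z - dl*Re z < - dl*C}"
   by (auto simp: V_def algebra_simps)
  have "{z. Im z - dl*Re z < - dl*C} = {z. Complex (- dl) 1 \<bullet> z < - dl*C}"
   "{z. - Im z - dl*Re z < - dl*C} = {z. Complex (- dl) (- 1) \<bullet> z < - dl*C}"
   by (auto simp: inner_complex_def)
  thus "open V" "convex V" unfolding e by (auto intro!: convex_Int open_halfspace_lt convex_halfspace_lt)
 qed
 have Vsub: "abs (Im z) <= dl*Re z" "C < Re z" "C <= norm z" if "z : V" for z
 proof -
  have 1: "abs (Im z) < dl*(Re z - C)" using that by (simp add: V_def)
  hence "0 < dl*(Re z - C)" by (rule le_less_trans[OF abs_ge_zero])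
  thus 2: "C < Re z" using dl by (simp add: zero_less_mult_iff)
  have "0 <= dl*C" using dl C by simp
  thus "abs (Im z) <= dl*Re z" using 1 by (simp add: right_diff_distrib)
  show "C <= norm z" using 2 complex_Re_le_cmod[of z] by linarith
 qed
 have sect: "- k*norm (?c*z) <= Re (?c*z)" "?c*z ~: nonpos_Reals" if "z : V" for z
  using rot_sector[of z, folded dl_def k_def] Vsub[OF that] C by (auto simp: norm_mult)
 have nz: "rot_sib al z ~= 0"
  and as: "abs (ln (norm (rot_sib al z)) - action_const*Re ((?c*z) powr (5/6))) <= C*norm z powr (2/3)"
  and ds: "norm (rot_dsib al z) <= C * sqrt (norm z)*norm (rot_sib al z)" if "z : V" for z
  using C(2)[OF _ sect(1)[OF that]] Vsub[OF that] by (auto simp: rot_sib_def rot_dsib_def norm_mult)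
 have real_V: "complex_of_real t : V" if "C < t" for t using that dl by (simp add: V_def)
 have "complex_of_real (C+1) : V" by (rule real_V) simp
 with holomorphic_logarithm_exists[OF V(2,1) rot_holomorphic(1) nz]
 obtain F where F: "F holomorphic_on V" "!!z. z : V ==> exp (F z) = rot_sib al z" by metis
 define E where "E z = F z - of_real action_const*(?c*z) powr (5/6)" for z
 have E: "E holomorphic_on V" unfolding E_def by (intro holomorphic_intros F) (use sect in auto)
 have ReE: "abs (Re (E z)) <= C*norm z powr (2/3)" if "z : V" for z
  using as[OF that] by (simp add: E_def F(2)[OF that, symmetric])
 define C1 where "C1 = (exp 1)^2*(C*2 powr (2/3))*(4/dl)"
 have C1: "0 < C1" using C dl by (auto simp: C1_def)
 define R where "R = 2*C"
 have R: "1 <= R" "C < R" using C by (auto simp: R_def)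
 have dE: "norm (deriv E (of_real t)) <= C1*t powr (- 1/3)" if t: "R <= t" for t
 proof -
  define r where "r = dl*t/4"
  have tC: "2*C <= t" and t0: "0 < t" using t C by (auto simp: R_def)
  have r: "0 < r" "r <= t" using dl t0 by (auto simp: r_def)
  have sub: "cball (of_real t) r <= V"
  proof
   fix w :: complex assume "w : cball (of_real t) r"
   hence w: "norm (w - of_real t) <= r" by (simp add: dist_norm norm_minus_commute)
   have "abs (Im w) <= r" "t - r <= Re w" using abs_Im_le_cmod[of "w - of_real t"] abs_Re_le_cmod[of "w - of_real t"] w by auto
   have "t/2 <= t - C" using tC by simp
   have "t/4 < t - C - r" using tC t0 dl mult_strict_right_mono[OF dl(2) t0] unfolding r_def by linarith
   hence "dl*(t/4) < dl*(Re w - C)" using dl \<open>t - r <= Re w\<close> by (intro mult_strict_left_mono) auto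
   thus "w \<in> V" using \<open>abs (Im w) <= r\<close> by (simp add: V_def r_def)
  qed
  have "norm (deriv E (of_real t)) <= (exp 1)^2*(C*(2*t) powr (2/3))/r"
  proof (rule norm_deriv_le_of_Re[OF E V(1) sub r(1)])
   show "0 < C*(2*t) powr (2/3)" using C t0 by simp
   fix w :: complex assume w: "w : cball (of_real t) r"
   hence "norm w <= t + r" using norm_triangle_ineq3[of w "of_real t"] t0 by (auto simp: dist_norm norm_minus_commute)
   hence "C*norm w powr (2/3) <= C*(2*t) powr (2/3)" using r C by (intro mult_left_mono powr_mono2) auto
   thus "abs (Re (E w)) <= C*(2*t) powr (2/3)" using ReE[of w] w sub by fastforce
  qed
  also have "... = C1*(t powr (2/3)/t)" by (simp add: C1_def r_def powr_mult)
  also have "t powr (2/3)/t = t powr (- 1/3)" using t0 powr_diff[of t "2/3" 1] by simp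
  finally show ?thesis .
 qed
 define phi where "phi t = Im (E (of_real t))" for t :: real
 have E': "((%t. E (of_real t)) has_vector_derivative deriv E (of_real t)) (at t)" if "R <= t" for t
  using that R by (intro has_vector_derivative_real_field holomorphic_derivI[OF E V(1)] real_V) simp
 have phi': "(phi has_real_derivative Im (deriv E (of_real t))) (at t)" if "R <= t" for t
  unfolding phi_def[abs_def] has_real_derivative_iff_has_vector_derivative
  by (rule bounded_linear.has_vector_derivative[OF bounded_linear_Im E'[OF that]])
 have phi_le: "abs (phi t) <= (abs (phi R) + 3/2*C1)*t powr (2/3)" if t: "R <= t" for t
 proof -
  have "norm (E (of_real t) - E (of_real R)) <= 3/2*C1*t powr (2/3) - 3/2*C1*R powr (2/3)"
  proof (rule norm_increment_le[OF t, where f = "%t. E (of_real t)" and f' = "%t. deriv E (of_real t)" and phi' = "%t. C1*t powr (- 1/3)"])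
   show "continuous_on {R..t} (%t. E (of_real t))"
    by (intro continuous_at_imp_continuous_on ballI has_vector_derivative_continuous[OF E']) simp
   show "continuous_on {R..t} (%t. 3/2*C1*t powr (2/3))" using R by (intro continuous_intros) auto
   fix x assume x: "R < x" "x < t"
   show "((%t. E (of_real t)) has_vector_derivative deriv E (of_real x)) (at x)" using x by (intro E') simp
   show "((%t. 3/2*C1*t powr (2/3)) has_real_derivative C1*x powr (- 1/3)) (at x)"
    using x R by (auto intro!: derivative_eq_intros)
   show "norm (deriv E (of_real x)) <= C1*x powr (- 1/3)" using dE[of x] x by simp
  qed
  hence "abs (phi t - phi R) <= 3/2*C1*t powr (2/3) - 3/2*C1*R powr (2/3)"
   using abs_Im_le_cmod[of "E (of_real t) - E (of_real R)"] by (simp add: phi_def)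
  moreover have "0 <= 3/2*C1*R powr (2/3)" using C1 by simp
  moreover have "abs (phi R)*1 <= abs (phi R)*t powr (2/3)" using t R by (intro mult_left_mono ge_one_powr_ge_zero) auto
  ultimately show ?thesis unfolding distrib_right by linarith
 qed
 have pw: "(?c * of_real t) powr (5/6) = of_real (t powr (5/6))*cis (2*pi/3)" if "R <= t" for t
  using powr_cis[of t "4*pi/5" "5/6"] that R by simp
 \<comment> \<open>The shift 3 pi/10 is the angle in \<open>stokes_wronskian\<close>; with it
   \<open>spec_det_mult_sib\<close> becomes a multiple of sin Th.\<close>
 define Th where "Th t = phi t + action_const * sin (2*pi/3)*t powr (5/6) - 3*pi/10" for t
 have ImF: "Im (F (of_real t)) = Th t + 3*pi/10" if "R <= t" for t
  using pw[OF that] by (simp add: Th_def phi_def E_def)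
 define D where "D = max (max C C1) (abs (phi R) + 3/2*C1+3*pi/10)"
 have D: "C <= D" "C1 <= D" "abs (phi R) + 3/2*C1+3*pi/10 <= D" by (auto simp: D_def)
 have le: "x*p <= D*p" if "x <= D" "0 <= p" for x p using that by (rule mult_right_mono)
 show ?thesis
 proof (rule exI[of _ R], rule exI[of _ D], rule exI[of _ Th], rule exI[of _ "%t. Im (deriv E (of_real t)) + 5/6*action_const * sin (2*pi/3)*t powr (- 1/6)"], intro conjI allI impI)
  show "1 <= R" "0 < D" using R C D by auto
  fix t assume t: "R <= t"
  have V: "complex_of_real t : V" using t R by (intro real_V) simp
  have t1: "1 <= t powr (2/3)" using t R by (intro ge_one_powr_ge_zero) auto
  show "rot_sib al (of_real t) ~= 0" by (rule nz[OF V])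
  have "rot_sib al (of_real t) = of_real (exp (Re (F (of_real t))))*cis (Im (F (of_real t)))"
   using F(2)[OF V] exp_eq_polar by metis
  thus "rot_sib al (of_real t) = of_real (norm (rot_sib al (of_real t)))*cis (3*pi/10 + Th t)"
   unfolding ImF[OF t] by (simp add: norm_mult add.commute)
  show "(Th has_real_derivative Im (deriv E (of_real t)) + 5/6*action_const * sin (2*pi/3)*t powr (- 1/6)) (at t)"
   unfolding Th_def[abs_def] using phi'[OF t] t R by (auto intro!: derivative_eq_intros)
  have "C1*t powr (- 1/3) <= D*t powr (- 1/3)" by (intro le D) simp
  thus "abs (Im (deriv E (of_real t)) + 5/6*action_const * sin (2*pi/3)*t powr (- 1/6) - 5/6*action_const * sin (2*pi/3)*t powr (- 1/6)) <= D*t powr (- 1/3)"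
   using dE[OF t] abs_Im_le_cmod[of "deriv E (of_real t)"] by simp
  have "abs (Th t - action_const * sin (2*pi/3)*t powr (5/6)) <= abs (phi t) + 3*pi/10*t powr (2/3)"
   using mult_left_mono[OF t1, of "3*pi/10"] pi_gt_zero unfolding Th_def by linarith
  also have "... <= (abs (phi R) + 3/2*C1+3*pi/10)*t powr (2/3)" using phi_le[OF t] by (simp add: distrib_right)
  also have "... <= D*t powr (2/3)" by (intro le D) simp
  finally show "abs (Th t - action_const * sin (2*pi/3)*t powr (5/6)) <= D*t powr (2/3)" .
    have 1: "C*t powr (2/3) <= D*t powr (2/3)" by (intro le D) simp
  show "abs (ln (norm (rot_sib al (of_real t))) - action_const*cos (2*pi/3)*t powr (5/6)) <= D*t powr (2/3)"
   using order_trans[OF as[OF V, unfolded pw[OF t]], of "D*t powr (2/3)"] 1 t R by (simp add: mult_ac)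
    have 2: "C*(sqrt t*norm (rot_sib al (of_real t))) <= D*(sqrt t*norm (rot_sib al (of_real t)))" using t R by (intro le D) simp
  show "norm (rot_dsib al (of_real t)) <= D * sqrt t*norm (rot_sib al (of_real t))"
   using order_trans[OF ds[OF V, unfolded mult.assoc], of "D*(sqrt t*norm (rot_sib al (of_real t)))"] 2 t R by (simp)
 qed
qed

lemma strict_mono_range_unique:
 fixes f g :: "nat => 'a::linorder"
 assumes f: "strict_mono f" and g: "strict_mono g" and fg: "range f = range g" shows "f = g"
proof
 fix n
 show "f n = g n"
 proof (induction n rule: less_induct)
  case (less n)
  obtain i where i: "f n = g i" using fg by blast
  obtain j where j: "g n = f j" using fg by (metis rangeE rangeI)
  have "n <= i"
  proof (rule ccontr)
   assume "~n <= i"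
   hence "f n = f i" using less i by simp
   thus False using f \<open>~n <= i\<close> by (simp add: strict_mono_eq)
  qed
  moreover have "n <= j"
  proof (rule ccontr)
   assume "~n <= j"
   hence "g n = g j" using less j by simp
   thus False using g \<open>~n <= j\<close> by (simp add: strict_mono_eq)
  qed
  ultimately show ?case using i j f g by (metis strict_mono_less_eq order.antisym)
 qed
qed

text \<open>The enumeration is the inverse of the rank, the number of smaller elements of S.\<close>

lemma strict_mono_enumeration:
 fixes S :: "'a::linorder set"
 assumes inf: "infinite S" and fin: "!!b. finite {x : S. x <= b}"
 obtains f :: "nat => 'a" where "strict_mono f" "range f = S"
proof -
 define r where "r x = card {y : S. y < x}" for x
 have fin': "finite {y : S. y < x}" for x by (rule finite_subset[OF _ fin[of x]]) auto
 have mono: "r x < r y" if "x : S" "x < y" for x y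
  unfolding r_def using that by (intro psubset_card_mono fin') auto
 hence inj: "inj_on r S" by (metis inj_onI linorder_neqE order_less_irrefl)
 have "n : r ` S" for n
 proof -
  have "infinite (r ` S)" using inf inj by (simp add: finite_image_iff)
  then obtain x where "x : S" "n <= r x" unfolding infinite_nat_iff_unbounded_le by blast
  thus ?thesis
  proof (induction "r x" arbitrary: x rule: less_induct)
   case less
   show ?case
   proof (cases "r x = n")
    case False
    hence "{y : S. y < x} ~= {}" using less.prems(2) unfolding r_def by (metis card.empty le_zero_eq)
    define m where "m = Max {y : S. y < x}"
    have m: "m \<in> S" "m < x" using Max_in[OF fin' \<open>{y \<in> S. y < x} ~= {}\<close>] by (auto simp: m_def)
    have "{y : S. y < x} = insert m {y : S. y < m}" using m Max_ge[OF fin', of _ x] by (fastforce simp: m_def)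
    hence "r x = Suc (r m)" unfolding r_def using fin'[of m] by simp
    thus ?thesis using less.hyps[of m] m False less.prems by auto
   qed (use less in auto)
  qed
 qed
 hence im: "r ` S = UNIV" by auto
 define f where "f = inv_into S r"
 have f: "f n : S" "r (f n) = n" for n using im by (auto simp: f_def inv_into_into f_inv_into_f)
 have "strict_mono f"
 proof (rule strict_monoI)
  fix m n :: nat assume "m < n"
  thus "f m < f n" using mono[of "f n" "f m"] f by (metis linorder_neqE not_less_iff_gr_or_eq)
 qed
 moreover have "range f = S"
 proof (intro equalityI subsetI)
  fix x assume "x : S"
  hence "x = f (r x)" using f(1)[of "r x"] f(2)[of "r x"] inj by (simp add: inj_on_eq_iff)
  thus "x : range f" by (rule range_eqI)
 qed (use f in auto)
 ultimately show thesis by (rule that)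
qed

text \<open>At a zero of g continuity of f is enough for the product rule. It is meant for
  |\<open>rot_sib\<close>| sin Th, of whose first factor only continuity is at hand.\<close>

lemma mult_zero_has_derivative:
 fixes f g :: "real => real"
 assumes "(g has_real_derivative D) (at x)" "g x = 0" "isCont f x"
 shows "((%x. f x*g x) has_real_derivative f x*D) (at x)"
proof -
 have "tendsto (%y. f y*((g y - g x)/(y-x))) (f x*D) (at x)"
  using assms by (intro tendsto_mult) (auto simp: has_field_derivative_iff isCont_def)
 thus ?thesis using assms(2) by (simp add: has_field_derivative_iff)
qed

lemma spec_det_mult_sib_real:
 assumes "rot_sib al (of_real t) = of_real rh*cis (3*pi/10+th)"
 shows "spec_det al (of_real t) * sib (- of_real al) (of_real t) = - 4*\<i> * of_real (rh * sin th)"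
proof -
 have "spec_det al (of_real t) * sib (- of_real al) (of_real t) = 2 * of_real rh*(cis (3*pi/10)*cnj (cis (3*pi/10+th))) - 2 * of_real rh*(cis (- (3*pi/10))*cis (3*pi/10+th))"
  unfolding spec_det_mult_sib by (simp add: assms)
 also have "cis (3*pi/10)*cnj (cis (3*pi/10+th)) = cis (- th)" unfolding cis_cnj cis_mult by simp
 also have "cis (- (3*pi/10))*cis (3*pi/10+th) = cis th" unfolding cis_mult by simp
 finally show ?thesis by (simp add: complex_eq_iff)
qed

lemma powr_quotient_limit:
 fixes g :: "real => real"
 assumes "!!t. R <= t ==> abs (g t - c*t powr (5/6)) <= C*t powr (2/3)"
 shows "tendsto (%t. g t/t powr (5/6)) c at_top"
proof (rule LIM_zero_cancel, rule Lim_null_comparison)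
 show "\<forall>\<^sub>F t in at_top. norm (g t/t powr (5/6) - c) <= C*t powr (- 1/6)"
  using eventually_ge_at_top[of R] eventually_gt_at_top[of 0]
 proof eventually_elim
  case (elim t)
    have "g t/t powr (5/6) - c = (g t - c*t powr (5/6))/t powr (5/6)" using elim by (simp add: diff_divide_distrib)
  hence "norm (g t/t powr (5/6) - c) = abs (g t - c*t powr (5/6))/t powr (5/6)" by (simp)
  also have "... <= C*t powr (2/3)/t powr (5/6)" using elim assms by (intro divide_right_mono) auto
  also have "... = C*t powr (- 1/6)" using powr_diff[of t "2/3" "5/6"] by simp
  finally show ?case .
 qed
 show "tendsto (%t. C*t powr (- 1/6)) 0 at_top" by real_asymp
qed

text \<open>Beyond some X the main term of Th' exceeds its error, so Th increases and the zeros are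
  the points where it meets multiples of pi. The finitely many zeros below X only shift the index by
  a constant.\<close>

theorem spectral_asymptotics:
 assumes al: "0 <= al"
 shows "EX l C k0. strict_mono l & range (%k. complex_of_real (l k)) = {z. spec_det al z = 0} &
  (%k. l k powr (5/6)/real (Suc k)) \<longlonglongrightarrow> 2*pi/(action_const * sqrt 3) &
  filterlim l at_top sequentially &
  (ALL k>=k0. deriv (spec_det al) (of_real (l k)) ~= 0) &
  (ALL k>=k0. norm (rot_dsib al (of_real (l k))) <= C * sqrt (l k)*norm (rot_sib al (of_real (l k)))) &
  (%k. (2*ln (norm (rot_sib al (of_real (l k)))) - ln (norm (deriv (spec_det al) (of_real (l k)))))/l k powr (5/6)) \<longlonglongrightarrow> action_const/2"
proof -
 define K where "K = action_const"
 have K: "0 < K" unfolding K_def by (rule action_const_pos)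
 define s where "s = sin (2*pi/3)"
 have s: "s = sqrt 3/2" using sin_pi_minus[of "pi/3"] sin_60 by (simp add: s_def)
 have cs: "cos (2*pi/3) = - (1/2)" using cos_pi_minus[of "pi/3"] cos_60 by simp
 obtain R C Th Th' where R: "1 <= R" "0 < C"
  and arg: "!!t. R <= t ==> rot_sib al (of_real t) = of_real (norm (rot_sib al (of_real t)))*cis (3*pi/10 + Th t)"
  and nz: "!!t. R <= t ==> rot_sib al (of_real t) ~= 0"
  and Th: "!!t. R <= t ==> (Th has_real_derivative Th' t) (at t)"
  and Th'b: "!!t. R <= t ==> abs (Th' t - 5/6*K * s*t powr (- 1/6)) <= C*t powr (- 1/3)"
  and Th_b: "!!t. R <= t ==> abs (Th t - K * s*t powr (5/6)) <= C*t powr (2/3)"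
  and fb: "!!t. R <= t ==> abs (ln (norm (rot_sib al (of_real t))) - K*cos (2*pi/3)*t powr (5/6)) <= C*t powr (2/3)"
  and db: "!!t. R <= t ==> norm (rot_dsib al (of_real t)) <= C * sqrt t*norm (rot_sib al (of_real t))"
  using phase_function[of al, folded K_def s_def] by blast
 obtain C0 where C0: "1 <= C0" "!!l. C0 <= norm l ==> 0 <= Re l ==> sib (- of_real al) l ~= 0 &
  abs (ln (norm (sib (- of_real al) l)) - action_const*Re (l powr (5/6))) <= C0*norm l powr (2/3)"
  using sib_asymptotics[of 0 "- of_real al"] by auto
 have f0: "sib (- of_real al) (of_real t) ~= 0" "abs (ln (norm (sib (- of_real al) (of_real t))) - K*t powr (5/6)) <= C0*t powr (2/3)"
  if "C0 <= t" for t using C0(2)[of "of_real t"] that C0(1) powr_of_real[of t "5/6"] by (auto simp: K_def)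
 have Ks: "0 < K * s" unfolding s using K by simp
 have "\<forall>\<^sub>F t in at_top. C*t powr (- 1/3) < (5/6*(K * s))*t powr (- 1/6)" using Ks R by real_asymp
 hence "\<forall>\<^sub>F t in at_top. C*t powr (- 1/3) < (5/6*(K * s))*t powr (- 1/6) & max R C0 <= t"
  using eventually_ge_at_top[of "max R C0"] by eventually_elim auto
 then obtain X where X: "!!t. X <= t ==> C*t powr (- 1/3) < (5/6*(K * s))*t powr (- 1/6) & max R C0 <= t"
  by (auto simp: eventually_at_top_linorder)
 have XR: "R <= t" "C0 <= t" if "X <= t" for t using X[OF that] by auto
 have Th'0: "0 < Th' t" if "X <= t" for t using X[OF that] Th'b[OF XR(1)[OF that]] by linarith
 have inc: "Th t < Th u" if "X <= t" "t < u" for t u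
  by (rule DERIV_pos_imp_increasing[OF that(2)]) (use that Th Th'0 XR in \<open>meson order_trans\<close>)
 have cont: "continuous_on {t..u} Th" if "X <= t" for t u
  by (intro continuous_at_imp_continuous_on ballI DERIV_isCont[OF Th]) (use that XR in auto)
 have eq: "spec_det al (of_real t) * sib (- of_real al) (of_real t) = - 4*\<i> * of_real (norm (rot_sib al (of_real t)) * sin (Th t))"
  if "X <= t" for t by (rule spec_det_mult_sib_real[OF arg[OF XR(1)[OF that]]])
 have zero: "spec_det al (of_real t) = 0 \<longleftrightarrow> (EX j::int. Th t = of_int j*pi)" if "X <= t" for t
   proof -
  have "spec_det al (of_real t) = 0 \<longleftrightarrow> spec_det al (of_real t) * sib (- of_real al) (of_real t) = 0" using f0(1)[OF XR(2)[OF that]] by simp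
  also have "... \<longleftrightarrow> sin (Th t) = 0" unfolding eq[OF that] using nz[OF XR(1)[OF that]] by simp
  finally show ?thesis by (simp add: sin_zero_iff_int2)
 qed
 have Th_top: "filterlim Th at_top at_top"
 proof (rule filterlim_at_top_mono)
  show "filterlim (%t::real. K * s*t powr (5/6) - C*t powr (2/3)) at_top at_top" using Ks R by real_asymp
  show "\<forall>\<^sub>F t in at_top. K * s*t powr (5/6) - C*t powr (2/3) <= Th t"
   using eventually_ge_at_top[of R] by eventually_elim (use Th_b in \<open>smt (verit)\<close>)
 qed
  have above: "y < of_int (\<lfloor>y/pi\<rfloor> + 1)*pi" for y
  proof -
  have "y/pi < of_int (\<lfloor>y/pi\<rfloor> + 1)" by simp
  thus ?thesis using pos_divide_less_eq[OF pi_gt_zero] by blast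
 qed
 have next_zero: "EX u>t. Th u = y" if t: "X <= t" and y: "Th t < y" for t y
 proof -
  have "\<forall>\<^sub>F u in at_top. y <= Th u" using Th_top by (auto simp: filterlim_at_top)
  hence "\<forall>\<^sub>F u in at_top. y <= Th u & t <= u" using eventually_ge_at_top[of t] by eventually_elim auto
  then obtain u where "y <= Th u" "t <= u" using eventually_happens'[OF trivial_limit_at_top_linorder] by blast
  then obtain v where "t <= v" "Th v = y" using IVT'[of Th t y u] y cont[OF t] by auto
  thus ?thesis using y by (intro exI[of _ v]) (auto simp: order_le_less)
 qed
 define S where "S = {t. spec_det al (of_real t) = 0}"
 have S0: "0 <= t" if "t : S" for t using spec_det_negative[of t al] that by (force simp: S_def)
 have fin: "finite {x : S. x <= b}" for b
 proof -
  have "finite {z : cball 0 b. spec_det al z = 0}"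
  proof (rule holomorphic_compact_finite_zeros[OF spec_det_holomorphic open_UNIV connected_UNIV])
   \<comment> \<open>The determinant vanishes at a point beyond X but not at - 1.\<close>
   show "~spec_det al constant_on UNIV"
   proof
    assume "spec_det al constant_on UNIV"
    then obtain c where c: "!!z. spec_det al z = c" by (auto simp: constant_on_def)
    obtain u where "X < u" "Th u = of_int (\<lfloor>Th X/pi\<rfloor> + 1)*pi"
     using next_zero[OF order_refl above] by blast
        hence "spec_det al (of_real u) = 0" using zero[of u] by (metis less_imp_le)
    thus False using spec_det_negative[of "- 1" al] unfolding c by simp
   qed
  qed (auto)
  hence "finite (Re ` {z : cball 0 b. spec_det al z = 0})" by (rule finite_imageI)
  thus ?thesis
  proof (rule finite_subset[rotated])
   show "{x : S. x <= b} <= Re ` {z : cball 0 b. spec_det al z = 0}"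
   proof
    fix x assume "x : {x : S. x <= b}"
    hence "complex_of_real x : {z : cball 0 b. spec_det al z = 0}" "x = Re (of_real x)"
     using S0[of x] by (auto simp: S_def)
    thus "x : Re ` {z : cball 0 b. spec_det al z = 0}" by (rule rev_image_eqI)
   qed
  qed
 qed
 have unbounded: "EX u>t. u : S" for t
 proof -
  let ?t = "max t X"
    obtain u where u: "?t < u" "Th u = of_int (\<lfloor>Th ?t/pi\<rfloor> + 1)*pi" using next_zero[OF max.cobounded2 above] by blast
  have "spec_det al (of_real u) = 0" using zero[of u] u by (metis less_imp_le max_less_iff_conj)
  hence "u : S" by (simp add: S_def)
  thus ?thesis using u by auto
 qed
 have "infinite S"
 proof
  assume f: "finite S"
  obtain u where "Max S < u" "u : S" using unbounded by blast
  thus False using Max_ge[OF f] by force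
 qed
 from strict_mono_enumeration[OF this fin] obtain l :: "nat => real" where l: "strict_mono l" "range l = S" by blast
 have lS: "l k : S" for k using l(2) by blast
 have lnext: "l (Suc k) <= u" if u: "u : S" "l k < u" for k u
 proof -
  obtain j where "u = l j" using u l(2) by blast
  thus ?thesis using u l(1) by (simp add: strict_mono_less strict_mono_less_eq)
 qed
 have ltop: "filterlim l at_top sequentially" unfolding filterlim_at_top_dense eventually_sequentially
 proof
  fix Z
  obtain u where "Z < u" "u : S" using unbounded by blast
  then obtain j where "Z < l j" using l(2) by blast
  thus "EX N. ALL n>=N. Z < l n" using l(1) by (metis order_less_le_trans strict_mono_less_eq)
 qed
 then obtain k1 where k1: "!!k. k1 <= k ==> X <= l k" by (auto simp: filterlim_at_top eventually_sequentially)
 \<comment> \<open>Th is continuous and increasing, so the next multiple of pi is attained, and the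
   point where this happens is a zero.\<close>
 have step: "Th (l (Suc k)) = Th (l k) + pi" if k: "k1 <= k" for k
 proof -
  obtain i where i: "Th (l k) = of_int i*pi" using zero[OF k1[OF k]] lS[of k] by (auto simp: S_def)
  obtain j where j: "Th (l (Suc k)) = of_int j*pi" using zero[OF k1[of "Suc k"]] lS[of "Suc k"] k by (auto simp: S_def)
  have lt: "l k < l (Suc k)" using l(1) by (simp add: strict_mono_less)
  have "of_int i*pi < of_int j*pi" using inc[OF k1[OF k] lt] by (simp add: i j)
  hence ij: "i < j" by simp
  have "Th (l k) < of_int (i+1)*pi" by (simp add: i)
  from next_zero[OF k1[OF k] this] obtain u where u: "l k < u" "Th u = of_int (i+1)*pi" by auto
  have uX: "X <= u" using k1[OF k] u by simp
  have "spec_det al (of_real u) = 0" using zero[OF uX] u(2) by blast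
  hence "u : S" by (simp add: S_def)
  hence "l (Suc k) <= u" using u(1) by (rule lnext)
  hence "Th (l (Suc k)) <= Th u" using inc[of "l (Suc k)" u] k1[of "Suc k"] k by (cases "l (Suc k) = u") auto
  hence "of_int j*pi <= of_int (i+1)*pi" by (simp add: j u)
  hence "j <= i + 1" by (simp del: of_int_add)
  hence "j = i + 1" using ij by simp
  thus ?thesis by (simp add: i j distrib_right)
 qed
 \<comment> \<open>The index \<open>k1\<close> and the value of Th there are unknown constants,
   hence invisible in the limit of Th (l k)/(k+1).\<close>
 have lin: "Th (l k) = Th (l k1) + pi*(real k - real k1)" if "k1 <= k" for k
  using that by (induction k rule: dec_induct) (auto simp: step algebra_simps)
 have lim_Th: "tendsto (%t. Th t/t powr (5/6)) (K * s) at_top" by (rule powr_quotient_limit[OF Th_b])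
 have "filterlim (%k. l k) at_top sequentially" by (rule ltop)
 from filterlim_compose[OF lim_Th this] have q: "LIMSEQ (%k. Th (l k)/l k powr (5/6)) (K * s)" .
 have "LIMSEQ (%k. (Th (l k)/real (Suc k))/(Th (l k)/l k powr (5/6))) (pi/(K * s))"
 proof (rule tendsto_divide[OF _ q])
  have "LIMSEQ (%k. (Th (l k1) + pi*(real k - real k1))/real (Suc k)) pi" by real_asymp
    moreover have "\<forall>\<^sub>F k in sequentially. (Th (l k1) + pi*(real k - real k1))/real (Suc k) = Th (l k)/real (Suc k)"
   using eventually_ge_at_top[of k1] by eventually_elim (erule arg_cong[OF lin[symmetric]])
  ultimately show "LIMSEQ (%k. Th (l k)/real (Suc k)) pi" by (rule Lim_transform_eventually)
 qed (use Ks in auto)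
 moreover have "\<forall>\<^sub>F k in sequentially. (Th (l k)/real (Suc k))/(Th (l k)/l k powr (5/6)) = l k powr (5/6)/real (Suc k)"
 proof -
  have "\<forall>\<^sub>F k in sequentially. 0 < Th (l k)"
   using filterlim_compose[OF Th_top ltop] by (simp add: filterlim_at_top_dense)
  thus ?thesis by eventually_elim auto
 qed
 ultimately have count: "LIMSEQ (%k. l k powr (5/6)/real (Suc k)) (pi/(K * s))" by (rule Lim_transform_eventually)
 have lim_Th': "tendsto (%t. ln (Th' t)/t powr (5/6)) 0 at_top"
 proof (rule tendsto_sandwich)
  show "tendsto (%t. ln (5/6*(K * s)*t powr (- 1/6) - C*t powr (- 1/3))/t powr (5/6)) 0 at_top"
   using Ks R by real_asymp
  show "tendsto (%t. ln (5/6*(K * s)*t powr (- 1/6) + C*t powr (- 1/3))/t powr (5/6)) 0 at_top"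
   using Ks R by real_asymp
  show "\<forall>\<^sub>F t in at_top. ln (5/6*(K * s)*t powr (- 1/6) - C*t powr (- 1/3))/t powr (5/6) <= ln (Th' t)/t powr (5/6)"
   using eventually_ge_at_top[of X]
  proof eventually_elim
   case (elim t)
   show ?case using X[OF elim] Th'b[OF XR(1)[OF elim]] Th'0[OF elim] by (intro divide_right_mono) (auto)
  qed
  show "\<forall>\<^sub>F t in at_top. ln (Th' t)/t powr (5/6) <= ln (5/6*(K * s)*t powr (- 1/6) + C*t powr (- 1/3))/t powr (5/6)"
   using eventually_ge_at_top[of X]
  proof eventually_elim
   case (elim t)
   show ?case using X[OF elim] Th'b[OF XR(1)[OF elim]] Th'0[OF elim] by (intro divide_right_mono) (auto)
  qed
 qed
 \<comment> \<open>At a zero this is 2 ln |f| - ln |D'| over t^(5/6), rewritten through |D'| |Y(0)|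
   = 4 |f| Th'. Its limit K cos (2 pi/3) + K is K/2.\<close>
 define G where "G t = ln (norm (rot_sib al (of_real t)))/t powr (5/6) - ln 4/t powr (5/6) - ln (Th' t)/t powr (5/6)
   + ln (norm (sib (- of_real al) (of_real t)))/t powr (5/6)" for t
 have "tendsto G (K*cos (2*pi/3) - 0 - 0 + K) at_top" unfolding G_def
 proof (intro tendsto_add tendsto_diff lim_Th' powr_quotient_limit[OF fb] powr_quotient_limit[OF f0(2)])
  show "tendsto (%t::real. ln 4/t powr (5/6)) 0 at_top" by real_asymp
 qed
 from filterlim_compose[OF this ltop] have limG: "LIMSEQ (%k. G (l k)) (K/2)" by (simp add: cs)
 \<comment> \<open>Differentiate both sides of \<open>eq\<close> at a zero: on the left only D' Y(0)
   survives, on the right only |f| cos Th Th', with |cos Th| = 1.\<close>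
 have deriv: "norm (deriv (spec_det al) (of_real t))*norm (sib (- of_real al) (of_real t)) = 4*(norm (rot_sib al (of_real t))*Th' t)"
  if t: "X < t" "t : S" for t
 proof -
  have Xt: "X <= t" using t by simp
    have rot_cont: "isCont (rot_sib al) z" for z
   using holomorphic_on_imp_continuous_on[OF rot_holomorphic(1)[of al UNIV]] by (simp add: continuous_on_eq_continuous_at)
  have "((%z. spec_det al z * sib (- of_real al) z) has_field_derivative
    deriv (spec_det al) (of_real t) * sib (- of_real al) (of_real t) + deriv (sib (- of_real al)) (of_real t) * spec_det al (of_real t)) (at (of_real t))"
   by (intro DERIV_mult holomorphic_derivI[OF _ open_UNIV UNIV_I] spec_det_holomorphic sib_holomorphic)
  hence "((%x. spec_det al (of_real x) * sib (- of_real al) (of_real x)) has_vector_derivative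
    deriv (spec_det al) (of_real t) * sib (- of_real al) (of_real t)) (at t)"
   using t(2) unfolding S_def mem_Collect_eq by (simp only: mult_zero_right add_0_right) (rule has_vector_derivative_real_field)
  moreover have "((%x. spec_det al (of_real x) * sib (- of_real al) (of_real x)) has_vector_derivative
    - 4*\<i> * of_real (norm (rot_sib al (of_real t))*(cos (Th t)*Th' t))) (at t)"
  proof (rule has_vector_derivative_transform_within_open[where S = "{X<..}"])
   have "isCont (%x. norm (rot_sib al (of_real x))) t"
        by (intro isCont_norm isCont_o2[where g = "rot_sib al" and f = of_real] rot_cont) simp
   moreover have "((%x. sin (Th x)) has_real_derivative cos (Th t)*Th' t) (at t)"
    using Th[OF XR(1)[OF Xt]] by (auto intro!: derivative_eq_intros)
   moreover have "sin (Th t) = 0" using zero[OF Xt] t by (auto simp: S_def sin_zero_iff_int2)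
   ultimately have "((%x. norm (rot_sib al (of_real x)) * sin (Th x)) has_real_derivative norm (rot_sib al (of_real t))*(cos (Th t)*Th' t)) (at t)"
    by (intro mult_zero_has_derivative)
   thus "((%x. - 4*\<i>*complex_of_real (norm (rot_sib al (of_real x)) * sin (Th x))) has_vector_derivative
    - 4*\<i> * of_real (norm (rot_sib al (of_real t))*(cos (Th t)*Th' t))) (at t)"
    by (intro has_vector_derivative_mult_right has_vector_derivative_complex_of_real)
   fix x assume "x : {X<..}"
   thus "- 4*\<i>*complex_of_real (norm (rot_sib al (of_real x)) * sin (Th x)) = spec_det al (of_real x) * sib (- of_real al) (of_real x)"
    by (intro eq[symmetric]) simp
  qed (use t in auto)
  ultimately have "deriv (spec_det al) (of_real t) * sib (- of_real al) (of_real t) = - 4*\<i> * of_real (norm (rot_sib al (of_real t))*(cos (Th t)*Th' t))"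
   by (rule vector_derivative_unique_at)
  hence "norm (deriv (spec_det al) (of_real t) * sib (- of_real al) (of_real t)) = norm (- 4*\<i>*complex_of_real (norm (rot_sib al (of_real t))*(cos (Th t)*Th' t)))"
   by (rule arg_cong)
  moreover have "abs (cos (Th t)) = 1"
  proof -
   have "sin (Th t) = 0" using zero[OF Xt] t by (auto simp: S_def sin_zero_iff_int2)
   thus ?thesis using sin_cos_squared_add[of "Th t"] by (auto simp: power2_eq_1_iff)
  qed
  ultimately show ?thesis using Th'0[OF Xt] by (simp add: norm_mult)
 qed
 obtain k0 where k0: "!!k. k0 <= k ==> X < l k" using ltop by (auto simp: filterlim_at_top_dense eventually_sequentially)
 have main: "deriv (spec_det al) (of_real (l k)) ~= 0 & (2*ln (norm (rot_sib al (of_real (l k)))) - ln (norm (deriv (spec_det al) (of_real (l k)))))/l k powr (5/6) = G (l k)"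
  if "k0 <= k" for k
 proof
  define t where "t = l k"
  have t: "X < t" "t : S" "X <= t" using k0[OF that] lS by (auto simp: t_def)
  define d f g where "d = norm (deriv (spec_det al) (of_real t))" and "f = norm (rot_sib al (of_real t))" and "g = norm (sib (- of_real al) (of_real t))"
  have e: "d*g = 4*(f*Th' t)" unfolding d_def f_def g_def by (rule deriv[OF t(1,2)])
  have pos: "0 < f" "0 < g" "0 < Th' t" using nz[OF XR(1)[OF t(3)]] f0(1)[OF XR(2)[OF t(3)]] Th'0[OF t(3)] by (auto simp: f_def g_def)
  hence "0 < 4*(f*Th' t)" by simp
  hence d: "0 < d" unfolding e[symmetric] using pos by (simp add: zero_less_mult_iff)
  thus "deriv (spec_det al) (of_real (l k)) ~= 0" by (simp add: d_def t_def)
  have "ln d + ln g = ln 4 + (ln f + ln (Th' t))" using arg_cong[OF e, of ln] d pos by (simp add: ln_mult)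
  hence "2*ln f - ln d = ln f - ln 4 - ln (Th' t) + ln g" by linarith
  hence "(2*ln f - ln d)/t powr (5/6) = G t" unfolding G_def f_def[symmetric] g_def[symmetric]
   by (simp only: add_divide_distrib diff_divide_distrib)
  thus "(2*ln (norm (rot_sib al (of_real (l k)))) - ln (norm (deriv (spec_det al) (of_real (l k)))))/l k powr (5/6) = G (l k)"
   by (simp add: d_def f_def t_def)
 qed
  show ?thesis
 proof (rule exI[of _ l], rule exI[of _ C], rule exI[of _ k0], intro conjI allI impI l(1) ltop)
  have "z : range (%k. complex_of_real (l k))" if "spec_det al z = 0" for z
  proof -
   have "Im z = 0" using spec_det_nonreal[OF al, of z] that by auto
   hence "z = of_real (Re z)" by (simp add: complex_eq_iff)
   hence "Re z : S" using that by (simp add: S_def)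
   thus ?thesis using l(2) \<open>z = of_real (Re z)\<close> by (metis imageE rangeI)
  qed
  thus "range (%k. complex_of_real (l k)) = {z. spec_det al z = 0}" using lS by (auto simp: S_def)
  show "LIMSEQ (%k. l k powr (5/6)/real (Suc k)) (2*pi/(action_const * sqrt 3))"
   using count by (simp add: K_def s mult.commute)
  show "LIMSEQ (%k. (2*ln (norm (rot_sib al (of_real (l k)))) - ln (norm (deriv (spec_det al) (of_real (l k)))))/l k powr (5/6)) (action_const/2)"
   proof (rule Lim_transform_eventually[OF limG[unfolded K_def]])
   show "\<forall>\<^sub>F k in sequentially. G (l k) = (2*ln (norm (rot_sib al (of_real (l k)))) - ln (norm (deriv (spec_det al) (of_real (l k)))))/l k powr (5/6)"
    using eventually_ge_at_top[of k0] by eventually_elim (rule conjunct2[OF main, symmetric])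
  qed
  fix k assume k: "k0 <= k"
  show "deriv (spec_det al) (of_real (l k)) ~= 0" using main[OF k] by simp
  show "norm (rot_dsib al (of_real (l k))) <= C * sqrt (l k)*norm (rot_sib al (of_real (l k)))"
   using k0[OF k] by (intro db XR) simp
 qed
qed

section \<open>Smooth functions, cutoffs and density of the test functions\<close>

text \<open>Counts n + 1 derivatives, passing from f to its derivative in each step, so that closure
  under sums, products and inverses is an induction on n.\<close>

primrec Cn :: "nat => (real => complex) => bool" where
 "Cn 0 f = (ALL x. f differentiable (at x))"
| "Cn (Suc n) f = ((ALL x. f differentiable (at x)) & Cn n (ddx f))"

definition smooth :: "(real => complex) => bool" where
 "smooth f \<longleftrightarrow> (ALL n. Cn n f)"

lemma Cn_Suc_D: "Cn (Suc n) f ==> Cn n f" by (induction n arbitrary: f) auto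

lemma Cn_differentiable: "Cn n f ==> f differentiable (at x)" by (cases n) auto

lemma smooth_funpow: "smooth f ==> (ddx ^^ n) f differentiable (at x)"
proof -
 have "Cn n f ==> (ddx ^^ n) f differentiable (at x)" for n f
  by (induction n arbitrary: f) (auto simp: funpow_swap1)
 thus "smooth f ==> (ddx ^^ n) f differentiable (at x)" by (simp add: smooth_def)
qed

lemma Cn_intro:
 assumes "!!x. (f has_vector_derivative f' x) (at x)" "Cn n f'" shows "Cn (Suc n) f"
proof -
 have "ddx f = f'" using assms(1) by (auto simp: ddx_def vector_derivative_at)
 thus ?thesis using assms differentiableI_vector by auto
qed

lemma smooth_intro:
 assumes "!!x. (f has_vector_derivative f' x) (at x)" "smooth f'" shows "smooth f"
 using Cn_intro[OF assms(1)] assms(2) Cn_Suc_D unfolding smooth_def by blast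

lemma smooth_derivative: "smooth f ==> (f has_vector_derivative ddx f x) (at x)"
 using Cn_differentiable[of 0 f x] vector_derivative_works[of f] unfolding smooth_def ddx_def by blast

lemma smooth_ddx: "smooth f ==> smooth (ddx f)" unfolding smooth_def using Cn.simps(2) by blast

lemma smooth_continuous: "smooth f ==> continuous_on S f"
 by (intro continuous_at_imp_continuous_on ballI) (rule has_vector_derivative_continuous[OF smooth_derivative])

lemma Cn_add: "Cn n f ==> Cn n g ==> Cn n (%x. f x + g x)"
proof (induction n arbitrary: f g)
 case (Suc n)
 have "ddx (%x. f x + g x) = (%x. ddx f x + ddx g x)"
  using Cn_differentiable[OF Suc.prems(1)] Cn_differentiable[OF Suc.prems(2)] by (auto simp: ddx_def)
 thus ?case using Suc by simp
qed auto

lemma Cn_mult: "Cn n f ==> Cn n g ==> Cn n (%x. f x*g x)"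
proof (induction n arbitrary: f g)
 case (Suc n)
 have "ddx (%x. f x*g x) = (%x. f x*ddx g x + ddx f x*g x)"
  using Cn_differentiable[OF Suc.prems(1)] Cn_differentiable[OF Suc.prems(2)] by (auto simp: ddx_def)
 moreover have "Cn n (%x. f x*ddx g x + ddx f x*g x)"
  using Suc.prems by (intro Cn_add Suc.IH) (auto intro: Cn_Suc_D)
 ultimately show ?case using Suc.prems by simp
qed auto

lemma Cn_inverse: "Cn n f ==> (!!x. f x ~= 0) ==> Cn n (%x. inverse (f x))"
proof (induction n)
 case (Suc n)
 have d: "(f has_vector_derivative ddx f x) (at x)" for x
  using Cn_differentiable[OF Suc.prems(1)] by (simp add: ddx_def vector_derivative_works)
 have inv: "((%x. inverse (f x)) has_vector_derivative (- 1)*(ddx f x*(inverse (f x)*inverse (f x)))) (at x)" for x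
  using field_vector_diff_chain_at[OF d DERIV_inverse[OF Suc.prems(2)]] by (simp add: o_def)
 have c: "Cn n (%x. c)" for c by (induction n arbitrary: c) (auto simp: ddx_def)
 show ?case using Suc.prems Suc.IH[OF Cn_Suc_D[OF Suc.prems(1)] Suc.prems(2)]
  by (intro Cn_intro[OF inv] Cn_mult c) auto
qed (auto intro!: differentiable_inverse)

lemma smooth_add: "smooth f ==> smooth g ==> smooth (%x. f x + g x)"
 and smooth_mult: "smooth f ==> smooth g ==> smooth (%x. f x*g x)"
 and smooth_inverse: "smooth f ==> (!!x. f x ~= 0) ==> smooth (%x. inverse (f x))"
 by (simp_all add: smooth_def Cn_add Cn_mult Cn_inverse)

lemma smooth_entire:
 assumes "f holomorphic_on UNIV" shows "smooth (%x. f (c * of_real x))"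
proof -
 have "f holomorphic_on UNIV ==> Cn n (%x. d*f (c * of_real x))" for d n
 proof (induction n arbitrary: d f)
  case (Suc n)
  have "((%z. d*f (c*z)) has_field_derivative (d*c)*deriv f (c*z)) (at z)" for z
      by (rule DERIV_cong[OF DERIV_cmult[OF DERIV_chain2[OF holomorphic_derivI[OF Suc.prems open_UNIV UNIV_I] DERIV_cmult_Id]]]) simp
  from has_vector_derivative_real_field[OF this] show ?case
   by (rule Cn_intro) (rule Suc.IH[OF holomorphic_deriv[OF Suc.prems open_UNIV]])
 next
  case 0
  thus ?case
      using has_vector_derivative_real_field[OF DERIV_cmult[OF DERIV_chain2[OF holomorphic_derivI[OF 0 open_UNIV UNIV_I] DERIV_cmult_Id]]]
    differentiableI_vector by (metis Cn.simps(1))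
 qed
 from this[OF assms, of _ 1] show ?thesis by (simp add: smooth_def)
qed

lemma smooth_const: "smooth (%x. c)" using smooth_entire[of "%_. c"] by simp

lemma smooth_affine:
 assumes "smooth f" shows "smooth (%x. f (a+b*x))"
proof -
 have d: "((%x. c*f (a+b*x)) has_vector_derivative (c * of_real b)*ddx f (a+b*x)) (at x)" if f: "smooth f" for f c x
 proof -
  have "((%x. a + b*x) has_vector_derivative b) (at x)" by (auto intro!: derivative_eq_intros)
  from vector_diff_chain_at[OF this smooth_derivative[OF f]]
  have "((%x. f (a+b*x)) has_vector_derivative b *\<^sub>R ddx f (a+b*x)) (at x)" by (simp only: o_def)
  from has_vector_derivative_mult_right[OF this, of c] show ?thesis by (simp add: scaleR_conv_of_real mult.assoc)
 qed
 have "Cn n (%x. c*f (a+b*x))" if "smooth f" for n c f using that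
 proof (induction n arbitrary: f c)
  case 0
  thus ?case using d differentiableI_vector by (metis Cn.simps(1))
 next
  case (Suc n)
  show ?case by (rule Cn_intro[OF d[OF Suc.prems]]) (rule Suc.IH[OF smooth_ddx[OF Suc.prems]])
 qed
 from this[OF assms, of _ 1] show ?thesis by (simp add: smooth_def)
qed

lemma smooth_polynomial_function: "polynomial_function p ==> smooth p"
proof -
 have "polynomial_function p ==> Cn n p" for n
 proof (induction n arbitrary: p)
  case 0
  thus ?case using has_vector_derivative_polynomial_function differentiableI_vector by (metis Cn.simps(1))
 next
  case (Suc n)
  obtain p' where "polynomial_function p'" "!!x. (p has_vector_derivative p' x) (at x)"
   using has_vector_derivative_polynomial_function[OF Suc.prems] by blast
  thus ?case using Cn_intro Suc.IH by blast
 qed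
 thus "polynomial_function p ==> smooth p" by (simp add: smooth_def)
qed

text \<open>\<open>flat 0\<close> is the classical exp (- 1/x) continued by 0; the powers of 1/x
  make the family closed under differentiation up to linear combinations.\<close>

definition flat :: "nat => real => real" where
 "flat n x = (if 0 < x then (1/x)^n*exp (- (1/x)) else 0)"

lemma flat_null: "tendsto (%x. flat n x) 0 (at 0)"
proof -
 have "tendsto (%x::real. (inverse x)^n/exp (inverse x)) 0 (at_right 0)"
  by (rule filterlim_compose[OF tendsto_power_div_exp_0 filterlim_inverse_at_top_right])
  moreover have "\<forall>\<^sub>F x in at_right (0::real). inverse x^n/exp (inverse x) = flat n x"
  using eventually_at_right_less[of 0] by eventually_elim (simp add: flat_def exp_minus inverse_eq_divide)
 ultimately have "(flat n \<longlongrightarrow> 0) (at_right 0)" by (rule Lim_transform_eventually)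
 moreover have "(flat n \<longlongrightarrow> 0) (at_left 0)"
  by (rule Lim_transform_eventually[OF tendsto_const]) (auto simp: flat_def eventually_at_filter)
 ultimately show ?thesis by (simp add: filterlim_at_split)
qed

lemma flat_deriv: "(flat n has_real_derivative flat (n+2) x - real n*flat (n+1) x) (at x)"
proof (cases x "0 :: real" rule: linorder_cases)
 case equal
 have "tendsto (%h. flat (Suc n) h) 0 (at 0)" by (rule flat_null)
 hence "tendsto (%h. flat n h/h) 0 (at 0)" by (rule Lim_transform_eventually) (auto simp: flat_def)
 thus ?thesis using equal by (simp add: has_field_derivative_iff flat_def)
next
 case less
 have "((%_. 0) has_real_derivative 0) (at x)" by simp
 hence "(flat n has_real_derivative 0) (at x)"
  by (rule has_field_derivative_transform_within_open[where S = "{..<0}"]) (use less in \<open>auto simp: flat_def\<close>)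
 thus ?thesis using less by (simp add: flat_def)
next
 case greater
 have "((%x. (1/x)^n*exp (- (1/x))) has_real_derivative flat (n+2) x - real n*flat (n+1) x) (at x)"
   proof -
  have d: "((%x. 1/x) has_real_derivative (- ((1/x)^2))) (at x)"
   using greater by (auto intro!: derivative_eq_intros simp: power2_eq_square)
  have e: "of_nat n*(- (c^2)*c^(n - Suc 0))*E+E*- (- (c^2))*c^n = c^(n+2)*E - real n*(c^(n+1)*E)" for c E :: real
   by (cases n) (simp_all add: power2_eq_square)
  show ?thesis
   using DERIV_cong[OF DERIV_mult[OF DERIV_power[OF d] DERIV_chain2[OF DERIV_exp DERIV_minus[OF d]]] e] greater
   by (simp add: flat_def)
 qed
 thus ?thesis
  by (rule has_field_derivative_transform_within_open[where S = "{0<..}"]) (use greater in \<open>auto simp: flat_def\<close>)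
qed

lemma smooth_flat: "smooth (%x. of_real (flat n x))"
proof -
 have "Cn k (%x. of_real (flat n x))" for k
 proof (induction k arbitrary: n)
  case 0
  show ?case using has_vector_derivative_complex_of_real[OF flat_deriv] differentiableI_vector by (metis Cn.simps(1))
 next
  case (Suc k)
  have "((%x. complex_of_real (flat n x)) has_vector_derivative of_real (flat (n+2) x) + (- of_nat n) * of_real (flat (n+1) x)) (at x)" for x
   using has_vector_derivative_complex_of_real[OF flat_deriv[of n x]] by simp
  thus ?case by (rule Cn_intro) (intro Cn_add Cn_mult Suc.IH, use smooth_const in \<open>simp add: smooth_def\<close>)
 qed
 thus ?thesis by (simp add: smooth_def)
qed

lemma smooth_bounded_of_support:
 assumes "smooth f" "!!x. r < abs x ==> f x = 0" shows "EX B. ALL x. norm (f x) <= B"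
proof -
 have "bounded (f ` {- r..r})"
  by (intro compact_imp_bounded compact_continuous_image smooth_continuous assms(1)) auto
 then obtain B where B: "!!x. x : {- r..r} ==> norm (f x) <= B" unfolding bounded_iff by blast
 have "norm (f x) <= max 0 B" for x using B[of x] assms(2)[of x] by (cases "r < abs x") force+
 thus ?thesis by blast
qed

lemma ddx_zero_outside:
 assumes "!!x. r < abs x ==> f x = 0" "r < abs x" shows "ddx f x = 0"
proof (rule ddx_eq_0)
 have "closure {x. f x ~= 0} <= {- r..r}" using assms(1) by (intro closure_minimal) force+
 moreover have "x ~: {- r..r}" using assms(2) by (auto)
 ultimately show "x ~: closure {x. f x ~= 0}" by blast
qed

lemma cutoff_exists:
 obtains rh B where "smooth rh" "!!x. abs x <= 1 ==> rh x = 1" "!!x. 2 < abs x ==> rh x = 0"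
  "0 <= B" "!!x. norm (rh x) <= B" "!!x. norm (ddx rh x) <= B" "!!x. norm (ddx (ddx rh) x) <= B"
proof -
 define E where "E x = complex_of_real (flat 0 x)" for x
 have E: "smooth (%x. E (a+b*x))" for a b unfolding E_def by (rule smooth_affine[OF smooth_flat])
 \<comment> \<open>The usual smooth step from 0 to 1 on [0, 1]; the denominator has no zero since x
   or 1 - x is positive.\<close>
 define h where "h x = E x*inverse (E x + E (1 + (- 1)*x))" for x
 have nz: "E x + E (1 + (- 1)*x) ~= 0" for x
 proof -
  have "0 < flat 0 x + flat 0 (1 + (- 1)*x)" by (simp add: flat_def add_pos_pos)
  thus ?thesis unfolding E_def by (metis of_real_add of_real_eq_0_iff less_irrefl)
 qed
 have h: "smooth h" unfolding h_def using E[of 0 1] by (intro smooth_mult smooth_inverse smooth_add E nz) auto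
 have h1: "h x = 1" if "1 <= x" for x using that by (simp add: h_def E_def flat_def)
 have h0: "h x = 0" if "x <= 0" for x using that by (simp add: h_def E_def flat_def)
 define rh where "rh x = h (2+1*x)*h (2 + (- 1)*x)" for x
 have rh: "smooth rh" unfolding rh_def by (intro smooth_mult smooth_affine h)
 have 0: "rh x = 0" if "2 < abs x" for x using that by (cases "0 <= x") (auto simp: rh_def h0)
 note rh_1 = smooth_ddx[OF rh] and rh_2 = smooth_ddx[OF smooth_ddx[OF rh]]
 have 1: "ddx rh x = 0" if "2 < abs x" for x by (rule ddx_zero_outside[OF 0 that])
 have 2: "ddx (ddx rh) x = 0" if "2 < abs x" for x by (rule ddx_zero_outside[OF 1 that])
 obtain B0 B1 B2 where B: "!!x. norm (rh x) <= B0" "!!x. norm (ddx rh x) <= B1" "!!x. norm (ddx (ddx rh) x) <= B2"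
  using smooth_bounded_of_support[OF rh 0] smooth_bounded_of_support[OF rh_1 1] smooth_bounded_of_support[OF rh_2 2] by blast
 show thesis
 proof (rule that[OF rh _ 0])
  show "rh x = 1" if "abs x <= 1" for x using that by (simp add: rh_def h1)
  show "0 <= max B0 (max B1 B2)" using order_trans[OF norm_ge_zero B(1)] by simp
  show "norm (rh x) <= max B0 (max B1 B2)" "norm (ddx rh x) <= max B0 (max B1 B2)" "norm (ddx (ddx rh) x) <= max B0 (max B1 B2)" for x
   using B[of x] by simp_all
 qed
qed

lemma test_function_smooth:
 assumes "smooth f" "!!x. r < abs x ==> f x = 0" shows "test_function f"
proof -
 have "closure {x. f x ~= 0} <= {- r..r}" using assms(2) by (intro closure_minimal) force+
 hence "compact (closure {x. f x ~= 0})" using compact_Int_closed[OF compact_Icc closed_closure] by (metis inf.absorb2)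
 thus ?thesis using assms(1) by (simp add: test_function_def smooth_funpow)
qed

lemma smooth_test_function:
 assumes "test_function f" shows "smooth f" "EX r>0. ALL x. r < abs x --> f x = 0"
proof -
 have "ALL k x. (ddx ^^ k) f differentiable (at x) ==> Cn n f" for n f
 proof (induction n arbitrary: f)
  case 0
    show ?case using 0[rule_format, of 0] by simp
 next
  case (Suc n)
  have "(ddx ^^ k) (ddx f) differentiable (at x)" for k x using Suc.prems[rule_format, of "Suc k" x] by (simp add: funpow_swap1)
  moreover have "f differentiable (at x)" for x using Suc.prems[rule_format, of 0 x] by simp
  ultimately show ?case using Suc.IH by simp
 qed
 thus "smooth f" using assms by (simp add: smooth_def test_function_def)
 have "bounded (closure {x. f x ~= 0})" using assms by (simp add: test_function_def compact_imp_bounded)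
 then obtain r where r: "0 < r" "!!x. x : closure {x. f x ~= 0} ==> abs x <= r" by (auto simp: bounded_pos)
 have "f x = 0" if "r < abs x" for x using r(2)[of x] that subsetD[OF closure_subset, of x "{x. f x ~= 0}"] by auto
 thus "EX r>0. ALL x. r < abs x --> f x = 0" using r(1) by blast
qed

lemma L2_dominated_convergence:
 assumes f: "!!n. square_integrable (f n)" and g: "square_integrable g" and w: "square_integrable w"
  and le: "!!n. AE x in lborel. norm (f n x) <= norm (w x)" and lim: "AE x in lborel. (%n. f n x) \<longlonglongrightarrow> g x"
 shows "LIMSEQ (%n. to_L2 (f n)) (to_L2 g)"
proof -
 note [measurable] = f[unfolded square_integrable_def, THEN conjunct1] g[unfolded square_integrable_def, THEN conjunct1]
  w[unfolded square_integrable_def, THEN conjunct1]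
 have "LIMSEQ (%n. LINT x|lborel. (norm (f n x - g x))^2) (LINT x|(lborel :: real measure). 0)"
 proof (rule integral_dominated_convergence[where w = "%x. 2*(norm (w x))^2 + 2*(norm (g x))^2"])
  show "integrable lborel (%x. 2*(norm (w x))^2 + 2*(norm (g x))^2)"
   using w g unfolding square_integrable_def by (intro Bochner_Integration.integrable_add) auto
  show "AE x in lborel. (%n. (norm (f n x - g x))^2) \<longlonglongrightarrow> 0"
   using lim by eventually_elim (auto intro!: tendsto_eq_intros simp: LIM_zero)
  show "AE x in lborel. norm ((norm (f n x - g x))^2) <= 2*(norm (w x))^2 + 2*(norm (g x))^2" for n using le[of n]
  proof eventually_elim
   case (elim x)
   have "(norm (f n x - g x))^2 <= (norm (w x) + norm (g x))^2"
    using elim norm_triangle_ineq4[of "f n x" "g x"] by (intro power_mono) auto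
   also have "... <= 2*(norm (w x))^2 + 2*(norm (g x))^2"
    using sum_squares_bound[of "norm (w x)" "norm (g x)"] by (simp add: power2_sum)
   finally show ?case by simp
  qed
 qed measurable
 hence "LIMSEQ (%n. sqrt (LINT x|lborel. (norm (f n x - g x))^2)) (sqrt 0)" by (intro tendsto_real_sqrt) simp
 hence "LIMSEQ (%n. norm (to_L2 (f n) - to_L2 g)) 0"
  using f g by (simp add: to_L2_diff[symmetric] norm_to_L2 square_integrable_diff)
 thus ?thesis by (simp add: LIM_zero_cancel tendsto_norm_zero_iff)
qed

lemma square_integrable_mono:
 assumes "f : borel_measurable lborel" "square_integrable g" "!!x. norm (f x) <= norm (g x)"
 shows "square_integrable f" unfolding square_integrable_def
proof
 show "integrable lborel (%x. (cmod (f x))^2)"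
   proof (rule Bochner_Integration.integrable_bound)
  show "integrable lborel (%x. (cmod (g x))^2)" using assms(2) by (simp add: square_integrable_def)
  show "AE x in lborel. norm ((cmod (f x))^2) <= norm ((cmod (g x))^2)" using power_mono[OF assms(3) norm_ge_zero] by simp
 qed (use assms(1) in measurable)
qed (rule assms)

lemma square_integrable_indicator: "square_integrable (%x. of_real (c*indicator {a..b} x))"
 proof -
 have e: "(%x. (cmod (of_real (c*indicator {a..b} x)))^2) = (%x. c^2*indicator {a..b} x)"
  by (auto simp: indicator_def)
 show ?thesis unfolding square_integrable_def e by (intro conjI) (auto simp: emeasure_lborel_Icc_eq)
qed

abbreviation test_classes :: "L2R set" where "test_classes == to_L2 ` Collect test_function"

text \<open>A measurable function is almost everywhere a limit of continuous ones. Projecting to the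
  disc of radius M keeps these bounded, Stone-Weierstrass replaces them by polynomials on a compact
  interval, and a cutoff makes test functions of those; dominated convergence does the rest.\<close>

lemma test_classes_dense_bounded:
 assumes f: "square_integrable f" and M: "!!x. norm (f x) <= M" and N: "!!x. N < abs x ==> f x = 0"
 shows "to_L2 f : closure test_classes"
proof -
 define R where "R = max 1 N"
 have R: "0 < R" "!!x. R < abs x ==> f x = 0" using N by (auto simp: R_def)
 have M0: "0 <= M" using order_trans[OF norm_ge_zero M] .
 have "f : borel_measurable lebesgue" using f by (intro measurable_completion) (simp add: square_integrable_def)
 hence "f measurable_on UNIV" by (intro lebesgue_measurable_imp_measurable_on) auto
 then obtain Z g where Z: "negligible Z" and g: "!!n. continuous_on UNIV (g n)" "!!x. x ~: Z ==> (%n. g n x) \<longlonglongrightarrow> f x"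
  unfolding measurable_on_def by auto
 have "Z : null_sets lebesgue" using Z by (simp add: negligible_iff_null_sets)
 hence Z: "AE x in lborel. x ~: Z" using AE_completion_iff AE_not_in by blast
 define P where "P = closest_point (cball (0 :: complex) M)"
 have P: "continuous_on UNIV P" unfolding P_def using M0 by (intro continuous_on_closest_point) auto
 have PM: "norm (P z) <= M" for z using closest_point_in_set[of "cball 0 M" z] M0 by (simp add: P_def)
 have Pf: "P (f x) = f x" for x unfolding P_def using M[of x] by (intro closest_point_self) auto
 have "EX p. polynomial_function p & (ALL x:{- (2*R)..2*R}. norm (P (g n x) - p x) < 1/Suc n)" for n
  using continuous_on_compose2[OF P g(1)[of n]] by (intro Stone_Weierstrass_polynomial_function) (auto intro: continuous_on_subset)
 then obtain p where p: "!!n. polynomial_function (p n)" "!!n x. x : {- (2*R)..2*R} ==> norm (P (g n x) - p n x) < 1/Suc n"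
  by metis
 obtain rh B where rh: "smooth rh" "!!x. abs x <= 1 ==> rh x = 1" "!!x. 2 < abs x ==> rh x = 0" and B: "0 <= B" "!!x. norm (rh x) <= B"
  using cutoff_exists by metis
 define k where "k x = rh (0 + (1/R)*x)" for x
 have sk: "smooth k" unfolding k_def by (rule smooth_affine[OF rh(1)])
 have k: "!!x. abs x <= R ==> k x = 1" "!!x. 2*R < abs x ==> k x = 0" "!!x. norm (k x) <= B"
  unfolding k_def using R B by (auto intro!: rh(2,3) simp: less_divide_eq)
 have test: "test_function (%x. k x*p n x)" for n
  using k(2) by (intro test_function_smooth[where r = "2*R"] smooth_mult smooth_polynomial_function p sk) auto
 have "LIMSEQ (%n. to_L2 (%x. k x*p n x)) (to_L2 f)"
 proof (rule L2_dominated_convergence[OF square_integrable_test_function[OF test] f square_integrable_indicator[of "B*(M+1)" "- (2*R)" "2*R"]])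
  show "AE x in lborel. norm (k x*p n x) <= norm (complex_of_real (B*(M+1)*indicator {- (2*R)..2*R} x))" for n
  proof (rule AE_I2)
   fix x
   show "norm (k x*p n x) <= norm (complex_of_real (B*(M+1)*indicator {- (2*R)..2*R} x))"
   proof (cases "x : {- (2*R)..2*R}")
    case True
    have "norm (p n x) <= norm (P (g n x)) + norm (P (g n x) - p n x)" using norm_triangle_ineq4[of "P (g n x)" "P (g n x) - p n x"] by simp
    also have "... <= M + 1" using less_le_trans[OF p(2)[OF True, of n], of 1] PM[of "g n x"] by simp
    finally have "norm (k x)*norm (p n x) <= B*(M+1)" using k B by (intro mult_mono) auto
    thus ?thesis using True B M0 by (simp add: norm_mult)
   qed (use k(2)[of x] in auto)
  qed
  show "AE x in lborel. (%n. k x*p n x) \<longlonglongrightarrow> f x" using Z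
  proof eventually_elim
   case (elim x)
   show ?case
   proof (cases "x : {- (2*R)..2*R}")
    case True
    have "LIMSEQ (%n. P (g n x)) (P (f x))"
     by (rule isCont_tendsto_compose[OF _ g(2)[OF elim]]) (use P in \<open>simp add: continuous_on_eq_continuous_at\<close>)
    moreover have "LIMSEQ (%n. P (g n x) - p n x) 0"
    proof (rule Lim_null_comparison[OF _ LIMSEQ_inverse_real_of_nat])
     show "\<forall>\<^sub>F n in sequentially. norm (P (g n x) - p n x) <= inverse (real (Suc n))"
      using p(2)[OF True] by (intro always_eventually) (simp add: inverse_eq_divide less_imp_le del: of_nat_Suc)
    qed
    ultimately have "LIMSEQ (%n. P (g n x) - (P (g n x) - p n x)) (f x - 0)" unfolding Pf by (rule tendsto_diff)
    hence "LIMSEQ (%n. k x*p n x) (k x*f x)" by (intro tendsto_mult_left) simp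
    moreover have "k x*f x = f x" using k(1)[of x] R(2)[of x] by (cases "abs x <= R") auto
    ultimately show ?thesis by simp
   next
    case False
    hence "2*R < abs x" "R < abs x" by (auto)
    thus ?thesis using k(2)[of x] R(2)[of x] by simp
   qed
  qed
 qed
  moreover have "ALL n. to_L2 (%x. k x*p n x) : test_classes" using test by blast
 ultimately show ?thesis unfolding closure_sequential by (intro exI[of _ "%n. to_L2 (%x. k x*p n x)"] conjI)
qed

lemma test_classes_dense: "closure test_classes = UNIV"
proof -
 have "u : closure test_classes" for u
 proof -
  obtain f where f: "square_integrable f" "to_L2 f = u" using to_L2_surj by blast
  note [measurable] = f(1)[unfolded square_integrable_def, THEN conjunct1]
  define F where "F n x = (if abs x <= real n & norm (f x) <= real n then f x else 0)" for n x
  have F: "square_integrable (F n)" for n by (rule square_integrable_mono[OF _ f(1)]) (auto simp: F_def[abs_def])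
  have "LIMSEQ (%n. to_L2 (F n)) (to_L2 f)"
  proof (rule L2_dominated_convergence[OF F f(1) f(1)])
   show "AE x in lborel. norm (F n x) <= norm (f x)" for n by (auto simp: F_def)
   show "AE x in lborel. (%n. F n x) \<longlonglongrightarrow> f x"
   proof (rule AE_I2)
    fix x
    obtain m where "max (abs x) (norm (f x)) <= real m" using real_arch_simple by blast
    hence "\<forall>\<^sub>F n in sequentially. f x = F n x"
     unfolding F_def by (intro eventually_sequentiallyI[of m]) auto
    thus "LIMSEQ (%n. F n x) (f x)" by (rule Lim_transform_eventually[OF tendsto_const])
   qed
  qed
    moreover have "ALL n. to_L2 (F n) : closure test_classes"
   proof
   fix n
   show "to_L2 (F n) : closure test_classes"
    by (rule test_classes_dense_bounded[OF F, of n "real n" "real n"]) (auto simp: F_def)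
  qed
  ultimately show ?thesis
   unfolding f(2) by - (rule closed_sequentially[OF closed_closure, where f = "%n. to_L2 (F n)"], erule spec, assumption)
 qed
 thus ?thesis by blast
qed

section \<open>The oscillator as a closed operator and a criterion for resolvents\<close>

lemma scaleC_add_left: "scaleC (c+d) u = scaleC c u + scaleC d u"
 by transfer (auto simp: L2_eq_def algebra_simps intro!: square_integrable_add square_integrable_cmult)

lemma scaleC_scaleC: "scaleC c (scaleC d u) = scaleC (c*d) u"
 by transfer (auto simp: L2_eq_def intro!: square_integrable_cmult)

lemma scaleC_of_real: "scaleC (of_real r) u = r *\<^sub>R u"
 by transfer (auto simp: L2_eq_def intro!: square_integrable_cmult)

lemma bounded_linear_scaleC: "bounded_linear (scaleC c)"
 using blinfun.bounded_linear_right[of "scaleC_op c"] by (simp add: scaleC_op.rep_eq)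

lemma scaleC_one: "scaleC 1 u = u" and scaleC_zero_left: "scaleC 0 u = 0"
 using scaleC_of_real[of 1 u] scaleC_of_real[of 0 u] by simp_all

lemma scaleC_diff_right: "scaleC c (u-v) = scaleC c u - scaleC c v"
 by (rule linear_simps(2)[OF bounded_linear_scaleC])

lemma scaleC_minus_left: "scaleC (- c) u = - scaleC c u"
 using scaleC_add_left[of c "- c" u] by (simp add: scaleC_zero_left eq_neg_iff_add_eq_0 add.commute)

lemma scaleC_diff_left: "scaleC (c-d) u = scaleC c u - scaleC d u"
 using scaleC_add_left[of c "- d" u] by (simp add: scaleC_minus_left)

lemma to_L2_add:
 "square_integrable f ==> square_integrable g ==> to_L2 (%x. f x + g x) = to_L2 f + to_L2 g"
 by (simp add: to_L2_def plus_L2R.abs_eq L2_eq_def)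

lemma to_L2_cmult: "square_integrable f ==> to_L2 (%x. c*f x) = scaleC c (to_L2 f)"
 by (simp add: to_L2_def scaleC.abs_eq L2_eq_def)

lemma smooth_cubic_expr: "smooth f ==> smooth (cubic_expr al f)"
proof -
 have "smooth (%x::real. complex_of_real x)" using smooth_entire[of "%z. z" 1] by simp
 note x = smooth_mult[OF smooth_const this]
 assume f: "smooth f"
 have "cubic_expr al f = (%x. (- 1)*ddx (ddx f) x + (\<i> * of_real x*(1 * of_real x)*(1 * of_real x)*f x + \<i> * of_real al * of_real x*f x))"
  by (auto simp: cubic_expr_def power3_eq_cube)
 thus ?thesis by (simp only:) (intro smooth_add smooth_mult smooth_const x smooth_ddx f)
qed

lemma ddx_add: "smooth f ==> smooth g ==> ddx (%x. f x + g x) = (%x. ddx f x + ddx g x)"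
  unfolding ddx_def[of "%x. f x + g x"] by (intro ext vector_derivative_at has_vector_derivative_add smooth_derivative)

lemma ddx_mult: "smooth f ==> smooth g ==> ddx (%x. f x*g x) = (%x. f x*ddx g x + ddx f x*g x)"
  unfolding ddx_def[of "%x. f x*g x"] by (intro ext vector_derivative_at has_vector_derivative_mult smooth_derivative)

lemma ddx_cmult: "smooth f ==> ddx (%x. c*f x) = (%x. c*ddx f x)"
 using ddx_mult[OF smooth_const, of f c] by (simp add: ddx_def[of "%x. c"])

lemma cubic_expr_add:
 "smooth f ==> smooth g ==> cubic_expr al (%x. f x + g x) = (%x. cubic_expr al f x + cubic_expr al g x)"
 by (simp add: cubic_expr_def ddx_add smooth_ddx algebra_simps)

lemma cubic_expr_cmult: "smooth f ==> cubic_expr al (%x. c*f x) = (%x. c*cubic_expr al f x)"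
 by (simp add: cubic_expr_def ddx_cmult smooth_ddx algebra_simps)

lemma test_function_add:
 assumes f: "test_function f" and g: "test_function g" shows "test_function (%x. f x + g x)"
proof -
 obtain r s where "!!x. r < abs x ==> f x = 0" "!!x. s < abs x ==> g x = 0"
  using smooth_test_function(2)[OF f] smooth_test_function(2)[OF g] by blast
 thus ?thesis using smooth_test_function(1)[OF f] smooth_test_function(1)[OF g]
  by (intro test_function_smooth[where r = "max r s"] smooth_add) auto
qed

lemma test_function_cmult:
 assumes f: "test_function f" shows "test_function (%x. c*f x)"
proof -
 obtain r where "!!x. r < abs x ==> f x = 0" using smooth_test_function(2)[OF f] by blast
 thus ?thesis using smooth_test_function(1)[OF f]
  by (intro test_function_smooth[where r = r] smooth_mult smooth_const) auto
qed

lemma cubic_oscillator_iff: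
 "(u, v) : cubic_oscillator al \<longleftrightarrow> (EX phi. (ALL n. test_function (phi n)) & (%n. to_L2 (phi n)) \<longlonglongrightarrow> u & (%n. to_L2 (cubic_expr al (phi n))) \<longlonglongrightarrow> v)"
proof
 assume "(u, v) : cubic_oscillator al"
 then obtain p where p: "ALL n. p n : {(to_L2 phi, to_L2 (cubic_expr al phi)) | phi. test_function phi}" "LIMSEQ p (u, v)"
  unfolding cubic_oscillator_def closure_sequential by blast
 hence "ALL n. EX phi. test_function phi & p n = (to_L2 phi, to_L2 (cubic_expr al phi))" by blast
 then obtain phi where phi: "!!n. test_function (phi n)" "!!n. p n = (to_L2 (phi n), to_L2 (cubic_expr al (phi n)))" by metis
 show "EX phi. (ALL n. test_function (phi n)) & (%n. to_L2 (phi n)) \<longlonglongrightarrow> u & (%n. to_L2 (cubic_expr al (phi n))) \<longlonglongrightarrow> v"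
  using tendsto_fst[OF p(2)] tendsto_snd[OF p(2)] phi by (intro exI[of _ phi]) simp
next
 assume "EX phi. (ALL n. test_function (phi n)) & (%n. to_L2 (phi n)) \<longlonglongrightarrow> u & (%n. to_L2 (cubic_expr al (phi n))) \<longlonglongrightarrow> v"
 then obtain phi where phi: "!!n. test_function (phi n)" "LIMSEQ (%n. to_L2 (phi n)) u" "LIMSEQ (%n. to_L2 (cubic_expr al (phi n))) v" by blast
 show "(u, v) : cubic_oscillator al" unfolding cubic_oscillator_def closure_sequential
  using phi(1) tendsto_Pair[OF phi(2,3)] by (intro exI[of _ "%n. (to_L2 (phi n), to_L2 (cubic_expr al (phi n)))"]) blast
qed

lemma cubic_oscillator_add:
 assumes "(u, v) : cubic_oscillator al" "(u', v') : cubic_oscillator al"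
 shows "(u + u', v + v') : cubic_oscillator al"
proof -
 obtain phi psi where phi: "!!n. test_function (phi n)" "LIMSEQ (%n. to_L2 (phi n)) u" "LIMSEQ (%n. to_L2 (cubic_expr al (phi n))) v"
  and psi: "!!n. test_function (psi n)" "LIMSEQ (%n. to_L2 (psi n)) u'" "LIMSEQ (%n. to_L2 (cubic_expr al (psi n))) v'"
  using assms unfolding cubic_oscillator_iff by blast
 show ?thesis unfolding cubic_oscillator_iff
  using tendsto_add[OF phi(2) psi(2)] tendsto_add[OF phi(3) psi(3)] phi(1) psi(1)
  by (intro exI[of _ "%n x. phi n x + psi n x"]) (simp add: test_function_add cubic_expr_add to_L2_add
    square_integrable_test_function square_integrable_cubic_expr smooth_test_function(1))
qed

lemma cubic_oscillator_scaleC: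
 assumes "(u, v) : cubic_oscillator al" shows "(scaleC c u, scaleC c v) : cubic_oscillator al"
proof -
 obtain phi where phi: "!!n. test_function (phi n)" "LIMSEQ (%n. to_L2 (phi n)) u" "LIMSEQ (%n. to_L2 (cubic_expr al (phi n))) v"
  using assms unfolding cubic_oscillator_iff by blast
 show ?thesis unfolding cubic_oscillator_iff
  using bounded_linear.tendsto[OF bounded_linear_scaleC[of c] phi(2)] bounded_linear.tendsto[OF bounded_linear_scaleC[of c] phi(3)] phi(1)
  by (intro exI[of _ "%n x. c*phi n x"]) (simp add: test_function_cmult cubic_expr_cmult to_L2_cmult
    square_integrable_test_function square_integrable_cubic_expr smooth_test_function(1))
qed

lemma cubic_oscillator_diff:
 assumes "(u, v) : cubic_oscillator al" "(u', v') : cubic_oscillator al"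
 shows "(u - u', v - v') : cubic_oscillator al"
 using cubic_oscillator_add[OF assms(1) cubic_oscillator_scaleC[OF assms(2), of "- 1"]]
 by (simp add: scaleC_minus_left scaleC_one)

lemma closed_cubic_oscillator: "closed (cubic_oscillator al)" by (simp add: cubic_oscillator_def)

lemma cubic_oscillator_lower_bound:
  assumes "ALL phi. test_function phi --> norm (to_L2 phi) <= C*norm (scaleC z (to_L2 phi) - to_L2 (cubic_expr al phi))"
  and "(u, v) : cubic_oscillator al" shows "norm u <= C*norm (scaleC z u - v)"
proof -
 obtain phi where phi: "!!n. test_function (phi n)" "LIMSEQ (%n. to_L2 (phi n)) u" "LIMSEQ (%n. to_L2 (cubic_expr al (phi n))) v"
  using assms(2) unfolding cubic_oscillator_iff by blast
 show ?thesis
 proof (rule LIMSEQ_le)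
  show "LIMSEQ (%n. norm (to_L2 (phi n))) (norm u)" by (intro tendsto_norm phi)
  show "LIMSEQ (%n. C*norm (scaleC z (to_L2 (phi n)) - to_L2 (cubic_expr al (phi n)))) (C*norm (scaleC z u - v))"
   by (intro tendsto_intros bounded_linear.tendsto[OF bounded_linear_scaleC] phi)
 qed (use assms(1) phi(1) in blast)
qed

text \<open>The lower bound passes from test functions to the closure and makes the inverse unique
  and bounded. Solvability for the dense set of test functions then extends to all right-hand sides,
  the graph being closed.\<close>

lemma resolvent_exists:
  assumes lb: "ALL phi. test_function phi --> norm (to_L2 phi) <= C*norm (scaleC z (to_L2 phi) - to_L2 (cubic_expr al phi))"
  and range: "!!g. test_function g ==> EX u. (u, scaleC z u - to_L2 g) : cubic_oscillator al"
 shows "EX R. resolvent_of (cubic_oscillator al) z R"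
proof -
 let ?A = "cubic_oscillator al"
 note lbA = cubic_oscillator_lower_bound[OF lb]
 have C: "norm u <= C*norm f" if "(u, scaleC z u - f) : ?A" for u f using lbA[OF that] by simp
 have diff: "(u - u', scaleC z (u-u') - (f-f')) : ?A" if "(u, scaleC z u - f) : ?A" "(u', scaleC z u' - f') : ?A" for u u' f f'
  using cubic_oscillator_diff[OF that] by (simp add: scaleC_diff_right algebra_simps)
 have unique: "u = u'" if "(u, scaleC z u - f) : ?A" "(u', scaleC z u' - f) : ?A" for u u' f
  using C[OF diff[OF that]] by simp
 have ex: "EX u. (u, scaleC z u - f) : ?A" for f
 proof -
  have "f : closure test_classes" by (simp add: test_classes_dense)
    then obtain h where h: "!!n. h n : test_classes" "LIMSEQ h f" unfolding closure_sequential by blast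
  hence "ALL n. EX g. test_function g & h n = to_L2 g" by blast
  then obtain g where g: "!!n. test_function (g n)" "!!n. h n = to_L2 (g n)" by metis
  have "h = (%n. to_L2 (g n))" using g(2) by blast
  with h(2) have gl: "LIMSEQ (%n. to_L2 (g n)) f" by simp
  obtain u where u: "!!n. (u n, scaleC z (u n) - to_L2 (g n)) : ?A" using range[OF g(1)] by metis
  have "Cauchy u"
  proof (rule metric_CauchyI)
   fix e :: real assume e: "0 < e"
   hence "0 < e/(abs C + 1)" by simp
   then obtain M where M: "!!m n. M <= m ==> M <= n ==> dist (to_L2 (g m)) (to_L2 (g n)) < e/(abs C + 1)"
    using LIMSEQ_imp_Cauchy[OF gl] unfolding Cauchy_def by blast
   have "dist (u m) (u n) < e" if "M <= m" "M <= n" for m n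
   proof -
    have "norm (u m - u n) <= C*norm (to_L2 (g m) - to_L2 (g n))" using C[OF diff[OF u[of m] u[of n]]] .
    also have "... <= (abs C + 1)*norm (to_L2 (g m) - to_L2 (g n))" by (intro mult_right_mono) auto
    also have "... < e" using M[OF that] by (simp add: dist_norm field_simps)
    finally show ?thesis by (simp add: dist_norm)
   qed
   thus "EX M. ALL m>=M. ALL n>=M. dist (u m) (u n) < e" by blast
  qed
  then obtain w where w: "LIMSEQ u w" using Cauchy_convergent convergent_def by blast
  have "LIMSEQ (%n. (u n, scaleC z (u n) - to_L2 (g n))) (w, scaleC z w - f)"
   by (intro tendsto_Pair tendsto_diff bounded_linear.tendsto[OF bounded_linear_scaleC] w gl)
  hence "(w, scaleC z w - f) : ?A" by (rule closed_sequentially[OF closed_cubic_oscillator u])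
  thus ?thesis ..
 qed
 then obtain r where r: "!!f. (r f, scaleC z (r f) - f) : ?A" by metis
 have "bounded_linear r"
 proof (rule bounded_linear_intro[where K = C])
  show "r (f+g) = r f + r g" for f g
   using cubic_oscillator_add[OF r[of f] r[of g]] by (intro unique[OF r]) (simp add: scaleC_add_right algebra_simps)
  show "r (c *\<^sub>R f) = c *\<^sub>R r f" for c f using cubic_oscillator_scaleC[OF r[of f], of "of_real c"]
   by (intro unique[OF r]) (simp add: scaleC_of_real scaleC_scaleR scaleR_diff_right)
  show "norm (r f) <= norm f*C" for f using C[OF r] by (simp add: mult.commute)
 qed
 hence R: "blinfun_apply (Blinfun r) = r" by (rule bounded_linear_Blinfun_apply)
 have "resolvent_of ?A z (Blinfun r)" unfolding resolvent_of_def R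
 proof (intro equalityI subsetI)
  fix p assume "p : {(f, r f) |f. True}"
  then obtain f where "p = (f, r f)" by blast
  thus "p : {(scaleC z u - v, u) |u v. (u, v) : ?A}" using r[of f] by force
 next
  fix p assume "p : {(scaleC z u - v, u) |u v. (u, v) : ?A}"
  then obtain u v where p: "p = (scaleC z u - v, u)" "(u, v) : ?A" by blast
  hence "r (scaleC z u - v) = u" by (intro unique[OF r]) simp
    hence "p = (scaleC z u - v, r (scaleC z u - v))" using p(1) by simp
  thus "p : {(f, r f) |f. True}" by blast
 qed
 thus ?thesis by blast
qed

lemma resolvent_of_iff:
 assumes "resolvent_of A z R" shows "blinfun_apply R f = u \<longleftrightarrow> (u, scaleC z u - f) : A"
proof
 assume "blinfun_apply R f = u"
 hence "(f, u) : {(scaleC z u - v, u) | u v. (u, v) : A}" using assms unfolding resolvent_of_def by blast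
 thus "(u, scaleC z u - f) : A" by auto
next
 assume "(u, scaleC z u - f) : A"
 hence "(scaleC z u - (scaleC z u - f), u) : {(f, blinfun_apply R f) | f. True}" using assms unfolding resolvent_of_def by blast
 thus "blinfun_apply R f = u" by simp
qed

lemma resolvent_resolvent_of:
 assumes "z ~: spectrum A" shows "resolvent_of A z (resolvent A z)"
 proof -
 obtain R where R: "resolvent_of A z R" using assms by (auto simp: spectrum_def)
 show ?thesis unfolding resolvent_def by (rule theI[of _ R]) (rule R, erule resolvent_of_unique[OF _ R])
qed

lemma eigenvalue_in_spectrum:
 assumes "z : eigenvalues A" "(0, 0) : A" shows "z : spectrum A"
proof (rule ccontr)
 assume "z ~: spectrum A"
 note R = resolvent_of_iff[OF resolvent_resolvent_of[OF this]]
 obtain u where u: "u ~= 0" "(u, scaleC z u) : A" using assms(1) by (auto simp: eigenvalues_def)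
 hence "blinfun_apply (resolvent A z) 0 = u" unfolding R by simp
 thus False using u by (simp)
qed

section \<open>Riesz projections through matrix elements\<close>

text \<open>The complex inner product recovered from the real one, since Re (u cnj (i v)) = Im (u
  cnj v). It is linear in the first argument.\<close>

definition cinner :: "L2R => L2R => complex" where
 "cinner u v = Complex (u \<bullet> v) (u \<bullet> scaleC \<i> v)"

lemma integrable_mult_cnj:
 assumes f: "square_integrable f" and g: "square_integrable g" shows "integrable lborel (%x. f x*cnj (g x))"
proof (rule Bochner_Integration.integrable_bound)
 note [measurable] = f[unfolded square_integrable_def, THEN conjunct1] g[unfolded square_integrable_def, THEN conjunct1]
 show "integrable lborel (%x. (cmod (f x))^2 + (cmod (g x))^2)" using f g by (simp add: square_integrable_def)
 have "(%x. cnj (g x)) : borel_measurable lborel"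
    by (rule measurable_compose[OF _ borel_measurable_continuous_onI[of cnj]]) (auto)
 thus "(%x. f x*cnj (g x)) : borel_measurable lborel" by measurable
 have "cmod (f x)*cmod (g x) <= (cmod (f x))^2 + (cmod (g x))^2" for x
  using sum_squares_bound[of "cmod (f x)" "cmod (g x)"] mult_nonneg_nonneg[OF norm_ge_zero[of "f x"] norm_ge_zero[of "g x"]] by linarith
 thus "AE x in lborel. norm (f x*cnj (g x)) <= norm ((cmod (f x))^2 + (cmod (g x))^2)" by (simp add: norm_mult)
qed

lemma cinner_to_L2:
 assumes f: "square_integrable f" and g: "square_integrable g"
 shows "cinner (to_L2 f) (to_L2 g) = (LINT x|lborel. f x*cnj (g x))"
proof (rule complex_eqI)
 have e: "L2_eq f f" "L2_eq g g" "L2_eq (%x. \<i>*g x) (%x. \<i>*g x)"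
  using f g by (simp_all add: L2_eq_def square_integrable_cmult)
 show "Re (cinner (to_L2 f) (to_L2 g)) = Re (LINT x|lborel. f x*cnj (g x))"
  using e integral_Re[OF integrable_mult_cnj[OF f g]] by (simp add: cinner_def to_L2_def inner_L2R.abs_eq)
 have "Im (cinner (to_L2 f) (to_L2 g)) = (LINT x|lborel. Re (f x*cnj (\<i>*g x)))"
  unfolding to_L2_cmult[OF g, symmetric] cinner_def using e by (simp add: to_L2_def inner_L2R.abs_eq)
 also have "... = (LINT x|lborel. Im (f x*cnj (g x)))" by (rule Bochner_Integration.integral_cong) auto
 finally show "Im (cinner (to_L2 f) (to_L2 g)) = Im (LINT x|lborel. f x*cnj (g x))"
  using integral_Im[OF integrable_mult_cnj[OF f g]] by simp
qed

lemma cinner_scaleC_left: "cinner (scaleC c u) v = c*cinner u v"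
proof -
 obtain f g where f: "square_integrable f" "to_L2 f = u" and g: "square_integrable g" "to_L2 g = v" using to_L2_surj by metis
 show ?thesis unfolding f(2)[symmetric] g(2)[symmetric] to_L2_cmult[OF f(1), symmetric]
   cinner_to_L2[OF f(1) g(1)] cinner_to_L2[OF square_integrable_cmult[OF f(1)] g(1)] by (simp add: mult.assoc)
qed

lemma norm_cinner_le: "norm (cinner u v) <= norm u*norm v"
proof (cases "cinner u v = 0")
 case False
 define c where "c = cnj (sgn (cinner u v))"
 have "norm c = 1" using False by (simp add: c_def norm_sgn)
 have "c*cinner u v = of_real (norm (cinner u v))"
   proof -
  have "c*cinner u v = of_real ((norm (cinner u v))^2)/of_real (norm (cinner u v))"
   unfolding complex_norm_square by (simp add: c_def sgn_eq)
  thus ?thesis by (simp add: power2_eq_square)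
 qed
 hence "norm (cinner u v) = scaleC c u \<bullet> v"
  unfolding cinner_scaleC_left[symmetric] by (simp add: cinner_def complex_eq_iff)
 also have "... <= norm (scaleC c u)*norm v" by (rule norm_cauchy_schwarz)
 finally show ?thesis using \<open>norm c = 1\<close> by (simp add: norm_scaleC)
qed simp

lemma bounded_linear_cinner: "bounded_linear (%u. cinner u v)"
proof (rule bounded_linear_intro[where K = "norm v"])
 show "norm (cinner u v) <= norm u*norm v" for u by (rule norm_cinner_le)
qed (simp_all add: cinner_def complex_eq_iff inner_add_left)

lemma cinner_diff_left: "cinner (u-w) v = cinner u v - cinner w v"
 by (rule linear_simps(2)[OF bounded_linear_cinner])

lemma cinner_self: "cinner u u = of_real ((norm u)^2)"
proof -
 obtain f where f: "square_integrable f" "to_L2 f = u" using to_L2_surj by metis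
 have "cinner u u = (LINT x|lborel. of_real ((cmod (f x))^2))"
  unfolding f(2)[symmetric] cinner_to_L2[OF f(1) f(1)] by (simp only: complex_norm_square)
 also have "... = of_real (LINT x|lborel. (cmod (f x))^2)" by (rule integral_complex_of_real)
 finally show ?thesis unfolding f(2)[symmetric] norm_to_L2[OF f(1)] by simp
qed

lemma cinner_zero_of_dense:
 assumes "!!h. test_function h ==> cinner u (to_L2 h) = 0" shows "u = 0"
proof -
 have "closed {h. cinner u h = 0}" unfolding cinner_def complex_eq_iff
  by (simp, intro closed_Collect_conj closed_Collect_eq continuous_intros
    linear_continuous_on[OF bounded_linear_scaleC])
 hence "closure test_classes <= {h. cinner u h = 0}" using assms by (intro closure_minimal) auto
 hence "cinner u u = 0" unfolding test_classes_dense by blast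
 thus ?thesis unfolding cinner_self by simp
qed

text \<open>Density of the test functions turns the matrix elements into P g = k (g, a) b for all g,
  and the norm of that operator is attained at a.\<close>

lemma norm_rank_one:
 assumes "!!g h. test_function g ==> test_function h ==>
  cinner (blinfun_apply P (to_L2 g)) (to_L2 h) = k*cinner (to_L2 g) a*cinner b (to_L2 h)"
 shows "norm P = norm k*norm a*norm b"
proof -
 have 1: "blinfun_apply P (to_L2 g) = scaleC (k*cinner (to_L2 g) a) b" if "test_function g" for g
 proof -
  have "blinfun_apply P (to_L2 g) - scaleC (k*cinner (to_L2 g) a) b = 0"
   by (rule cinner_zero_of_dense) (simp add: cinner_diff_left cinner_scaleC_left assms that)
  thus ?thesis by simp
 qed
 have bl: "bounded_linear (%g. scaleC (k*cinner g a) b)"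
 proof (rule bounded_linear_intro[where K = "norm k*norm a*norm b"])
  show "scaleC (k*cinner (x+y) a) b = scaleC (k*cinner x a) b + scaleC (k*cinner y a) b" for x y
   by (simp add: linear_simps(1)[OF bounded_linear_cinner] distrib_left scaleC_add_left)
  show "scaleC (k*cinner (r *\<^sub>R x) a) b = r *\<^sub>R scaleC (k*cinner x a) b" for r x
   unfolding scaleC_of_real[symmetric] scaleC_scaleC cinner_scaleC_left by (simp add: mult.left_commute)
  show "norm (scaleC (k*cinner x a) b) <= norm x*(norm k*norm a*norm b)" for x
   using mult_left_mono[OF norm_cinner_le[of x a], of "norm k*norm b"] by (simp add: norm_scaleC norm_mult mult_ac)
 qed
 have "closed {g. blinfun_apply P g = scaleC (k*cinner g a) b}"
  by (intro closed_Collect_eq linear_continuous_on bl blinfun.bounded_linear_right)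
 hence "closure test_classes <= {g. blinfun_apply P g = scaleC (k*cinner g a) b}" using 1 by (intro closure_minimal) auto
 hence P: "blinfun_apply P g = scaleC (k*cinner g a) b" for g unfolding test_classes_dense by blast
 show ?thesis
 proof (rule antisym)
  show "norm P <= norm k*norm a*norm b"
  proof (rule norm_blinfun_bound)
   show "norm (blinfun_apply P x) <= norm k*norm a*norm b*norm x" for x
    using mult_left_mono[OF norm_cinner_le[of x a], of "norm k*norm b"] by (simp add: P norm_scaleC norm_mult mult_ac)
  qed simp
  have "norm (blinfun_apply P a) <= norm P*norm a" by (rule norm_blinfun)
  moreover have "norm (blinfun_apply P a) = (norm k*norm a*norm b)*norm a"
   by (simp add: P norm_scaleC norm_mult cinner_self power2_eq_square)
  ultimately show "norm k*norm a*norm b <= norm P" by (cases "a = 0") (simp_all only: mult_le_cancel_right, auto)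
 qed
qed

lemma resolvent_identity:
 assumes R: "resolvent_of (cubic_oscillator al) z R" and S: "resolvent_of (cubic_oscillator al) w S"
 shows "blinfun_apply R f - blinfun_apply S f = scaleC (w-z) (blinfun_apply R (blinfun_apply S f))"
proof -
 let ?A = "cubic_oscillator al"
 define u v where "u = blinfun_apply R f" and "v = blinfun_apply S f"
 define x where "x = blinfun_apply R v"
 have "(u, scaleC z u - f) : ?A" "(v, scaleC w v - f) : ?A" and x: "(x, scaleC z x - v) : ?A"
    unfolding resolvent_of_iff[OF R, symmetric] resolvent_of_iff[OF S, symmetric] by (simp_all add: u_def v_def x_def)
 hence "(u - v - scaleC (w-z) x, (scaleC z u - f) - (scaleC w v - f) - scaleC (w-z) (scaleC z x - v)) : ?A"
  by (intro cubic_oscillator_diff cubic_oscillator_scaleC)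
 hence "blinfun_apply R 0 = u - v - scaleC (w-z) x" unfolding resolvent_of_iff[OF R]
    by (simp add: scaleC_diff_right scaleC_diff_left scaleC_scaleC scaleC_add_right algebra_simps)
 thus ?thesis by (simp add: u_def v_def x_def)
qed

lemma norm_scaleC_op_le: "norm (scaleC_op c) <= norm c"
 by (rule norm_blinfun_bound) (simp_all add: scaleC_op.rep_eq norm_scaleC)

lemma bounded_linear_scaleC_op: "bounded_linear scaleC_op"
proof (rule bounded_linear_intro[where K = 1])
 show "norm (scaleC_op c) <= norm c*1" for c using norm_scaleC_op_le by simp
qed (auto intro!: blinfun_eqI simp: scaleC_op.rep_eq blinfun.add_left blinfun.scaleR_left scaleC_add_left
  scaleR_conv_of_real scaleC_scaleC[symmetric] scaleC_of_real)

lemma resolvent_difference_le: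
 assumes z: "z ~: spectrum (cubic_oscillator al)" and w: "w ~: spectrum (cubic_oscillator al)"
 defines "R == resolvent (cubic_oscillator al)" shows "norm (R w - R z) <= norm (z-w)*norm (R z)*norm (R w)"
proof (rule norm_blinfun_bound)
 fix f
 have "blinfun_apply (R z) f - blinfun_apply (R w) f = scaleC (w-z) (blinfun_apply (R z) (blinfun_apply (R w) f))"
  unfolding R_def by (intro resolvent_identity[of al] resolvent_resolvent_of z w)
 hence "norm (blinfun_apply (R w - R z) f) = norm (z-w)*norm (blinfun_apply (R z) (blinfun_apply (R w) f))"
  by (metis blinfun.diff_left norm_minus_commute norm_scaleC)
 also have "... <= norm (z-w)*(norm (R z)*(norm (R w)*norm f))"
  by (intro mult_left_mono order_trans[OF norm_blinfun]) auto
 finally show "norm (blinfun_apply (R w - R z) f) <= norm (z-w)*norm (R z)*norm (R w)*norm f" by (simp)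
qed simp

lemma resolvent_continuous:
 assumes "U \<inter> spectrum (cubic_oscillator al) = {}" shows "continuous_on U (resolvent (cubic_oscillator al))"
 unfolding continuous_on_def
proof
 fix z assume z: "z : U"
 define R where "R = resolvent (cubic_oscillator al)"
 define C where "C = norm (R z)"
 have C: "0 <= C" by (simp add: C_def)
 have le: "norm (R w - R z) <= norm (z-w)*C*norm (R w)" if "w : U" for w
  unfolding R_def C_def using assms z that by (intro resolvent_difference_le) auto
 show "tendsto R (R z) (at z within U)"
 proof (rule LIM_zero_cancel, rule Lim_null_comparison)
  have "tendsto (%w. norm (z-w)*C) (norm (z-z)*C) (at z within U)" by (intro tendsto_intros)
  hence "\<forall>\<^sub>F w in at z within U. norm (z-w)*C < 1/2" by (intro order_tendstoD) auto
  moreover have "\<forall>\<^sub>F w in at z within U. w : U" by (simp add: eventually_at_filter)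
  ultimately show "\<forall>\<^sub>F w in at z within U. norm (R w - R z) <= norm (z-w)*C*(2*C)"
  proof eventually_elim
   case (elim w)
   have "norm (R w) <= C + norm (R w - R z)" unfolding C_def using norm_triangle_sub[of "R w" "R z"] by simp
   also have "... <= C + 1/2*norm (R w)" using le[OF elim(2)] mult_right_mono[OF less_imp_le[OF elim(1)] norm_ge_zero[of "R w"]] by linarith
   finally have "norm (R w) <= 2*C" by simp
   thus ?case using le[OF elim(2)] C by (elim order_trans) (intro mult_left_mono; simp)
  qed
  have "tendsto (%w. norm (z-w)*C*(2*C)) (norm (z-z)*C*(2*C)) (at z within U)" by (intro tendsto_intros)
  thus "tendsto (%w. norm (z-w)*C*(2*C)) 0 (at z within U)" by simp
 qed
qed

text \<open>The resolvent identity rewrites the difference quotient as - R w (R z g), which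
  converges by continuity of the resolvent.\<close>

lemma resolvent_cinner_holomorphic:
 assumes U: "open U" "U \<inter> spectrum (cubic_oscillator al) = {}"
 shows "(%z. cinner (blinfun_apply (resolvent (cubic_oscillator al) z) g) h) holomorphic_on U"
 unfolding holomorphic_on_open[OF U(1)]
proof (intro ballI exI)
 fix z assume z: "z : U"
 define R where "R = resolvent (cubic_oscillator al)"
 have "continuous_on U R" unfolding R_def by (rule resolvent_continuous[OF U(2)])
 hence "tendsto R (R z) (at z)" using z U(1) by (simp add: continuous_on_eq_continuous_at isCont_def)
 hence "tendsto (%w. - cinner (blinfun_apply (R w) (blinfun_apply (R z) g)) h) (- cinner (blinfun_apply (R z) (blinfun_apply (R z) g)) h) (at z)"
  by (intro tendsto_minus bounded_linear.tendsto[OF bounded_linear_cinner] blinfun.tendsto tendsto_const)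
 moreover have "\<forall>\<^sub>F w in at z. - cinner (blinfun_apply (R w) (blinfun_apply (R z) g)) h =
   (cinner (blinfun_apply (R w) g) h - cinner (blinfun_apply (R z) g) h)/(w - z)"
  using eventually_at_in_open[OF U(1) z]
 proof eventually_elim
  case (elim w)
  have "blinfun_apply (R w) g - blinfun_apply (R z) g = scaleC (z-w) (blinfun_apply (R w) (blinfun_apply (R z) g))"
   unfolding R_def using U elim z by (intro resolvent_identity[of al] resolvent_resolvent_of) auto
  hence "cinner (blinfun_apply (R w) g) h - cinner (blinfun_apply (R z) g) h = (z-w)*cinner (blinfun_apply (R w) (blinfun_apply (R z) g)) h"
   unfolding cinner_diff_left[symmetric] by (simp add: cinner_scaleC_left)
  thus ?case using elim by (simp add: field_simps)
 qed
 ultimately show "((%z. cinner (blinfun_apply (resolvent (cubic_oscillator al) z) g) h) has_field_derivative - cinner (blinfun_apply (R z) (blinfun_apply (R z) g)) h) (at z)"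
  unfolding has_field_derivative_iff R_def[symmetric] by (rule Lim_transform_eventually)
qed

text \<open>Tested against g and h the operator integral becomes a scalar Cauchy integral. The
  radius is the unspecified one chosen in \<open>riesz_projection\<close>, so all that can be used
  of it is that the closed disc meets the zero set of D at mu only.\<close>

lemma riesz_projection_cinner:
 assumes D: "D holomorphic_on UNIV" "deriv D mu ~= 0" and spec: "spectrum (cubic_oscillator al) = {z. D z = 0}" and mu: "D mu = 0"
  and be: "!!z. D z ~= 0 ==> D z*cinner (blinfun_apply (resolvent (cubic_oscillator al) z) g) h = be z" "isCont be mu"
 shows "cinner (blinfun_apply (riesz_projection (cubic_oscillator al) mu) g) h = be mu/deriv D mu"
proof -
 let ?A = "cubic_oscillator al"
 have lim: "tendsto (%z. D z/(z-mu)) (deriv D mu) (at mu)"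
  using holomorphic_derivI[OF D(1) open_UNIV UNIV_I, of mu] mu by (simp add: has_field_derivative_iff)
 hence "\<forall>\<^sub>F z in at mu. D z/(z-mu) ~= 0" using D(2) tendsto_imp_eventually_ne by blast
 then obtain d where d: "0 < d" "!!z. z ~= mu ==> dist z mu < d ==> D z ~= 0" unfolding eventually_at by auto
 have "cball mu (d/2) \<inter> spectrum ?A <= {mu}"
 proof
  fix z assume z: "z : cball mu (d/2) \<inter> spectrum ?A"
  hence "dist z mu < d" "D z = 0" using d(1) spec by (auto simp: dist_commute)
  thus "z : {mu}" using d(2)[of z] by blast
 qed
 hence "0 < d/2 & cball mu (d/2) \<inter> spectrum ?A <= {mu}" using d by simp
 define r where "r = (SOME r. 0 < r & cball mu r \<inter> spectrum ?A <= {mu})"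
 have r: "0 < r" "cball mu r \<inter> spectrum ?A <= {mu}"
  using someI[of "%r. 0 < r & cball mu r \<inter> spectrum ?A <= {mu}", OF \<open>0 < d/2 & _\<close>] by (simp_all add: r_def)
 define ga where "ga = circlepath mu r"
 define f where "f z = cinner (blinfun_apply (resolvent ?A z) g) h" for z
 have riesz: "riesz_projection ?A mu = scaleC_op (1/(2 * of_real pi*\<i>)) o\<^sub>L op_contour_integral ga (resolvent ?A)"
  by (simp add: riesz_projection_def r_def ga_def)
 \<comment> \<open>(z - mu) times the matrix element, with the singularity removed: it equals be z
   divided by D z/(z - mu), which tends to be mu/D' mu.\<close>
 define F where "F z = (if z = mu then be mu/deriv D mu else (z-mu)*f z)" for z
 define U where "U = {z. D z ~= 0}"
 have contD: "continuous_on UNIV D" by (rule holomorphic_on_imp_continuous_on[OF D(1)])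
 have U: "open U" "U \<inter> spectrum ?A = {}"
  unfolding U_def spec using open_Collect_neq[OF contD continuous_on_const] by auto
 have hf: "f holomorphic_on U" unfolding f_def by (rule resolvent_cinner_holomorphic[OF U])
 have Usub: "z : U" if "z : cball mu r" "z ~= mu" for z using r(2) that spec by (auto simp: U_def)
 have holF: "F holomorphic_on ball mu r - {mu}"
 proof (rule holomorphic_transform)
    have "ball mu r - {mu} <= U"
  proof
   fix z assume "z : ball mu r - {mu}"
   thus "z : U" by (intro Usub) auto
  qed
  thus "(%z. (z-mu)*f z) holomorphic_on ball mu r - {mu}"
   by (intro holomorphic_intros holomorphic_on_subset[OF hf])
 qed (simp add: F_def)
 have contF_mu: "isCont F mu"
 proof -
  have "tendsto (%z. be z/(D z/(z-mu))) (be mu/deriv D mu) (at mu)"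
   using be(2) by (intro tendsto_divide lim D(2)) (simp add: isCont_def)
  moreover have "\<forall>\<^sub>F z in at mu. be z/(D z/(z-mu)) = F z" unfolding eventually_at
  proof (intro exI[of _ d] conjI d ballI impI)
   fix z assume z: "z ~= mu & dist z mu < d"
   hence "D z ~= 0" using d(2) by blast
   thus "be z/(D z/(z-mu)) = F z" using be(1)[of z] z by (simp add: F_def f_def field_simps)
  qed
  ultimately have "tendsto F (be mu/deriv D mu) (at mu)" by (rule Lim_transform_eventually)
  thus ?thesis by (simp add: isCont_def F_def)
 qed
 have contF: "continuous_on (cball mu r) F" unfolding continuous_on_eq_continuous_within
 proof
  fix z assume z: "z : cball mu r"
  show "continuous (at z within cball mu r) F"
  proof (cases "z = mu")
   case False
   hence "isCont f z" using hf U(1) Usub[OF z] by (meson continuous_on_eq_continuous_at holomorphic_on_imp_continuous_on)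
   hence "isCont (%z. (z-mu)*f z) z" by (intro continuous_intros)
   moreover have "\<forall>\<^sub>F w in nhds z. F w = (w-mu)*f w"
       proof -
    have "\<forall>\<^sub>F w in nhds z. w : - {mu}" using False by (intro eventually_nhds_in_open) auto
    thus ?thesis by eventually_elim (simp add: F_def)
   qed
   ultimately have "isCont F z" by (simp add: isCont_cong)
   thus ?thesis by (rule continuous_at_imp_continuous_at_within)
  qed (use contF_mu continuous_at_imp_continuous_at_within in blast)
 qed
 have "F holomorphic_on ball mu r"
  using no_isolated_singularity[OF continuous_on_subset[OF contF ball_subset_cball] holF] by simp
 from Cauchy_integral_circlepath[OF contF this, of mu] r
 have int: "((%u. F u/(u-mu)) has_contour_integral 2 * of_real pi*\<i>*F mu) ga" by (simp add: ga_def)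
 define V where "V t = scaleC_op (vector_derivative ga (at t within {0..1})) o\<^sub>L resolvent ?A (ga t)" for t
 have im: "ga t : sphere mu r" if "t : {0..1}" for t
  using path_image_circlepath_nonneg[of r mu] r that unfolding ga_def path_image_def by auto
 have "continuous_on {0..1} V"
 proof -
  have "continuous_on {0..1} ga" unfolding ga_def using path_circlepath path_def by blast
  moreover have "ga ` {0..1} <= U"
  proof
   fix w assume "w : ga ` {0..1}"
   hence "w : sphere mu r" using im by blast
   thus "w : U" using r(1) by (intro Usub) auto
  qed
  ultimately have 1: "continuous_on {0..1} (%t. resolvent ?A (ga t))"
   by (intro continuous_on_compose2[OF resolvent_continuous[OF U(2)]])
  have "continuous_on {0..1} (%t. vector_derivative ga (at t within {0..1}))"
  proof (rule continuous_on_eq)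
   show "continuous_on {0..1} (%t. 2 * of_real pi*\<i> * of_real r*exp (2 * of_real pi*\<i> * of_real t))"
    by (intro continuous_intros)
  qed (simp add: ga_def vector_derivative_circlepath01)
  from bounded_linear.continuous_on[OF bounded_linear_scaleC_op this] 1 show ?thesis
   unfolding V_def by (intro bounded_bilinear.continuous_on[OF bounded_bilinear_blinfun_compose])
 qed
 hence "V integrable_on {0..1}" by (rule integrable_continuous_real)
 hence "(V has_integral op_contour_integral ga (resolvent ?A)) {0..1}"
  unfolding op_contour_integral_def V_def[symmetric] by (rule integrable_integral)
 moreover have "bounded_linear (%T. cinner (blinfun_apply T g) h)"
  by (rule bounded_linear_compose[OF bounded_linear_cinner blinfun.bounded_linear_left])
 ultimately have "((%t. cinner (blinfun_apply (V t) g) h) has_integral cinner (blinfun_apply (op_contour_integral ga (resolvent ?A)) g) h) {0..1}"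
  using has_integral_linear[of V _ "{0..1}" "%T. cinner (blinfun_apply T g) h"] by (simp add: o_def)
 moreover have "((%t. F (ga t)/(ga t - mu) * vector_derivative ga (at t within {0..1})) has_integral 2 * of_real pi*\<i>*F mu) {0..1}"
  using int unfolding has_contour_integral_def .
 hence "((%t. cinner (blinfun_apply (V t) g) h) has_integral 2 * of_real pi*\<i>*F mu) {0..1}"
 proof (rule has_integral_eq[rotated])
  fix t :: real assume "t : {0..1}"
  hence "ga t ~= mu" using im[of t] r by auto
  thus "F (ga t)/(ga t - mu) * vector_derivative ga (at t within {0..1}) = cinner (blinfun_apply (V t) g) h"
   by (simp add: F_def V_def f_def scaleC_op.rep_eq cinner_scaleC_left)
 qed
 ultimately have "cinner (blinfun_apply (op_contour_integral ga (resolvent ?A)) g) h = 2 * of_real pi*\<i>*F mu"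
  by (rule has_integral_unique)
 thus ?thesis by (simp add: riesz scaleC_op.rep_eq cinner_scaleC_left F_def)
qed

section \<open>Jost solutions and the bound on the Green kernel\<close>

text \<open>The cubic potential with a = - al on the line z = i x, multiplied by i^2 = - 1 from the
  two derivatives in x; one such derivative gives the factor i of \<open>line_dsol\<close>.\<close>

definition line_pot :: "real => complex => real => complex" where
 "line_pot al z x = \<i> * of_real (x^3) + \<i> * of_real al * of_real x - z"
definition line_sol :: "complex => complex => real => complex => real => complex" where
 "line_sol A B al z x = lsol A B (- of_real al) z (\<i> * of_real x)"
definition line_dsol :: "complex => complex => real => complex => real => complex" where
 "line_dsol A B al z x = \<i>*ldsol A B (- of_real al) z (\<i> * of_real x)"

abbreviation "jost_r al z == line_sol (rot_sib al z) (rot_dsib al z) al z"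
abbreviation "jost_dr al z == line_dsol (rot_sib al z) (rot_dsib al z) al z"
abbreviation "jost_l al z == line_sol (cnj (rot_sib al (cnj z))) (cnj (rot_dsib al (cnj z))) al z"
abbreviation "jost_dl al z == line_dsol (cnj (rot_sib al (cnj z))) (cnj (rot_dsib al (cnj z))) al z"

lemma line_sol_deriv: "(line_sol A B al z has_vector_derivative line_dsol A B al z x) (at x)"
 unfolding line_sol_def[abs_def] line_dsol_def by (rule lsol_ray_deriv(1))

lemma line_dsol_deriv: "(line_dsol A B al z has_vector_derivative line_pot al z x*line_sol A B al z x) (at x)"
proof -
 have "\<i>^2*pot (- of_real al) z (\<i> * of_real x) = line_pot al z x"
  by (simp add: pot_def line_pot_def power3_eq_cube algebra_simps)
 thus ?thesis
  using lsol_ray_deriv(2)[of \<i> A B "- of_real al" z x] unfolding line_dsol_def[abs_def] line_sol_def by simp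
qed

lemma line_sol_0 [simp]: "line_sol A B al z 0 = A" "line_dsol A B al z 0 = \<i>*B"
 by (simp_all add: line_sol_def line_dsol_def)

lemma smooth_line_sol: "smooth (line_sol A B al z)" unfolding line_sol_def[abs_def]
 by (rule smooth_entire) (auto simp: holomorphic_on_open intro: lsol_deriv)

lemma ddx_line_sol: "ddx (line_sol A B al z) = line_dsol A B al z"
 using line_sol_deriv by (auto simp: ddx_def vector_derivative_at)

lemma smooth_line_dsol: "smooth (line_dsol A B al z)"
 using smooth_ddx[OF smooth_line_sol] by (simp add: ddx_line_sol)

lemma line_wronskian:
 "line_sol A B al z x*line_dsol A' B' al z x - line_dsol A B al z x*line_sol A' B' al z x = \<i>*(A*B'-B*A')"
 using wronskian_lsol[of A B "- of_real al" z "\<i> * of_real x" A' B'] unfolding line_sol_def line_dsol_def by algebra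

lemma jost_wronskian:
 "jost_l al z x*jost_dr al z x - jost_dl al z x*jost_r al z x = \<i> * spec_det al z"
 unfolding line_wronskian spec_det_def by simp

text \<open>PT symmetry: conjugation together with x to - x exchanges the equations for z and cnj
  z.\<close>

lemma jost_l_eq: "jost_l al z x = cnj (jost_r al (cnj z) (- x))" "jost_dl al z x = - cnj (jost_dr al (cnj z) (- x))"
 using lsol_cnj[of "rot_sib al (cnj z)" "rot_dsib al (cnj z)" "- of_real al" "cnj z" "\<i> * of_real (- x)"]
 by (simp_all add: line_sol_def line_dsol_def)

text \<open>The right half-line is the ray of angle pi/10 for the rotated solution, well inside the
  sector of decay |th| < pi/5.\<close>

lemma jost_r_ray:
 "jost_r al z x = sibuya_sol (rot_coupling al) (cis (4*pi/5)*z) (cis (pi/10) * of_real x)"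
 "jost_dr al z x = cis (pi/10) * sibuya_dsol (rot_coupling al) (cis (4*pi/5)*z) (cis (pi/10) * of_real x)"
proof -
 have e: "cis (- (2*pi/5))*\<i> = cis (pi/10)" unfolding cis_pi_half[symmetric] cis_mult by (rule arg_cong[where f = cis]) simp
 hence "cis (- (2*pi/5))*(\<i> * of_real x) = cis (pi/10) * of_real x" by (simp)
 thus "jost_r al z x = sibuya_sol (rot_coupling al) (cis (4*pi/5)*z) (cis (pi/10) * of_real x)"
  "jost_dr al z x = cis (pi/10) * sibuya_dsol (rot_coupling al) (cis (4*pi/5)*z) (cis (pi/10) * of_real x)"
    unfolding line_sol_def line_dsol_def rot_solution e[symmetric] by (simp_all add: mult.assoc)
qed

lemma jost_r_ratio: "EX X>=1. ALL t>=X. jost_r al z t ~= 0 & Re (jost_dr al z t/jost_r al z t) <= - 2"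
 unfolding jost_r_ray using sibuya_ray[of "pi/10" "rot_coupling al" "cis (4*pi/5)*z"] by auto

lemma jost_r_decay:
 "EX C>=0. ALL x>=- X. norm (jost_r al z x) <= C*exp (- x) & norm (jost_dr al z x) <= C*exp (- x)"
proof -
 obtain C where C: "!!x. 0 <= x ==> norm (jost_r al z x) <= C*exp (- x) & norm (jost_dr al z x) <= C*exp (- x)"
  unfolding jost_r_ray using sibuya_ray_decay[of "pi/10" "rot_coupling al" "cis (4*pi/5)*z"] by (auto simp: norm_mult)
 have "bounded (jost_r al z ` {- X..0})" "bounded (jost_dr al z ` {- X..0})"
  by (intro compact_imp_bounded compact_continuous_image smooth_continuous smooth_line_sol smooth_line_dsol compact_Icc)+
 then obtain M M' where M: "!!x. x : {- X..0} ==> norm (jost_r al z x) <= M" "!!x. x : {- X..0} ==> norm (jost_dr al z x) <= M'"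
  unfolding bounded_iff by blast
 define D where "D = max 0 (max C (max M M'))"
 have D: "0 <= D" "C <= D" "M <= D" "M' <= D" by (auto simp: D_def)
 have "norm (jost_r al z x) <= D*exp (- x) & norm (jost_dr al z x) <= D*exp (- x)" if "- X <= x" for x
 proof (cases "0 <= x")
  case True
    have "C*exp (- x) <= D*exp (- x)" using D(2) by (rule mult_right_mono) simp
  thus ?thesis using C[OF True] by linarith
 next
  case False
  hence "D*1 <= D*exp (- x)" using D(1) by (intro mult_left_mono) auto
  thus ?thesis using M[of x] D False that by simp
 qed
 thus ?thesis using D(1) by blast
qed

text \<open>The product h satisfies h' = 2 q h - W, with q the logarithmic derivative of the
  decaying solution and W the constant Wronskian. As Re q <= - 2, (|h|^2 - |W|^2) exp t is
  nonincreasing. This takes the place of asymptotics for the growing solution.\<close>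

lemma jost_product_bounded:
 assumes "1 <= X" and r: "!!t. X <= t ==> jost_r al z t ~= 0 & Re (jost_dr al z t/jost_r al z t) <= - 2"
 shows "EX K. ALL t>=X. norm (jost_l al z t)*norm (jost_r al z t) <= K"
proof -
 define W where "W = \<i> * spec_det al z"
 define c where "c = (norm W)^2"
 define h where "h t = jost_l al z t*jost_r al z t" for t
 define h' where "h' t = jost_l al z t*jost_dr al z t + jost_dl al z t*jost_r al z t" for t
 have h: "(h has_vector_derivative h' t) (at t)" for t
  unfolding h_def[abs_def] h'_def by (intro has_vector_derivative_mult line_sol_deriv)
 define g where "g t = (h t \<bullet> h t - c)*exp t" for t
 have "g t <= g X" if t: "X <= t" for t
 proof (rule DERIV_nonpos_imp_nonincreasing[OF t])
  fix s assume s: "X <= s" "s <= t"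
  have hi: "((%t. h t \<bullet> h t) has_real_derivative 2*(h s \<bullet> h' s)) (at s)"
   using bounded_bilinear.has_vector_derivative[OF bounded_bilinear_inner h[of s] h[of s]]
   by (simp add: has_real_derivative_iff_has_vector_derivative inner_commute)
  hence g': "(g has_real_derivative (2*(h s \<bullet> h' s) + (h s \<bullet> h s - c))*exp s) (at s)"
   unfolding g_def[abs_def] by (auto intro!: derivative_eq_intros simp: algebra_simps)
  define q where "q = jost_dr al z s/jost_r al z s"
  have q: "Re q <= - 2" and nz: "jost_r al z s ~= 0" using r[OF s(1)] by (auto simp: q_def)
  have "h' s = 2*(jost_l al z s*jost_dr al z s) - W" unfolding W_def jost_wronskian[of al z s, symmetric] h'_def by simp
  also have "jost_l al z s*jost_dr al z s = q*h s" using nz by (simp add: q_def h_def)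
    finally have "h' s = 2*(q*h s) - W" .
  hence "h s \<bullet> h' s = 2*(h s \<bullet> (q*h s)) - h s \<bullet> W" by (simp only: inner_diff_right) (simp add: inner_complex_def algebra_simps)
  also have "h s \<bullet> (q*h s) = Re q*(h s \<bullet> h s)" by (simp add: inner_complex_def algebra_simps)
  also have "2*(Re q*(h s \<bullet> h s)) - h s \<bullet> W <= 2*(- 2*(h s \<bullet> h s)) + norm (h s)*norm W"
   using mult_right_mono[OF q inner_ge_zero[of "h s"]] norm_cauchy_schwarz[of "h s" "- W"] by simp
    finally have 1: "h s \<bullet> h' s <= 2*(- 2*(h s \<bullet> h s)) + norm (h s)*norm W" .
  have 2: "norm (h s)*norm W <= (h s \<bullet> h s + c)/2"
   using sum_squares_bound[of "norm (h s)" "norm W"] by (simp add: c_def dot_square_norm)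
    have "2*(h s \<bullet> h' s) + (h s \<bullet> h s - c) <= 0" proof -
   have "x <= 2*(- 2*H) + y ==> y <= (H+c)/2 ==> 0 <= H ==> 2*x + (H-c) <= 0" for x y H :: real by argo
   from this[OF 1 2 inner_ge_zero] show ?thesis .
  qed
  thus "EX y. (g has_real_derivative y) (at s) & y <= 0" using g' mult_nonpos_nonneg[OF _ exp_ge_zero] by blast
 qed
 hence le: "(h t \<bullet> h t - c)*exp t <= (h X \<bullet> h X)*exp t" if "X <= t" for t
 proof -
  have "(h X \<bullet> h X - c)*exp X <= (h X \<bullet> h X)*exp t" using that by (intro mult_mono) (auto simp: c_def)
    thus ?thesis using \<open>X <= t ==> g t <= g X\<close>[OF that] unfolding g_def by linarith
 qed
 have "norm (h t) <= sqrt (h X \<bullet> h X + c)" if "X <= t" for t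
  using le[OF that] by (intro real_le_rsqrt) (simp add: dot_square_norm[symmetric])
 thus ?thesis unfolding h_def norm_mult by blast
qed

text \<open>The numerator of the Green kernel. Far to the right the bound on the diagonal is carried
  from x to y by \<open>decreasing_ratio\<close>, far to the left the reflection
  \<open>jost_l_eq\<close> is used, and in between both factors obey their own exponential
  bounds.\<close>

lemma jost_kernel_bound:
 "EX K>=0. ALL x y. x <= y --> norm (jost_l al z x)*norm (jost_r al z y) <= K*exp (- (y-x))"
proof -
 have right: "EX X0>=1. ALL X>=X0. EX K. ALL x y. X <= x --> x <= y --> norm (jost_l al z x)*norm (jost_r al z y) <= K*exp (- (y-x))" for z
 proof -
  obtain X0 where X0: "1 <= X0" "!!t. X0 <= t ==> jost_r al z t ~= 0 & Re (jost_dr al z t/jost_r al z t) <= - 2"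
   using jost_r_ratio by blast
  have "EX K. ALL x y. X <= x --> x <= y --> norm (jost_l al z x)*norm (jost_r al z y) <= K*exp (- (y-x))" if X: "X0 <= X" for X
  proof -
   have X1: "1 <= X" using X X0 by simp
   have X2: "!!t. X <= t ==> jost_r al z t ~= 0 & Re (jost_dr al z t/jost_r al z t) <= - 2" using X0(2) X by simp
   obtain K where K: "!!t. X <= t ==> norm (jost_l al z t)*norm (jost_r al z t) <= K"
    using jost_product_bounded[OF X1 X2] by blast
   have "norm (jost_l al z x)*norm (jost_r al z y) <= K*exp (- (y-x))" if xy: "X <= x" "x <= y" for x y
   proof -
    have "norm (jost_r al z y) <= exp (- 2*(y-x))*norm (jost_r al z x)"
     by (rule decreasing_ratio[OF line_sol_deriv, where X = X]) (use X2 xy in auto)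
    also have "... <= exp (- (y-x))*norm (jost_r al z x)" using xy by (intro mult_right_mono) auto
    finally have "norm (jost_l al z x)*norm (jost_r al z y) <= norm (jost_l al z x)*(exp (- (y-x))*norm (jost_r al z x))"
     by (rule mult_left_mono) simp
    also have "... = (norm (jost_l al z x)*norm (jost_r al z x))*exp (- (y-x))" by simp
    also have "... <= K*exp (- (y-x))" using K[OF xy(1)] by (intro mult_right_mono) auto
    finally show ?thesis .
   qed
   thus ?thesis by blast
  qed
  thus ?thesis using X0(1) by blast
 qed
 have reflect: "norm (jost_l al z x) = norm (jost_r al (cnj z) (- x))" "norm (jost_r al z x) = norm (jost_l al (cnj z) (- x))" for x
  using jost_l_eq(1)[of al z x] jost_l_eq(1)[of al "cnj z" "- x"] by simp_all
 obtain X1 X2 where X1: "1 <= X1" "!!X. X1 <= X ==> EX K. ALL x y. X <= x --> x <= y --> norm (jost_l al z x)*norm (jost_r al z y) <= K*exp (- (y-x))"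
  and X2: "!!X. X2 <= X ==> EX K. ALL x y. X <= x --> x <= y --> norm (jost_l al (cnj z) x)*norm (jost_r al (cnj z) y) <= K*exp (- (y-x))"
  using right[of z] right[of "cnj z"] by blast
 define X where "X = max X1 X2"
 obtain K1 where K1: "!!x y. X <= x ==> x <= y ==> norm (jost_l al z x)*norm (jost_r al z y) <= K1*exp (- (y-x))"
  using X1(2)[of X] by (auto simp: X_def)
 obtain K2 where K2: "!!x y. X <= x ==> x <= y ==> norm (jost_l al (cnj z) x)*norm (jost_r al (cnj z) y) <= K2*exp (- (y-x))"
  using X2[of X] by (auto simp: X_def)
 obtain C where C: "0 <= C" "!!x. - X <= x ==> norm (jost_r al z x) <= C*exp (- x)" using jost_r_decay by blast
 obtain C' where C': "0 <= C'" "!!x. - X <= x ==> norm (jost_r al (cnj z) x) <= C'*exp (- x)" using jost_r_decay by blast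
 define K where "K = max (C'*C) (max K1 K2)"
 have K: "C'*C <= K" "K1 <= K" "K2 <= K" "0 <= K" using C(1) C'(1) by (auto simp: K_def le_max_iff_disj)
 have le: "a*exp (- (y-x)) <= K*exp (- (y-x))" if "a <= K" for a x y :: real using that by (intro mult_right_mono) auto
 have "norm (jost_l al z x)*norm (jost_r al z y) <= K*exp (- (y-x))" if xy: "x <= y" for x y
 proof -
  consider "X <= x" | "y <= - X" | "x <= X" "- X <= y" by linarith
  thus ?thesis
  proof cases
   case 1
   thus ?thesis using K1[of x y] xy le[OF K(2), of y x] by linarith
  next
   case 2
   thus ?thesis using order_trans[OF K2[of "- y" "- x"], of "K*exp (- (y-x))"] xy le[OF K(3), of y x]
    unfolding reflect(1)[of x] reflect(2)[of y] by (simp add: mult.commute)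
  next
   case 3
   have "norm (jost_l al z x)*norm (jost_r al z y) <= (C'*exp x)*(C*exp (- y))"
    using C(2)[of y] C'(2)[of "- x"] C C' 3 unfolding reflect(1)[of x] by (intro mult_mono) auto
   also have "... = C'*C*exp (- (y-x))" by (simp add: exp_diff exp_minus field_simps)
   finally show ?thesis using le[OF K(1), of y x] by linarith
  qed
 qed
 thus ?thesis using K(4) by blast
qed

section \<open>Resolvent and spectrum\<close>

definition exp_decay :: "(real => complex) => bool" where
 "exp_decay f \<longleftrightarrow> (EX C>=0. ALL x. norm (f x) <= C*exp (- abs x))"

lemma nn_integral_exp_abs_le: "(\<integral>\<^sup>+y. ennreal (exp (- abs (x-y))) \<partial>lborel) <= 2"
proof -
 define E where "E t = ennreal (exp (- t))*indicator {0..} t" for t :: real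
 have [measurable]: "E : borel_measurable borel" unfolding E_def[abs_def] by measurable
 have "tendsto (%t::real. - exp (- t)) 0 at_top" by real_asymp
 hence E: "(\<integral>\<^sup>+t. E t \<partial>lborel) = 1"
  unfolding E_def by (subst nn_integral_FTC_atLeast[where F = "%t. - exp (- t)" and T = 0]) (auto intro!: derivative_eq_intros)
 have "(\<integral>\<^sup>+y. ennreal (exp (- abs (x-y))) \<partial>lborel) <= (\<integral>\<^sup>+y. E (x + (- 1)*y) + E (- x + 1*y) \<partial>lborel)"
  by (intro nn_integral_mono) (auto simp: E_def split: split_indicator)
 also have "... = (\<integral>\<^sup>+y. E (x + (- 1)*y) \<partial>lborel) + (\<integral>\<^sup>+y. E (- x + 1*y) \<partial>lborel)"
  by (intro nn_integral_add) measurable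
 also have "... = 1 + 1"
  using nn_integral_real_affine[of E "- 1" x] nn_integral_real_affine[of E 1 "- x"] E by simp
 finally show ?thesis by simp
qed

lemma exp_decay_square_integrable:
 assumes "continuous_on UNIV f" "exp_decay f" shows "square_integrable f"
proof -
 obtain C where C: "0 <= C" "!!x. norm (f x) <= C*exp (- abs x)" using assms(2) by (auto simp: exp_decay_def)
 have m [measurable]: "f : borel_measurable lborel" using assms(1) by (simp add: borel_measurable_continuous_onI)
 have "(\<integral>\<^sup>+x. ennreal (norm ((cmod (f x))^2)) \<partial>lborel) <= (\<integral>\<^sup>+x. ennreal (C^2)*ennreal (exp (- abs (0-x))) \<partial>lborel)"
 proof (intro nn_integral_mono)
  fix x
  have "(cmod (f x))^2 <= (C*exp (- abs x))^2" by (intro power_mono C) auto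
  also have "... = C^2*exp (- 2*abs x)" by (simp add: power_mult_distrib exp_double[symmetric])
  also have "... <= C^2*exp (- abs x)" by (intro mult_left_mono) auto
  finally show "ennreal (norm ((cmod (f x))^2)) <= ennreal (C^2)*ennreal (exp (- abs (0-x)))"
   by (simp add: ennreal_mult[symmetric])
 qed
 also have "... = ennreal (C^2)*(\<integral>\<^sup>+x. ennreal (exp (- abs (0-x))) \<partial>lborel)" by (intro nn_integral_cmult) measurable
 also have "... <= ennreal (C^2)*2" by (intro mult_left_mono nn_integral_exp_abs_le) auto
 also have "... < \<infinity>" by (simp add: ennreal_mult_less_top)
 finally show ?thesis by (simp add: square_integrable_def integrable_iff_bounded)
qed

lemma exp_decayI:
  assumes "0 <= r" "continuous_on UNIV f" "!!x. r <= x ==> norm (f x) <= C*exp (- x)" "!!x. x <= - r ==> norm (f x) <= C'*exp x"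
 shows "exp_decay f"
proof -
 have "bounded ((%x. norm (f x)*exp (abs x)) ` {- r..r})"
  by (intro compact_imp_bounded compact_continuous_image continuous_intros continuous_on_subset[OF assms(2)]) auto
 then obtain M where M: "!!x. x : {- r..r} ==> norm (norm (f x)*exp (abs x)) <= M" unfolding bounded_iff by blast
 define K where "K = max (max 0 M) (max (abs C) (abs C'))"
 have r: "norm (f x) <= K*exp (- abs x)" for x
 proof -
  consider "x : {- r..r}" | "r <= x" | "x <= - r" by fastforce
  thus ?thesis
  proof cases
   case 1
   hence "norm (f x)*exp (abs x) <= K" using M[OF 1] by (simp add: K_def)
   hence "norm (f x)*exp (abs x)*exp (- abs x) <= K*exp (- abs x)" by (intro mult_right_mono) auto
   thus ?thesis by (simp add: mult.assoc exp_add[symmetric])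
  next
   case 2
      have "C*exp (- x) <= K*exp (- abs x)" using 2 assms(1) by (intro mult_mono) (auto simp: K_def)
   thus ?thesis using assms(3)[OF 2] by linarith
  next
   case 3
      have "C'*exp x <= K*exp (- abs x)" using 3 assms(1) by (intro mult_mono) (auto simp: K_def)
   thus ?thesis using assms(4)[OF 3] by linarith
  qed
 qed
 moreover have "0 <= K" by (simp add: K_def)
 ultimately show ?thesis by (auto simp: exp_decay_def)
qed

lemma ddx_affine:
 assumes "smooth f" shows "ddx (%x. f (a+b*x)) = (%x. of_real b*ddx f (a+b*x))"
proof
 fix x
 have "((%x. a + b*x) has_vector_derivative b) (at x)" by (auto intro!: derivative_eq_intros)
 from vector_diff_chain_at[OF this smooth_derivative[OF assms]]
 show "ddx (%x. f (a+b*x)) x = of_real b*ddx f (a+b*x)"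
  by (simp add: ddx_def o_def vector_derivative_at scaleR_conv_of_real)
qed

lemma ddx_locally_constant:
 assumes "open S" "x : S" "!!y. y : S ==> f y = c" shows "ddx f x = 0"
proof -
 have "(f has_vector_derivative 0) (at x)"
  by (rule has_vector_derivative_transform_within_open[OF has_vector_derivative_const[of c] assms(1,2)]) (simp add: assms(3))
 thus ?thesis by (simp add: ddx_def vector_derivative_at)
qed

lemma cubic_expr_mult:
 assumes "smooth k" "smooth u"
 shows "cubic_expr al (%x. k x*u x) x = k x*cubic_expr al u x - 2*(ddx k x*ddx u x) - ddx (ddx k) x*u x"
 by (simp add: cubic_expr_def ddx_mult ddx_add smooth_mult smooth_ddx assms algebra_simps)

text \<open>Cutoffs at scale n + 1 bring u into the closure: the commutator terms 2 k' u' + k'' u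
  are dominated by u and u' and vanish on growing intervals.\<close>

lemma cubic_oscillator_of_decay:
 assumes u: "smooth u" "exp_decay u" "exp_decay (ddx u)" and sq: "square_integrable (cubic_expr al u)"
 shows "(to_L2 u, to_L2 (cubic_expr al u)) : cubic_oscillator al"
proof -
 obtain rh B where rh: "smooth rh" "!!x. abs x <= 1 ==> rh x = 1" "!!x. 2 < abs x ==> rh x = 0"
  and B: "0 <= B" "!!x. norm (rh x) <= B" "!!x. norm (ddx rh x) <= B" "!!x. norm (ddx (ddx rh) x) <= B"
  using cutoff_exists by metis
 have rh_1: "ddx rh x = 0" if "abs x < 1" for x
  by (rule ddx_locally_constant[of "{- 1<..<1}"]) (use that rh(2) in auto)
 have rh_2: "ddx (ddx rh) x = 0" if "abs x < 1" for x
  by (rule ddx_locally_constant[of "{- 1<..<1}"]) (use that rh_1 in auto)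
 define b where "b n = 1/real (Suc n)" for n
 have b: "0 < b n" "b n <= 1" for n by (auto simp: b_def)
 define k where "k n x = rh (0 + b n*x)" for n x
 have k: "smooth (k n)" for n unfolding k_def by (rule smooth_affine[OF rh(1)])
 have dk: "ddx (k n) x = of_real (b n)*ddx rh (0 + b n*x)" for n x unfolding k_def ddx_affine[OF rh(1)] by simp
 have ddk: "ddx (ddx (k n)) x = of_real (b n)*(of_real (b n)*ddx (ddx rh) (0 + b n*x))" for n x
    unfolding k_def ddx_affine[OF rh(1)] ddx_cmult[OF smooth_affine[OF smooth_ddx[OF rh(1)]]] ddx_affine[OF smooth_ddx[OF rh(1)]] by simp
 have bb: "abs (b n*b n) <= 1" for n using b[of n] mult_mono[of "b n" 1 "b n" 1] by simp
 have kB: "norm (k n x) <= B" "norm (ddx (k n) x) <= B" "norm (ddx (ddx (k n)) x) <= B" for n x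
  using B mult_mono[of "b n" 1 "norm (ddx rh (0 + b n*x))" B] mult_mono[of "abs (b n*b n)" 1 "norm (ddx (ddx rh) (0 + b n*x))" B] b[of n] bb[of n]
  unfolding dk ddk by (auto simp: k_def norm_mult abs_mult mult.assoc)
 have k1: "k n x = 1" "ddx (k n) x = 0" "ddx (ddx (k n)) x = 0" if "abs x < real (Suc n)" for n x
 proof -
  have "abs (b n*x) < 1" using that by (simp add: b_def)
  thus "k n x = 1" "ddx (k n) x = 0" "ddx (ddx (k n)) x = 0" using rh(2) rh_1 rh_2 unfolding dk ddk by (simp_all add: k_def)
 qed
 have test: "test_function (%x. k n x*u x)" for n
 proof (rule test_function_smooth[where r = "2*real (Suc n)"])
  fix x assume "2*real (Suc n) < abs x"
  hence "2 < abs (0 + b n*x)" by (simp add: b_def less_divide_eq)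
  thus "k n x*u x = 0" unfolding k_def by (simp only: rh(3)) simp
 qed (intro smooth_mult k u)
 have su: "square_integrable u" "square_integrable (ddx u)"
  by (intro exp_decay_square_integrable smooth_continuous smooth_ddx u)+
 have ev: "\<forall>\<^sub>F n in sequentially. abs x < real (Suc n)" for x
 proof -
  obtain N where "abs x < real N" using reals_Archimedean2 by blast
  thus ?thesis by (intro eventually_sequentiallyI[of N]) auto
 qed
 have lim1: "LIMSEQ (%n. to_L2 (%x. k n x*u x)) (to_L2 u)"
 proof (rule L2_dominated_convergence[OF square_integrable_test_function[OF test] su(1) square_integrable_cmult[OF su(1), of "of_real B"]])
  show "AE x in lborel. norm (k n x*u x) <= norm (of_real B*u x)" for n
   using kB B(1) by (auto simp: norm_mult intro!: mult_right_mono)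
  show "AE x in lborel. (%n. k n x*u x) \<longlonglongrightarrow> u x"
  proof (rule AE_I2)
   fix x
   have "\<forall>\<^sub>F n in sequentially. u x = k n x*u x" using ev[of x] by eventually_elim (simp add: k1)
   thus "LIMSEQ (%n. k n x*u x) (u x)" by (rule Lim_transform_eventually[OF tendsto_const])
  qed
 qed
 define w :: "real => complex" where "w x = of_real B*(of_real (norm (cubic_expr al u x)) + (of_real (2*norm (ddx u x)) + of_real (norm (u x))))" for x
 have mw: "square_integrable (%x. complex_of_real (c*norm (f x)))" if "square_integrable f" for f :: "real => complex" and c
 proof (rule square_integrable_mono[OF _ square_integrable_cmult[OF that, of "of_real c"]])
  have [measurable]: "f : borel_measurable lborel" using that by (simp add: square_integrable_def)
  show "(%x. complex_of_real (c*norm (f x))) : borel_measurable lborel" by measurable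
 qed (simp add: norm_mult abs_mult)
 have w: "square_integrable w" unfolding w_def
  using mw[OF sq, of 1] mw[OF su(1), of 1] mw[OF su(2), of 2] by (intro square_integrable_cmult square_integrable_add) auto
 have lim2: "LIMSEQ (%n. to_L2 (cubic_expr al (%x. k n x*u x))) (to_L2 (cubic_expr al u))"
 proof (rule L2_dominated_convergence[OF square_integrable_cubic_expr[OF test] sq w])
  show "AE x in lborel. norm (cubic_expr al (%x. k n x*u x) x) <= norm (w x)" for n
  proof (rule AE_I2)
   fix x
   have "norm (cubic_expr al (%x. k n x*u x) x) <= norm (k n x)*norm (cubic_expr al u x) + 2*(norm (ddx (k n) x)*norm (ddx u x)) + norm (ddx (ddx (k n)) x)*norm (u x)"
    unfolding cubic_expr_mult[OF k u(1)]
    by (intro order_trans[OF norm_triangle_ineq4] add_mono) (simp_all add: norm_mult)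
   also have "... <= B*norm (cubic_expr al u x) + 2*(B*norm (ddx u x)) + B*norm (u x)"
    by (intro add_mono mult_left_mono mult_right_mono kB) auto
   also have "... = norm (w x)"
   proof -
    have "w x = of_real (B*norm (cubic_expr al u x) + 2*(B*norm (ddx u x)) + B*norm (u x))" by (simp add: w_def algebra_simps)
    thus ?thesis using B(1) by (simp only: norm_of_real) simp
   qed
   finally show "norm (cubic_expr al (%x. k n x*u x) x) <= norm (w x)" .
  qed
  show "AE x in lborel. (%n. cubic_expr al (%x. k n x*u x) x) \<longlonglongrightarrow> cubic_expr al u x"
  proof (rule AE_I2)
   fix x
   have "\<forall>\<^sub>F n in sequentially. cubic_expr al u x = cubic_expr al (%x. k n x*u x) x"
    using ev[of x] by eventually_elim (simp add: k1 cubic_expr_mult[OF k u(1)])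
   thus "LIMSEQ (%n. cubic_expr al (%x. k n x*u x) x) (cubic_expr al u x)"
    by (rule Lim_transform_eventually[OF tendsto_const])
  qed
 qed
 show ?thesis unfolding cubic_oscillator_iff using test lim1 lim2 by (intro exI[of _ "%n x. k n x*u x"]) blast
qed

text \<open>Schur's test: split the exponential evenly, apply Cauchy-Schwarz in y, then exchange the
  integrals. Each of the two integrations of the exponential costs at most a factor 2, and a square
  root is taken at the end.\<close>

lemma norm_L2_le_of_kernel:
 assumes phi: "square_integrable phi" and h: "square_integrable h" and K: "0 <= K"
  and le: "!!x. ennreal (norm (phi x)) <= (\<integral>\<^sup>+y. ennreal (K*exp (- abs (x-y))*norm (h y)) \<partial>lborel)"
 shows "norm (to_L2 phi) <= 2*K*norm (to_L2 h)"
proof -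
 have [measurable]: "h : borel_measurable borel" using h by (simp add: square_integrable_def)
 define G where "G x y = ennreal (K^2*exp (- abs (x-y))*(norm (h y))^2)" for x y
 have pt: "ennreal ((norm (phi x))^2) <= 2*(\<integral>\<^sup>+y. G x y \<partial>lborel)" for x
 proof -
    have e: "exp (- abs (x-y)/2)*exp (- abs (x-y)/2) = exp (- abs (x-y))" for y by (simp add: exp_add[symmetric])
  have e2: "(exp (- abs (x-y)/2))^2 = exp (- abs (x-y))" for y unfolding power2_eq_square by (rule e)
  have "ennreal ((norm (phi x))^2) = (ennreal (norm (phi x)))^2" by (simp add: ennreal_power)
  also have "... <= (\<integral>\<^sup>+y. ennreal (K*exp (- abs (x-y))*norm (h y)) \<partial>lborel)^2" by (intro power_mono le) auto
  also have "(\<integral>\<^sup>+y. ennreal (K*exp (- abs (x - y))*norm (h y)) \<partial>lborel) =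
    (\<integral>\<^sup>+y. ennreal (exp (- abs (x - y)/2))*ennreal (K*exp (- abs (x - y)/2)*norm (h y)) \<partial>lborel)"
   using K by (intro nn_integral_cong) (simp add: ennreal_mult[symmetric] e[symmetric])
  also have "...^2 <= (\<integral>\<^sup>+y. (ennreal (exp (- abs (x-y)/2)))^2 \<partial>lborel)*(\<integral>\<^sup>+y. (ennreal (K*exp (- abs (x-y)/2)*norm (h y)))^2 \<partial>lborel)"
   by (rule Cauchy_Schwarz_nn_integral) measurable
  also have "(\<integral>\<^sup>+y. (ennreal (exp (- abs (x-y)/2)))^2 \<partial>lborel) = (\<integral>\<^sup>+y. ennreal (exp (- abs (x-y))) \<partial>lborel)"
   by (intro nn_integral_cong) (simp only: ennreal_power exp_ge_zero e2)
  also have "(\<integral>\<^sup>+y. (ennreal (K*exp (- abs (x-y)/2)*norm (h y)))^2 \<partial>lborel) = (\<integral>\<^sup>+y. G x y \<partial>lborel)"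
   using K by (intro nn_integral_cong) (simp only: G_def ennreal_power mult_nonneg_nonneg exp_ge_zero norm_ge_zero power_mult_distrib e2)
  also have "(\<integral>\<^sup>+y. ennreal (exp (- abs (x-y))) \<partial>lborel)*(\<integral>\<^sup>+y. G x y \<partial>lborel) <= 2*(\<integral>\<^sup>+y. G x y \<partial>lborel)"
   by (intro mult_right_mono nn_integral_exp_abs_le) auto
  finally show ?thesis .
 qed
 have [measurable]: "case_prod G : borel_measurable (lborel \<Otimes>\<^sub>M lborel)"
  unfolding G_def[abs_def] by (simp) measurable
 have "(\<integral>\<^sup>+x. ennreal ((norm (phi x))^2) \<partial>lborel) <= (\<integral>\<^sup>+x. 2*(\<integral>\<^sup>+y. G x y \<partial>lborel) \<partial>lborel)"
  by (intro nn_integral_mono pt)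
 also have "... = 2*(\<integral>\<^sup>+x. (\<integral>\<^sup>+y. G x y \<partial>lborel) \<partial>lborel)" by (intro nn_integral_cmult) measurable
 also have "(\<integral>\<^sup>+x. (\<integral>\<^sup>+y. G x y \<partial>lborel) \<partial>lborel) = (\<integral>\<^sup>+y. (\<integral>\<^sup>+x. G x y \<partial>lborel) \<partial>lborel)"
  by (rule lborel_pair.Fubini'[symmetric]) measurable
 also have "... <= (\<integral>\<^sup>+y. ennreal (2*K^2)*ennreal ((norm (h y))^2) \<partial>lborel)"
 proof (intro nn_integral_mono)
  fix y
  have "(\<integral>\<^sup>+x. G x y \<partial>lborel) = (\<integral>\<^sup>+x. ennreal (K^2*(norm (h y))^2)*ennreal (exp (- abs (y-x))) \<partial>lborel)"
   by (intro nn_integral_cong) (simp add: G_def ennreal_mult[symmetric] abs_minus_commute)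
  also have "... = ennreal (K^2*(norm (h y))^2)*(\<integral>\<^sup>+x. ennreal (exp (- abs (y-x))) \<partial>lborel)" by (intro nn_integral_cmult) measurable
  also have "... <= ennreal (K^2*(norm (h y))^2)*ennreal 2" using nn_integral_exp_abs_le[of y] by (intro mult_left_mono) auto
  also have "... = ennreal (2*K^2)*ennreal ((norm (h y))^2)" by (simp add: ennreal_mult[symmetric] del: ennreal_numeral)
  finally show "(\<integral>\<^sup>+x. G x y \<partial>lborel) <= ennreal (2*K^2)*ennreal ((norm (h y))^2)" .
 qed
 also have "... = ennreal (2*K^2)*(\<integral>\<^sup>+y. ennreal ((norm (h y))^2) \<partial>lborel)" by (intro nn_integral_cmult) measurable
 finally have "ennreal ((norm (to_L2 phi))^2) <= 2*(ennreal (2*K^2)*ennreal ((norm (to_L2 h))^2))"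
  unfolding nn_integral_to_L2[OF phi] nn_integral_to_L2[OF h] by (simp add: mult_left_mono)
 also have "... = ennreal ((2*K*norm (to_L2 h))^2)"
  by (simp add: ennreal_mult[symmetric] power_mult_distrib flip: ennreal_numeral)
 finally have "(norm (to_L2 phi))^2 <= (2*K*norm (to_L2 h))^2" by simp
 thus ?thesis by (rule power2_le_imp_le) (use K in simp)
qed

lemma has_integral_of_derivative:
 fixes f :: "real => complex"
 assumes "a <= b" "!!x. (f has_vector_derivative f' x) (at x)" shows "(f' has_integral (f b - f a)) {a..b}"
 using assms by (intro fundamental_theorem_of_calculus) (auto intro: has_vector_derivative_at_within)

lemma constant_of_zero_derivative:
 fixes f :: "real => complex"
 assumes "a <= b" "!!x. (f has_vector_derivative f' x) (at x)" "!!x. x : {a..b} ==> f' x = 0" shows "f a = f b"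
 using has_integral_unique[OF has_integral_of_derivative[OF assms(1,2)] has_integral_is_0[OF assms(3)]] by simp

text \<open>For a test function Green's formula has no boundary terms at infinity and represents W
  phi by the Jost kernel applied to h = (z - A) phi; the kernel bound and Schur's test give the
  estimate.\<close>

lemma jost_lower_bound:
 assumes D: "spec_det al z ~= 0"
 shows "EX C. ALL phi. test_function phi --> norm (to_L2 phi) <= C*norm (scaleC z (to_L2 phi) - to_L2 (cubic_expr al phi))"
proof -
 obtain K where K: "0 <= K" "!!x y. x <= y ==> norm (jost_l al z x)*norm (jost_r al z y) <= K*exp (- (y-x))"
  using jost_kernel_bound by blast
 define W where "W = \<i> * spec_det al z"
 have W: "0 < norm W" using D by (simp add: W_def)
 have "norm (to_L2 phi) <= 2*(K/norm W)*norm (scaleC z (to_L2 phi) - to_L2 (cubic_expr al phi))" if test: "test_function phi" for phi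
 proof -
  have s: "smooth phi" by (rule smooth_test_function(1)[OF test])
  obtain r where r: "0 < r" "!!x. r < abs x ==> phi x = 0" using smooth_test_function(2)[OF test] by blast
  define h where "h x = z*phi x - cubic_expr al phi x" for x
  have sq: "square_integrable phi" "square_integrable (cubic_expr al phi)" using test by (simp_all add: square_integrable_test_function square_integrable_cubic_expr)
  have h: "square_integrable h" "to_L2 h = scaleC z (to_L2 phi) - to_L2 (cubic_expr al phi)"
   unfolding h_def using sq by (simp_all add: to_L2_diff to_L2_cmult square_integrable_diff square_integrable_cmult)
  have hc: "continuous_on S h" for S unfolding h_def by (intro continuous_intros smooth_continuous smooth_cubic_expr s)
  have hq: "h x = ddx (ddx phi) x - line_pot al z x*phi x" for x by (simp add: h_def cubic_expr_def line_pot_def algebra_simps)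
  define F where "F A B x = line_sol A B al z x*ddx phi x - line_dsol A B al z x*phi x" for A B x
  have F: "(F A B has_vector_derivative line_sol A B al z x*h x) (at x)" for A B x
  proof -
   have "(F A B has_vector_derivative (line_sol A B al z x*ddx (ddx phi) x + line_dsol A B al z x*ddx phi x)
     - (line_dsol A B al z x*ddx phi x + line_pot al z x*line_sol A B al z x*phi x)) (at x)"
    unfolding F_def[abs_def]
    by (intro has_vector_derivative_diff has_vector_derivative_mult line_sol_deriv line_dsol_deriv smooth_derivative smooth_ddx s)
   thus ?thesis by (simp add: hq algebra_simps)
  qed
  define t where "t = r + 1"
  have F0: "F A B t = 0" "F A B (- t) = 0" for A B
   using r ddx_zero_outside[of r phi t] ddx_zero_outside[of r phi "- t"] by (simp_all add: F_def t_def)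
  show ?thesis unfolding h(2)[symmetric]
  proof (rule norm_L2_le_of_kernel[OF sq(1) h(1)])
   show "0 <= K/norm W" using K by simp
   fix x
   define k where "k y = K*exp (- abs (x-y))*norm (h y)" for y
   have kc: "continuous_on S k" for S unfolding k_def by (intro continuous_intros hc)
   show "ennreal (norm (phi x)) <= (\<integral>\<^sup>+y. ennreal (K/norm W*exp (- abs (x-y))*norm (h y)) \<partial>lborel)"
   proof (cases "abs x <= t")
    case True
    hence x: "- t <= x" "x <= t" by auto
    define I J where "I = integral {- t..x} (%y. jost_r al z x*(jost_l al z y*h y))"
     and "J = integral {x..t} (%y. jost_l al z x*(jost_r al z y*h y))"
    have "I = jost_r al z x*(jost_l al z x*ddx phi x - jost_dl al z x*phi x)"
     unfolding I_def using has_integral_of_derivative[OF x(1) F, of "cnj (rot_sib al (cnj z))" "cnj (rot_dsib al (cnj z))"]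
     by (intro integral_unique has_integral_mult_right) (simp add: F0, simp add: F_def)
    moreover have "J = jost_l al z x*- (jost_r al z x*ddx phi x - jost_dr al z x*phi x)"
     unfolding J_def using has_integral_of_derivative[OF x(2) F, of "rot_sib al z" "rot_dsib al z"]
     by (intro integral_unique has_integral_mult_right) (simp add: F0, simp add: F_def)
    ultimately have "W*phi x = I + J" unfolding W_def jost_wronskian[of al z x, symmetric] by algebra
    hence "norm W*norm (phi x) <= norm I + norm J" by (metis norm_mult norm_triangle_ineq)
    also have "norm I <= integral {- t..x} k" unfolding I_def
    proof (rule integral_norm_bound_integral)
     fix y assume y: "y : {- t..x}"
     have "norm (jost_l al z y)*norm (jost_r al z x)*norm (h y) <= K*exp (- (x-y))*norm (h y)"
      using y by (intro mult_right_mono K(2)) auto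
     thus "norm (jost_r al z x*(jost_l al z y*h y)) <= k y" using y by (simp add: norm_mult k_def mult_ac)
    qed (intro integrable_continuous_real continuous_intros smooth_continuous smooth_line_sol hc kc)+
    also have "norm J <= integral {x..t} k" unfolding J_def
    proof (rule integral_norm_bound_integral)
     fix y assume y: "y : {x..t}"
     have "norm (jost_l al z x)*norm (jost_r al z y)*norm (h y) <= K*exp (- (y-x))*norm (h y)"
      using y by (intro mult_right_mono K(2)) auto
     thus "norm (jost_l al z x*(jost_r al z y*h y)) <= k y" using y by (simp add: norm_mult k_def)
    qed (intro integrable_continuous_real continuous_intros smooth_continuous smooth_line_sol hc kc)+
    also have "integral {- t..x} k + integral {x..t} k = integral {- t..t} k"
     by (rule Henstock_Kurzweil_Integration.integral_combine[OF x integrable_continuous_real[OF kc]])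
    finally have le: "norm (phi x) <= integral {- t..t} (%y. k y/norm W)" using W by (simp add: field_simps)
    have k0: "0 <= k y/norm W" for y using K by (simp add: k_def)
    have "((%y. k y/norm W) has_integral integral {- t..t} (%y. k y/norm W)) {- t..t}"
     by (intro integrable_integral integrable_continuous_real continuous_intros kc) (use W in auto)
    from nn_integral_has_integral_lebesgue'[OF k0 this]
    have "ennreal (integral {- t..t} (%y. k y/norm W)) = (\<integral>\<^sup>+y. ennreal (k y/norm W)*indicator {- t..t} y \<partial>lborel)" by simp
    also have "... <= (\<integral>\<^sup>+y. ennreal (k y/norm W) \<partial>lborel)" by (intro nn_integral_mono) (auto split: split_indicator)
        finally have "ennreal (norm (phi x)) <= (\<integral>\<^sup>+y. ennreal (k y/norm W) \<partial>lborel)" by (rule order_trans[OF ennreal_leI[OF le]])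
    also have "(\<integral>\<^sup>+y. ennreal (k y/norm W) \<partial>lborel) = (\<integral>\<^sup>+y. ennreal (K/norm W*exp (- abs (x-y))*norm (h y)) \<partial>lborel)"
     by (intro nn_integral_cong) (simp add: k_def)
    finally show ?thesis .
   next
    case False
    thus ?thesis using r by (simp add: t_def)
   qed
  qed
 qed
 thus ?thesis by blast
qed

lemma antiderivative_exists:
 fixes f :: "real => complex"
 assumes "continuous_on UNIV f" shows "EX F. (ALL x. (F has_vector_derivative f x) (at x)) & F s = 0"
proof -
 have "EX F. ALL x::real. - \<infinity> < ereal x --> ereal x < \<infinity> --> (F has_vector_derivative f x) (at x)"
  using assms by (intro einterval_antiderivative) (auto simp: continuous_on_eq_continuous_at)
 then obtain F where F: "!!x. (F has_vector_derivative f x) (at x)" by auto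
 have "((%x. F x - F s) has_vector_derivative f x) (at x)" for x
  using has_vector_derivative_diff[OF F has_vector_derivative_const[of "F s"]] by simp
 thus ?thesis by (intro exI[of _ "%x. F x - F s"]) simp
qed

lemma jost_decay:
 "EX C>=0. ALL x>=0. norm (jost_r al z x) <= C*exp (- x) & norm (jost_dr al z x) <= C*exp (- x)"
 "EX C>=0. ALL x<=0. norm (jost_l al z x) <= C*exp x & norm (jost_dl al z x) <= C*exp x"
proof -
 show "EX C>=0. ALL x>=0. norm (jost_r al z x) <= C*exp (- x) & norm (jost_dr al z x) <= C*exp (- x)"
  using jost_r_decay[of 0] by simp
 obtain C where "0 <= C" "!!x. 0 <= x ==> norm (jost_r al (cnj z) x) <= C*exp (- x) & norm (jost_dr al (cnj z) x) <= C*exp (- x)"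
  using jost_r_decay[of 0 al "cnj z"] by auto
 hence "norm (jost_l al z x) <= C*exp x & norm (jost_dl al z x) <= C*exp x" if "x <= 0" for x
  unfolding jost_l_eq complex_mod_cnj norm_minus_cancel using that by (metis minus_minus neg_0_le_iff_le)
 thus "EX C>=0. ALL x<=0. norm (jost_l al z x) <= C*exp x & norm (jost_dl al z x) <= C*exp x"
  using \<open>0 <= C\<close> by blast
qed

text \<open>Variation of constants. Outside [- s, s] the solution is a multiple of the Jost solution
  that decays there, which puts it into the domain. The formula on [- s, s] is kept for the residue
  at an eigenvalue.\<close>

lemma resolvent_solution:
 assumes D: "spec_det al z ~= 0" and g: "test_function g" "!!x. r < abs x ==> g x = 0" and s: "0 <= r" "r < s"
  shows "EX u. square_integrable u & (to_L2 u, scaleC z (to_L2 u) - to_L2 g) : cubic_oscillator al &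
  (ALL x:{- s..s}. \<i> * spec_det al z*u x =
   jost_r al z x*integral {- s..x} (%y. jost_l al z y*g y) + jost_l al z x*integral {x..s} (%y. jost_r al z y*g y))"
proof -
 define W where "W = \<i> * spec_det al z"
 have W: "W ~= 0" using D by (simp add: W_def)
 define c where "c = 1/W"
 have sg: "smooth g" by (rule smooth_test_function(1)[OF g(1)])
 have g0: "g x = 0" if "s <= abs x" for x using g(2)[of x] that s by simp
 have sl: "smooth (%y. jost_l al z y*g y)" "smooth (%y. jost_r al z y*g y)" by (intro smooth_mult smooth_line_sol sg)+
 obtain P where P: "!!x. (P has_vector_derivative jost_l al z x*g x) (at x)" "P (- s) = 0"
  using antiderivative_exists[OF smooth_continuous[OF sl(1)]] by blast
 obtain M where M: "!!x. (M has_vector_derivative jost_r al z x*g x) (at x)" "M s = 0"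
  using antiderivative_exists[OF smooth_continuous[OF sl(2)]] by blast
 have PM: "smooth P" "smooth M" using smooth_intro[OF P(1) sl(1)] smooth_intro[OF M(1) sl(2)] by auto
 have P0: "P x = 0" if "x <= - s" for x using constant_of_zero_derivative[OF that P(1)] g0 P(2) s by simp
 have P1: "P x = P s" if "s <= x" for x using constant_of_zero_derivative[OF that P(1)] g0 s by simp
 have M0: "M x = 0" if "s <= x" for x using constant_of_zero_derivative[OF that M(1)] g0 M(2) s by simp
 have M1: "M x = M (- s)" if "x <= - s" for x using constant_of_zero_derivative[OF that M(1)] g0 s by simp
 define u where "u x = c*(jost_r al z x*P x) + (- c)*(jost_l al z x*M x)" for x
 define du where "du x = c*(jost_dr al z x*P x) + (- c)*(jost_dl al z x*M x)" for x
 have su: "smooth u" "smooth du" unfolding u_def[abs_def] du_def[abs_def]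
  by (intro smooth_add smooth_mult smooth_const smooth_line_sol smooth_line_dsol PM)+
 have u': "(u has_vector_derivative du x) (at x)" for x
 proof -
  have "(u has_vector_derivative c*(jost_r al z x*(jost_l al z x*g x) + jost_dr al z x*P x) + (- c)*(jost_l al z x*(jost_r al z x*g x) + jost_dl al z x*M x)) (at x)"
   unfolding u_def[abs_def] by (intro has_vector_derivative_add has_vector_derivative_mult_right has_vector_derivative_mult line_sol_deriv P M)
  thus ?thesis by (simp add: du_def algebra_simps)
 qed
 have du': "(du has_vector_derivative line_pot al z x*u x + g x) (at x)" for x
 proof -
  have "(du has_vector_derivative c*(jost_dr al z x*(jost_l al z x*g x) + line_pot al z x*jost_r al z x*P x)
    + (- c)*(jost_dl al z x*(jost_r al z x*g x) + line_pot al z x*jost_l al z x*M x)) (at x)"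
   unfolding du_def[abs_def] by (intro has_vector_derivative_add has_vector_derivative_mult_right has_vector_derivative_mult line_dsol_deriv P M)
  moreover have "c*(jost_dr al z x*(jost_l al z x*g x) + line_pot al z x*jost_r al z x*P x)
    + (- c)*(jost_dl al z x*(jost_r al z x*g x) + line_pot al z x*jost_l al z x*M x)
    = line_pot al z x*u x + c*(jost_l al z x*jost_dr al z x - jost_dl al z x*jost_r al z x)*g x"
   by (simp add: u_def algebra_simps)
  ultimately show ?thesis unfolding jost_wronskian W_def[symmetric] using W by (simp add: c_def)
 qed
 have ddu: "ddx u = du" "ddx du = (%x. line_pot al z x*u x + g x)"
  using u' du' by (auto simp: ddx_def vector_derivative_at)
 have cu: "cubic_expr al u = (%x. z*u x - g x)" by (auto simp: cubic_expr_def ddu line_pot_def algebra_simps)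
 obtain C where C: "0 <= C" "!!x. 0 <= x ==> norm (jost_r al z x) <= C*exp (- x) & norm (jost_dr al z x) <= C*exp (- x)"
  using jost_decay(1) by blast
 obtain C' where C': "0 <= C'" "!!x. x <= 0 ==> norm (jost_l al z x) <= C'*exp x & norm (jost_dl al z x) <= C'*exp x"
  using jost_decay(2) by blast
 have le: "norm (c*(y*p)) <= (norm c*norm p*B)*e" if "norm y <= B*e" for y p B e
  using mult_left_mono[OF that, of "norm c*norm p"] by (simp add: norm_mult mult_ac)
 have dec: "exp_decay u" "exp_decay du"
 proof -
  have 1: "norm (u x) <= (norm c*norm (P s)*C)*exp (- x)" "norm (du x) <= (norm c*norm (P s)*C)*exp (- x)" if "s <= x" for x
   using le C(2)[of x] that s P1[OF that] M0[OF that] by (auto simp: u_def du_def)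
  have 2: "norm (u x) <= (norm c*norm (M (- s))*C')*exp x" "norm (du x) <= (norm c*norm (M (- s))*C')*exp x" if "x <= - s" for x
   using le C'(2)[of x] that s M1[OF that] P0[OF that] by (auto simp: u_def du_def)
  show "exp_decay u" "exp_decay du"
   using s by (intro exp_decayI[OF _ _ 1(1) 2(1)] exp_decayI[OF _ _ 1(2) 2(2)] smooth_continuous su; simp)+
 qed
 have squ: "square_integrable u" by (intro exp_decay_square_integrable smooth_continuous su dec)
 note sqg = square_integrable_test_function[OF g(1)]
 have sqc: "square_integrable (cubic_expr al u)" unfolding cu by (intro square_integrable_diff square_integrable_cmult squ sqg)
 have "(to_L2 u, to_L2 (cubic_expr al u)) : cubic_oscillator al"
  by (rule cubic_oscillator_of_decay) (use su dec sqc in \<open>simp_all add: ddu\<close>)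
 moreover have "to_L2 (cubic_expr al u) = scaleC z (to_L2 u) - to_L2 g"
  unfolding cu using squ sqg by (simp add: to_L2_diff to_L2_cmult square_integrable_cmult)
 ultimately have "(to_L2 u, scaleC z (to_L2 u) - to_L2 g) : cubic_oscillator al" by simp
 moreover have "\<i> * spec_det al z*u x =
   jost_r al z x*integral {- s..x} (%y. jost_l al z y*g y) + jost_l al z x*integral {x..s} (%y. jost_r al z y*g y)"
  if x: "- s <= x" "x <= s" for x
 proof -
  have "integral {- s..x} (%y. jost_l al z y*g y) = P x" "integral {x..s} (%y. jost_r al z y*g y) = - M x"
   using integral_unique[OF has_integral_of_derivative[OF x(1) P(1)]] integral_unique[OF has_integral_of_derivative[OF x(2) M(1)]] P(2) M(2)
   by simp_all
  thus ?thesis using W unfolding W_def[symmetric] by (simp add: u_def c_def field_simps)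
 qed
 ultimately show ?thesis using squ by (intro exI[of _ u]) simp
qed

lemma jost_r_nonzero: "rot_sib al z ~= 0 | rot_dsib al z ~= 0"
proof -
 obtain t where "jost_r al z t ~= 0" using jost_r_ratio by blast
 thus ?thesis by (auto simp: line_sol_def lsol_def)
qed

lemma jost_proportional:
 assumes "spec_det al z = 0"
 obtains c where "!!x. jost_r al z x = c*jost_l al z x" "!!x. jost_dr al z x = c*jost_dl al z x"
proof -
 define f e f' e' where "f = rot_sib al z" and "e = rot_dsib al z" and "f' = cnj (rot_sib al (cnj z))" and "e' = cnj (rot_dsib al (cnj z))"
 have W: "f'*e = e'*f" using assms by (simp add: spec_det_def f_def e_def f'_def e'_def)
 have "f' ~= 0 | e' ~= 0" using jost_r_nonzero[of al "cnj z"] by (auto simp: f'_def e'_def)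
 hence "EX c. f = c*f' & e = c*e'"
 proof
  assume "f' ~= 0"
  thus ?thesis using W by (intro exI[of _ "f/f'"]) (simp add: field_simps)
 next
  assume "e' ~= 0"
  thus ?thesis using W by (intro exI[of _ "e/e'"]) (simp add: field_simps)
 qed
 then obtain c where c: "f = c*f'" "e = c*e'" by blast
 show thesis
  by (rule that[of c]) (simp_all add: f_def[symmetric] e_def[symmetric] f'_def[symmetric] e'_def[symmetric] c line_sol_def line_dsol_def lsol_def ldsol_def algebra_simps)
qed

lemma jost_r_exp_decay:
 assumes "spec_det al z = 0" shows "exp_decay (jost_r al z)" "exp_decay (jost_dr al z)"
proof -
 obtain c where c: "!!x. jost_r al z x = c*jost_l al z x" "!!x. jost_dr al z x = c*jost_dl al z x"
  using jost_proportional[OF assms] by blast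
 obtain C where C: "!!x. 0 <= x ==> norm (jost_r al z x) <= C*exp (- x) & norm (jost_dr al z x) <= C*exp (- x)"
  using jost_decay(1) by blast
 obtain C' where C': "!!x. x <= 0 ==> norm (jost_l al z x) <= C'*exp x & norm (jost_dl al z x) <= C'*exp x"
  using jost_decay(2) by blast
 have 2: "norm (jost_r al z x) <= (norm c*C')*exp x" "norm (jost_dr al z x) <= (norm c*C')*exp x" if "x <= - 0" for x
  unfolding c norm_mult mult.assoc using C'[of x] that by (auto intro!: mult_left_mono)
 show "exp_decay (jost_r al z)" "exp_decay (jost_dr al z)"
  by (rule exp_decayI[OF order_refl _ _ 2(1)], use C in \<open>auto intro: smooth_continuous smooth_line_sol\<close>)
   (rule exp_decayI[OF order_refl _ _ 2(2)], use C in \<open>auto intro: smooth_continuous smooth_line_dsol\<close>)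
qed

lemma norm_to_L2_pos:
 assumes "continuous_on UNIV f" "square_integrable f" "f a ~= 0" shows "to_L2 f ~= 0"
proof
 assume "to_L2 f = 0"
 hence "(\<integral>\<^sup>+x. ennreal ((cmod (f x))^2) \<partial>lborel) = 0" using nn_integral_to_L2[OF assms(2)] by simp
 moreover have [measurable]: "f : borel_measurable borel" using assms(2) by (simp add: square_integrable_def)
 ultimately have "AE x in lborel. f x = 0" by (subst (asm) nn_integral_0_iff_AE) (auto)
 hence "AE x in lebesgue. x \<in> {x. f x = 0}" using AE_completion by simp
 moreover have "closed {x. f x = 0}" by (intro closed_Collect_eq assms continuous_intros)
 ultimately show False using mem_closed_if_AE_lebesgue[of "{x. f x = 0}" a] assms(3) by simp
qed

lemma jost_eigenvalue:
 assumes "spec_det al z = 0" shows "z : eigenvalues (cubic_oscillator al)" "square_integrable (jost_r al z)"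
proof -
 note dec = jost_r_exp_decay[OF assms]
 have c: "cubic_expr al (jost_r al z) = (%x. z*jost_r al z x)"
    by (simp add: cubic_expr_def ddx_line_sol ddx_def[of "jost_dr al z"] vector_derivative_at[OF line_dsol_deriv] line_pot_def algebra_simps)
 show sq: "square_integrable (jost_r al z)" by (intro exp_decay_square_integrable smooth_continuous smooth_line_sol dec)
 have "(to_L2 (jost_r al z), to_L2 (cubic_expr al (jost_r al z))) : cubic_oscillator al"
  by (rule cubic_oscillator_of_decay) (use dec in \<open>auto simp: smooth_line_sol ddx_line_sol c intro: square_integrable_cmult sq\<close>)
 hence "(to_L2 (jost_r al z), scaleC z (to_L2 (jost_r al z))) : cubic_oscillator al"
  unfolding c to_L2_cmult[OF sq] .
 moreover obtain t where "jost_r al z t ~= 0" using jost_r_ratio by blast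
 hence "to_L2 (jost_r al z) ~= 0" by (intro norm_to_L2_pos[OF smooth_continuous[OF smooth_line_sol] sq])
 ultimately show "z : eigenvalues (cubic_oscillator al)" by (auto simp: eigenvalues_def)
qed

text \<open>At a zero of the determinant the Jost solutions are proportional, so one function decays
  at both ends and is an eigenfunction; elsewhere the lower bound and the solvability yield a
  resolvent.\<close>

lemma spectrum_eq:
 "spectrum (cubic_oscillator al) = {z. spec_det al z = 0}" "eigenvalues (cubic_oscillator al) = {z. spec_det al z = 0}"
proof -
 let ?A = "cubic_oscillator al"
 have "test_function (%x. 0)" by (rule test_function_smooth[of _ 0]) (auto intro: smooth_const)
 moreover have "cubic_expr al (%x. 0) = (%x. 0)" by (simp add: cubic_expr_def ddx_def)
 moreover have "to_L2 (%x. 0) = 0" by (simp add: to_L2_def zero_L2R_def)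
 ultimately have "(0, 0) : ?A" unfolding cubic_oscillator_iff by (intro exI[of _ "%_ _. 0"]) simp
 hence 1: "eigenvalues ?A <= spectrum ?A" using eigenvalue_in_spectrum by blast
 have 2: "spec_det al z = 0" if z: "z : spectrum ?A" for z
 proof (rule ccontr)
  assume D: "spec_det al z ~= 0"
  obtain C where C: "ALL phi. test_function phi --> norm (to_L2 phi) <= C*norm (scaleC z (to_L2 phi) - to_L2 (cubic_expr al phi))"
   using jost_lower_bound[OF D] by blast
  have "EX u. (u, scaleC z u - to_L2 g) : ?A" if g: "test_function g" for g
  proof -
   obtain r where r: "0 < r" "!!x. r < abs x ==> g x = 0" using smooth_test_function(2)[OF g] by blast
         have "0 <= r" "r < r + 1" using r(1) by simp_all
   from resolvent_solution[OF D g r(2) this] show ?thesis by blast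
  qed
    from resolvent_exists[OF C this] have "z ~: spectrum ?A" by (simp add: spectrum_def)
  thus False using z by blast
 qed
 show "spectrum ?A = {z. spec_det al z = 0}" "eigenvalues ?A = {z. spec_det al z = 0}"
  using 1 2 jost_eigenvalue(1) by blast+
qed

section \<open>The norm of the spectral projection\<close>

lemma jost_r_continuous: "continuous_on UNIV (%p. jost_r al (fst p) (snd p))"
proof -
 have o: "continuous_on UNIV (%p :: complex \<times> real. ode_sol A B (- of_real al) (fst p) (\<i> * of_real (snd p)))"
  if "norm A <= 1" "norm B <= 1" for A B
  using continuous_on_compose2[OF continuous_on_ode(1)[OF that, of "- of_real al"], of UNIV "%p :: complex \<times> real. (fst p, \<i> * of_real (snd p))"]
  by (simp add: continuous_intros)
 have r: "continuous_on UNIV (%p :: complex \<times> real. rot_sib al (fst p))" "continuous_on UNIV (%p :: complex \<times> real. rot_dsib al (fst p))"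
  by (rule continuous_on_compose2[OF holomorphic_on_imp_continuous_on[OF rot_holomorphic(1)[of al UNIV]] continuous_on_fst[OF continuous_on_id]], simp)
   (rule continuous_on_compose2[OF holomorphic_on_imp_continuous_on[OF rot_holomorphic(2)[of al UNIV]] continuous_on_fst[OF continuous_on_id]], simp)
 show ?thesis unfolding line_sol_def lsol_def by (intro continuous_on_add continuous_on_mult r o) auto
qed

lemma jost_l_continuous: "continuous_on UNIV (%p. jost_l al (fst p) (snd p))"
proof -
 have "continuous_on UNIV (%p :: complex \<times> real. jost_r al (cnj (fst p)) (- snd p))"
  using continuous_on_compose2[OF jost_r_continuous, of UNIV "%p :: complex \<times> real. (cnj (fst p), - snd p)"] by (simp add: continuous_intros)
 thus ?thesis unfolding jost_l_eq by (intro continuous_intros)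
qed

lemma integral_unit_interval:
 fixes f :: "real => complex"
 assumes "continuous_on UNIV f" "a <= b"
 shows "integral {a..b} f = of_real (b-a)*integral {0..1} (%t. f (a+t*(b-a)))"
proof -
 obtain F where F: "!!x. (F has_vector_derivative f x) (at x)" using antiderivative_exists[OF assms(1)] by blast
 have "((%t. F (a+t*(b-a))) has_vector_derivative of_real (b-a)*f (a+t*(b-a))) (at t)" for t
 proof -
  have "((%t. a + t*(b-a)) has_vector_derivative (b-a)) (at t)" by (auto intro!: derivative_eq_intros)
  from vector_diff_chain_at[OF this F] show ?thesis by (simp add: o_def scaleR_conv_of_real)
 qed
 from integral_unique[OF has_integral_of_derivative[OF zero_le_one this]]
 have "integral {0..1} (%t. of_real (b-a)*f (a+t*(b-a))) = F b - F a" by simp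
 moreover have "integral {a..b} f = F b - F a" by (rule integral_unique[OF has_integral_of_derivative[OF assms(2) F]])
 ultimately show ?thesis by simp
qed

text \<open>Rescaling to [0, 1] moves the parameter from the limits of integration into the
  integrand.\<close>

lemma moving_integral_continuous:
 fixes f :: "complex \<times> real => complex" and a b :: "complex \<times> real => real"
 assumes f: "continuous_on UNIV f" and ab: "continuous_on UNIV a" "continuous_on UNIV b" "!!p. p : S ==> a p <= b p"
 shows "continuous_on S (%p. integral {a p..b p} (%y. f (fst p, y)))"
proof -
 have "continuous_on UNIV (%q :: (complex \<times> real) \<times> real. f (fst (fst q), a (fst q) + snd q*(b (fst q) - a (fst q))))"
    by (rule continuous_on_compose2[OF f _ subset_UNIV])
   (intro continuous_intros continuous_on_compose2[OF ab(1) _ subset_UNIV] continuous_on_compose2[OF ab(2) _ subset_UNIV])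
 hence "continuous_on (UNIV \<times> cbox 0 1) (%(p, t). f (fst p, a p + t*(b p - a p)))"
    unfolding split_beta' by (rule continuous_on_subset) simp
 hence "continuous_on UNIV (%p. integral (cbox 0 1) (%t. f (fst p, a p + t*(b p - a p))))"
  by (rule integral_continuous_on_param)
 hence "continuous_on UNIV (%p. of_real (b p - a p)*integral {0..1} (%t. f (fst p, a p + t*(b p - a p))))"
  using ab by (intro continuous_intros) auto
 hence "continuous_on S (%p. of_real (b p - a p)*integral {0..1} (%t. f (fst p, a p + t*(b p - a p))))"
  by (rule continuous_on_subset) simp
 thus ?thesis
 proof (rule continuous_on_eq)
  fix p assume "p : S"
  have "continuous_on UNIV (%y. f (fst p, y))" by (rule continuous_on_compose2[OF f _ subset_UNIV]) (intro continuous_intros)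
  from integral_unit_interval[OF this ab(3)[OF \<open>p \<in> S\<close>]]
  show "of_real (b p - a p)*integral {0..1} (%t. f (fst p, a p + t*(b p - a p))) = integral {a p..b p} (%y. f (fst p, y))" by simp
 qed
qed

lemma lebesgue_integral_of_support:
  fixes f :: "real => complex"
 assumes "integrable lborel f" "!!x. s < abs x ==> f x = 0" shows "(LINT x|lborel. f x) = integral {- s..s} f"
proof -
 have "((%x. if x \<in> {- s..s} then f x else 0) has_integral (LINT x|lborel. f x)) UNIV"
 proof (rule has_integral_eq[OF _ has_integral_integral_lborel[OF assms(1)]])
  fix x
  show "f x = (if x : {- s..s} then f x else 0)"
  proof (cases "x : {- s..s}")
   case False
   hence "s < abs x" unfolding atLeastAtMost_iff by arith
   thus ?thesis using assms(2)[of x] by simp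
  qed simp
 qed
 hence "(f has_integral (LINT x|lborel. f x)) {- s..s}" unfolding has_integral_restrict_UNIV .
 thus ?thesis by (rule integral_unique[symmetric])
qed

text \<open>For real mu the left Jost solution is the reflected conjugate of the right one; the two
  have equal modulus at 0, so their factor of proportionality is unimodular.\<close>

lemma jost_abs_eq:
 assumes "0 <= al" "Im mu = 0" "spec_det al mu = 0"
 shows "norm (jost_l al mu x) = norm (jost_r al mu x)" "norm (jost_r al mu (- x)) = norm (jost_r al mu x)"
proof -
 have mu: "cnj mu = mu" using assms(2) by (simp add: complex_eq_iff)
 have f: "rot_sib al mu ~= 0" using assms by (intro rot_sib_nonzero) auto
 obtain c where c: "!!x. jost_r al mu x = c*jost_l al mu x" using jost_proportional[OF assms(3)] by blast
 have "norm c = 1" using arg_cong[OF c[of 0], of norm] f by (simp add: norm_mult mu)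
 thus 1: "norm (jost_l al mu x) = norm (jost_r al mu x)" for x unfolding c by (simp add: norm_mult)
 show "norm (jost_r al mu (- x)) = norm (jost_r al mu x)"
    using 1[of x] jost_l_eq(1)[of al mu x] unfolding mu by simp
qed

text \<open>The residue of the Green kernel: at a zero of the determinant the Jost solutions are
  proportional, the integrals over [- s, x] and [x, s] join, and the matrix element factors. So the
  projection has rank one, and both of its vectors have the norm of psi by
  \<open>jost_abs_eq\<close>.\<close>

theorem norm_riesz_projection:
 assumes al: "0 <= al" and mu: "Im mu = 0" "spec_det al mu = 0" "deriv (spec_det al) mu ~= 0"
 shows "norm (riesz_projection (cubic_oscillator al) mu) = (norm (to_L2 (jost_r al mu)))^2/norm (deriv (spec_det al) mu)"
proof -
 let ?A = "cubic_oscillator al" and ?D = "spec_det al"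
 note sqr = jost_eigenvalue(2)[OF mu(2)]
 note abs = jost_abs_eq[OF al mu(1,2)]
 \<comment> \<open>\<open>cinner\<close> conjugates its second argument, so the conjugate restores
   \<open>jost_l\<close> in the kernel.\<close>
 define a where "a x = cnj (jost_l al mu x)" for x
 have "continuous_on UNIV a" unfolding a_def by (intro continuous_intros smooth_continuous smooth_line_sol)
 hence sqa: "square_integrable a"
  by (intro square_integrable_mono[OF _ sqr]) (auto simp: a_def abs intro: borel_measurable_continuous_onI)
 have na: "norm (to_L2 a) = norm (to_L2 (jost_r al mu))" unfolding norm_to_L2[OF sqa] norm_to_L2[OF sqr] by (simp add: a_def abs)
 have "cinner (blinfun_apply (riesz_projection ?A mu) (to_L2 g)) (to_L2 h) = - \<i>/deriv ?D mu*cinner (to_L2 g) (to_L2 a)*cinner (to_L2 (jost_r al mu)) (to_L2 h)"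
  if g: "test_function g" and h: "test_function h" for g h
 proof -
  obtain r1 r2 where r1: "0 < r1" "!!x. r1 < abs x ==> g x = 0" and r2: "0 < r2" "!!x. r2 < abs x ==> h x = 0"
   using smooth_test_function(2)[OF g] smooth_test_function(2)[OF h] by blast
  define s where "s = max r1 r2 + 1"
  have s: "0 <= r1" "r1 < s" "r2 < s" "- s <= s" using r1(1) by (auto simp: s_def)
  have gc: "continuous_on S g" and hc: "continuous_on S h" for S using smooth_continuous smooth_test_function(1) g h by auto
  note sqg = square_integrable_test_function[OF g] and sqh = square_integrable_test_function[OF h]
  have h0: "h x = 0" "g x = 0" if "s < abs x" for x using r2(2)[of x] r1(2)[of x] that s by auto
  define U where "U z x = jost_r al z x*integral {- s..x} (%y. jost_l al z y*g y) + jost_l al z x*integral {x..s} (%y. jost_r al z y*g y)" for z x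
  define be where "be z = integral {- s..s} (%x. U z x*cnj (h x))/\<i>" for z
  have be_D: "?D z*cinner (blinfun_apply (resolvent ?A z) (to_L2 g)) (to_L2 h) = be z" if z: "?D z ~= 0" for z
  proof -
   obtain u where u: "square_integrable u" "(to_L2 u, scaleC z (to_L2 u) - to_L2 g) : ?A"
        "!!x. x : {- s..s} ==> \<i>*?D z*u x = U z x"
    unfolding U_def using resolvent_solution[OF z g r1(2) s(1,2)] by blast
   have "z ~: spectrum ?A" using z spectrum_eq(1) by auto
   from resolvent_of_iff[OF resolvent_resolvent_of[OF this]] u(2)
   have "blinfun_apply (resolvent ?A z) (to_L2 g) = to_L2 u" by blast
   hence "cinner (blinfun_apply (resolvent ?A z) (to_L2 g)) (to_L2 h) = integral {- s..s} (%x. u x*cnj (h x))"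
    by (simp add: cinner_to_L2[OF u(1) sqh] lebesgue_integral_of_support integrable_mult_cnj[OF u(1) sqh] h0)
   hence "\<i>*(?D z*cinner (blinfun_apply (resolvent ?A z) (to_L2 g)) (to_L2 h)) = integral {- s..s} (%x. (\<i>*?D z)*(u x*cnj (h x)))"
    by simp
   also have "... = integral {- s..s} (%x. U z x*cnj (h x))"
    by (rule Henstock_Kurzweil_Integration.integral_cong) (simp add: u(3)[symmetric])
   finally show ?thesis
    unfolding be_def by (simp only: nonzero_eq_divide_eq[OF complex_i_not_zero] mult.commute[of _ \<i>])
  qed
  have be_c: "isCont be mu"
  proof -
   have g': "continuous_on UNIV (%p :: complex \<times> real. g (snd p))" by (rule continuous_on_compose2[OF gc _ subset_UNIV]) (intro continuous_intros)
   have h': "continuous_on S (%p :: complex \<times> real. h (snd p))" for S by (rule continuous_on_compose2[OF hc _ subset_UNIV]) (intro continuous_intros)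
      have le: "- s <= snd p" "snd p <= s" if "p : UNIV \<times> {- s..s}" for p :: "complex \<times> real" using that by auto
   have 1: "continuous_on (UNIV \<times> {- s..s}) (%p. integral {- s..snd p} (%y. jost_l al (fst p) y*g y))"
        using moving_integral_continuous[OF continuous_on_mult[OF jost_l_continuous g'] continuous_on_const continuous_on_snd[OF continuous_on_id] le(1)] by simp
   have 2: "continuous_on (UNIV \<times> {- s..s}) (%p. integral {snd p..s} (%y. jost_r al (fst p) y*g y))"
        using moving_integral_continuous[OF continuous_on_mult[OF jost_r_continuous g'] continuous_on_snd[OF continuous_on_id] continuous_on_const le(2)] by simp
   have "continuous_on (UNIV \<times> {- s..s}) (%p. U (fst p) (snd p)*cnj (h (snd p)))"
    unfolding U_def by (intro continuous_on_mult continuous_on_add continuous_on_cnj h' 1 2 continuous_on_subset[OF jost_r_continuous] continuous_on_subset[OF jost_l_continuous]) auto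
   hence "continuous_on UNIV (%z. integral (cbox (- s) s) (%x. U z x*cnj (h x)))"
    by (intro integral_continuous_on_param) (simp add: split_beta')
   hence "continuous_on UNIV be" unfolding be_def by (intro continuous_intros) auto
   thus ?thesis by (simp add: continuous_on_eq_continuous_at)
  qed
  have "be mu = cinner (to_L2 g) (to_L2 a)*cinner (to_L2 (jost_r al mu)) (to_L2 h)/\<i>"
  proof -
   obtain c where c: "!!x. jost_r al mu x = c*jost_l al mu x" using jost_proportional[OF mu(2)] by blast
   define L where "L = integral {- s..s} (%y. jost_l al mu y*g y)"
   have "U mu x = L*jost_r al mu x" if x: "- s <= x" "x <= s" for x
   proof -
    have "integral {- s..x} (%y. jost_l al mu y*g y) + integral {x..s} (%y. jost_l al mu y*g y) = L"
     unfolding L_def by (intro Henstock_Kurzweil_Integration.integral_combine x integrable_continuous_real continuous_intros smooth_continuous smooth_line_sol gc)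
    thus ?thesis by (simp add: U_def c algebra_simps flip: distrib_left)
   qed
   hence "integral {- s..s} (%x. U mu x*cnj (h x)) = integral {- s..s} (%x. L*(jost_r al mu x*cnj (h x)))"
    by (intro Henstock_Kurzweil_Integration.integral_cong) (simp)
   also have "... = L*integral {- s..s} (%x. jost_r al mu x*cnj (h x))" by simp
   also have "integral {- s..s} (%x. jost_r al mu x*cnj (h x)) = cinner (to_L2 (jost_r al mu)) (to_L2 h)"
    unfolding cinner_to_L2[OF sqr sqh] by (rule lebesgue_integral_of_support[symmetric, OF integrable_mult_cnj[OF sqr sqh]]) (simp add: h0)
   also have "L = cinner (to_L2 g) (to_L2 a)"
    unfolding cinner_to_L2[OF sqg sqa] L_def lebesgue_integral_of_support[OF integrable_mult_cnj[OF sqg sqa], of s, simplified h0 mult_zero_left, OF refl]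
    by (simp add: a_def mult.commute)
   finally show ?thesis by (simp add: be_def)
  qed
    moreover have "cinner (blinfun_apply (riesz_projection ?A mu) (to_L2 g)) (to_L2 h) = be mu/deriv ?D mu"
   using riesz_projection_cinner[OF spec_det_holomorphic mu(3) spectrum_eq(1) mu(2) be_D be_c] .
  ultimately show ?thesis by simp
 qed
 from norm_rank_one[OF this] show ?thesis by (simp add: na norm_divide power2_eq_square)
qed

text \<open>The norm of psi equals |psi 0| up to powers of mu, which do not affect an exponential
  rate. On [0, 1] the energy estimate controls psi; beyond 1 the growing imaginary part of the
  potential does, through the imaginary part of Green's formula.\<close>

lemma jost_norm_bounds:
 fixes al C mu :: real
 defines "M == (C^2 + 1)*exp (1+al)" and "f == norm (rot_sib al (of_real mu))" and "psi == jost_r al (of_real mu)"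
 assumes al: "0 <= al" and C: "0 <= C" and mu: "1 <= mu" and D: "spec_det al (of_real mu) = 0"
  and e: "norm (rot_dsib al (of_real mu)) <= C * sqrt mu*f"
 shows "(norm (to_L2 psi))^2 <= 2*(M+C) * sqrt mu*f^2" "f^2 <= 8 * sqrt M * sqrt mu*(norm (to_L2 psi))^2"
proof -
 define z where "z = complex_of_real mu"
 define psi' where "psi' = jost_dr al z"
 have psi: "psi = jost_r al z" by (simp add: psi_def z_def)
 note sq = jost_eigenvalue(2)[OF D, folded psi_def]
 have [measurable]: "psi : borel_measurable borel" using sq by (simp add: square_integrable_def)
 have sl: "0 < sqrt mu" "1 <= sqrt mu" "(sqrt mu)^2 = mu" using mu by auto
 have M: "1 <= M" using mult_mono[of 1 "C^2 + 1" 1 "exp (1+al)"] al by (simp add: M_def)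
 have f0: "0 <= f" by (simp add: f_def)
 have psi_d: "(psi has_vector_derivative psi' t) (at t)" "(psi' has_vector_derivative line_pot al z t*psi t) (at t)" for t
  unfolding psi psi'_def by (rule line_sol_deriv line_dsol_deriv)+
 have energy: "(norm (psi' t))^2 + mu*(norm (psi t))^2 <= M*mu*f^2" if t: "0 <= t" "t <= 1" for t
 proof -
  have "(norm (psi' t))^2 + (sqrt mu)^2*(norm (psi t))^2 <= ((norm (psi' 0))^2 + (sqrt mu)^2*(norm (psi 0))^2)*exp ((1+al)*(t-0))"
  proof (rule energy_gronwall(2)[where Q = "line_pot al z"])
   fix s assume s: "s : {0..t}"
   have "line_pot al z s + of_real ((sqrt mu)^2) = \<i> * of_real (s^3 + al * s)" using sl by (simp add: line_pot_def z_def algebra_simps)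
   hence "norm (line_pot al z s + of_real ((sqrt mu)^2)) = abs (s^3 + al * s)" by (simp only: norm_mult norm_ii norm_of_real) simp
   also have "... <= 1 + al*1" using s t al power_le_one[of s 3] mult_left_mono[of s 1 al] by (simp)
   also have "... <= (1+al) * sqrt mu" using mult_left_mono[OF sl(2), of "1 + al"] al by simp
   finally show "norm (line_pot al z s + of_real ((sqrt mu)^2)) <= (1+al) * sqrt mu" .
  qed (use t sl psi_d in auto)
  also have "... <= ((C^2 + 1)*mu*f^2)*exp (1+al)"
  proof (rule mult_mono)
   have "(norm (psi' 0))^2 <= (C * sqrt mu*f)^2" using e by (intro power_mono) (auto simp: psi'_def z_def norm_mult)
   thus "(norm (psi' 0))^2 + (sqrt mu)^2*(norm (psi 0))^2 <= (C^2 + 1)*mu*f^2"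
    using sl by (simp add: psi z_def f_def power_mult_distrib algebra_simps)
   show "exp ((1+al)*(t-0)) <= exp (1+al)" using t al mult_left_mono[of t 1 "1 + al"] by simp
   show "0 <= (C^2 + 1)*mu*f^2" using mu by simp
  qed simp
  finally show ?thesis using sl by (simp add: M_def mult_ac)
 qed
 have up: "(norm (psi t))^2 <= M*f^2" "norm (psi' t) <= sqrt M * sqrt mu*f" if t: "0 <= t" "t <= 1" for t
 proof -
    have "mu*(norm (psi t))^2 <= (norm (psi' t))^2 + mu*(norm (psi t))^2" by simp
  also note energy[OF t]
  also have "M*mu*f^2 = mu*(M*f^2)" by simp
  finally have "mu*(norm (psi t))^2 <= mu*(M*f^2)" .
  thus "(norm (psi t))^2 <= M*f^2" using mu by simp
    have "(norm (psi' t))^2 <= (norm (psi' t))^2 + mu*(norm (psi t))^2" using mu by simp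
  also note energy[OF t]
    also have "M*mu*f^2 = (sqrt M * sqrt mu*f)^2" using M mu by (simp add: power_mult_distrib)
  finally show "norm (psi' t) <= sqrt M * sqrt mu*f" by (rule power2_le_imp_le) (use M sl f0 in simp)
 qed
 define N where "N = (\<integral>\<^sup>+x. ennreal ((norm (psi x))^2) \<partial>lborel)"
 have N: "N = ennreal ((norm (to_L2 psi))^2)" unfolding N_def by (rule nn_integral_to_L2[OF sq])
 show "f^2 <= 8 * sqrt M * sqrt mu*(norm (to_L2 psi))^2"
 proof -
  \<comment> \<open>|psi'| is at most sqrt M sqrt mu f, so over this length psi loses at most half
    of its initial modulus f.\<close>
  define ta where "ta = 1/(2*(sqrt M * sqrt mu))"
  have "1 <= sqrt M * sqrt mu" using mult_mono[of 1 "sqrt M" 1 "sqrt mu"] M sl by simp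
  hence ta: "0 < ta" "ta <= 1" "ta*(sqrt M * sqrt mu) = 1/2" by (auto simp: ta_def)
  have lo: "f/2 <= norm (psi t)" if t: "0 <= t" "t <= ta" for t
  proof -
   have "norm (psi t - psi 0) <= sqrt M * sqrt mu*f*t - sqrt M * sqrt mu*f*0"
   proof (rule norm_increment_le[OF t(1), where f' = psi' and phi' = "%_. sqrt M * sqrt mu*f"])
    show "continuous_on {0..t} psi" unfolding psi by (intro smooth_continuous smooth_line_sol)
    show "((%t. sqrt M * sqrt mu*f*t) has_real_derivative sqrt M * sqrt mu*f) (at s)" for s by (auto)
   qed (use t ta psi_d up in \<open>auto intro!: continuous_intros\<close>)
   also have "... <= f/2" using mult_right_mono[OF mult_left_mono[OF t(2), of "sqrt M * sqrt mu"] f0] ta(3) M sl by (simp add: mult_ac)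
   finally have "norm (psi t - psi 0) <= f/2" .
   moreover have "norm (psi 0) = f" by (simp add: psi z_def f_def)
   ultimately show ?thesis using norm_triangle_ineq3[of "psi t" "psi 0"] by linarith
  qed
  have "ennreal (f^2/4*ta) = (\<integral>\<^sup>+x. ennreal (f^2/4)*indicator {0..ta} x \<partial>lborel)"
   using ta by (simp add: nn_integral_cmult_indicator ennreal_mult[symmetric])
  also have "... <= N" unfolding N_def
  proof (intro nn_integral_mono)
   fix x
   show "ennreal (f^2/4)*indicator {0..ta} x <= ennreal ((norm (psi x))^2)"
    using power_mono[OF lo[of x], of 2] f0 by (auto split: split_indicator simp: power_divide)
  qed
  finally have "f^2/4*ta <= (norm (to_L2 psi))^2" unfolding N by simp
  hence "f^2/4*ta*(8*(sqrt M * sqrt mu)) <= (norm (to_L2 psi))^2*(8*(sqrt M * sqrt mu))"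
   using M sl by (intro mult_right_mono) auto
    moreover have "f^2/4*ta*(8*(sqrt M * sqrt mu)) = 2*f^2*(ta*(sqrt M * sqrt mu))" by simp
  moreover have "2*f^2*(ta*(sqrt M * sqrt mu)) = f^2" unfolding ta(3) by simp
  ultimately have "f^2 <= (norm (to_L2 psi))^2*(8*(sqrt M * sqrt mu))" by linarith
  also have "... = 8 * sqrt M * sqrt mu*(norm (to_L2 psi))^2" by simp
  finally show ?thesis .
 qed
 define G where "G x = (x^3 + al*x)*(norm (psi x))^2" for x
 have [measurable]: "G : borel_measurable borel" unfolding G_def[abs_def] by measurable
 \<comment> \<open>F' = G and F vanishes at infinity, so G has the integral - F 0 over the
   half-line, of order sqrt mu f^2; and G dominates |psi|^2 beyond 1.\<close>
 define F where "F x = Im (cnj (psi x)*psi' x)" for x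
 have F': "DERIV F x :> G x" for x
 proof -
  have "((%x. cnj (psi x)*psi' x) has_vector_derivative cnj (psi x)*(line_pot al z x*psi x) + cnj (psi' x)*psi' x) (at x)"
   by (intro has_vector_derivative_mult has_vector_derivative_cnj psi_d)
  from bounded_linear.has_vector_derivative[OF bounded_linear_Im this]
  have "(F has_real_derivative Im (cnj (psi x)*(line_pot al z x*psi x) + cnj (psi' x)*psi' x)) (at x)"
   unfolding F_def[abs_def] has_real_derivative_iff_has_vector_derivative .
  moreover have "Im (cnj (psi x)*(line_pot al z x*psi x) + cnj (psi' x)*psi' x) = G x"
      unfolding G_def cmod_power2 by (simp add: line_pot_def z_def power2_eq_square algebra_simps)
  ultimately show ?thesis by simp
 qed
 obtain K where K: "0 <= K" "!!x. 0 <= x ==> norm (psi x) <= K*exp (- x) & norm (psi' x) <= K*exp (- x)"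
  using jost_decay(1)[of al z] unfolding psi psi'_def by blast
 have "tendsto F 0 at_top"
 proof (rule Lim_null_comparison)
  show "\<forall>\<^sub>F x in at_top. norm (F x) <= K*exp (- x)*(K*exp (- x))" using eventually_ge_at_top[of 0]
  proof eventually_elim
   case (elim x)
   have "norm (F x) <= norm (psi x)*norm (psi' x)" unfolding F_def real_norm_def by (rule order_trans[OF abs_Im_le_cmod]) (simp add: norm_mult)
   also have "... <= K*exp (- x)*(K*exp (- x))" using K(2)[OF elim] K(1) by (intro mult_mono) auto
   finally show ?case .
  qed
  show "tendsto (%x. K*exp (- x)*(K*exp (- x))) 0 at_top" by real_asymp
 qed
 hence int: "(\<integral>\<^sup>+x. ennreal (G x)*indicator {0..} x \<partial>lborel) = ennreal (0 - F 0)"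
  using al by (intro nn_integral_FTC_atLeast F') (auto simp: G_def)
 have "- F 0 <= norm (psi 0)*norm (psi' 0)" using abs_Im_le_cmod[of "cnj (psi 0)*psi' 0"] by (simp add: F_def norm_mult del: times_complex.sel)
 also have "... <= f*(C * sqrt mu*f)" using e f0 unfolding psi psi'_def z_def by (intro mult_mono) (auto simp: f_def norm_mult)
 finally have F0: "0 - F 0 <= C * sqrt mu*f^2" by (simp add: power2_eq_square mult_ac)
 define H where "H x = ennreal ((norm (psi x))^2)*indicator {0..} x" for x
 have [measurable]: "H : borel_measurable borel" unfolding H_def[abs_def] by measurable
 have "(\<integral>\<^sup>+x. H x \<partial>lborel) <= (\<integral>\<^sup>+x. ennreal (M*f^2)*indicator {0..1} x + ennreal (G x)*indicator {0..} x \<partial>lborel)"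
 proof (intro nn_integral_mono)
    fix x :: real
  consider "x < 0" | "0 <= x" "x <= 1" | "1 < x" by fastforce
  thus "H x <= ennreal (M*f^2)*indicator {0..1} x + ennreal (G x)*indicator {0..} x"
  proof cases
   case 2
      thus ?thesis using ennreal_leI[OF up(1)[OF 2]] by (simp add: H_def add_increasing2)
  next
   case 3
   have "1*(norm (psi x))^2 <= (x^3 + al*x)*(norm (psi x))^2"
       proof (rule mult_right_mono)
    have "1 <= x^3" "0 <= al*x" using 3 al by simp_all
    thus "1 <= x^3 + al*x" by linarith
   qed simp
      thus ?thesis using 3 by (simp add: H_def G_def ennreal_leI)
  qed (simp add: H_def)
 qed
 also have "... = ennreal (M*f^2) + ennreal (0 - F 0)"
  unfolding int[symmetric] by (subst nn_integral_add) (auto simp: nn_integral_cmult_indicator)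
 also have "... <= ennreal (M*f^2 * sqrt mu) + ennreal (C * sqrt mu*f^2)"
  using F0 M mult_left_mono[OF sl(2), of "M*f^2"] by (intro add_mono ennreal_leI) auto
 also have "... = ennreal ((M+C) * sqrt mu*f^2)" using M C sl by (simp add: ennreal_plus[symmetric] algebra_simps del: ennreal_plus)
 finally have H: "(\<integral>\<^sup>+x. H x \<partial>lborel) <= ennreal ((M+C) * sqrt mu*f^2)" .
 \<comment> \<open>The modulus of psi is even, so the half-line bound is doubled.\<close>
 have "N <= (\<integral>\<^sup>+x. H x + H (0 + (- 1)*x) \<partial>lborel)" unfolding N_def
 proof (intro nn_integral_mono)
  fix x
  have "norm (psi (- x)) = norm (psi x)" unfolding psi z_def by (rule jost_abs_eq(2)[OF al _ D]) simp
  thus "ennreal ((norm (psi x))^2) <= H x + H (0 + (- 1)*x)" by (auto simp: H_def split: split_indicator)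
 qed
 also have "... = (\<integral>\<^sup>+x. H x \<partial>lborel) + (\<integral>\<^sup>+x. H (0 + (- 1)*x) \<partial>lborel)" by (intro nn_integral_add) measurable
 also have "(\<integral>\<^sup>+x. H (0 + (- 1)*x) \<partial>lborel) = (\<integral>\<^sup>+x. H x \<partial>lborel)" using nn_integral_real_affine[of H "- 1" 0] by simp
 also have "(\<integral>\<^sup>+x. H x \<partial>lborel) + (\<integral>\<^sup>+x. H x \<partial>lborel) <= ennreal ((M+C) * sqrt mu*f^2) + ennreal ((M+C) * sqrt mu*f^2)" by (intro add_mono H)
 also have "... = ennreal (2*(M+C) * sqrt mu*f^2)" using M C sl by (simp add: ennreal_plus[symmetric] del: ennreal_plus)
 finally show "(norm (to_L2 psi))^2 <= 2*(M+C) * sqrt mu*f^2" unfolding N using M C sl by simp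
qed

theorem theorem1p1:
  fixes \<alpha> :: real
  assumes "\<alpha> \<ge> 0"
  shows "(\<lambda>n. (1 / real n) * ln (instability_index \<alpha> n)) \<longlonglongrightarrow> pi / sqrt 3"
proof -
 let ?A = "cubic_oscillator \<alpha>" and ?D = "spec_det \<alpha>"
 obtain l C k0 where l: "strict_mono l" "range (%k. complex_of_real (l k)) = {z. ?D z = 0}"
  and count: "LIMSEQ (%k. l k powr (5/6)/real (Suc k)) (2*pi/(action_const * sqrt 3))"
  and ltop: "filterlim l at_top sequentially" and nz: "!!k. k0 <= k ==> deriv ?D (of_real (l k)) ~= 0"
  and ds: "!!k. k0 <= k ==> norm (rot_dsib \<alpha> (of_real (l k))) <= C * sqrt (l k)*norm (rot_sib \<alpha> (of_real (l k)))"
  and lim: "LIMSEQ (%k. (2*ln (norm (rot_sib \<alpha> (of_real (l k)))) - ln (norm (deriv ?D (of_real (l k)))))/l k powr (5/6)) (action_const/2)"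
  using spectral_asymptotics[OF assms] by blast
  have unique: "l' = l" if "strict_mono l'" "range (%k. complex_of_real (l' k)) = eigenvalues ?A" for l'
 proof (rule strict_mono_range_unique[OF that(1) l(1)])
  have "complex_of_real ` range l' = complex_of_real ` range l" using that(2) l(2) by (simp add: spectrum_eq image_image)
  thus "range l' = range l" by (simp add: inj_image_eq_iff inj_of_real)
 qed
  \<comment> \<open>l meets the unique description: its values are all the eigenvalues by
    \<open>spectrum_eq\<close>, and a strictly increasing enumeration is determined by its
    range.\<close>
  have enum: "eigenvalue_enum \<alpha> = l" unfolding eigenvalue_enum_def
 proof (rule the_equality)
  show "strict_mono l & range (%k. complex_of_real (l k)) = eigenvalues ?A" using l by (simp add: spectrum_eq)
 qed (erule conjE, rule unique)
 define mu f d N where "mu = (%k. complex_of_real (l k))" and "f k = norm (rot_sib \<alpha> (mu k))" and "d k = norm (deriv ?D (mu k))"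
  and "N k = (norm (to_L2 (jost_r \<alpha> (mu k))))^2" for k
 have zero: "?D (mu k) = 0" for k using l(2) by (auto simp: mu_def)
 define C' where "C' = max 0 C"
 define M where "M = (C'^2 + 1)*exp (1 + \<alpha>)"
 have M: "0 < M" by (simp add: M_def add_nonneg_pos)
 define B where "B = max (2*(M+C')) (8 * sqrt M)"
 have B: "0 < B" using M by (simp add: B_def less_max_iff_disj)
 obtain k1 where k1: "!!k. k1 <= k ==> 1 <= l k" using ltop by (auto simp: filterlim_at_top eventually_sequentially)
 define k2 where "k2 = max k0 k1"
 \<comment> \<open>The powers of the eigenvalue in \<open>jost_norm_bounds\<close> become ln (l
   k)/2, which is lost after division by l k powr (5/6).\<close>
 have bounds: "0 < f k & 0 < N k & abs (ln (N k) - 2*ln (f k)) <= ln B + ln (l k)/2" if k: "k2 <= k" for k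
 proof -
  have l1: "1 <= l k" and kk: "k0 <= k" using k k1[of k] by (auto simp: k2_def)
  have f: "0 < f k" using rot_sib_nonzero[OF assms, of "mu k"] by (simp add: f_def mu_def)
  have "C * sqrt (l k)*f k <= C' * sqrt (l k)*f k" using f l1 by (intro mult_right_mono) (auto simp: C'_def)
  hence e: "norm (rot_dsib \<alpha> (of_real (l k))) <= C' * sqrt (l k)*norm (rot_sib \<alpha> (of_real (l k)))"
   using ds[OF kk] unfolding f_def mu_def by linarith
  have C': "0 <= C'" by (simp add: C'_def)
  have 1: "N k <= 2*(M+C') * sqrt (l k)*(f k)^2" "(f k)^2 <= 8 * sqrt M * sqrt (l k)*N k"
   using jost_norm_bounds[OF assms C' l1 zero[of k, unfolded mu_def] e] unfolding N_def f_def mu_def M_def by simp_all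
  have p: "0 < sqrt (l k)" "0 < (f k)^2" "0 <= N k" using l1 f by (auto simp: N_def)
  have "2*(M+C')*(sqrt (l k)*(f k)^2) <= B*(sqrt (l k)*(f k)^2)" "8 * sqrt M*(sqrt (l k)*N k) <= B*(sqrt (l k)*N k)"
   using p by (intro mult_right_mono; simp add: B_def)+
  hence 2: "N k <= B * sqrt (l k)*(f k)^2" "(f k)^2 <= B * sqrt (l k)*N k" using 1 by (simp_all)
  have N: "0 < N k" using 2(2) p by (cases "N k = 0") auto
  have "ln (N k) <= ln (B * sqrt (l k)*(f k)^2)" "ln ((f k)^2) <= ln (B * sqrt (l k)*N k)"
   using 2 N p B by simp_all
  hence "ln (N k) <= ln B + ln (l k)/2+2*ln (f k)" "2*ln (f k) <= ln B + ln (l k)/2 + ln (N k)"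
   using N B f l1 by (simp_all add: ln_mult ln_sqrt ln_realpow)
  thus ?thesis using f N by (simp)
 qed
 have lim0: "LIMSEQ (%k. (ln (N k) - 2*ln (f k))/l k powr (5/6)) 0"
 proof (rule Lim_null_comparison)
  show "\<forall>\<^sub>F k in sequentially. norm ((ln (N k) - 2*ln (f k))/l k powr (5/6)) <= (ln B + ln (l k)/2)/l k powr (5/6)"
   using eventually_ge_at_top[of k2]
   by eventually_elim (use bounds in \<open>auto simp: abs_divide intro!: divide_right_mono\<close>)
  have "tendsto (%t::real. (ln B + ln t/2)/t powr (5/6)) 0 at_top" by real_asymp
  thus "LIMSEQ (%k. (ln B + ln (l k)/2)/l k powr (5/6)) 0" by (rule filterlim_compose[OF _ ltop])
 qed
 \<comment> \<open>ln kappa split into its main part, with rate K/2, and the negligible norm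
   comparison; the counting quotient supplies 2 pi/(K sqrt 3), so that K cancels.\<close>
 have "(%k. ((2*ln (f k) - ln (d k))/l k powr (5/6) + (ln (N k) - 2*ln (f k))/l k powr (5/6))*(l k powr (5/6)/real (Suc k)))
   \<longlonglongrightarrow> (action_const/2 + 0)*(2*pi/(action_const * sqrt 3))"
  using lim unfolding f_def d_def mu_def by (intro tendsto_mult tendsto_add count lim0[unfolded f_def mu_def]) simp
 moreover have "(action_const/2+0)*(2*pi/(action_const * sqrt 3)) = pi/sqrt 3" using action_const_pos by simp
 moreover have "\<forall>\<^sub>F k in sequentially. ((2*ln (f k) - ln (d k))/l k powr (5/6) + (ln (N k) - 2*ln (f k))/l k powr (5/6))*(l k powr (5/6)/real (Suc k))
   = (1/real (Suc k))*ln (instability_index \<alpha> (Suc k))" using eventually_ge_at_top[of k2]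
 proof eventually_elim
  case (elim k)
  have lk: "0 < l k" and kk: "k0 <= k" using k1[of k] elim by (auto simp: k2_def)
  have "instability_index \<alpha> (Suc k) = N k/d k"
   unfolding instability_index_def spectral_projection_def eigenvalue_def enum N_def d_def mu_def
   using norm_riesz_projection[OF assms _ zero[of k, unfolded mu_def] nz[OF kk]] by simp
  moreover have "0 < d k" using nz[OF kk] by (simp add: d_def mu_def)
  ultimately have "ln (instability_index \<alpha> (Suc k)) = ln (N k) - ln (d k)" using bounds[OF elim] by (simp add: ln_div)
  thus ?case using lk by (simp add: add_divide_distrib[symmetric])
 qed
 ultimately have "LIMSEQ (%k. (1/real (Suc k))*ln (instability_index \<alpha> (Suc k))) (pi/sqrt 3)"
  using Lim_transform_eventually by force
 \<comment> \<open>\<open>eigenvalue \<alpha> n\<close> reads entry n - 1 of the enumeration, so the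
   limit has been computed for n = k + 1.\<close>
 thus ?thesis by (rule LIMSEQ_imp_Suc)
qed
end
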